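(* Let $k$ be a commutative ring, let $S=k[x_1,\dots,x_n]$ be graded by an abelian group $A$ via $\deg\colon\mathbb{N}^n\to A$, and let $h\colon A\to\mathbb{N}$ be a function supported on $A_+$. If the set of degrees $D\subseteq A$ is very supportive for $h$, then the canonical morphism $H_S^h\to H_{S_D}^h$ (restriction of degrees, $I\mapsto\bigoplus_{a\in D}I_a$) is an isomorphism.
   Context: A grading of $S$ by an abelian group $A$ is a semigroup homomorphism $\deg\colon\mathbb{N}^n\to A$; $S_a$ is the $k$-span of the monomials $x^u$ with $\deg(u)=a$. It is assumed that $A$ is generated by the degrees of the variables; $A_+=\deg(\mathbb{N}^n)$. $H_S^h$ is the functor (and the quasiprojective $k$-scheme representing it) sending a commutative $k$-algebra $R$ to the set of $A$-homogeneous ideals $I\subseteq R\otimes_k S$ with $(R\otimes_k S_a)/I_a$ locally free of rank $h(a)$ over $R$ for all $a\in A$. For $D\subseteq A$ finite, $H_{S_D}^h$ is the functor (and the quasiprojective $k$-scheme representing it) sending $R$ to the set of graded $R$-submodules $L=\bigoplus_{a\in D}L_a\subseteq\bigoplus_{a\in D}R\otimes_k S_a$ such that $x^uL_a\subseteq L_b$ for all $a,b\in D$ and all monomials $x^u$ of degree $b-a$, and $(R\otimes_k S_a)/L_a$ is locally free of rank $h(a)$ for all $a\in D$. For a monomial ideal $I\subseteq S$, $h_I(a)$ is the number of monomials of degree $a$ not in $I$. A subset $D\subseteq A$ is very supportive for $h$ if it is finite and satisfies: (g) every monomial ideal with Hilbert function $h$ is generated by monomials of degree belonging to $D$; (h)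 every monomial ideal $I$ generated in degrees $D$ satisfies: if $h_I(a)=h(a)$ for all $a\in D$, then $h_I(a)=h(a)$ for all $a\in A$; (s) for every monomial ideal $I$ with $h_I=h$, the syzygy module of $I$ is generated by the syzygies $x^ux^{v'}=x^vx^{u'}=\operatorname{lcm}(x^u,x^v)$ among generators $x^u,x^v$ of $I$ such that $\deg\operatorname{lcm}(x^u,x^v)\in D$. *)

theory Defs
  imports
    "HOL-Algebra.Module"
    "HOL-Algebra.QuotRing"
    "HOL-Library.Multiset"
    "HOL-Computational_Algebra.Group_Closure"
begin

section \<open>Submodules, quotients, localization, local freeness\<close>

text \<open>
  A module is a record extending a ring record (theory \<open>HOL-Algebra.Module\<close>); the fields
  \<open>mult\<close> and \<open>one\<close> play no role in the module axioms and are left undefined where the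
  module carries no ring structure.
\<close>

definition gen_submodule ::
    "('r, 'x) ring_scheme \<Rightarrow> ('r, 'm, 'y) module_scheme \<Rightarrow> 'm set \<Rightarrow> 'm set" where
  "gen_submodule R M Y = \<Inter>{N. submodule N R M \<and> Y \<subseteq> N}"

definition quot_module :: "('r, 'm, 'y) module_scheme \<Rightarrow> 'm set \<Rightarrow> ('r, 'm set) module" where
  "quot_module M N =
    \<lparr>carrier = a_rcosets\<^bsub>M\<^esub> N, monoid.mult = undefined, monoid.one = undefined,
     ring.zero = N, ring.add = set_add M,
     smult = (\<lambda>r Y. \<Union>x\<in>Y. N +>\<^bsub>M\<^esub> (r \<odot>\<^bsub>M\<^esub> x))\<rparr>"

text \<open>
  Localization at the powers of a single element \<open>f\<close>: the pair \<open>(m, i)\<close> stands for the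
  fraction \<open>m / f\<^sup>i\<close>.
\<close>

definition loc_rel ::
    "('r, 'x) ring_scheme \<Rightarrow> ('r, 'm, 'y) module_scheme \<Rightarrow> 'r \<Rightarrow> (('m \<times> nat) \<times> ('m \<times> nat)) set" where
  "loc_rel R M f =
    {((m, i), (m', j)) | m i m' j. m \<in> carrier M \<and> m' \<in> carrier M \<and>
       (\<exists>t::nat. (f [^]\<^bsub>R\<^esub> (t + j)) \<odot>\<^bsub>M\<^esub> m = (f [^]\<^bsub>R\<^esub> (t + i)) \<odot>\<^bsub>M\<^esub> m')}"

definition loc_frac ::
    "('r, 'x) ring_scheme \<Rightarrow> ('r, 'm, 'y) module_scheme \<Rightarrow> 'r \<Rightarrow> 'm \<Rightarrow> nat \<Rightarrow> ('m \<times> nat) set" where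
  "loc_frac R M f m i = loc_rel R M f `` {(m, i)}"

definition loc_module ::
    "('r, 'x) ring_scheme \<Rightarrow> ('r, 'm, 'y) module_scheme \<Rightarrow> 'r
      \<Rightarrow> (('r \<times> nat) set, ('m \<times> nat) set) module" where
  "loc_module R M f =
    \<lparr>carrier = (carrier M \<times> UNIV) // loc_rel R M f, monoid.mult = undefined, monoid.one = undefined,
     ring.zero = loc_frac R M f \<zero>\<^bsub>M\<^esub> 0,
     ring.add = (\<lambda>Y Z. \<Union>(m, i)\<in>Y. \<Union>(m', j)\<in>Z.
        loc_frac R M f ((f [^]\<^bsub>R\<^esub> j) \<odot>\<^bsub>M\<^esub> m \<oplus>\<^bsub>M\<^esub> (f [^]\<^bsub>R\<^esub> i) \<odot>\<^bsub>M\<^esub> m') (i + j)),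
     smult = (\<lambda>C Y. \<Union>(c, i)\<in>C. \<Union>(m, j)\<in>Y. loc_frac R M f (c \<odot>\<^bsub>M\<^esub> m) (i + j))\<rparr>"

definition self_module :: "('r, 'x) ring_scheme \<Rightarrow> ('r, 'r) module" where
  "self_module R =
    \<lparr>carrier = carrier R, monoid.mult = (\<otimes>\<^bsub>R\<^esub>), monoid.one = \<one>\<^bsub>R\<^esub>,
     ring.zero = \<zero>\<^bsub>R\<^esub>, ring.add = (\<oplus>\<^bsub>R\<^esub>), smult = (\<otimes>\<^bsub>R\<^esub>)\<rparr>"

definition loc_ring :: "('r, 'x) ring_scheme \<Rightarrow> 'r \<Rightarrow> ('r \<times> nat) set ring" where
  "loc_ring R f = (let M = loc_module R (self_module R) f in
    \<lparr>carrier = carrier M, monoid.mult = smult M, monoid.one = loc_frac R (self_module R) f \<one>\<^bsub>R\<^esub> 0,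
     ring.zero = \<zero>\<^bsub>M\<^esub>, ring.add = (\<oplus>\<^bsub>M\<^esub>)\<rparr>)"

text \<open>
  The basis is an indexed family, not a set, so that every module over the zero ring is free
  of every rank; localizations of a nonzero ring may be zero.
\<close>

definition free_of_rank ::
    "('r, 'x) ring_scheme \<Rightarrow> ('r, 'm, 'y) module_scheme \<Rightarrow> nat \<Rightarrow> bool" where
  "free_of_rank R M r \<longleftrightarrow>
    (\<exists>e \<in> {..<r} \<rightarrow> carrier M. \<forall>m \<in> carrier M.
       \<exists>!c. c \<in> {..<r} \<rightarrow>\<^sub>E carrier R \<and> m = (\<Oplus>\<^bsub>M\<^esub>i\<in>{..<r}. c i \<odot>\<^bsub>M\<^esub> e i))"

text \<open>Locally free in the Zariski topology: \<open>Spec R\<close> is covered by basic open sets \<open>D(f)\<close>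
  over which the module becomes free.\<close>

definition locally_free ::
    "('r, 'x) ring_scheme \<Rightarrow> ('r, 'm, 'y) module_scheme \<Rightarrow> nat \<Rightarrow> bool" where
  "locally_free R M r \<longleftrightarrow>
    (\<exists>F \<subseteq> carrier R. Idl\<^bsub>R\<^esub> F = carrier R \<and>
       (\<forall>f\<in>F. free_of_rank (loc_ring R f) (loc_module R M f) r))"

section \<open>Graded polynomial rings\<close>

text \<open>
  As in \<open>HOL-Algebra.Indexed_Polynomials\<close>, a monomial is the multiset of its variables, so
  \<open>\<nat>\<^sup>n\<close> is the set of multisets over \<open>{..<n}\<close>: addition of exponents is \<open>+\<close>, divisibility of
  monomials is \<open>\<subseteq>#\<close> and the least common multiple is \<open>\<union>#\<close>.
\<close>

definition expo :: "nat \<Rightarrow> nat multiset set" where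
  "expo n = {u. set_mset u \<subseteq> {..<n}}"

definition grading :: "nat \<Rightarrow> (nat multiset \<Rightarrow> 'a::ab_group_add) \<Rightarrow> bool" where
  "grading n dg \<longleftrightarrow>
    (\<forall>u\<in>expo n. \<forall>v\<in>expo n. dg (u + v) = dg u + dg v) \<and>
    group_closure ((\<lambda>i. dg {#i#}) ` {..<n}) = UNIV"

text \<open>
  The polynomial ring \<open>R[x\<^sub>1, \<dots>, x\<^sub>n]\<close>, which is also an \<open>R\<close>-module. For a \<open>k\<close>-algebra
  \<open>R\<close> it serves as \<open>R \<otimes>\<^sub>k S\<close> with \<open>S = mpoly_alg k n\<close>.
\<close>

definition mpoly_alg :: "('r, 'x) ring_scheme \<Rightarrow> nat \<Rightarrow> ('r, nat multiset \<Rightarrow> 'r) module" where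
  "mpoly_alg R n =
    \<lparr>carrier = {p. range p \<subseteq> carrier R \<and> finite {u. p u \<noteq> \<zero>\<^bsub>R\<^esub>} \<and> {u. p u \<noteq> \<zero>\<^bsub>R\<^esub>} \<subseteq> expo n},
     monoid.mult = (\<lambda>p q w. \<Oplus>\<^bsub>R\<^esub>v\<in>{v. v \<subseteq># w}. p v \<otimes>\<^bsub>R\<^esub> q (w - v)),
     monoid.one = (\<lambda>u. if u = {#} then \<one>\<^bsub>R\<^esub> else \<zero>\<^bsub>R\<^esub>),
     ring.zero = (\<lambda>u. \<zero>\<^bsub>R\<^esub>),
     ring.add = (\<lambda>p q u. p u \<oplus>\<^bsub>R\<^esub> q u),
     smult = (\<lambda>c p u. c \<otimes>\<^bsub>R\<^esub> p u)\<rparr>"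

definition mon :: "('r, 'x) ring_scheme \<Rightarrow> nat multiset \<Rightarrow> (nat multiset \<Rightarrow> 'r)" where
  "mon R u = (\<lambda>v. if v = u then \<one>\<^bsub>R\<^esub> else \<zero>\<^bsub>R\<^esub>)"

text \<open>The \<open>R\<close>-module \<open>\<Oplus>\<^bsub>a\<in>E\<^esub> R \<otimes>\<^sub>k S\<^sub>a\<close>.\<close>

definition graded_part ::
    "('r, 'x) ring_scheme \<Rightarrow> nat \<Rightarrow> (nat multiset \<Rightarrow> 'a) \<Rightarrow> 'a set
      \<Rightarrow> ('r, nat multiset \<Rightarrow> 'r) module" where
  "graded_part R n dg E =
    (mpoly_alg R n)\<lparr>carrier := {p \<in> carrier (mpoly_alg R n). \<forall>u. p u \<noteq> \<zero>\<^bsub>R\<^esub> \<longrightarrow> dg u \<in> E}\<rparr>"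

definition component ::
    "('r, 'x) ring_scheme \<Rightarrow> (nat multiset \<Rightarrow> 'a) \<Rightarrow> 'a \<Rightarrow> (nat multiset \<Rightarrow> 'r) \<Rightarrow> (nat multiset \<Rightarrow> 'r)" where
  "component R dg a p = (\<lambda>u. if dg u = a then p u else \<zero>\<^bsub>R\<^esub>)"

definition homogeneous ::
    "('r, 'x) ring_scheme \<Rightarrow> (nat multiset \<Rightarrow> 'a) \<Rightarrow> (nat multiset \<Rightarrow> 'r) set \<Rightarrow> bool" where
  "homogeneous R dg N \<longleftrightarrow> (\<forall>p\<in>N. \<forall>a. component R dg a p \<in> N)"

text \<open>For homogeneous \<open>N\<close> this is \<open>\<Oplus>\<^bsub>a\<in>E\<^esub> N\<^sub>a\<close>; in particular \<open>N\<^sub>a\<close> is the case \<open>E = {a}\<close>.\<close>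

definition restrict_degrees ::
    "('r, 'x) ring_scheme \<Rightarrow> nat \<Rightarrow> (nat multiset \<Rightarrow> 'a) \<Rightarrow> 'a set
      \<Rightarrow> (nat multiset \<Rightarrow> 'r) set \<Rightarrow> (nat multiset \<Rightarrow> 'r) set" where
  "restrict_degrees R n dg E N = N \<inter> carrier (graded_part R n dg E)"

section \<open>The Hilbert functors\<close>

definition quot_locally_free ::
    "('r, 'x) ring_scheme \<Rightarrow> nat \<Rightarrow> (nat multiset \<Rightarrow> 'a) \<Rightarrow> ('a \<Rightarrow> nat)
      \<Rightarrow> (nat multiset \<Rightarrow> 'r) set \<Rightarrow> 'a \<Rightarrow> bool" where
  "quot_locally_free R n dg h N a \<longleftrightarrow>
    locally_free R (quot_module (graded_part R n dg {a}) (restrict_degrees R n dg {a} N)) (h a)"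

definition hilb ::
    "('r, 'x) ring_scheme \<Rightarrow> nat \<Rightarrow> (nat multiset \<Rightarrow> 'a) \<Rightarrow> ('a \<Rightarrow> nat)
      \<Rightarrow> (nat multiset \<Rightarrow> 'r) set set" where
  "hilb R n dg h =
    {I. ideal I (mpoly_alg R n) \<and> homogeneous R dg I \<and> (\<forall>a. quot_locally_free R n dg h I a)}"

definition hilb_deg ::
    "('r, 'x) ring_scheme \<Rightarrow> nat \<Rightarrow> (nat multiset \<Rightarrow> 'a::ab_group_add) \<Rightarrow> ('a \<Rightarrow> nat) \<Rightarrow> 'a set
      \<Rightarrow> (nat multiset \<Rightarrow> 'r) set set" where
  "hilb_deg R n dg h D =
    {L. submodule L R (graded_part R n dg D) \<and> homogeneous R dg L \<and>
        (\<forall>a\<in>D. \<forall>b\<in>D. \<forall>u\<in>expo n. dg u = b - a \<longrightarrow>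
           (\<forall>p \<in> restrict_degrees R n dg {a} L.
              mon R u \<otimes>\<^bsub>mpoly_alg R n\<^esub> p \<in> restrict_degrees R n dg {b} L)) \<and>
        (\<forall>a\<in>D. quot_locally_free R n dg h L a)}"

text \<open>
  The action of the two functors on a \<open>k\<close>-algebra homomorphism \<open>\<psi>: R \<rightarrow> R'\<close>: the image of
  \<open>R' \<otimes>\<^sub>R I\<close> in \<open>R' \<otimes>\<^sub>k S\<close>, and likewise for \<open>L\<close>.
\<close>

definition alg_hom ::
    "('k, 'x) ring_scheme \<Rightarrow> ('k, 'r, 'y) module_scheme \<Rightarrow> ('k, 's, 'z) module_scheme \<Rightarrow> ('r \<Rightarrow> 's) set" where
  "alg_hom k R R' = {\<psi> \<in> ring_hom R R'.
    \<forall>c\<in>carrier k. \<forall>x\<in>carrier R. \<psi> (c \<odot>\<^bsub>R\<^esub> x) = c \<odot>\<^bsub>R'\<^esub> \<psi> x}"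

definition hilb_map ::
    "('s, 'x) ring_scheme \<Rightarrow> nat \<Rightarrow> ('r \<Rightarrow> 's) \<Rightarrow> (nat multiset \<Rightarrow> 'r) set \<Rightarrow> (nat multiset \<Rightarrow> 's) set" where
  "hilb_map R' n \<psi> I = Idl\<^bsub>mpoly_alg R' n\<^esub> ((\<lambda>p. \<psi> \<circ> p) ` I)"

definition hilb_deg_map ::
    "('s, 'x) ring_scheme \<Rightarrow> nat \<Rightarrow> (nat multiset \<Rightarrow> 'a) \<Rightarrow> 'a set \<Rightarrow> ('r \<Rightarrow> 's)
      \<Rightarrow> (nat multiset \<Rightarrow> 'r) set \<Rightarrow> (nat multiset \<Rightarrow> 's) set" where
  "hilb_deg_map R' n dg D \<psi> L = gen_submodule R' (graded_part R' n dg D) ((\<lambda>p. \<psi> \<circ> p) ` L)"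

section \<open>Monomial ideals and very supportive sets of degrees\<close>

definition monomial_ideal :: "('k, 'x) ring_scheme \<Rightarrow> nat \<Rightarrow> (nat multiset \<Rightarrow> 'k) set \<Rightarrow> bool" where
  "monomial_ideal k n I \<longleftrightarrow> (\<exists>U \<subseteq> expo n. I = Idl\<^bsub>mpoly_alg k n\<^esub> (mon k ` U))"

definition monomial_generated_in ::
    "('k, 'x) ring_scheme \<Rightarrow> nat \<Rightarrow> (nat multiset \<Rightarrow> 'a) \<Rightarrow> 'a set \<Rightarrow> (nat multiset \<Rightarrow> 'k) set \<Rightarrow> bool" where
  "monomial_generated_in k n dg D I \<longleftrightarrow>
    (\<exists>U \<subseteq> {u \<in> expo n. dg u \<in> D}. I = Idl\<^bsub>mpoly_alg k n\<^esub> (mon k ` U))"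

text \<open>\<open>h\<^sub>I(a) = h(a)\<close>; finiteness is explicit because \<^const>\<open>card\<close> vanishes on infinite sets.\<close>

definition hilb_fun_eq ::
    "('k, 'x) ring_scheme \<Rightarrow> nat \<Rightarrow> (nat multiset \<Rightarrow> 'a) \<Rightarrow> ('a \<Rightarrow> nat)
      \<Rightarrow> (nat multiset \<Rightarrow> 'k) set \<Rightarrow> 'a \<Rightarrow> bool" where
  "hilb_fun_eq k n dg h I a \<longleftrightarrow>
    (let B = {u \<in> expo n. dg u = a \<and> mon k u \<notin> I} in finite B \<and> card B = h a)"

text \<open>Exponents of the minimal monomial generators; by Dickson's lemma a finite set.\<close>

definition min_gens :: "('k, 'x) ring_scheme \<Rightarrow> nat \<Rightarrow> (nat multiset \<Rightarrow> 'k) set \<Rightarrow> nat multiset set" where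
  "min_gens k n I = {u \<in> expo n. mon k u \<in> I \<and> (\<forall>v. v \<subset># u \<longrightarrow> mon k v \<notin> I)}"

definition free_module :: "('s, 'x) ring_scheme \<Rightarrow> 'g set \<Rightarrow> ('s, 'g \<Rightarrow> 's) module" where
  "free_module S G =
    \<lparr>carrier = G \<rightarrow>\<^sub>E carrier S, monoid.mult = undefined, monoid.one = undefined,
     ring.zero = (\<lambda>g\<in>G. \<zero>\<^bsub>S\<^esub>),
     ring.add = (\<lambda>s t. \<lambda>g\<in>G. s g \<oplus>\<^bsub>S\<^esub> t g),
     smult = (\<lambda>c s. \<lambda>g\<in>G. c \<otimes>\<^bsub>S\<^esub> s g)\<rparr>"

definition syzygies ::
    "('k, 'x) ring_scheme \<Rightarrow> nat \<Rightarrow> nat multiset set \<Rightarrow> (nat multiset \<Rightarrow> nat multiset \<Rightarrow> 'k) set" where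
  "syzygies k n G = (let S = mpoly_alg k n in
    {s \<in> carrier (free_module S G). (\<Oplus>\<^bsub>S\<^esub>g\<in>G. s g \<otimes>\<^bsub>S\<^esub> mon k g) = \<zero>\<^bsub>S\<^esub>})"

text \<open>The syzygy \<open>x\<^sup>v\<^sup>' e\<^sub>u - x\<^sup>u\<^sup>' e\<^sub>v\<close> with \<open>x\<^sup>u x\<^sup>v\<^sup>' = x\<^sup>v x\<^sup>u\<^sup>' = lcm(x\<^sup>u, x\<^sup>v)\<close>.\<close>

definition pair_syzygy ::
    "('k, 'x) ring_scheme \<Rightarrow> nat \<Rightarrow> nat multiset set \<Rightarrow> nat multiset \<Rightarrow> nat multiset
      \<Rightarrow> (nat multiset \<Rightarrow> nat multiset \<Rightarrow> 'k)" where
  "pair_syzygy k n G u v = (let S = mpoly_alg k n in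
    (\<lambda>g\<in>G. (if g = u then mon k (u \<union># v - u) else \<zero>\<^bsub>S\<^esub>)
        \<ominus>\<^bsub>S\<^esub> (if g = v then mon k (u \<union># v - v) else \<zero>\<^bsub>S\<^esub>)))"

definition syzygies_generated_in ::
    "('k, 'x) ring_scheme \<Rightarrow> nat \<Rightarrow> (nat multiset \<Rightarrow> 'a) \<Rightarrow> 'a set \<Rightarrow> (nat multiset \<Rightarrow> 'k) set \<Rightarrow> bool" where
  "syzygies_generated_in k n dg D I \<longleftrightarrow>
    (let S = mpoly_alg k n; G = min_gens k n I in
     gen_submodule S (free_module S G)
       {pair_syzygy k n G u v | u v. u \<in> G \<and> v \<in> G \<and> dg (u \<union># v) \<in> D}
     = syzygies k n G)"

definition very_supportive ::
    "('k, 'x) ring_scheme \<Rightarrow> nat \<Rightarrow> (nat multiset \<Rightarrow> 'a) \<Rightarrow> ('a \<Rightarrow> nat) \<Rightarrow> 'a set \<Rightarrow> bool" where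
  "very_supportive k n dg h D \<longleftrightarrow>
    finite D \<and>
    (\<forall>I. monomial_ideal k n I \<and> (\<forall>a. hilb_fun_eq k n dg h I a)
        \<longrightarrow> monomial_generated_in k n dg D I) \<and>
    (\<forall>I. monomial_generated_in k n dg D I \<and> (\<forall>a\<in>D. hilb_fun_eq k n dg h I a)
        \<longrightarrow> (\<forall>a. hilb_fun_eq k n dg h I a)) \<and>
    (\<forall>I. monomial_ideal k n I \<and> (\<forall>a. hilb_fun_eq k n dg h I a)
        \<longrightarrow> syzygies_generated_in k n dg D I)"

end

theory Submission
  imports Defs "HOL-Library.Multiset_Order"
begin

text \<open>
  Local freeness and equality of submodules can be checked at each maximal ideal \<open>\<mm>\<close> of \<open>R\<close>. Let \<open>J\<close> be
  the ideal generated by a point \<open>L\<close> of the truncated functor. The leading exponents of \<open>L\<close> modulo \<open>\<mm>\<close>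
  generate a monomial ideal, which has Hilbert function \<open>h\<close> by condition (h); hence there are \<open>h(a)\<close>
  standard monomials in every degree \<open>a\<close>. By Nakayama's lemma they span \<open>S\<^sub>a/J\<^sub>a\<close> after inverting an element
  outside \<open>\<mm>\<close>. By condition (s), Buchberger's criterion holds modulo \<open>\<mm>\<close>, so that a relation among standard
  monomials is a combination, with coefficients in \<open>\<mm>\<close>, of multiples of elements of \<open>L\<close>. The groups \<open>S\<^sub>a\<close> may
  have infinite rank, but by Dickson's lemma finitely many multiples matter locally, and a second use of
  Nakayama's lemma shows that the relation vanishes locally. So \<open>S\<^sub>a/J\<^sub>a\<close> is locally free of rank \<open>h(a)\<close>.
  Any other homogeneous ideal of this kind that restricts to \<open>L\<close> contains \<open>J\<close> and has equally many standard
  monomials, thus the same ones, and therefore coincides with \<open>J\<close>.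
\<close>

section \<open>Spans with restricted coefficients\<close>

text \<open>The obstacle is that R is arbitrary and that S_0 may contain infinitely many monomials,
  so neither S_a nor J_a need be finitely generated. Finiteness comes from the degrees in D, where a
  finite local basis is given: a non-standard monomial of degree a factors as x^e times a monomial
  whose degree lies in D, with e from a finite set, and rewriting the second factor leaves only a
  finite set \<open>W a\<close> of monomials. A monomial has several such factorizations; the
  discrepancies between the resulting rewritings are relations among the monomials of
  \<open>W a\<close>. There are infinitely many of them, but they are controlled by finitely many,
  because a leftover factor of degree 0 can be replaced by standard monomials. Apart from the
  translation to and from \<open>free_of_rank\<close>, no module is localized: a statement valid
  after inverting f is membership in a saturation \<open>sat\<close>, and products with \<mm> are
  spans \<open>lspan\<close> with coefficients in \<mm>. Residue fields are not formed either;
  leading exponents are read off modulo \<mm>. The hypotheses over k reach R because they are first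
  turned into statements about divisibility of exponents.\<close>

inductive_set lspan :: "('r, 'm, 'y) module_scheme \<Rightarrow> 'r set \<Rightarrow> 'm set \<Rightarrow> 'm set"
  for M C Y where
  lspan_zero: "\<zero>\<^bsub>M\<^esub> \<in> lspan M C Y"
| lspan_step: "c \<in> C \<Longrightarrow> y \<in> Y \<Longrightarrow> x \<in> lspan M C Y \<Longrightarrow> c \<odot>\<^bsub>M\<^esub> y \<oplus>\<^bsub>M\<^esub> x \<in> lspan M C Y"

lemma lspan_mono:
  assumes "C \<subseteq> C'" "Y \<subseteq> Y'" shows "lspan M C Y \<subseteq> lspan M C' Y'"
proof
  fix x assume "x \<in> lspan M C Y"
  then show "x \<in> lspan M C' Y'"
    by induction (use assms in \<open>auto intro: lspan.intros\<close>)
qed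

lemma lspan_finite_subset:
  assumes "x \<in> lspan M C Y"
  obtains Y0 where "finite Y0" "Y0 \<subseteq> Y" "x \<in> lspan M C Y0"
proof -
  from assms have "\<exists>Y0. finite Y0 \<and> Y0 \<subseteq> Y \<and> x \<in> lspan M C Y0"
  proof induction
    case lspan_zero
    then show ?case by (auto intro: lspan.intros)
  next
    case (lspan_step c y x)
    then obtain Y0 where Y0: "finite Y0" "Y0 \<subseteq> Y" "x \<in> lspan M C Y0" by blast
    have "x \<in> lspan M C (insert y Y0)"
      using Y0(3) lspan_mono[of C C Y0 "insert y Y0"] by blast
    then have "c \<odot>\<^bsub>M\<^esub> y \<oplus>\<^bsub>M\<^esub> x \<in> lspan M C (insert y Y0)"
      using lspan_step(1) by (auto intro: lspan.intros)
    then show ?case using Y0 lspan_step(2) by (intro exI[of _ "insert y Y0"]) auto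
  qed
  then show ?thesis using that by blast
qed

section \<open>Ideals, complements of primes, spans and Nakayama's lemma\<close>

context cring
begin

lemma ideal_mult_left: "ideal C R \<Longrightarrow> r \<in> carrier R \<Longrightarrow> c \<in> C \<Longrightarrow> r \<otimes> c \<in> C"
  by (rule ideal.I_l_closed)

lemma ideal_subset: "ideal C R \<Longrightarrow> C \<subseteq> carrier R"
  by (rule additive_subgroup.a_subset[OF ideal.axioms(1)])

lemma ideal_zero: "ideal C R \<Longrightarrow> \<zero> \<in> C"
  by (rule additive_subgroup.zero_closed[OF ideal.axioms(1)])

lemma ideal_add: "ideal C R \<Longrightarrow> a \<in> C \<Longrightarrow> b \<in> C \<Longrightarrow> a \<oplus> b \<in> C"
  by (rule additive_subgroup.a_closed[OF ideal.axioms(1)])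

lemma ideal_minus: "ideal C R \<Longrightarrow> a \<in> C \<Longrightarrow> \<ominus> a \<in> C"
  by (rule additive_subgroup.a_inv_closed[OF ideal.axioms(1)])

lemma ideal_diff: "ideal C R \<Longrightarrow> a \<in> C \<Longrightarrow> b \<in> C \<Longrightarrow> a \<ominus> b \<in> C"
  unfolding a_minus_def by (intro ideal_minus ideal_add)

end

lemma (in primeideal) mult_notin:
  "a \<in> carrier R - I \<Longrightarrow> b \<in> carrier R - I \<Longrightarrow> a \<otimes> b \<in> carrier R - I"
  using I_prime by auto

lemma (in primeideal) one_notin: "\<one> \<in> carrier R - I"
  using I_notcarr ideal.one_imp_carrier[OF is_ideal] by auto

lemma (in primeideal) pow_notin:
  "a \<in> carrier R - I \<Longrightarrow> a [^] (t::nat) \<in> carrier R - I"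
proof (induction t)
  case (Suc t)
  then show ?case using mult_notin by (simp del: Diff_iff)
qed (use one_notin in simp)

context module
begin

lemma submodule_diff:
  assumes "submodule N R M" "a \<in> N" "b \<in> N" shows "a \<ominus>\<^bsub>M\<^esub> b \<in> N"
  using submoduleE[OF assms(1)] assms by (simp add: M.minus_eq)

lemma submodule_zero: "submodule N R M \<Longrightarrow> \<zero>\<^bsub>M\<^esub> \<in> N"
  using submodule.axioms(1) subgroup.one_closed by fastforce

lemma zero_submodule: "submodule {\<zero>\<^bsub>M\<^esub>} R M"
  by (rule submoduleI) auto

lemma submodule_cancel:
  assumes "submodule N R M" "a \<oplus>\<^bsub>M\<^esub> b \<in> N" "a \<in> N" "b \<in> carrier M" shows "b \<in> N"
proof -
  have a: "a \<in> carrier M" using submoduleE(1)[OF assms(1)] assms by blast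
  have "(a \<oplus>\<^bsub>M\<^esub> b) \<ominus>\<^bsub>M\<^esub> a = b"
    using a assms(4) by (metis M.a_comm M.a_inv_closed M.add.inv_solve_right M.add.m_closed M.minus_eq)
  then show ?thesis using submodule_diff[OF assms(1,2,3)] by simp
qed

lemma lspan_carrier: "C \<subseteq> carrier R \<Longrightarrow> Y \<subseteq> carrier M \<Longrightarrow> lspan M C Y \<subseteq> carrier M"
proof
  fix x assume a: "C \<subseteq> carrier R" "Y \<subseteq> carrier M" and "x \<in> lspan M C Y"
  from this(3) show "x \<in> carrier M" by induction (use a in auto)
qed

lemma lspan_base:
  "C \<subseteq> carrier R \<Longrightarrow> Y \<subseteq> carrier M \<Longrightarrow> c \<in> C \<Longrightarrow> y \<in> Y \<Longrightarrow> c \<odot>\<^bsub>M\<^esub> y \<in> lspan M C Y"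
  using lspan_step[OF _ _ lspan_zero, of c C y Y M]
  by (metis M.r_zero smult_closed subsetD)

lemma lspan_base1: "Y \<subseteq> carrier M \<Longrightarrow> y \<in> Y \<Longrightarrow> y \<in> lspan M (carrier R) Y"
  using lspan_base[of "carrier R" Y \<one> y] by auto

lemma lspan_add:
  assumes "C \<subseteq> carrier R" "Y \<subseteq> carrier M" "x \<in> lspan M C Y" "z \<in> lspan M C Y"
  shows "x \<oplus>\<^bsub>M\<^esub> z \<in> lspan M C Y"
  using assms(3)
proof induction
  case lspan_zero
  then show ?case using assms lspan_carrier[OF assms(1,2)] by auto
next
  case (lspan_step c y x)
  have "x \<in> carrier M" "z \<in> carrier M" "c \<odot>\<^bsub>M\<^esub> y \<in> carrier M"
    using assms lspan_step lspan_carrier[OF assms(1,2)] by auto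
  then have "c \<odot>\<^bsub>M\<^esub> y \<oplus>\<^bsub>M\<^esub> x \<oplus>\<^bsub>M\<^esub> z = c \<odot>\<^bsub>M\<^esub> y \<oplus>\<^bsub>M\<^esub> (x \<oplus>\<^bsub>M\<^esub> z)" by (simp add: M.a_assoc)
  then show ?case using lspan_step by (auto intro: lspan.intros)
qed

lemma lspan_smult_gen:
  assumes "C \<subseteq> carrier R" "Y \<subseteq> carrier M" "x \<in> lspan M C Y" "r \<in> carrier R"
    "\<And>c. c \<in> C \<Longrightarrow> r \<otimes> c \<in> C'" "C' \<subseteq> carrier R"
  shows "r \<odot>\<^bsub>M\<^esub> x \<in> lspan M C' Y"
  using assms(3)
proof induction
  case lspan_zero
  then show ?case using assms by (simp add: lspan.intros)
next
  case (lspan_step c y x)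
  have "x \<in> carrier M" "c \<in> carrier R" "y \<in> carrier M"
    using assms lspan_step lspan_carrier[OF assms(1,2)] by auto
  then have "r \<odot>\<^bsub>M\<^esub> (c \<odot>\<^bsub>M\<^esub> y \<oplus>\<^bsub>M\<^esub> x) = (r \<otimes> c) \<odot>\<^bsub>M\<^esub> y \<oplus>\<^bsub>M\<^esub> r \<odot>\<^bsub>M\<^esub> x"
    using assms(4) by (simp add: smult_r_distr smult_assoc1)
  then show ?case using lspan_step assms(5) by (auto intro: lspan.intros)
qed

lemma lspan_submodule:
  assumes "ideal C R" "Y \<subseteq> carrier M" shows "submodule (lspan M C Y) R M"
proof -
  have C: "C \<subseteq> carrier R" using ideal_subset assms(1) .
  have sm: "r \<odot>\<^bsub>M\<^esub> x \<in> lspan M C Y" if "r \<in> carrier R" "x \<in> lspan M C Y" for r x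
    using lspan_smult_gen[OF C assms(2) that(2,1) _ C] ideal_mult_left[OF assms(1)] that by blast
  show ?thesis
  proof (rule submoduleI)
    fix a assume a: "a \<in> lspan M C Y"
    have "(\<ominus> \<one>) \<odot>\<^bsub>M\<^esub> a = \<ominus>\<^bsub>M\<^esub> a"
      using a lspan_carrier[OF C assms(2)] by (metis R.one_closed smult_l_minus smult_one subsetD)
    then show "\<ominus>\<^bsub>M\<^esub> a \<in> lspan M C Y" using sm[OF _ a, of "\<ominus> \<one>"] by simp
  qed (use lspan_carrier[OF C assms(2)] lspan_add[OF C assms(2)] sm in \<open>auto intro: lspan.intros\<close>)
qed

lemma span_submodule: "Y \<subseteq> carrier M \<Longrightarrow> submodule (lspan M (carrier R) Y) R M"
  by (simp add: lspan_submodule oneideal)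

lemma lspan_subset:
  assumes "submodule N R M" "\<And>c y. c \<in> C \<Longrightarrow> y \<in> Y \<Longrightarrow> c \<odot>\<^bsub>M\<^esub> y \<in> N"
  shows "lspan M C Y \<subseteq> N"
proof
  fix x assume "x \<in> lspan M C Y"
  then show "x \<in> N"
    by induction (use assms submodule_zero submoduleE(5)[OF assms(1)] in auto)
qed

lemma span_subset:
  assumes "submodule N R M" "Y \<subseteq> N" shows "lspan M (carrier R) Y \<subseteq> N"
  using lspan_subset[OF assms(1)] assms submoduleE(4)[OF assms(1)] by blast

lemma lspan_un:
  assumes "C \<subseteq> carrier R" "A \<subseteq> carrier M" "B \<subseteq> carrier M" "x \<in> lspan M C (A \<union> B)"
  obtains a b where "a \<in> lspan M C A" "b \<in> lspan M C B" "x = a \<oplus>\<^bsub>M\<^esub> b"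
proof -
  from assms(4) have "\<exists>a\<in>lspan M C A. \<exists>b\<in>lspan M C B. x = a \<oplus>\<^bsub>M\<^esub> b"
  proof induction
    case lspan_zero
    show ?case by (intro bexI[of _ "\<zero>\<^bsub>M\<^esub>"]) (auto intro: lspan.intros)
  next
    case (lspan_step c y x)
    then obtain a b where ab: "a \<in> lspan M C A" "b \<in> lspan M C B" "x = a \<oplus>\<^bsub>M\<^esub> b" by blast
    have carr: "a \<in> carrier M" "b \<in> carrier M" "c \<odot>\<^bsub>M\<^esub> y \<in> carrier M"
      using ab(1,2) lspan_carrier[OF assms(1,2)] lspan_carrier[OF assms(1,3)] assms(1,2,3) lspan_step(1,2)
      by auto
    show ?case
    proof (cases "y \<in> A")
      case True
      then have "c \<odot>\<^bsub>M\<^esub> y \<oplus>\<^bsub>M\<^esub> a \<in> lspan M C A" using ab lspan_step by (auto intro: lspan.intros)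
      moreover have "c \<odot>\<^bsub>M\<^esub> y \<oplus>\<^bsub>M\<^esub> x = (c \<odot>\<^bsub>M\<^esub> y \<oplus>\<^bsub>M\<^esub> a) \<oplus>\<^bsub>M\<^esub> b"
        using carr ab by (simp add: M.a_assoc)
      ultimately show ?thesis using ab by blast
    next
      case False
      then have "c \<odot>\<^bsub>M\<^esub> y \<oplus>\<^bsub>M\<^esub> b \<in> lspan M C B" using ab lspan_step by (auto intro: lspan.intros)
      moreover have "c \<odot>\<^bsub>M\<^esub> y \<oplus>\<^bsub>M\<^esub> x = a \<oplus>\<^bsub>M\<^esub> (c \<odot>\<^bsub>M\<^esub> y \<oplus>\<^bsub>M\<^esub> b)"
        using carr ab by (simp add: M.a_ac)
      ultimately show ?thesis using ab by blast
    qed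
  qed
  then show ?thesis using that by blast
qed

lemma lspan_singleton:
  assumes "ideal C R" "w \<in> carrier M" "x \<in> lspan M C {w}"
  obtains c where "c \<in> C" "x = c \<odot>\<^bsub>M\<^esub> w"
proof -
  from assms(3) have "\<exists>c\<in>C. x = c \<odot>\<^bsub>M\<^esub> w"
  proof induction
    case lspan_zero
    show ?case using assms by (intro bexI[of _ \<zero>]) (auto simp: ideal_zero)
  next
    case (lspan_step c y x)
    then obtain d where d: "d \<in> C" "x = d \<odot>\<^bsub>M\<^esub> w" by blast
    have "c \<odot>\<^bsub>M\<^esub> y \<oplus>\<^bsub>M\<^esub> x = (c \<oplus> d) \<odot>\<^bsub>M\<^esub> w"
      using d lspan_step(1,2) assms(2) subsetD[OF ideal_subset[OF assms(1)]]
      by (simp add: smult_l_distr)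
    then show ?case using d lspan_step ideal_add[OF assms(1)] by blast
  qed
  then show ?thesis using that by blast
qed

lemma lspan_insert:
  assumes "ideal C R" "w \<in> carrier M" "W \<subseteq> carrier M" "x \<in> lspan M C (insert w W)"
  obtains c y where "c \<in> C" "y \<in> lspan M C W" "x = c \<odot>\<^bsub>M\<^esub> w \<oplus>\<^bsub>M\<^esub> y"
proof -
  have "x \<in> lspan M C ({w} \<union> W)" using assms by simp
  then obtain a b where "a \<in> lspan M C {w}" "b \<in> lspan M C W" "x = a \<oplus>\<^bsub>M\<^esub> b"
    using lspan_un[of C "{w}" W x] ideal_subset[OF assms(1)] assms(2,3) by blast
  then show ?thesis using lspan_singleton[OF assms(1,2)] that by metis
qed

text \<open>This is the localized form: the multipliers \<open>g\<close> stand for units at \<mm>,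
  so no local ring is needed. The generators are eliminated one at a time. The relation for
  \<open>w0\<close> is solved for \<open>w0\<close> and substituted into the others, which leaves a
  relation of the same shape for the smaller set; the induction hypothesis then provides the final
  multiplier.\<close>

lemma nakayama:
  assumes m: "primeideal \<mm> R" and "finite W" "W \<subseteq> carrier M" and N: "submodule N R M"
    and "\<And>w. w \<in> W \<Longrightarrow>
      \<exists>g\<in>carrier R - \<mm>. \<exists>\<nu>\<in>N. \<exists>y\<in>lspan M \<mm> W. g \<odot>\<^bsub>M\<^esub> w = \<nu> \<oplus>\<^bsub>M\<^esub> y"
  shows "\<exists>s\<in>carrier R - \<mm>. \<forall>w\<in>W. s \<odot>\<^bsub>M\<^esub> w \<in> N"
  using assms(2,3,5)
proof (induction W)
  case empty
  then show ?case using primeideal.one_notin[OF m] by blast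
next
  case (insert w0 W)
  interpret m: primeideal \<mm> R by (rule m)
  have mi: "ideal \<mm> R" ..
  have Nc: "N \<subseteq> carrier M" using submoduleE(1)[OF N] .
  have mc: "\<mm> \<subseteq> carrier R" using ideal_subset[OF mi] .
  have w0: "w0 \<in> carrier M" and W: "W \<subseteq> carrier M" using insert by auto
  have spanW: "submodule (lspan M \<mm> W) R M" using lspan_submodule[OF mi W] .
  have dec: "\<exists>g\<in>carrier R - \<mm>. \<exists>\<mu>\<in>\<mm>. \<exists>\<nu>\<in>N. \<exists>y\<in>lspan M \<mm> W.
      g \<odot>\<^bsub>M\<^esub> w = \<nu> \<oplus>\<^bsub>M\<^esub> (\<mu> \<odot>\<^bsub>M\<^esub> w0 \<oplus>\<^bsub>M\<^esub> y)" if "w \<in> insert w0 W" for w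
  proof -
    obtain g \<nu> y where g: "g \<in> carrier R - \<mm>" "\<nu> \<in> N" "y \<in> lspan M \<mm> (insert w0 W)"
        "g \<odot>\<^bsub>M\<^esub> w = \<nu> \<oplus>\<^bsub>M\<^esub> y"
      using insert.prems(2)[OF \<open>w \<in> insert w0 W\<close>] by blast
    obtain \<mu> y' where "\<mu> \<in> \<mm>" "y' \<in> lspan M \<mm> W" "y = \<mu> \<odot>\<^bsub>M\<^esub> w0 \<oplus>\<^bsub>M\<^esub> y'"
      using lspan_insert[OF mi w0 W g(3)] by blast
    then show ?thesis using g by blast
  qed
  have yc: "y \<in> carrier M" if "y \<in> lspan M \<mm> W" for y using that submoduleE(1)[OF spanW] by blast
  obtain g0 \<mu>0 \<nu>0 y0 where g0: "g0 \<in> carrier R - \<mm>" "\<mu>0 \<in> \<mm>" "\<nu>0 \<in> N" "y0 \<in> lspan M \<mm> W"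
      "g0 \<odot>\<^bsub>M\<^esub> w0 = \<nu>0 \<oplus>\<^bsub>M\<^esub> (\<mu>0 \<odot>\<^bsub>M\<^esub> w0 \<oplus>\<^bsub>M\<^esub> y0)" using dec[OF insertI1] by blast
  \<comment> \<open>This plays the part of the unit 1 - \<mu>0: moving the \<open>w0\<close> term of
    the right-hand side to the left keeps the multiplier outside \<mm>.\<close>
  define h where "h = g0 \<ominus> \<mu>0"
  have hc: "h \<in> carrier R" using g0 mc by (auto simp: h_def)
  have h: "h \<in> carrier R - \<mm>"
  proof -
    have "h \<oplus> \<mu>0 = g0" using g0 mc by (simp add: h_def R.minus_eq R.a_assoc R.l_neg subset_iff)
    then have "h \<notin> \<mm>" using g0 ideal_add[OF mi, of h \<mu>0] by auto
    then show ?thesis using hc by simp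
  qed
  have hw0: "h \<odot>\<^bsub>M\<^esub> w0 = \<nu>0 \<oplus>\<^bsub>M\<^esub> y0"
  proof -
    have carr: "g0 \<in> carrier R" "\<mu>0 \<in> carrier R" "\<nu>0 \<in> carrier M" "y0 \<in> carrier M"
      using g0 Nc yc mc by auto
    have "h \<odot>\<^bsub>M\<^esub> w0 = g0 \<odot>\<^bsub>M\<^esub> w0 \<oplus>\<^bsub>M\<^esub> \<ominus>\<^bsub>M\<^esub> (\<mu>0 \<odot>\<^bsub>M\<^esub> w0)"
      using carr w0 by (simp add: h_def R.minus_eq smult_l_distr smult_l_minus)
    also have "\<dots> = \<nu>0 \<oplus>\<^bsub>M\<^esub> y0"
      unfolding g0(5) using carr w0 by (simp add: M.a_ac M.r_neg M.r_neg1)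
    finally show ?thesis .
  qed
  have step: "\<exists>g\<in>carrier R - \<mm>. \<exists>\<nu>\<in>N. \<exists>y\<in>lspan M \<mm> W. g \<odot>\<^bsub>M\<^esub> w = \<nu> \<oplus>\<^bsub>M\<^esub> y" if wW: "w \<in> W" for w
  proof -
    obtain g \<mu> \<nu> y where g: "g \<in> carrier R - \<mm>" "\<mu> \<in> \<mm>" "\<nu> \<in> N" "y \<in> lspan M \<mm> W"
        "g \<odot>\<^bsub>M\<^esub> w = \<nu> \<oplus>\<^bsub>M\<^esub> (\<mu> \<odot>\<^bsub>M\<^esub> w0 \<oplus>\<^bsub>M\<^esub> y)" using dec[OF insertI2[OF wW]] by blast
    have carr: "g \<in> carrier R" "\<mu> \<in> carrier R" "\<nu> \<in> carrier M" "y \<in> carrier M" "w \<in> carrier M"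
      "\<nu>0 \<in> carrier M" "y0 \<in> carrier M"
      using g Nc yc mc that W g0 by auto
    have "(h \<otimes> g) \<odot>\<^bsub>M\<^esub> w = h \<odot>\<^bsub>M\<^esub> \<nu> \<oplus>\<^bsub>M\<^esub> (\<mu> \<odot>\<^bsub>M\<^esub> (h \<odot>\<^bsub>M\<^esub> w0) \<oplus>\<^bsub>M\<^esub> h \<odot>\<^bsub>M\<^esub> y)"
      using carr hc w0
      by (simp add: smult_assoc1 g(5) smult_r_distr) (metis R.m_comm smult_assoc1)
    also have "\<dots> = (h \<odot>\<^bsub>M\<^esub> \<nu> \<oplus>\<^bsub>M\<^esub> \<mu> \<odot>\<^bsub>M\<^esub> \<nu>0) \<oplus>\<^bsub>M\<^esub> (\<mu> \<odot>\<^bsub>M\<^esub> y0 \<oplus>\<^bsub>M\<^esub> h \<odot>\<^bsub>M\<^esub> y)"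
      unfolding hw0 using carr hc by (simp add: smult_r_distr M.a_ac)
    finally have "(h \<otimes> g) \<odot>\<^bsub>M\<^esub> w = \<dots>" .
    moreover have "h \<odot>\<^bsub>M\<^esub> \<nu> \<oplus>\<^bsub>M\<^esub> \<mu> \<odot>\<^bsub>M\<^esub> \<nu>0 \<in> N"
      using submoduleE(4,5)[OF N] g(3) g0(3) carr hc by simp
    moreover have "\<mu> \<odot>\<^bsub>M\<^esub> y0 \<oplus>\<^bsub>M\<^esub> h \<odot>\<^bsub>M\<^esub> y \<in> lspan M \<mm> W"
      using submoduleE(4,5)[OF spanW] g(4) g0(4) carr hc by simp
    ultimately show ?thesis using m.mult_notin[OF h g(1)] by blast
  qed
  obtain s where s: "s \<in> carrier R - \<mm>" "\<forall>w\<in>W. s \<odot>\<^bsub>M\<^esub> w \<in> N"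
    using insert.IH[OF W step] by blast
  have sy: "s \<odot>\<^bsub>M\<^esub> y \<in> N" if "y \<in> lspan M \<mm> W" for y
    using that
  proof induction
    case lspan_zero
    then show ?case using s submodule_zero[OF N] by simp
  next
    case (lspan_step c y x)
    have carr: "s \<in> carrier R" "c \<in> carrier R" "y \<in> carrier M" "x \<in> carrier M"
      using s lspan_step mc W yc by auto
    have "s \<odot>\<^bsub>M\<^esub> (c \<odot>\<^bsub>M\<^esub> y \<oplus>\<^bsub>M\<^esub> x) = c \<odot>\<^bsub>M\<^esub> (s \<odot>\<^bsub>M\<^esub> y) \<oplus>\<^bsub>M\<^esub> s \<odot>\<^bsub>M\<^esub> x"
      using carr by (simp add: smult_r_distr) (metis R.m_comm smult_assoc1)
    then show ?case using submoduleE(4,5)[OF N] s lspan_step carr by simp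
  qed
  have sc: "s \<in> carrier R" using s by simp
  have "(s \<otimes> h) \<odot>\<^bsub>M\<^esub> w0 = s \<odot>\<^bsub>M\<^esub> \<nu>0 \<oplus>\<^bsub>M\<^esub> s \<odot>\<^bsub>M\<^esub> y0"
    using sc hc w0 hw0 Nc g0 yc by (simp add: smult_assoc1 smult_r_distr subset_iff)
  then have 1: "(s \<otimes> h) \<odot>\<^bsub>M\<^esub> w0 \<in> N"
    using submoduleE(4,5)[OF N] sc g0 sy by simp
  have 2: "(s \<otimes> h) \<odot>\<^bsub>M\<^esub> w \<in> N" if "w \<in> W" for w
  proof -
    have "(s \<otimes> h) \<odot>\<^bsub>M\<^esub> w = h \<odot>\<^bsub>M\<^esub> (s \<odot>\<^bsub>M\<^esub> w)"
      using sc hc that W by (metis R.m_comm smult_assoc1 subsetD)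
    then show ?thesis using submoduleE(4)[OF N hc] s that by simp
  qed
  show ?case using 1 2 m.mult_notin[OF s(1) h] by blast
qed

end

section \<open>Saturations and bases of localized modules\<close>

definition sat :: "('r, 'x) ring_scheme \<Rightarrow> ('r, 'm, 'y) module_scheme \<Rightarrow> 'r \<Rightarrow> 'm set \<Rightarrow> 'm set" where
  "sat R M f N = {x \<in> carrier M. \<exists>t::nat. (f [^]\<^bsub>R\<^esub> t) \<odot>\<^bsub>M\<^esub> x \<in> N}"

text \<open>The images of the elements of \<open>E\<close> form a basis of the localization \<open>M\<^sub>f\<close>.\<close>

definition loc_basis ::
    "('r, 'x) ring_scheme \<Rightarrow> ('r, 'm, 'y) module_scheme \<Rightarrow> 'r \<Rightarrow> 'm set \<Rightarrow> bool" where
  "loc_basis R M f E \<longleftrightarrow> finite E \<and> E \<subseteq> carrier M \<and>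
     carrier M \<subseteq> sat R M f (lspan M (carrier R) E) \<and>
     (\<forall>x\<in>E. \<forall>c\<in>carrier R. c \<odot>\<^bsub>M\<^esub> x \<in> lspan M (carrier R) (E - {x}) \<longrightarrow>
        (\<exists>t::nat. (f [^]\<^bsub>R\<^esub> t) \<otimes>\<^bsub>R\<^esub> c = \<zero>\<^bsub>R\<^esub>))"

context module
begin

lemma smult_comm: "a \<in> carrier R \<Longrightarrow> b \<in> carrier R \<Longrightarrow> x \<in> carrier M \<Longrightarrow>
    a \<odot>\<^bsub>M\<^esub> (b \<odot>\<^bsub>M\<^esub> x) = b \<odot>\<^bsub>M\<^esub> (a \<odot>\<^bsub>M\<^esub> x)"
  by (metis R.m_comm smult_assoc1)

lemma satI: "x \<in> carrier M \<Longrightarrow> (f [^] (t::nat)) \<odot>\<^bsub>M\<^esub> x \<in> N \<Longrightarrow> x \<in> sat R M f N"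
  unfolding sat_def by blast

lemma satE:
  assumes "x \<in> sat R M f N" obtains t :: nat where "x \<in> carrier M" "(f [^] t) \<odot>\<^bsub>M\<^esub> x \<in> N"
  using assms unfolding sat_def by blast

lemma sat_carrier: "sat R M f N \<subseteq> carrier M"
  unfolding sat_def by blast

lemma sat_incl: "f \<in> carrier R \<Longrightarrow> submodule N R M \<Longrightarrow> N \<subseteq> sat R M f N"
proof
  fix x assume "f \<in> carrier R" "submodule N R M" "x \<in> N"
  then show "x \<in> sat R M f N"
    using submoduleE(1)[of N] by (intro satI[where t=0]) auto
qed

lemma sat_mono: "N \<subseteq> N' \<Longrightarrow> sat R M f N \<subseteq> sat R M f N'"
  unfolding sat_def by blast

lemma pow_smult:
  assumes "f \<in> carrier R" "x \<in> carrier M"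
  shows "(f [^] (s + t :: nat)) \<odot>\<^bsub>M\<^esub> x = (f [^] s) \<odot>\<^bsub>M\<^esub> ((f [^] t) \<odot>\<^bsub>M\<^esub> x)"
proof -
  have "f [^] (s + t) = f [^] s \<otimes> f [^] t" using assms by (simp add: R.nat_pow_mult)
  then show ?thesis using assms by (simp add: smult_assoc1)
qed

lemma sat_add_pow:
  assumes "f \<in> carrier R" "submodule N R M" "x \<in> carrier M" "(f [^] (t::nat)) \<odot>\<^bsub>M\<^esub> x \<in> N"
  shows "(f [^] (s + t)) \<odot>\<^bsub>M\<^esub> x \<in> N"
  using submoduleE(4)[OF assms(2), of "f [^] s"] assms by (simp add: pow_smult)

lemma sat_submodule:
  assumes "f \<in> carrier R" "submodule N R M" shows "submodule (sat R M f N) R M"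
proof (rule submoduleI[OF sat_carrier])
  show "\<zero>\<^bsub>M\<^esub> \<in> sat R M f N"
    using sat_incl[OF assms] submodule_zero[OF assms(2)] by blast
next
  fix a b assume "a \<in> sat R M f N" "b \<in> sat R M f N"
  then obtain s t :: nat where a: "a \<in> carrier M" "(f [^] s) \<odot>\<^bsub>M\<^esub> a \<in> N"
    and b: "b \<in> carrier M" "(f [^] t) \<odot>\<^bsub>M\<^esub> b \<in> N" by (metis satE)
  have "(f [^] (s + t)) \<odot>\<^bsub>M\<^esub> (a \<oplus>\<^bsub>M\<^esub> b) \<in> N"
    using sat_add_pow[OF assms a, of t] sat_add_pow[OF assms b, of s] submoduleE(5)[OF assms(2)]
      a(1) b(1) assms(1)
    by (simp add: smult_r_distr add.commute)
  then show "a \<oplus>\<^bsub>M\<^esub> b \<in> sat R M f N" using a b by (intro satI[where t="s+t"]) auto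
next
  fix a assume "a \<in> sat R M f N"
  then obtain s :: nat where a: "a \<in> carrier M" "(f [^] s) \<odot>\<^bsub>M\<^esub> a \<in> N" by (metis satE)
  then show "\<ominus>\<^bsub>M\<^esub> a \<in> sat R M f N"
    using submoduleE(3)[OF assms(2)] assms(1) by (intro satI[where t=s]) (auto simp: smult_r_minus)
next
  fix r a assume r: "r \<in> carrier R" and "a \<in> sat R M f N"
  then obtain s :: nat where a: "a \<in> carrier M" "(f [^] s) \<odot>\<^bsub>M\<^esub> a \<in> N" by (metis satE)
  have "(f [^] s) \<odot>\<^bsub>M\<^esub> (r \<odot>\<^bsub>M\<^esub> a) \<in> N"
    using a r assms(1) submoduleE(4)[OF assms(2) r a(2)] smult_comm by simp
  then show "r \<odot>\<^bsub>M\<^esub> a \<in> sat R M f N" using a r by (intro satI[where t=s]) auto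
qed

lemma sat_pow_cancel:
  assumes "f \<in> carrier R" "submodule N R M" "x \<in> carrier M" "(f [^] (t::nat)) \<odot>\<^bsub>M\<^esub> x \<in> sat R M f N"
  shows "x \<in> sat R M f N"
proof -
  obtain s :: nat where "(f [^] s) \<odot>\<^bsub>M\<^esub> ((f [^] t) \<odot>\<^bsub>M\<^esub> x) \<in> N" using assms(4) satE by metis
  then have "(f [^] (s + t)) \<odot>\<^bsub>M\<^esub> x \<in> N" using pow_smult assms by simp
  then show ?thesis by (rule satI[OF assms(3)])
qed

lemma sat_mult:
  assumes "f \<in> carrier R" "g \<in> carrier R" "submodule N R M"
  shows "sat R M f N \<subseteq> sat R M (f \<otimes> g) N"
proof
  fix x assume "x \<in> sat R M f N"
  then obtain t :: nat where t: "x \<in> carrier M" "(f [^] t) \<odot>\<^bsub>M\<^esub> x \<in> N" by (rule satE)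
  have "((f \<otimes> g) [^] t) \<odot>\<^bsub>M\<^esub> x = (g [^] t) \<odot>\<^bsub>M\<^esub> ((f [^] t) \<odot>\<^bsub>M\<^esub> x)"
    using t assms by (simp add: R.nat_pow_distrib smult_assoc1 R.m_comm[of "f [^] t"])
  then show "x \<in> sat R M (f \<otimes> g) N"
    using t assms submoduleE(4)[OF assms(3), of "g [^] t"] by (intro satI[where t=t]) auto
qed

lemma sat_sat: 
  assumes "f \<in> carrier R" "submodule N R M" "submodule N' R M" "N \<subseteq> sat R M f N'"
  shows "sat R M f N \<subseteq> sat R M f N'"
  using sat_pow_cancel[OF assms(1,3)] assms(4) by (blast elim: satE)

text \<open>The element \<open>(f \<otimes> c) [^] (s + t + 1)\<close> is a multiple of f^t (f^s c).
  This is how annihilators found with f alone are converted once c is inverted as well.\<close>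

lemma pow_kill_cancel:
  assumes "f \<in> carrier R" "c \<in> carrier R" "d \<in> carrier R"
    "(f [^] (t::nat)) \<otimes> (((f [^] (s::nat)) \<otimes> c) \<otimes> d) = \<zero>"
  shows "\<exists>t::nat. ((f \<otimes> c) [^] t) \<otimes> d = \<zero>"
proof -
  have "((f \<otimes> c) [^] (s + t + 1)) \<otimes> d =
      (f \<otimes> c [^] (s + t)) \<otimes> ((f [^] t) \<otimes> (((f [^] s) \<otimes> c) \<otimes> d))"
    using assms(1-3) by (simp add: R.nat_pow_distrib R.m_ac R.nat_pow_mult[symmetric])
  then show ?thesis using assms by (metis R.m_closed R.nat_pow_closed R.r_null)
qed

text \<open>Once c is inverted too, \<open>eq\<close> can be solved for x, so v can take its place.
  Independence of the new family is traced back to that of E by clearing v with \<open>eq\<close>,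
  at the price of a factor c in the annihilators.\<close>

lemma exchange_step:
  assumes f: "f \<in> carrier R" and E: "loc_basis R M f E" and v: "v \<in> carrier M" "v \<notin> E - {x}"
    and x: "x \<in> E" and c: "c \<in> carrier R" and y: "y \<in> lspan M (carrier R) (E - {x})"
    and eq: "(f [^] (t::nat)) \<odot>\<^bsub>M\<^esub> v = c \<odot>\<^bsub>M\<^esub> x \<oplus>\<^bsub>M\<^esub> y"
  shows "loc_basis R M (f \<otimes> c) (insert v (E - {x}))"
proof -
  let ?E = "insert v (E - {x})" and ?sp = "lspan M (carrier R)" and ?f = "f \<otimes> c"
  have Ec: "E \<subseteq> carrier M" "finite E" and sp: "carrier M \<subseteq> sat R M f (?sp E)"
    and ind: "\<And>x c. x \<in> E \<Longrightarrow> c \<in> carrier R \<Longrightarrow> c \<odot>\<^bsub>M\<^esub> x \<in> ?sp (E - {x}) \<Longrightarrow>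
      (\<exists>t::nat. (f [^] t) \<otimes> c = \<zero>)"
    using E unfolding loc_basis_def by auto
  have xc: "x \<in> carrier M" using x Ec by blast
  have fc: "?f \<in> carrier R" using f c by simp
  have spc: "?sp Y \<subseteq> carrier M" if "Y \<subseteq> carrier M" for Y using lspan_carrier[OF subset_refl that] .
  have E'c: "?E \<subseteq> carrier M" using Ec v by blast
  have Exc: "E - {x} \<subseteq> carrier M" using Ec by blast
  have yc: "y \<in> carrier M" using y spc[OF Exc] by blast
  have subE': "submodule (?sp ?E) R M" using span_submodule[OF E'c] .
  have subEx: "submodule (?sp (E - {x})) R M" using span_submodule[OF Exc] .
  let ?N = "sat R M ?f (?sp ?E)"
  have subN: "submodule ?N R M" using sat_submodule[OF fc subE'] .
  have spN: "?sp ?E \<subseteq> ?N" using sat_incl[OF fc subE'] .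
  have vsp: "v \<in> ?sp ?E" using lspan_base1[OF E'c] by blast
  have ysp: "y \<in> ?sp ?E" using y lspan_mono[of "carrier R" "carrier R" "E - {x}" ?E M] by blast
  have "y \<oplus>\<^bsub>M\<^esub> c \<odot>\<^bsub>M\<^esub> x \<in> ?sp ?E"
    using eq submoduleE(4)[OF subE' _ vsp, of "f [^] t"] f xc yc c by (simp add: M.a_comm)
  then have "c \<odot>\<^bsub>M\<^esub> x \<in> ?sp ?E"
    using submodule_cancel[OF subE' _ ysp] c xc by simp
  then have "f \<odot>\<^bsub>M\<^esub> (c \<odot>\<^bsub>M\<^esub> x) \<in> ?sp ?E" using submoduleE(4)[OF subE' f] by simp
  then have "x \<in> ?N" using f c xc by (intro satI[where t=1]) (auto simp: smult_assoc1)
  then have "E \<subseteq> ?N" using spN lspan_base1[OF E'c] by blast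
  then have "?sp E \<subseteq> ?N" using span_subset[OF subN] by blast
  then have "sat R M f (?sp E) \<subseteq> sat R M f ?N" by (rule sat_mono)
  also have "\<dots> \<subseteq> sat R M ?f ?N" using sat_mult[OF f c subN] .
  also have "\<dots> \<subseteq> ?N" using sat_sat[OF fc subN subE'] by blast
  finally have span: "carrier M \<subseteq> ?N" using sp by blast
  have indep: "\<exists>t::nat. (?f [^] t) \<otimes> d = \<zero>"
    if z: "z \<in> ?E" and d: "d \<in> carrier R" and dz: "d \<odot>\<^bsub>M\<^esub> z \<in> ?sp (?E - {z})" for z d
  proof (cases "z = v")
    case True
    then have "?E - {z} = E - {x}" using v by blast
    then have dv: "d \<odot>\<^bsub>M\<^esub> v \<in> ?sp (E - {x})" using dz True by simp
    have "(f [^] t) \<odot>\<^bsub>M\<^esub> (d \<odot>\<^bsub>M\<^esub> v) = d \<odot>\<^bsub>M\<^esub> y \<oplus>\<^bsub>M\<^esub> (d \<otimes> c) \<odot>\<^bsub>M\<^esub> x"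
      using d c f v xc yc eq
      by (simp add: smult_comm[of _ d] smult_r_distr smult_assoc1 M.a_comm)
    then have "d \<odot>\<^bsub>M\<^esub> y \<oplus>\<^bsub>M\<^esub> (d \<otimes> c) \<odot>\<^bsub>M\<^esub> x \<in> ?sp (E - {x})"
      using submoduleE(4)[OF subEx _ dv, of "f [^] t"] f by simp
    then have "(d \<otimes> c) \<odot>\<^bsub>M\<^esub> x \<in> ?sp (E - {x})"
      using submodule_cancel[OF subEx _ submoduleE(4)[OF subEx d y]] c d xc by simp
    then obtain s :: nat where "(f [^] s) \<otimes> (d \<otimes> c) = \<zero>" using ind[OF x] c d by blast
    then have "(f [^] s) \<otimes> (((f [^] (0::nat)) \<otimes> c) \<otimes> d) = \<zero>" using f c d by (simp add: R.m_comm)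
    then show ?thesis using pow_kill_cancel[OF f c d] by blast
  next
    case False
    then have zE: "z \<in> E" "z \<noteq> x" and zc: "z \<in> carrier M" using z Ec by auto
    have "?E - {z} = insert v (E - {x} - {z})" using False by blast
    then have dz': "d \<odot>\<^bsub>M\<^esub> z \<in> ?sp (insert v (E - {x} - {z}))" using dz by simp
    have Exz: "E - {x} - {z} \<subseteq> carrier M" using Ec by blast
    obtain l y1 where l: "l \<in> carrier R" "y1 \<in> ?sp (E - {x} - {z})" "d \<odot>\<^bsub>M\<^esub> z = l \<odot>\<^bsub>M\<^esub> v \<oplus>\<^bsub>M\<^esub> y1"
      using lspan_insert[OF oneideal v(1) Exz dz'] by blast
    have y1: "y1 \<in> ?sp (E - {x})" "y1 \<in> ?sp (E - {z})"
      using l(2) lspan_mono[of "carrier R" "carrier R" "E - {x} - {z}" "E - {x}" M]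
        lspan_mono[of "carrier R" "carrier R" "E - {x} - {z}" "E - {z}" M] by blast+
    have y1c: "y1 \<in> carrier M" using y1 spc[OF Exc] by blast
    have zsp: "z \<in> ?sp (E - {x})" using lspan_base1[OF Exc] zE by blast
    have "(f [^] t) \<odot>\<^bsub>M\<^esub> (d \<odot>\<^bsub>M\<^esub> z) = (l \<odot>\<^bsub>M\<^esub> y \<oplus>\<^bsub>M\<^esub> (f [^] t) \<odot>\<^bsub>M\<^esub> y1) \<oplus>\<^bsub>M\<^esub> (l \<otimes> c) \<odot>\<^bsub>M\<^esub> x"
      using d c f v xc yc eq y1c l(1)
      by (simp add: l(3) smult_comm[of _ l] smult_r_distr smult_assoc1 M.a_ac)
    moreover have "(f [^] t) \<odot>\<^bsub>M\<^esub> (d \<odot>\<^bsub>M\<^esub> z) \<in> ?sp (E - {x})"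
      using submoduleE(4)[OF subEx] zsp d f by simp
    moreover have "l \<odot>\<^bsub>M\<^esub> y \<oplus>\<^bsub>M\<^esub> (f [^] t) \<odot>\<^bsub>M\<^esub> y1 \<in> ?sp (E - {x})"
      using submoduleE(4,5)[OF subEx] y1 y l f by simp
    ultimately have "(l \<otimes> c) \<odot>\<^bsub>M\<^esub> x \<in> ?sp (E - {x})"
      using submodule_cancel[OF subEx, of "l \<odot>\<^bsub>M\<^esub> y \<oplus>\<^bsub>M\<^esub> (f [^] t) \<odot>\<^bsub>M\<^esub> y1"] l c xc by simp
    then obtain s :: nat where s: "(f [^] s) \<otimes> (l \<otimes> c) = \<zero>" using ind[OF x] c l by blast
    \<comment> \<open>The coefficient l of v need not vanish, but f^s c kills it. Multiplying by
      this element removes v from the relation and leaves one inside E, to which the independence of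
      z applies.\<close>
    define w where "w = f [^] s \<otimes> c"
    have wc: "w \<in> carrier R" using f c by (simp add: w_def)
    have wl: "w \<otimes> l = \<zero>" using s f c l by (simp add: w_def R.m_ac)
    have "(w \<otimes> d) \<odot>\<^bsub>M\<^esub> z = w \<odot>\<^bsub>M\<^esub> y1"
      using wc d zc l(1,3) v y1c wl by (simp add: smult_assoc1 smult_r_distr) (metis M.l_zero smult_assoc1 smult_closed smult_l_null)
    then have "(w \<otimes> d) \<odot>\<^bsub>M\<^esub> z \<in> ?sp (E - {z})"
      using submoduleE(4)[OF span_submodule wc y1(2)] Ec by auto
    then obtain r :: nat where "(f [^] r) \<otimes> (w \<otimes> d) = \<zero>" using ind[OF zE(1)] wc d by blast
    then show ?thesis using pow_kill_cancel[OF f c d] by (simp add: w_def)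
  qed
  show ?thesis unfolding loc_basis_def using Ec E'c span indep by auto
qed

text \<open>The dichotomy behind the exchange: either all coefficients on A can be taken in \<mm>,
  so that A is invisible over the residue field, or some coefficient is a unit at \<mm> and its
  generator can be traded.\<close>

lemma lspan_unit_coeff:
  assumes m: "primeideal \<mm> R" and "finite A" "A \<subseteq> carrier M" "B \<subseteq> carrier M" "A \<inter> B = {}"
    "y \<in> lspan M (carrier R) (B \<union> A)"
  shows "(\<exists>a\<in>lspan M (carrier R) B. \<exists>b\<in>lspan M \<mm> A. y = a \<oplus>\<^bsub>M\<^esub> b) \<or>
    (\<exists>x\<in>A. \<exists>c\<in>carrier R - \<mm>. \<exists>z\<in>lspan M (carrier R) (B \<union> A - {x}). y = c \<odot>\<^bsub>M\<^esub> x \<oplus>\<^bsub>M\<^esub> z)"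
  using assms(2-)
proof (induction A arbitrary: y)
  case empty
  then show ?case using lspan_carrier[of "carrier R" B]
    by (intro disjI1 bexI[of _ y] bexI[of _ "\<zero>\<^bsub>M\<^esub>"]) (auto intro: lspan.intros)
next
  case (insert x A)
  interpret m: primeideal \<mm> R by (rule m)
  have mi: "ideal \<mm> R" ..
  have xc: "x \<in> carrier M" and Ac: "A \<subseteq> carrier M" and BA: "B \<union> A \<subseteq> carrier M" using insert by auto
  obtain c y' where c: "c \<in> carrier R" "y' \<in> lspan M (carrier R) (B \<union> A)" "y = c \<odot>\<^bsub>M\<^esub> x \<oplus>\<^bsub>M\<^esub> y'"
    using lspan_insert[OF oneideal xc BA, of y] insert.prems by auto
  have y'c: "y' \<in> carrier M" using c(2) lspan_carrier[OF subset_refl BA] by blast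
  show ?case
  proof (cases "c \<in> \<mm>")
    case False
    have "B \<union> insert x A - {x} = B \<union> A" using insert by blast
    then show ?thesis using c False
      by (intro disjI2 bexI[of _ x] bexI[of _ c] bexI[of _ y']) simp_all
  next
    case True
    have "A \<inter> B = {}" using insert by blast
    from insert.IH[OF Ac insert.prems(2) this c(2)] show ?thesis
    proof
      assume "\<exists>a\<in>lspan M (carrier R) B. \<exists>b\<in>lspan M \<mm> A. y' = a \<oplus>\<^bsub>M\<^esub> b"
      then obtain a b where ab: "a\<in>lspan M (carrier R) B" "b\<in>lspan M \<mm> A" "y' = a \<oplus>\<^bsub>M\<^esub> b" by blast
      have "a \<in> carrier M" "b \<in> carrier M"
        using ab lspan_carrier[OF subset_refl insert.prems(2)] lspan_carrier[OF ideal_subset[OF mi] Ac]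
        by auto
      then have "y = a \<oplus>\<^bsub>M\<^esub> (c \<odot>\<^bsub>M\<^esub> x \<oplus>\<^bsub>M\<^esub> b)" using c ab xc by (simp add: M.a_ac)
      moreover have "c \<odot>\<^bsub>M\<^esub> x \<oplus>\<^bsub>M\<^esub> b \<in> lspan M \<mm> (insert x A)"
        using ab(2) True lspan_mono[of \<mm> \<mm> A "insert x A" M] by (auto intro: lspan.intros)
      ultimately show ?thesis using ab(1) by blast
    next
      assume "\<exists>x\<in>A. \<exists>c\<in>carrier R - \<mm>. \<exists>z\<in>lspan M (carrier R) (B \<union> A - {x}). y' = c \<odot>\<^bsub>M\<^esub> x \<oplus>\<^bsub>M\<^esub> z"
      then obtain x' c' z where z: "x' \<in> A" "c' \<in> carrier R - \<mm>"
        "z \<in> lspan M (carrier R) (B \<union> A - {x'})" "y' = c' \<odot>\<^bsub>M\<^esub> x' \<oplus>\<^bsub>M\<^esub> z" by blast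
      have zc: "z \<in> carrier M" using z(3) lspan_carrier[of "carrier R" "B \<union> A - {x'}"] BA by blast
      have "y = c' \<odot>\<^bsub>M\<^esub> x' \<oplus>\<^bsub>M\<^esub> (c \<odot>\<^bsub>M\<^esub> x \<oplus>\<^bsub>M\<^esub> z)"
        using c z xc zc Ac by (simp add: M.a_ac subset_iff)
      moreover have "c \<odot>\<^bsub>M\<^esub> x \<oplus>\<^bsub>M\<^esub> z \<in> lspan M (carrier R) (B \<union> insert x A - {x'})"
      proof (rule lspan_step)
        show "x \<in> B \<union> insert x A - {x'}" using z insert by auto
        show "z \<in> lspan M (carrier R) (B \<union> insert x A - {x'})"
          using z(3) lspan_mono[of "carrier R" "carrier R" "B \<union> A - {x'}" "B \<union> insert x A - {x'}" M]
          by blast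
      qed (use c in auto)
      ultimately show ?thesis using z 
        by (intro disjI2 bexI[of _ x'] bexI[of _ c'] bexI[of _ "c \<odot>\<^bsub>M\<^esub> x \<oplus>\<^bsub>M\<^esub> z"]) simp_all
    qed
  qed
qed

text \<open>Steinitz exchange: over the residue field at \<open>\<mm>\<close>, the set \<open>B\<close> is a basis.\<close>

lemma loc_basis_exchange:
  assumes m: "primeideal \<mm> R" and f: "f \<in> carrier R - \<mm>" and E: "loc_basis R M f E"
    and B: "B \<subseteq> carrier M"
    and spm: "\<And>x. x \<in> carrier M \<Longrightarrow>
      \<exists>a\<in>lspan M (carrier R) B. \<exists>b\<in>lspan M \<mm> (carrier M). x = a \<oplus>\<^bsub>M\<^esub> b"
    and indm: "\<And>x c a b. x \<in> B \<Longrightarrow> c \<in> carrier R \<Longrightarrow> a \<in> lspan M (carrier R) (B - {x}) \<Longrightarrow>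
      b \<in> lspan M \<mm> (carrier M) \<Longrightarrow> c \<odot>\<^bsub>M\<^esub> x = a \<oplus>\<^bsub>M\<^esub> b \<Longrightarrow> c \<in> \<mm>"
  shows "finite B \<and> card B = card E \<and> (\<exists>f'\<in>carrier R - \<mm>. loc_basis R M f' B)"
proof -
  let ?sp = "lspan M (carrier R)"
  interpret m: primeideal \<mm> R by (rule m)
  have mi: "ideal \<mm> R" ..
  have mc: "\<mm> \<subseteq> carrier R" using ideal_subset[OF mi] .
  have Ec: "E \<subseteq> carrier M" "finite E" using E unfolding loc_basis_def by auto
  \<comment> \<open>The elements of B are brought in one by one. The set E' is what remains of E,
    and f' collects everything inverted on the way.\<close>
  have key: "\<exists>E' f'. E' \<subseteq> E \<and> f' \<in> carrier R - \<mm> \<and> B' \<inter> E' = {} \<and> loc_basis R M f' (B' \<union> E') \<and>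
      card B' + card E' = card E" if "finite B'" "B' \<subseteq> B" for B'
    using that
  proof (induction B')
    case empty
    then show ?case using E f by (intro exI[of _ E] exI[of _ f]) auto
  next
    case (insert v B')
    then obtain E' f' where E': "E' \<subseteq> E" "f' \<in> carrier R - \<mm>" "B' \<inter> E' = {}"
      "loc_basis R M f' (B' \<union> E')" "card B' + card E' = card E" by blast
    have fin: "finite E'" using E' Ec finite_subset by blast
    have cc: "B' \<subseteq> carrier M" "E' \<subseteq> carrier M" "v \<in> carrier M" using insert E' Ec B by auto
    have f'c: "f' \<in> carrier R" using E' by simp
    show ?case
    proof (cases "v \<in> E'")
      case True
      have "insert v B' \<union> (E' - {v}) = B' \<union> E'" using True by blast
      moreover have "card (insert v B') + card (E' - {v}) = card E"
        using True insert.hyps fin E'(5) card_gt_0_iff[of E'] by (auto simp: card_Diff_singleton)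
      ultimately show ?thesis using E' insert.hyps
        by (intro exI[of _ "E' - {v}"] exI[of _ f']) auto
    next
      case False
      have "v \<in> sat R M f' (?sp (B' \<union> E'))" using E'(4) cc(3) unfolding loc_basis_def by blast
      then obtain t :: nat where t: "(f' [^] t) \<odot>\<^bsub>M\<^esub> v \<in> ?sp (B' \<union> E')" by (rule satE)
      have "E' \<inter> B' = {}" using E' by blast
      \<comment> \<open>The first alternative makes f'^t v a combination of elements already placed,
        modulo \<mm>; this contradicts \<open>indm\<close>, since no power of f' lies in \<mm>. The
        second one provides the element to be replaced by v.\<close>
      from lspan_unit_coeff[OF m fin cc(2,1) this t] show ?thesis
      proof
        assume "\<exists>a\<in>?sp B'. \<exists>b\<in>lspan M \<mm> E'. f' [^] t \<odot>\<^bsub>M\<^esub> v = a \<oplus>\<^bsub>M\<^esub> b"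
        then obtain a b where ab: "a \<in> ?sp B'" "b \<in> lspan M \<mm> E'" "f' [^] t \<odot>\<^bsub>M\<^esub> v = a \<oplus>\<^bsub>M\<^esub> b"
          by blast
        have "a \<in> ?sp (B - {v})"
          using ab(1) lspan_mono[of "carrier R" "carrier R" B' "B - {v}" M] insert by blast
        moreover have "b \<in> lspan M \<mm> (carrier M)"
          using ab(2) lspan_mono[of \<mm> \<mm> E' "carrier M" M] cc by blast
        ultimately have "f' [^] t \<in> \<mm>" using indm[of v "f' [^] t" a b] insert ab f'c by auto
        then show ?thesis using m.pow_notin[OF E'(2)] by blast
      next
        assume "\<exists>x\<in>E'. \<exists>c\<in>carrier R - \<mm>. \<exists>z\<in>?sp (B' \<union> E' - {x}). f' [^] t \<odot>\<^bsub>M\<^esub> v = c \<odot>\<^bsub>M\<^esub> x \<oplus>\<^bsub>M\<^esub> z"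
        then obtain x c z where z: "x \<in> E'" "c \<in> carrier R - \<mm>" "z \<in> ?sp (B' \<union> E' - {x})"
          "f' [^] t \<odot>\<^bsub>M\<^esub> v = c \<odot>\<^bsub>M\<^esub> x \<oplus>\<^bsub>M\<^esub> z" by blast
        have vn: "v \<notin> B' \<union> E' - {x}" using False insert by blast
        have "loc_basis R M (f' \<otimes> c) (insert v (B' \<union> E' - {x}))"
          using exchange_step[OF f'c E'(4) cc(3) vn _ _ z(3,4)] z by auto
        moreover have "insert v (B' \<union> E' - {x}) = insert v B' \<union> (E' - {x})"
          using z E' by blast
        moreover have "card (insert v B') + card (E' - {x}) = card E"
          using z insert.hyps fin E'(5) card_gt_0_iff[of E'] by (auto simp: card_Diff_singleton)
        moreover have "f' \<otimes> c \<in> carrier R - \<mm>" using m.mult_notin[OF E'(2) z(2)] .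
        ultimately show ?thesis using E' False insert.hyps
          by (intro exI[of _ "E' - {x}"] exI[of _ "f' \<otimes> c"]) auto
      qed
    qed
  qed
  have fin: "finite B"
  proof (rule ccontr)
    assume "infinite B"
    then obtain B' where "finite B'" "B' \<subseteq> B" "card B' = Suc (card E)"
      using infinite_arbitrarily_large by blast
    then show False using key[of B'] by force
  qed
  obtain E' f' where E': "E' \<subseteq> E" "f' \<in> carrier R - \<mm>" "B \<inter> E' = {}"
      "loc_basis R M f' (B \<union> E')" "card B + card E' = card E" using key[OF fin subset_refl] by blast
  have f'c: "f' \<in> carrier R" using E' by simp
  have cc: "E' \<subseteq> carrier M" "B \<union> E' \<subseteq> carrier M" using E' Ec B by auto
  \<comment> \<open>A leftover x is a combination of B modulo \<mm>. Expanding the \<mm>-part in the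
    current basis B \<union> E' and moving its x-term to the left gives h x in the span of the other
    elements with h outside \<mm>. Independence would then kill h by a power of f', which the prime
    \<mm> forbids.\<close>
  have "E' = {}"
  proof (rule ccontr)
    assume "E' \<noteq> {}"
    then obtain x where x: "x \<in> E'" by blast
    have xc: "x \<in> carrier M" using x cc by blast
    obtain a b where ab: "a \<in> ?sp B" "b \<in> lspan M \<mm> (carrier M)" "x = a \<oplus>\<^bsub>M\<^esub> b"
      using spm[OF xc] by blast
    have sub: "submodule (lspan M \<mm> (B \<union> E')) R M" using lspan_submodule[OF mi cc(2)] .
    have "lspan M \<mm> (carrier M) \<subseteq> sat R M f' (lspan M \<mm> (B \<union> E'))"
    proof (rule lspan_subset[OF sat_submodule[OF f'c sub]])
      fix c y assume c: "c \<in> \<mm>" and y: "y \<in> carrier M"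
      have cR: "c \<in> carrier R" using c mc by blast
      have "y \<in> sat R M f' (?sp (B \<union> E'))" using E'(4) y unfolding loc_basis_def by blast
      then obtain s :: nat where s: "(f' [^] s) \<odot>\<^bsub>M\<^esub> y \<in> ?sp (B \<union> E')" by (rule satE)
      have "c \<odot>\<^bsub>M\<^esub> ((f' [^] s) \<odot>\<^bsub>M\<^esub> y) \<in> lspan M \<mm> (B \<union> E')"
        using lspan_smult_gen[OF subset_refl cc(2) s cR _ mc] c m.I_r_closed by blast
      then show "c \<odot>\<^bsub>M\<^esub> y \<in> sat R M f' (lspan M \<mm> (B \<union> E'))"
        using cR y f'c by (intro satI[where t=s]) (auto simp: smult_comm)
    qed
    then have "b \<in> sat R M f' (lspan M \<mm> (B \<union> E'))" using ab(2) by blast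
    then obtain s :: nat where s: "(f' [^] s) \<odot>\<^bsub>M\<^esub> b \<in> lspan M \<mm> (B \<union> E')" by (rule satE)
    have BEx: "B \<union> E' - {x} \<subseteq> carrier M" using cc by blast
    have "insert x (B \<union> E' - {x}) = B \<union> E'" using x by blast
    then have "(f' [^] s) \<odot>\<^bsub>M\<^esub> b \<in> lspan M \<mm> (insert x (B \<union> E' - {x}))" using s by simp
    then obtain \<mu> b' where b': "\<mu> \<in> \<mm>" "b' \<in> lspan M \<mm> (B \<union> E' - {x})"
      "(f' [^] s) \<odot>\<^bsub>M\<^esub> b = \<mu> \<odot>\<^bsub>M\<^esub> x \<oplus>\<^bsub>M\<^esub> b'"
      using lspan_insert[OF mi xc BEx] by blast
    have subx: "submodule (?sp (B \<union> E' - {x})) R M" using span_submodule[OF BEx] .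
    have a: "a \<in> ?sp (B \<union> E' - {x})"
      using ab(1) lspan_mono[of "carrier R" "carrier R" B "B \<union> E' - {x}" M] x E'(3) by blast
    have b'': "b' \<in> ?sp (B \<union> E' - {x})"
      using b'(2) lspan_mono[of \<mm> "carrier R" "B \<union> E' - {x}" "B \<union> E' - {x}" M] mc by blast
    define h where "h = f' [^] s \<ominus> \<mu>"
    have \<mu>: "\<mu> \<in> carrier R" using b' mc by blast
    have hc: "h \<in> carrier R" using \<mu> f'c by (simp add: h_def)
    have hm: "h \<notin> \<mm>"
    proof
      assume "h \<in> \<mm>"
      then have "h \<oplus> \<mu> \<in> \<mm>" using ideal_add[OF mi] b' by blast
      moreover have "h \<oplus> \<mu> = f' [^] s" using \<mu> f'c by (simp add: h_def R.minus_eq R.a_assoc R.l_neg)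
      ultimately show False using m.pow_notin[OF E'(2)] by auto
    qed
    have carr: "a \<in> carrier M" "b \<in> carrier M" "b' \<in> carrier M"
      using a b'' submoduleE(1)[OF subx] ab(2) lspan_carrier[OF mc subset_refl] by blast+
    have "(f' [^] s) \<odot>\<^bsub>M\<^esub> x = (f' [^] s) \<odot>\<^bsub>M\<^esub> a \<oplus>\<^bsub>M\<^esub> (\<mu> \<odot>\<^bsub>M\<^esub> x \<oplus>\<^bsub>M\<^esub> b')"
      by (subst ab(3)) (use carr f'c b'(3) in \<open>simp add: smult_r_distr\<close>)
    then have "h \<odot>\<^bsub>M\<^esub> x = (f' [^] s) \<odot>\<^bsub>M\<^esub> a \<oplus>\<^bsub>M\<^esub> (\<mu> \<odot>\<^bsub>M\<^esub> x \<oplus>\<^bsub>M\<^esub> b') \<oplus>\<^bsub>M\<^esub> \<ominus>\<^bsub>M\<^esub> (\<mu> \<odot>\<^bsub>M\<^esub> x)"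
      using \<mu> f'c xc by (simp add: h_def R.minus_eq smult_l_distr smult_l_minus)
    also have "\<dots> = (f' [^] s) \<odot>\<^bsub>M\<^esub> a \<oplus>\<^bsub>M\<^esub> b'"
      using carr \<mu> xc f'c by (simp add: M.a_ac M.r_neg M.r_neg2)
    finally have "h \<odot>\<^bsub>M\<^esub> x \<in> ?sp (B \<union> E' - {x})"
      using submoduleE(4,5)[OF subx] a b'' f'c by simp
    then obtain t :: nat where "(f' [^] t) \<otimes> h = \<zero>"
      using E'(4) x hc unfolding loc_basis_def by blast
    moreover have "(f' [^] t) \<otimes> h \<notin> \<mm>"
      using m.mult_notin[OF m.pow_notin[OF E'(2)], of h t] hc hm by simp
    ultimately show False using ideal_zero[OF mi] by simp
  qed
  then show ?thesis using fin E' by auto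
qed

end

section \<open>Quotients and localizations of modules\<close>

locale quot_mod = module R M for R (structure) and M (structure) +
  fixes N
  assumes sub: "submodule N R M"
begin

lemma abelian_subgroup_N: "abelian_subgroup N M"
proof (rule abelian_subgroupI3)
  show "additive_subgroup N M"
    using submodule.axioms(1)[OF sub] by (rule additive_subgroupI)
  show "abelian_group M" ..
qed

sublocale N: abelian_subgroup N M by (rule abelian_subgroup_N)

lemma coset_eq_iff:
  assumes "x \<in> carrier M" "y \<in> carrier M"
  shows "N +>\<^bsub>M\<^esub> x = N +>\<^bsub>M\<^esub> y \<longleftrightarrow> x \<ominus>\<^bsub>M\<^esub> y \<in> N"
proof -
  have "N +>\<^bsub>M\<^esub> x = N +>\<^bsub>M\<^esub> y \<longleftrightarrow> x \<in> N +>\<^bsub>M\<^esub> y"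
    using N.a_rcos_self[OF assms(1)] N.a_repr_independence'[OF _ assms(2), of x] by auto
  then show ?thesis using N.a_rcos_module_minus[of y x] assms M.abelian_group_axioms 
    N.a_rcos_module[OF assms(2,1)] by (simp add: M.minus_eq)
qed

lemma carrier_quot: "carrier (quot_module M N) = (\<lambda>x. N +>\<^bsub>M\<^esub> x) ` carrier M"
  by (auto simp: quot_module_def A_RCOSETS_def')

lemma add_quot: "x \<in> carrier M \<Longrightarrow> y \<in> carrier M \<Longrightarrow>
    (N +>\<^bsub>M\<^esub> x) \<oplus>\<^bsub>quot_module M N\<^esub> (N +>\<^bsub>M\<^esub> y) = N +>\<^bsub>M\<^esub> (x \<oplus>\<^bsub>M\<^esub> y)"
  using N.a_rcos_sum by (simp add: quot_module_def)

lemma zero_quot: "\<zero>\<^bsub>quot_module M N\<^esub> = N +>\<^bsub>M\<^esub> \<zero>\<^bsub>M\<^esub>"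
  by (simp add: quot_module_def N.a_subset)

lemma smult_quot:
  assumes "r \<in> carrier R" "x \<in> carrier M"
  shows "r \<odot>\<^bsub>quot_module M N\<^esub> (N +>\<^bsub>M\<^esub> x) = N +>\<^bsub>M\<^esub> (r \<odot>\<^bsub>M\<^esub> x)"
proof -
  have "N +>\<^bsub>M\<^esub> (r \<odot>\<^bsub>M\<^esub> y) = N +>\<^bsub>M\<^esub> (r \<odot>\<^bsub>M\<^esub> x)" if y: "y \<in> N +>\<^bsub>M\<^esub> x" for y
  proof -
    have yc: "y \<in> carrier M" using y N.a_elemrcos_carrier[OF assms(2)] by blast
    have "y \<ominus>\<^bsub>M\<^esub> x \<in> N" using coset_eq_iff[OF yc assms(2)] N.a_repr_independence'[OF y assms(2)] by simp
    then have "r \<odot>\<^bsub>M\<^esub> (y \<ominus>\<^bsub>M\<^esub> x) \<in> N" using submoduleE(4)[OF sub assms(1)] by blast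
    then have "r \<odot>\<^bsub>M\<^esub> y \<ominus>\<^bsub>M\<^esub> r \<odot>\<^bsub>M\<^esub> x \<in> N"
      using assms yc by (simp add: M.minus_eq smult_r_distr smult_r_minus)
    then show ?thesis using coset_eq_iff assms yc by simp
  qed
  then have "(\<Union>y\<in>N +>\<^bsub>M\<^esub> x. N +>\<^bsub>M\<^esub> (r \<odot>\<^bsub>M\<^esub> y)) = N +>\<^bsub>M\<^esub> (r \<odot>\<^bsub>M\<^esub> x)"
    using N.a_rcos_self[OF assms(2)] by blast
  then show ?thesis by (simp add: quot_module_def)
qed

lemma quot_module: "module R (quot_module M N)"
proof (rule moduleI)
  show "cring R" ..
  show "abelian_group (quot_module M N)"
  proof (rule abelian_groupI)
    fix x assume "x \<in> carrier (quot_module M N)"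
    then obtain a where a: "x = N +>\<^bsub>M\<^esub> a" "a \<in> carrier M" unfolding carrier_quot by blast
    have "(N +>\<^bsub>M\<^esub> (\<ominus>\<^bsub>M\<^esub> a)) \<oplus>\<^bsub>quot_module M N\<^esub> x = \<zero>\<^bsub>quot_module M N\<^esub>"
      using a by (simp add: add_quot zero_quot M.l_neg)
    then show "\<exists>y\<in>carrier (quot_module M N). y \<oplus>\<^bsub>quot_module M N\<^esub> x = \<zero>\<^bsub>quot_module M N\<^esub>"
      using a unfolding carrier_quot by blast
  qed (auto simp: carrier_quot add_quot zero_quot M.a_ac)
qed (auto simp: carrier_quot add_quot smult_quot smult_l_distr smult_r_distr smult_assoc1)

end

locale loc_mod = module R M for R (structure) and M (structure) +
  fixes f
  assumes f: "f \<in> carrier R"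
begin

abbreviation frac where "frac \<equiv> loc_frac R M f"
abbreviation Mf where "Mf \<equiv> loc_module R M f"

lemma frac_mem: "(m', j) \<in> frac m i \<longleftrightarrow> m \<in> carrier M \<and> m' \<in> carrier M \<and>
   (\<exists>t::nat. (f [^] (t + j)) \<odot>\<^bsub>M\<^esub> m = (f [^] (t + i)) \<odot>\<^bsub>M\<^esub> m')"
  by (auto simp: loc_frac_def loc_rel_def)

lemma pow_mult_eq:
  assumes "m \<in> carrier M" "m' \<in> carrier M" "(f [^] (a::nat)) \<odot>\<^bsub>M\<^esub> m = (f [^] (b::nat)) \<odot>\<^bsub>M\<^esub> m'"
  shows "(f [^] (c + a)) \<odot>\<^bsub>M\<^esub> m = (f [^] (c + b)) \<odot>\<^bsub>M\<^esub> m'"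
  using assms f by (simp add: pow_smult)

lemma equiv_loc_rel: "equiv (carrier M \<times> UNIV) (loc_rel R M f)"
proof (rule equivI)
  show "refl_on (carrier M \<times> UNIV) (loc_rel R M f)"
    by (rule refl_onI) (auto simp: loc_rel_def)
  show "loc_rel R M f \<subseteq> (carrier M \<times> UNIV) \<times> carrier M \<times> UNIV"
    by (auto simp: loc_rel_def)
  show "sym (loc_rel R M f)"
    by (rule symI) (auto simp: loc_rel_def, metis)
  show "trans (loc_rel R M f)"
  proof (rule transI)
    fix x y z assume "(x, y) \<in> loc_rel R M f" "(y, z) \<in> loc_rel R M f"
    then obtain m i m' j m'' l s t where e: "x = (m, i)" "y = (m', j)" "z = (m'', l)"
      "m \<in> carrier M" "m' \<in> carrier M" "m'' \<in> carrier M"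
      "(f [^] (s + j :: nat)) \<odot>\<^bsub>M\<^esub> m = (f [^] (s + i)) \<odot>\<^bsub>M\<^esub> m'"
      "(f [^] (t + l :: nat)) \<odot>\<^bsub>M\<^esub> m' = (f [^] (t + j)) \<odot>\<^bsub>M\<^esub> m''"
      unfolding loc_rel_def by blast
    have "(f [^] ((t + l) + (s + j))) \<odot>\<^bsub>M\<^esub> m = (f [^] ((t + l) + (s + i))) \<odot>\<^bsub>M\<^esub> m'"
      using pow_mult_eq e by blast
    moreover have "(f [^] ((s + i) + (t + l))) \<odot>\<^bsub>M\<^esub> m' = (f [^] ((s + i) + (t + j))) \<odot>\<^bsub>M\<^esub> m''"
      using pow_mult_eq e by blast
    ultimately have "(f [^] ((s + t + j) + l)) \<odot>\<^bsub>M\<^esub> m = (f [^] ((s + t + j) + i)) \<odot>\<^bsub>M\<^esub> m''"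
      by (simp add: ac_simps)
    then show "(x, z) \<in> loc_rel R M f" using e(1-6) unfolding loc_rel_def by blast
  qed
qed

lemma frac_eq_iff:
  assumes "m \<in> carrier M" "m' \<in> carrier M"
  shows "frac m i = frac m' j \<longleftrightarrow>
    (\<exists>t::nat. (f [^] (t + j)) \<odot>\<^bsub>M\<^esub> m = (f [^] (t + i)) \<odot>\<^bsub>M\<^esub> m')"
proof -
  have "frac m i = frac m' j \<longleftrightarrow> ((m, i), (m', j)) \<in> loc_rel R M f"
    unfolding loc_frac_def using eq_equiv_class_iff[OF equiv_loc_rel] assms by simp
  then show ?thesis using assms by (simp add: loc_rel_def)
qed

lemma frac_self: "m \<in> carrier M \<Longrightarrow> (m, i) \<in> frac m i"
  by (auto simp: frac_mem)

lemma carrier_Mf: "carrier Mf = {frac m i | m i. m \<in> carrier M}"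
  by (auto simp: loc_module_def quotient_def loc_frac_def)

lemma zero_Mf: "\<zero>\<^bsub>Mf\<^esub> = frac \<zero>\<^bsub>M\<^esub> 0"
  by (simp add: loc_module_def)

lemma frac_expand: "m \<in> carrier M \<Longrightarrow> frac m i = frac ((f [^] (t::nat)) \<odot>\<^bsub>M\<^esub> m) (t + i)"
  using f by (subst frac_eq_iff) (auto simp: pow_smult intro!: exI[of _ 0] smult_comm)

text \<open>The sum in \<open>loc_module\<close> is a union over all pairs of representatives; it
  collapses to one class because the usual formula does not depend on them.\<close>

lemma add_Mf:
  assumes "m \<in> carrier M" "m' \<in> carrier M"
  shows "frac m i \<oplus>\<^bsub>Mf\<^esub> frac m' j = frac ((f [^] j) \<odot>\<^bsub>M\<^esub> m \<oplus>\<^bsub>M\<^esub> (f [^] i) \<odot>\<^bsub>M\<^esub> m') (i + j)"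
proof -
  let ?g = "\<lambda>a p b q. frac ((f [^] q) \<odot>\<^bsub>M\<^esub> a \<oplus>\<^bsub>M\<^esub> (f [^] p) \<odot>\<^bsub>M\<^esub> b) (p + q)"
  have g: "?g a p b q = ?g m i m' j" if "(a, p) \<in> frac m i" "(b, q) \<in> frac m' j" for a b p q
  proof -
    from that obtain s t :: nat where
      s: "(f [^] (s + p)) \<odot>\<^bsub>M\<^esub> m = (f [^] (s + i)) \<odot>\<^bsub>M\<^esub> a"
      and t: "(f [^] (t + q)) \<odot>\<^bsub>M\<^esub> m' = (f [^] (t + j)) \<odot>\<^bsub>M\<^esub> b"
      and c: "a \<in> carrier M" "b \<in> carrier M" unfolding frac_mem by blast
    have 1: "(f [^] ((t + q + j) + (s + p))) \<odot>\<^bsub>M\<^esub> m = (f [^] ((t + q + j) + (s + i))) \<odot>\<^bsub>M\<^esub> a"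
      using pow_mult_eq[OF assms(1) c(1) s] .
    have 2: "(f [^] ((s + p + i) + (t + q))) \<odot>\<^bsub>M\<^esub> m' = (f [^] ((s + p + i) + (t + j))) \<odot>\<^bsub>M\<^esub> b"
      using pow_mult_eq[OF assms(2) c(2) t] .
    show ?thesis
    proof (subst frac_eq_iff)
      have "(f [^] ((s + t) + (i + j))) \<odot>\<^bsub>M\<^esub> ((f [^] q) \<odot>\<^bsub>M\<^esub> a \<oplus>\<^bsub>M\<^esub> (f [^] p) \<odot>\<^bsub>M\<^esub> b) =
        (f [^] ((t + q + j) + (s + i))) \<odot>\<^bsub>M\<^esub> a \<oplus>\<^bsub>M\<^esub> (f [^] ((s + p + i) + (t + j))) \<odot>\<^bsub>M\<^esub> b"
        using f c assms by (simp add: smult_r_distr pow_smult[symmetric] ac_simps)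
      also have "\<dots> = (f [^] ((t + q + j) + (s + p))) \<odot>\<^bsub>M\<^esub> m \<oplus>\<^bsub>M\<^esub> (f [^] ((s + p + i) + (t + q))) \<odot>\<^bsub>M\<^esub> m'"
        by (simp only: 1 2)
      also have "\<dots> = (f [^] ((s + t) + (p + q))) \<odot>\<^bsub>M\<^esub> ((f [^] j) \<odot>\<^bsub>M\<^esub> m \<oplus>\<^bsub>M\<^esub> (f [^] i) \<odot>\<^bsub>M\<^esub> m')"
        using f c assms by (simp add: smult_r_distr pow_smult[symmetric] ac_simps)
      finally show "\<exists>u::nat. (f [^] (u + (i + j))) \<odot>\<^bsub>M\<^esub> ((f [^] q) \<odot>\<^bsub>M\<^esub> a \<oplus>\<^bsub>M\<^esub> (f [^] p) \<odot>\<^bsub>M\<^esub> b) =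
        (f [^] (u + (p + q))) \<odot>\<^bsub>M\<^esub> ((f [^] j) \<odot>\<^bsub>M\<^esub> m \<oplus>\<^bsub>M\<^esub> (f [^] i) \<odot>\<^bsub>M\<^esub> m')" by blast
    qed (use f c assms in auto)
  qed
  have "frac m i \<oplus>\<^bsub>Mf\<^esub> frac m' j = (\<Union>(a, p)\<in>frac m i. \<Union>(b, q)\<in>frac m' j. ?g a p b q)"
    by (simp add: loc_module_def)
  also have "\<dots> = (\<Union>(a, p)\<in>frac m i. \<Union>(b, q)\<in>frac m' j. ?g m i m' j)"
    by (intro SUP_cong refl) (auto simp: g cong: SUP_cong)
  also have "\<dots> = ?g m i m' j"
    using frac_self[OF assms(1)] frac_self[OF assms(2)] by auto
  finally show ?thesis .
qed

text \<open>With a common denominator, addition of fractions is addition of numerators, so the laws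
  of the localization reduce to those of M.\<close>

lemma add_Mf_same:
  assumes "m \<in> carrier M" "m' \<in> carrier M"
  shows "frac m i \<oplus>\<^bsub>Mf\<^esub> frac m' i = frac (m \<oplus>\<^bsub>M\<^esub> m') i"
  using assms f frac_expand[of "m \<oplus>\<^bsub>M\<^esub> m'" i i] by (simp add: add_Mf smult_r_distr)

lemma abelian_monoid_Mf: "abelian_monoid Mf"
proof (rule abelian_monoidI)
  have common: "\<exists>a b c l. a \<in> carrier M \<and> b \<in> carrier M \<and> c \<in> carrier M \<and>
    x = frac a l \<and> y = frac b l \<and> z = frac c l"
    if xyz: "x \<in> carrier Mf" "y \<in> carrier Mf" "z \<in> carrier Mf" for x y z
  proof -
    from xyz obtain a i b j c l where e: "a \<in> carrier M" "b \<in> carrier M" "c \<in> carrier M"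
      "x = frac a i" "y = frac b j" "z = frac c l" unfolding carrier_Mf by blast
    have "x = frac ((f [^] (j + l)) \<odot>\<^bsub>M\<^esub> a) (i + j + l)" "y = frac ((f [^] (i + l)) \<odot>\<^bsub>M\<^esub> b) (i + j + l)"
      "z = frac ((f [^] (i + j)) \<odot>\<^bsub>M\<^esub> c) (i + j + l)"
      using frac_expand[OF e(1), of i "j + l"] frac_expand[OF e(2), of j "i + l"]
        frac_expand[OF e(3), of l "i + j"] e by (simp_all add: ac_simps)
    then show ?thesis using e f by (metis nat_pow_closed smult_closed)
  qed
  fix x y z assume xyz: "x \<in> carrier Mf" "y \<in> carrier Mf"
  then obtain a b l where ab: "a \<in> carrier M" "b \<in> carrier M" "x = frac a l" "y = frac b l"
    using common[of x y y] by blast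
  show "x \<oplus>\<^bsub>Mf\<^esub> y \<in> carrier Mf" using ab unfolding carrier_Mf by (auto simp: add_Mf_same)
  show "x \<oplus>\<^bsub>Mf\<^esub> y = y \<oplus>\<^bsub>Mf\<^esub> x" using ab by (simp add: add_Mf_same M.a_comm)
  have "\<zero>\<^bsub>Mf\<^esub> = frac \<zero>\<^bsub>M\<^esub> l" using frac_expand[of "\<zero>\<^bsub>M\<^esub>" 0 l] f by (simp add: zero_Mf)
  then show "\<zero>\<^bsub>Mf\<^esub> \<oplus>\<^bsub>Mf\<^esub> x = x" using ab by (simp add: add_Mf_same)
  assume z: "z \<in> carrier Mf"
  then obtain a b c l where abc: "a \<in> carrier M" "b \<in> carrier M" "c \<in> carrier M"
    "x = frac a l" "y = frac b l" "z = frac c l"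
    using common[OF xyz z] by blast
  then show "x \<oplus>\<^bsub>Mf\<^esub> y \<oplus>\<^bsub>Mf\<^esub> z = x \<oplus>\<^bsub>Mf\<^esub> (y \<oplus>\<^bsub>Mf\<^esub> z)" by (simp add: add_Mf_same M.a_assoc)
qed (auto simp: carrier_Mf zero_Mf)

lemma finsum_frac:
  assumes "finite A" "g \<in> A \<rightarrow> carrier M"
  shows "(\<Oplus>\<^bsub>Mf\<^esub>i\<in>A. frac (g i) l) = frac (\<Oplus>\<^bsub>M\<^esub>i\<in>A. g i) l"
  using assms
proof (induction A)
  case empty
  interpret F: abelian_monoid Mf by (rule abelian_monoid_Mf)
  show ?case using frac_expand[of "\<zero>\<^bsub>M\<^esub>" 0 l] f by (simp add: zero_Mf)
next
  case (insert x A)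
  interpret F: abelian_monoid Mf by (rule abelian_monoid_Mf)
  have "(\<lambda>i. frac (g i) l) \<in> insert x A \<rightarrow> carrier Mf" using insert.prems by (auto simp: carrier_Mf)
  then show ?case using insert by (simp add: add_Mf_same M.finsum_closed)
qed

end

lemma self_module_simps [simp]:
  "carrier (self_module R) = carrier R" "smult (self_module R) = monoid.mult R"
  "ring.add (self_module R) = ring.add R" "ring.zero (self_module R) = ring.zero R"
  by (simp_all add: self_module_def)

lemma (in abelian_group) minus_zero_imp_eq:
  assumes "a \<in> carrier G" "b \<in> carrier G" "a \<ominus> b = \<zero>" shows "a = b"
  using assms by (metis a_inv_closed add.inv_solve_right l_zero minus_eq zero_closed)

lemma (in cring) self_module: "module R (self_module R)"
proof (rule moduleI)
  show "abelian_group (self_module R)"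
    by (rule abelian_groupI) (auto simp: a_ac intro: bexI[OF _ a_inv_closed] l_neg)
qed (auto simp: l_distr r_distr m_assoc is_cring)

lemma (in loc_mod) self_loc: "loc_mod R (self_module R) f"
  by (simp add: loc_mod_def loc_mod_axioms_def self_module f)

section \<open>Free localizations versus local bases\<close>

context loc_mod
begin

abbreviation "fracR \<equiv> loc_frac R (self_module R) f"
abbreviation "Rf \<equiv> loc_ring R f"

lemma carrier_Rf: "carrier Rf = {fracR c i | c i. c \<in> carrier R}"
  using loc_mod.carrier_Mf[OF self_loc] by (simp add: loc_ring_def Let_def)

lemma fracR_eq_iff: "c \<in> carrier R \<Longrightarrow> d \<in> carrier R \<Longrightarrow> fracR c i = fracR d j \<longleftrightarrow>
    (\<exists>t::nat. (f [^] (t + j)) \<otimes> c = (f [^] (t + i)) \<otimes> d)"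
  using loc_mod.frac_eq_iff[OF self_loc, of c d i j] by simp

lemma fracR_expand: "c \<in> carrier R \<Longrightarrow> fracR c i = fracR ((f [^] (t::nat)) \<otimes> c) (t + i)"
  using loc_mod.frac_expand[OF self_loc, of c i t] by simp

lemma fracR_mem: "(d, j) \<in> fracR c i \<longleftrightarrow> c \<in> carrier R \<and> d \<in> carrier R \<and>
   (\<exists>t::nat. (f [^] (t + j)) \<otimes> c = (f [^] (t + i)) \<otimes> d)"
  using loc_mod.frac_mem[OF self_loc, of d j c i] by simp

lemma smult_Mf:
  assumes c: "c \<in> carrier R" and m: "m \<in> carrier M"
  shows "fracR c i \<odot>\<^bsub>Mf\<^esub> frac m j = frac (c \<odot>\<^bsub>M\<^esub> m) (i + j)"
proof -
  have g: "frac (d \<odot>\<^bsub>M\<^esub> b) (p + q) = frac (c \<odot>\<^bsub>M\<^esub> m) (i + j)"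
    if "(d, p) \<in> fracR c i" "(b, q) \<in> frac m j" for d p b q
  proof -
    from that obtain s t :: nat where
      s: "(f [^] (s + p)) \<otimes> c = (f [^] (s + i)) \<otimes> d"
      and t: "(f [^] (t + q)) \<odot>\<^bsub>M\<^esub> m = (f [^] (t + j)) \<odot>\<^bsub>M\<^esub> b"
      and carr: "d \<in> carrier R" "b \<in> carrier M" unfolding frac_mem fracR_mem by blast
    have pw: "f [^] (u::nat) \<in> carrier R" for u using f by simp
    have "(f [^] ((s + t) + (i + j))) \<odot>\<^bsub>M\<^esub> (d \<odot>\<^bsub>M\<^esub> b)
        = ((f [^] (s + i)) \<otimes> d) \<odot>\<^bsub>M\<^esub> ((f [^] (t + j)) \<odot>\<^bsub>M\<^esub> b)"
      using carr pw f by (simp add: smult_assoc1[symmetric] R.nat_pow_mult[symmetric] R.m_ac)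
    also have "\<dots> = ((f [^] (s + p)) \<otimes> c) \<odot>\<^bsub>M\<^esub> ((f [^] (t + q)) \<odot>\<^bsub>M\<^esub> m)"
      by (simp only: s t)
    also have "\<dots> = (f [^] ((s + t) + (p + q))) \<odot>\<^bsub>M\<^esub> (c \<odot>\<^bsub>M\<^esub> m)"
      using c m pw f by (simp add: smult_assoc1[symmetric] R.nat_pow_mult[symmetric] R.m_ac)
    finally show ?thesis using carr c m by (subst frac_eq_iff) auto
  qed
  have "fracR c i \<odot>\<^bsub>Mf\<^esub> frac m j = (\<Union>(d, p)\<in>fracR c i. \<Union>(b, q)\<in>frac m j. frac (d \<odot>\<^bsub>M\<^esub> b) (p + q))"
    by (simp add: loc_module_def)
  also have "\<dots> = (\<Union>(d, p)\<in>fracR c i. \<Union>(b, q)\<in>frac m j. frac (c \<odot>\<^bsub>M\<^esub> m) (i + j))"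
    by (intro SUP_cong refl) (auto simp: g cong: SUP_cong)
  also have "\<dots> = frac (c \<odot>\<^bsub>M\<^esub> m) (i + j)"
    using frac_self[OF m] loc_mod.frac_self[OF self_loc, of c i] c by auto
  finally show ?thesis .
qed

lemma common_denominator:
  assumes "finite A" "c \<in> A \<rightarrow> carrier Rf"
  obtains k d where "d \<in> A \<rightarrow> carrier R" "\<And>i. i \<in> A \<Longrightarrow> c i = fracR (d i) k"
proof -
  have "\<forall>i\<in>A. \<exists>d k. d \<in> carrier R \<and> c i = fracR d k"
    using assms(2) unfolding carrier_Rf by blast
  then obtain d k where d: "\<And>i. i \<in> A \<Longrightarrow> d i \<in> carrier R" "\<And>i. i \<in> A \<Longrightarrow> c i = fracR (d i) (k i)"
    by metis
  define K where "K = sum k A"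
  have "c i = fracR ((f [^] (K - k i)) \<otimes> d i) K" if "i \<in> A" for i
  proof -
    have "k i \<le> K" using that assms(1) unfolding K_def by (simp add: member_le_sum)
    then show ?thesis using fracR_expand[OF d(1)[OF that], of "k i" "K - k i"] d(2)[OF that] by simp
  qed
  moreover have "(\<lambda>i. (f [^] (K - k i)) \<otimes> d i) \<in> A \<rightarrow> carrier R" using d(1) f by auto
  ultimately show ?thesis using that by blast
qed

lemma lincomb_frac:
  assumes "finite A" "d \<in> A \<rightarrow> carrier R" "e \<in> A \<rightarrow> carrier M"
    "\<And>i. i \<in> A \<Longrightarrow> c i = fracR (d i) k" "\<And>i. i \<in> A \<Longrightarrow> b i = frac (e i) 0"
  shows "(\<Oplus>\<^bsub>Mf\<^esub>i\<in>A. c i \<odot>\<^bsub>Mf\<^esub> b i) = frac (\<Oplus>\<^bsub>M\<^esub>i\<in>A. d i \<odot>\<^bsub>M\<^esub> e i) k"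
proof -
  interpret F: abelian_monoid Mf by (rule abelian_monoid_Mf)
  have "(\<Oplus>\<^bsub>Mf\<^esub>i\<in>A. c i \<odot>\<^bsub>Mf\<^esub> b i) = (\<Oplus>\<^bsub>Mf\<^esub>i\<in>A. frac (d i \<odot>\<^bsub>M\<^esub> e i) k)"
  proof (rule F.finsum_cong')
    fix i assume i: "i \<in> A"
    then have "d i \<in> carrier R" "e i \<in> carrier M" using assms by auto
    then show "c i \<odot>\<^bsub>Mf\<^esub> b i = frac (d i \<odot>\<^bsub>M\<^esub> e i) k"
      using assms(4,5)[OF i] by (simp add: smult_Mf)
  qed (use assms in \<open>auto simp: carrier_Mf\<close>)
  also have "\<dots> = frac (\<Oplus>\<^bsub>M\<^esub>i\<in>A. d i \<odot>\<^bsub>M\<^esub> e i) k"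
    using assms by (intro finsum_frac) auto
  finally show ?thesis .
qed

end

context module
begin

lemma finsum_in_submodule:
  assumes "submodule N R M" "finite A" "\<And>i. i \<in> A \<Longrightarrow> g i \<in> N"
  shows "(\<Oplus>\<^bsub>M\<^esub>i\<in>A. g i) \<in> N"
  using assms(2,3)
proof (induction A)
  case empty
  then show ?case using submodule_zero[OF assms(1)] by simp
next
  case (insert x A)
  have "g \<in> A \<rightarrow> carrier M" "g x \<in> carrier M" using insert.prems submoduleE(1)[OF assms(1)] by auto
  then show ?case using insert submoduleE(5)[OF assms(1)] by simp
qed

lemma lspan_finsum:
  assumes "finite A" "e \<in> A \<rightarrow> carrier M" "x \<in> lspan M (carrier R) (e ` A)"
  shows "\<exists>d \<in> A \<rightarrow> carrier R. x = (\<Oplus>\<^bsub>M\<^esub>i\<in>A. d i \<odot>\<^bsub>M\<^esub> e i)"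
  using assms
proof (induction A arbitrary: x)
  case empty
  from empty(2) have "x = \<zero>\<^bsub>M\<^esub>" by (auto elim: lspan.cases)
  then show ?case by auto
next
  case (insert a A)
  have ea: "e a \<in> carrier M" "e ` A \<subseteq> carrier M" using insert.prems by auto
  have eA: "e \<in> A \<rightarrow> carrier M" using insert.prems by auto
  obtain c y where c: "c \<in> carrier R" "y \<in> lspan M (carrier R) (e ` A)" "x = c \<odot>\<^bsub>M\<^esub> e a \<oplus>\<^bsub>M\<^esub> y"
    using lspan_insert[OF oneideal ea, of x] insert.prems(2) by auto
  obtain d where d: "d \<in> A \<rightarrow> carrier R" "y = (\<Oplus>\<^bsub>M\<^esub>i\<in>A. d i \<odot>\<^bsub>M\<^esub> e i)"
    using insert.IH[OF eA c(2)] by blast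
  let ?d = "d(a := c)"
  have "(\<Oplus>\<^bsub>M\<^esub>i\<in>A. ?d i \<odot>\<^bsub>M\<^esub> e i) = y"
    unfolding d(2) using insert.hyps d(1) eA by (intro M.finsum_cong') auto
  moreover have "(\<lambda>i. ?d i \<odot>\<^bsub>M\<^esub> e i) \<in> A \<rightarrow> carrier M"
    using d(1) eA insert.hyps by (auto simp: Pi_iff)
  ultimately have "(\<Oplus>\<^bsub>M\<^esub>i\<in>insert a A. ?d i \<odot>\<^bsub>M\<^esub> e i) = x"
    using insert.hyps ea c by (subst M.finsum_insert) auto
  moreover have "?d \<in> insert a A \<rightarrow> carrier R" using d(1) c(1) by auto
  ultimately show ?case by blast
qed

text \<open>The numerators of the given basis serve, because powers of f are invertible. Since f is
  outside a prime, none of its powers is zero, so the localized ring is not zero; this is what makes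
  the indexed family injective and its image a set of exactly r elements.\<close>

lemma free_of_rank_imp_loc_basis:
  assumes m: "primeideal \<mm> R" and f: "f \<in> carrier R - \<mm>"
    and fr: "free_of_rank (loc_ring R f) (loc_module R M f) r"
  shows "\<exists>E. loc_basis R M f E \<and> card E = r"
proof -
  interpret m: primeideal \<mm> R by (rule m)
  have mi: "ideal \<mm> R" ..
  have fc: "f \<in> carrier R" using f by simp
  interpret L: loc_mod R M f by unfold_locales (rule fc)
  have pw: "f [^] (t::nat) \<in> carrier R" for t using fc by simp
  obtain e where e: "e \<in> {..<r} \<rightarrow> carrier L.Mf"
    and ex1: "\<And>x. x \<in> carrier L.Mf \<Longrightarrow>
      \<exists>!c. c \<in> {..<r} \<rightarrow>\<^sub>E carrier L.Rf \<and> x = (\<Oplus>\<^bsub>L.Mf\<^esub>i\<in>{..<r}. c i \<odot>\<^bsub>L.Mf\<^esub> e i)"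
    using fr unfolding free_of_rank_def by auto
  have "\<forall>i\<in>{..<r}. \<exists>x k. x \<in> carrier M \<and> e i = L.frac x k"
    using e unfolding L.carrier_Mf by blast
  then obtain x k where x: "\<And>i. i < r \<Longrightarrow> x i \<in> carrier M" "\<And>i. i < r \<Longrightarrow> e i = L.frac (x i) (k i)"
    by (metis lessThan_iff)
  interpret F: abelian_monoid L.Mf by (rule L.abelian_monoid_Mf)
  have sum_e: "(\<Oplus>\<^bsub>L.Mf\<^esub>i\<in>{..<r}. c i \<odot>\<^bsub>L.Mf\<^esub> e i) = L.frac (\<Oplus>\<^bsub>M\<^esub>i\<in>{..<r}. d i \<odot>\<^bsub>M\<^esub> x i) l"
    if "d \<in> {..<r} \<rightarrow> carrier R" "\<And>i. i < r \<Longrightarrow> c i = L.fracR ((f [^] k i) \<otimes> d i) l" for c d l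
  proof -
    have "(\<Oplus>\<^bsub>L.Mf\<^esub>i\<in>{..<r}. c i \<odot>\<^bsub>L.Mf\<^esub> e i) = (\<Oplus>\<^bsub>L.Mf\<^esub>i\<in>{..<r}. L.frac (d i \<odot>\<^bsub>M\<^esub> x i) l)"
    proof (rule F.finsum_cong')
      fix i assume "i \<in> {..<r}"
      then have i: "i < r" and carr: "d i \<in> carrier R" "x i \<in> carrier M" using x that by auto
      have "c i \<odot>\<^bsub>L.Mf\<^esub> e i = L.frac (((f [^] k i) \<otimes> d i) \<odot>\<^bsub>M\<^esub> x i) (l + k i)"
        using carr pw x(2)[OF i] that(2)[OF i] by (simp add: L.smult_Mf)
      also have "\<dots> = L.frac (d i \<odot>\<^bsub>M\<^esub> x i) l"
        using L.frac_expand[of "d i \<odot>\<^bsub>M\<^esub> x i" l "k i"] carr pw by (simp add: smult_assoc1 add.commute)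
      finally show "c i \<odot>\<^bsub>L.Mf\<^esub> e i = L.frac (d i \<odot>\<^bsub>M\<^esub> x i) l" .
    next
      show "(\<lambda>i. L.frac (d i \<odot>\<^bsub>M\<^esub> x i) l) \<in> {..<r} \<rightarrow> carrier L.Mf"
        unfolding L.carrier_Mf using that(1) x(1) by fast
    qed simp
    also have "\<dots> = L.frac (\<Oplus>\<^bsub>M\<^esub>i\<in>{..<r}. d i \<odot>\<^bsub>M\<^esub> x i) l"
      using that x by (intro L.finsum_frac) auto
    finally show ?thesis .
  qed
  \<comment> \<open>Uniqueness is applied to the two expansions of zero, the given one and the
    trivial one. The factors f^(k i) undo the denominators of the basis vectors.\<close>
  have indep: "\<exists>t::nat. (f [^] t) \<otimes> d i = \<zero>"
    if d: "d \<in> {..<r} \<rightarrow> carrier R" and z: "(\<Oplus>\<^bsub>M\<^esub>i\<in>{..<r}. d i \<odot>\<^bsub>M\<^esub> x i) = \<zero>\<^bsub>M\<^esub>" and i: "i < r" for d i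
  proof -
    let ?c = "\<lambda>i\<in>{..<r}. L.fracR ((f [^] k i) \<otimes> d i) 0" and ?z = "\<lambda>i\<in>{..<r}. L.fracR \<zero> 0"
    have "?c \<in> {..<r} \<rightarrow>\<^sub>E carrier L.Rf" unfolding L.carrier_Rf using d pw by auto
    moreover have "L.frac \<zero>\<^bsub>M\<^esub> 0 = (\<Oplus>\<^bsub>L.Mf\<^esub>i\<in>{..<r}. ?c i \<odot>\<^bsub>L.Mf\<^esub> e i)"
    proof -
      have "(\<Oplus>\<^bsub>L.Mf\<^esub>i\<in>{..<r}. ?c i \<odot>\<^bsub>L.Mf\<^esub> e i) = L.frac (\<Oplus>\<^bsub>M\<^esub>i\<in>{..<r}. d i \<odot>\<^bsub>M\<^esub> x i) 0"
        by (rule sum_e[OF d, where c = ?c]) simp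
      then show ?thesis by (simp only: z)
    qed
    moreover have "?z \<in> {..<r} \<rightarrow>\<^sub>E carrier L.Rf" unfolding L.carrier_Rf by auto
    moreover have "L.frac \<zero>\<^bsub>M\<^esub> 0 = (\<Oplus>\<^bsub>L.Mf\<^esub>i\<in>{..<r}. ?z i \<odot>\<^bsub>L.Mf\<^esub> e i)"
    proof -
      have "(\<Oplus>\<^bsub>M\<^esub>i\<in>{..<r}. \<zero> \<odot>\<^bsub>M\<^esub> x i) = (\<Oplus>\<^bsub>M\<^esub>i\<in>{..<r}. \<zero>\<^bsub>M\<^esub>)"
        using x by (intro M.finsum_cong') auto
      moreover have "(\<Oplus>\<^bsub>L.Mf\<^esub>i\<in>{..<r}. ?z i \<odot>\<^bsub>L.Mf\<^esub> e i) = L.frac (\<Oplus>\<^bsub>M\<^esub>i\<in>{..<r}. \<zero> \<odot>\<^bsub>M\<^esub> x i) 0"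
        by (rule sum_e[where d = "\<lambda>_. \<zero>" and c = ?z]) (use pw in auto)
      ultimately show ?thesis by simp
    qed
    moreover have zc: "L.frac \<zero>\<^bsub>M\<^esub> 0 \<in> carrier L.Mf" unfolding L.carrier_Mf by auto
    ultimately have "?c = ?z"
      by (intro Uniq_D[OF conjunct2[OF ex1_iff_ex_Uniq[THEN iffD1, OF ex1[OF zc]]]] conjI)
    then have "?c i = ?z i" by (rule fun_cong)
    then have "L.fracR ((f [^] k i) \<otimes> d i) 0 = L.fracR \<zero> 0" using i by simp
    then obtain t :: nat where "(f [^] t) \<otimes> ((f [^] k i) \<otimes> d i) = \<zero>"
      using L.fracR_eq_iff[of "(f [^] k i) \<otimes> d i" \<zero> 0 0] funcset_mem[OF d, of i] i pw by auto
    then have "(f [^] (t + k i)) \<otimes> d i = \<zero>" using d i pw fc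
      by (simp add: R.nat_pow_mult[symmetric] R.m_assoc Pi_iff)
    then show ?thesis by blast
  qed
  have inj: "inj_on x {..<r}"
  proof (rule inj_onI, rule ccontr)
    fix i j assume ij: "i \<in> {..<r}" "j \<in> {..<r}" "x i = x j" "i \<noteq> j"
    let ?d = "\<lambda>l. if l = i then \<one> else if l = j then \<ominus> \<one> else \<zero>"
    have "{..<r} = insert i (insert j ({..<r} - {i, j}))" using ij by auto
    then have "(\<Oplus>\<^bsub>M\<^esub>l\<in>{..<r}. ?d l \<odot>\<^bsub>M\<^esub> x l) = (\<Oplus>\<^bsub>M\<^esub>l\<in>insert i (insert j ({..<r} - {i, j})). ?d l \<odot>\<^bsub>M\<^esub> x l)"
      by simp
    also have "\<dots> = x i \<oplus>\<^bsub>M\<^esub> (\<ominus>\<^bsub>M\<^esub> x i \<oplus>\<^bsub>M\<^esub> (\<Oplus>\<^bsub>M\<^esub>l\<in>{..<r} - {i, j}. ?d l \<odot>\<^bsub>M\<^esub> x l))"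
      using ij x by (simp add: smult_l_minus Pi_iff)
    also have "(\<Oplus>\<^bsub>M\<^esub>l\<in>{..<r} - {i, j}. ?d l \<odot>\<^bsub>M\<^esub> x l) = (\<Oplus>\<^bsub>M\<^esub>l\<in>{..<r} - {i, j}. \<zero>\<^bsub>M\<^esub>)"
      using x by (intro M.finsum_cong') auto
    finally have "(\<Oplus>\<^bsub>M\<^esub>l\<in>{..<r}. ?d l \<odot>\<^bsub>M\<^esub> x l) = \<zero>\<^bsub>M\<^esub>" using x ij by (simp add: M.r_neg)
    then obtain t :: nat where "(f [^] t) \<otimes> \<one> = \<zero>" using indep[of ?d i] ij by auto
    then show False using m.pow_notin[OF f, of t] ideal_zero[OF mi] pw by auto
  qed
  let ?E = "x ` {..<r}"
  have Ec: "?E \<subseteq> carrier M" using x by auto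
  have "carrier M \<subseteq> sat R M f (lspan M (carrier R) ?E)"
  proof
    fix y assume y: "y \<in> carrier M"
    then have yc: "L.frac y 0 \<in> carrier L.Mf" unfolding L.carrier_Mf by auto
    obtain c where c: "c \<in> {..<r} \<rightarrow>\<^sub>E carrier L.Rf"
      "L.frac y 0 = (\<Oplus>\<^bsub>L.Mf\<^esub>i\<in>{..<r}. c i \<odot>\<^bsub>L.Mf\<^esub> e i)"
      using ex1_implies_ex[OF ex1[OF yc]] by (elim exE conjE)
    have cP: "c \<in> {..<r} \<rightarrow> carrier L.Rf" using c by (auto simp: PiE_def)
    obtain l d where d: "d \<in> {..<r} \<rightarrow> carrier R" "\<And>i. i \<in> {..<r} \<Longrightarrow> c i = L.fracR (d i) l"
      using L.common_denominator[OF finite_lessThan cP] by metis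
    \<comment> \<open>A bound for all denominators of the basis: the coefficient of the numerator x
      i then absorbs the complementary power f^(K - k i), and the total denominator becomes K +
      l.\<close>
    define K where "K = sum k {..<r}"
    let ?d = "\<lambda>i. (f [^] (K - k i)) \<otimes> d i"
    have dc: "?d \<in> {..<r} \<rightarrow> carrier R" using d pw by auto
    have "c i = L.fracR ((f [^] k i) \<otimes> ?d i) (K + l)" if "i < r" for i
    proof -
      have "k i \<le> K" using that unfolding K_def by (simp add: member_le_sum)
      then have "(f [^] k i) \<otimes> ?d i = (f [^] K) \<otimes> d i"
        using d that pw fc by (simp add: R.m_assoc[symmetric] R.nat_pow_mult Pi_iff)
      then show ?thesis using L.fracR_expand[of "d i" l K] d that by auto
    qed
    then have "L.frac y 0 = L.frac (\<Oplus>\<^bsub>M\<^esub>i\<in>{..<r}. ?d i \<odot>\<^bsub>M\<^esub> x i) (K + l)"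
      using sum_e[OF dc, of c "K + l"] c by simp
    moreover have sc: "(\<Oplus>\<^bsub>M\<^esub>i\<in>{..<r}. ?d i \<odot>\<^bsub>M\<^esub> x i) \<in> lspan M (carrier R) ?E"
      by (intro finsum_in_submodule span_submodule Ec finite_lessThan lspan_base[OF subset_refl Ec]
        funcset_mem[OF dc] imageI)
    ultimately obtain t :: nat where
      "(f [^] (t + (K + l))) \<odot>\<^bsub>M\<^esub> y = (f [^] (t + 0)) \<odot>\<^bsub>M\<^esub> (\<Oplus>\<^bsub>M\<^esub>i\<in>{..<r}. ?d i \<odot>\<^bsub>M\<^esub> x i)"
      using L.frac_eq_iff[OF y] lspan_carrier[OF subset_refl Ec] by blast
    then have "(f [^] (t + (K + l))) \<odot>\<^bsub>M\<^esub> y \<in> lspan M (carrier R) ?E"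
      using submoduleE(4)[OF span_submodule[OF Ec] _ sc] pw by simp
    then show "y \<in> sat R M f (lspan M (carrier R) ?E)" using y by (rule satI[rotated])
  qed
  moreover have "\<exists>t::nat. (f [^] t) \<otimes> c = \<zero>"
    if z: "z \<in> ?E" and c: "c \<in> carrier R" and cz: "c \<odot>\<^bsub>M\<^esub> z \<in> lspan M (carrier R) (?E - {z})" for z c
  proof -
    obtain i where i: "i < r" "z = x i" using z by auto
    have "?E - {z} = x ` ({..<r} - {i})" using inj i by (auto simp: inj_on_def)
    then obtain d where d: "d \<in> {..<r} - {i} \<rightarrow> carrier R"
      "c \<odot>\<^bsub>M\<^esub> z = (\<Oplus>\<^bsub>M\<^esub>j\<in>{..<r} - {i}. d j \<odot>\<^bsub>M\<^esub> x j)"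
      using lspan_finsum[of "{..<r} - {i}" x "c \<odot>\<^bsub>M\<^esub> z"] cz x by auto
    let ?d = "d(i := \<ominus> c)"
    have dc: "?d \<in> {..<r} \<rightarrow> carrier R" using d c by (auto simp: Pi_iff)
    have xi: "x i \<in> carrier M" using x i by simp
    have "{..<r} = insert i ({..<r} - {i})" using i by auto
    then have "(\<Oplus>\<^bsub>M\<^esub>j\<in>{..<r}. ?d j \<odot>\<^bsub>M\<^esub> x j) = (\<Oplus>\<^bsub>M\<^esub>j\<in>insert i ({..<r} - {i}). ?d j \<odot>\<^bsub>M\<^esub> x j)"
      by simp
    also have "\<dots> = \<ominus> c \<odot>\<^bsub>M\<^esub> x i \<oplus>\<^bsub>M\<^esub> (\<Oplus>\<^bsub>M\<^esub>j\<in>{..<r} - {i}. ?d j \<odot>\<^bsub>M\<^esub> x j)"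
      using d x i c by (subst M.finsum_insert) (auto simp: Pi_iff)
    also have "(\<Oplus>\<^bsub>M\<^esub>j\<in>{..<r} - {i}. ?d j \<odot>\<^bsub>M\<^esub> x j) = c \<odot>\<^bsub>M\<^esub> z"
      unfolding d(2) using d x by (intro M.finsum_cong') (auto simp: Pi_iff)
    finally have "(\<Oplus>\<^bsub>M\<^esub>j\<in>{..<r}. ?d j \<odot>\<^bsub>M\<^esub> x j) = \<zero>\<^bsub>M\<^esub>"
      using xi c i by (simp add: smult_l_minus M.l_neg)
    then obtain t :: nat where "(f [^] t) \<otimes> (\<ominus> c) = \<zero>" using indep[OF dc _ i(1)] by auto
    then have "(f [^] t) \<otimes> c = \<zero>" using c pw
      by (metis R.add.inv_closed R.minus_minus R.minus_zero R.r_minus)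
    then show ?thesis by blast
  qed
  ultimately have "loc_basis R M f ?E" unfolding loc_basis_def using Ec by auto
  moreover have "card ?E = r" using inj by (simp add: card_image)
  ultimately show ?thesis by blast
qed

lemma loc_basis_imp_free_of_rank:
  assumes fc: "f \<in> carrier R" and E: "loc_basis R M f E"
  shows "free_of_rank (loc_ring R f) (loc_module R M f) (card E)"
proof -
  interpret L: loc_mod R M f by unfold_locales (rule fc)
  have pw: "f [^] (t::nat) \<in> carrier R" for t using fc by simp
  have Ec: "finite E" "E \<subseteq> carrier M" and sp: "carrier M \<subseteq> sat R M f (lspan M (carrier R) E)"
    and ind: "\<And>x c. x \<in> E \<Longrightarrow> c \<in> carrier R \<Longrightarrow> c \<odot>\<^bsub>M\<^esub> x \<in> lspan M (carrier R) (E - {x}) \<Longrightarrow>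
      (\<exists>t::nat. (f [^] t) \<otimes> c = \<zero>)"
    using E unfolding loc_basis_def by auto
  let ?r = "card E"
  obtain x where bij: "bij_betw x {..<?r} E" using ex_bij_betw_nat_finite[OF Ec(1)] atLeast0LessThan by metis
  have inj: "inj_on x {..<?r}" and xE: "x ` {..<?r} = E" using bij by (auto simp: bij_betw_def)
  have xc: "x i \<in> carrier M" if "i < ?r" for i using that xE Ec by auto
  let ?e = "\<lambda>i. L.frac (x i) 0"
  have ex1: "\<exists>!c. c \<in> {..<?r} \<rightarrow>\<^sub>E carrier L.Rf \<and> y = (\<Oplus>\<^bsub>L.Mf\<^esub>i\<in>{..<?r}. c i \<odot>\<^bsub>L.Mf\<^esub> ?e i)"
    if y: "y \<in> carrier L.Mf" for y
  proof (rule ex_ex1I)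
    obtain z j where z: "y = L.frac z j" "z \<in> carrier M" using y unfolding L.carrier_Mf by auto
    have "z \<in> sat R M f (lspan M (carrier R) E)" using sp z by blast
    then obtain t :: nat where "(f [^] t) \<odot>\<^bsub>M\<^esub> z \<in> lspan M (carrier R) E" by (rule satE)
    then obtain d where d: "d \<in> {..<?r} \<rightarrow> carrier R" "(f [^] t) \<odot>\<^bsub>M\<^esub> z = (\<Oplus>\<^bsub>M\<^esub>i\<in>{..<?r}. d i \<odot>\<^bsub>M\<^esub> x i)"
      using lspan_finsum[of "{..<?r}" x "(f [^] t) \<odot>\<^bsub>M\<^esub> z"] xc xE by auto
    let ?c = "\<lambda>i\<in>{..<?r}. L.fracR (d i) (t + j)"
    have "?c \<in> {..<?r} \<rightarrow>\<^sub>E carrier L.Rf" unfolding L.carrier_Rf using d by auto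
    moreover have "(\<Oplus>\<^bsub>L.Mf\<^esub>i\<in>{..<?r}. ?c i \<odot>\<^bsub>L.Mf\<^esub> ?e i) = L.frac (\<Oplus>\<^bsub>M\<^esub>i\<in>{..<?r}. d i \<odot>\<^bsub>M\<^esub> x i) (t + j)"
      using d xc by (intro L.lincomb_frac) auto
    moreover have "\<dots> = y" using L.frac_expand[OF z(2), of j t] z d by simp
    ultimately have "?c \<in> {..<?r} \<rightarrow>\<^sub>E carrier L.Rf \<and> y = (\<Oplus>\<^bsub>L.Mf\<^esub>i\<in>{..<?r}. ?c i \<odot>\<^bsub>L.Mf\<^esub> ?e i)"
      by (simp only: simp_thms)
    then show "\<exists>c. c \<in> {..<?r} \<rightarrow>\<^sub>E carrier L.Rf \<and> y = (\<Oplus>\<^bsub>L.Mf\<^esub>i\<in>{..<?r}. c i \<odot>\<^bsub>L.Mf\<^esub> ?e i)"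
      by (rule exI[where x = ?c])
  next
    fix c c'
    assume c: "c \<in> {..<?r} \<rightarrow>\<^sub>E carrier L.Rf \<and> y = (\<Oplus>\<^bsub>L.Mf\<^esub>i\<in>{..<?r}. c i \<odot>\<^bsub>L.Mf\<^esub> ?e i)"
    assume c': "c' \<in> {..<?r} \<rightarrow>\<^sub>E carrier L.Rf \<and> y = (\<Oplus>\<^bsub>L.Mf\<^esub>i\<in>{..<?r}. c' i \<odot>\<^bsub>L.Mf\<^esub> ?e i)"
    have cP: "c \<in> {..<?r} \<rightarrow> carrier L.Rf" "c' \<in> {..<?r} \<rightarrow> carrier L.Rf"
      using c c' by (auto simp: PiE_def)
    obtain k d where d: "d \<in> {..<?r} \<rightarrow> carrier R" "\<And>i. i \<in> {..<?r} \<Longrightarrow> c i = L.fracR (d i) k"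
      using L.common_denominator[OF finite_lessThan cP(1)] by metis
    obtain k' d' where d': "d' \<in> {..<?r} \<rightarrow> carrier R" "\<And>i. i \<in> {..<?r} \<Longrightarrow> c' i = L.fracR (d' i) k'"
      using L.common_denominator[OF finite_lessThan cP(2)] by metis
    let ?S = "\<lambda>d. \<Oplus>\<^bsub>M\<^esub>i\<in>{..<?r}. d i \<odot>\<^bsub>M\<^esub> x i"
    have Sc: "?S d \<in> carrier M" if "d \<in> {..<?r} \<rightarrow> carrier R" for d
      using that xc by (intro M.finsum_closed) auto
    have "y = L.frac (?S d) k" using c d xc L.lincomb_frac[of "{..<?r}" d x c k ?e] by auto
    moreover have "y = L.frac (?S d') k'" using c' d' xc L.lincomb_frac[of "{..<?r}" d' x c' k' ?e] by auto
    ultimately have "L.frac (?S d) k = L.frac (?S d') k'" by (rule subst)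
    then obtain t :: nat where t: "(f [^] (t + k')) \<odot>\<^bsub>M\<^esub> ?S d = (f [^] (t + k)) \<odot>\<^bsub>M\<^esub> ?S d'"
      unfolding L.frac_eq_iff[OF Sc Sc, OF d(1) d'(1)] by (elim exE)
    \<comment> \<open>The differences of the two coefficient families over a common denominator.
      They are the coefficients of a relation in M itself, so independence kills each of them by a
      power of f.\<close>
    let ?g = "\<lambda>i. (f [^] (t + k')) \<otimes> d i \<ominus> (f [^] (t + k)) \<otimes> d' i"
    have gc: "?g \<in> {..<?r} \<rightarrow> carrier R" using d d' pw by (auto simp: Pi_iff)
    have "?S ?g \<oplus>\<^bsub>M\<^esub> (f [^] (t + k)) \<odot>\<^bsub>M\<^esub> ?S d' = (f [^] (t + k')) \<odot>\<^bsub>M\<^esub> ?S d"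
    proof -
      have "(f [^] (t + k')) \<odot>\<^bsub>M\<^esub> ?S d = (\<Oplus>\<^bsub>M\<^esub>i\<in>{..<?r}. (f [^] (t + k')) \<odot>\<^bsub>M\<^esub> (d i \<odot>\<^bsub>M\<^esub> x i))"
        using d xc pw by (intro finsum_smult_ldistr) auto
      also have "\<dots> = (\<Oplus>\<^bsub>M\<^esub>i\<in>{..<?r}. ?g i \<odot>\<^bsub>M\<^esub> x i \<oplus>\<^bsub>M\<^esub> (f [^] (t + k)) \<odot>\<^bsub>M\<^esub> (d' i \<odot>\<^bsub>M\<^esub> x i))"
      proof (rule M.finsum_cong')
        fix i assume "i \<in> {..<?r}"
        then have carr: "d i \<in> carrier R" "d' i \<in> carrier R" "x i \<in> carrier M" using d d' xc by auto
        have "?g i \<oplus> (f [^] (t + k)) \<otimes> d' i = (f [^] (t + k')) \<otimes> d i"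
          using carr pw by (simp add: R.minus_eq R.a_assoc R.l_neg)
        then have "(?g i \<oplus> (f [^] (t + k)) \<otimes> d' i) \<odot>\<^bsub>M\<^esub> x i = ((f [^] (t + k')) \<otimes> d i) \<odot>\<^bsub>M\<^esub> x i" by simp
        then show "(f [^] (t + k')) \<odot>\<^bsub>M\<^esub> (d i \<odot>\<^bsub>M\<^esub> x i) =
          ?g i \<odot>\<^bsub>M\<^esub> x i \<oplus>\<^bsub>M\<^esub> (f [^] (t + k)) \<odot>\<^bsub>M\<^esub> (d' i \<odot>\<^bsub>M\<^esub> x i)"
          using carr pw by (simp add: smult_l_distr smult_assoc1)
      qed (use d d' xc pw in \<open>auto simp: Pi_iff\<close>)
      also have "\<dots> = ?S ?g \<oplus>\<^bsub>M\<^esub> (\<Oplus>\<^bsub>M\<^esub>i\<in>{..<?r}. (f [^] (t + k)) \<odot>\<^bsub>M\<^esub> (d' i \<odot>\<^bsub>M\<^esub> x i))"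
        using gc d' xc pw by (intro M.finsum_addf) (auto simp: Pi_iff)
      also have "(\<Oplus>\<^bsub>M\<^esub>i\<in>{..<?r}. (f [^] (t + k)) \<odot>\<^bsub>M\<^esub> (d' i \<odot>\<^bsub>M\<^esub> x i)) = (f [^] (t + k)) \<odot>\<^bsub>M\<^esub> ?S d'"
        using d' xc pw by (intro finsum_smult_ldistr[symmetric]) auto
      finally show ?thesis by simp
    qed
    then have "?S ?g \<oplus>\<^bsub>M\<^esub> (f [^] (t + k)) \<odot>\<^bsub>M\<^esub> ?S d' = (f [^] (t + k)) \<odot>\<^bsub>M\<^esub> ?S d'"
      by (simp only: t)
    then have z: "?S ?g = \<zero>\<^bsub>M\<^esub>"
      using M.add.r_cancel_one[of "(f [^] (t + k)) \<odot>\<^bsub>M\<^esub> ?S d'" "?S ?g"] Sc[OF gc] Sc[OF d'(1)] pw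
      by simp
    have kill: "\<exists>s::nat. (f [^] s) \<otimes> ?g i = \<zero>" if i: "i < ?r" for i
    proof -
      have gi: "?g i \<in> carrier R" using gc i by auto
      let ?B = "lspan M (carrier R) (E - {x i})"
      have Eic: "E - {x i} \<subseteq> carrier M" using Ec by auto
      have "{..<?r} = insert i ({..<?r} - {i})" using i by auto
      then have "?S ?g = (\<Oplus>\<^bsub>M\<^esub>j\<in>insert i ({..<?r} - {i}). ?g j \<odot>\<^bsub>M\<^esub> x j)" by simp
      also have "\<dots> = ?g i \<odot>\<^bsub>M\<^esub> x i \<oplus>\<^bsub>M\<^esub> (\<Oplus>\<^bsub>M\<^esub>j\<in>{..<?r} - {i}. ?g j \<odot>\<^bsub>M\<^esub> x j)"
        using gc xc i by (subst M.finsum_insert) (auto simp: Pi_iff)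
      finally have eq: "(\<Oplus>\<^bsub>M\<^esub>j\<in>{..<?r} - {i}. ?g j \<odot>\<^bsub>M\<^esub> x j) \<oplus>\<^bsub>M\<^esub> ?g i \<odot>\<^bsub>M\<^esub> x i = \<zero>\<^bsub>M\<^esub>"
        using z gc xc i gi by (subst M.a_comm) (auto simp: Pi_iff intro!: M.finsum_closed)
      have rest: "(\<Oplus>\<^bsub>M\<^esub>j\<in>{..<?r} - {i}. ?g j \<odot>\<^bsub>M\<^esub> x j) \<in> ?B"
      proof (rule finsum_in_submodule[OF span_submodule[OF Eic]])
        fix j assume j: "j \<in> {..<?r} - {i}"
        then have "x j \<in> E - {x i}" using inj i xE by (auto simp: inj_on_def)
        then show "?g j \<odot>\<^bsub>M\<^esub> x j \<in> ?B" using gc j by (intro lspan_base[OF subset_refl Eic]) auto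
      qed simp
      have "?g i \<odot>\<^bsub>M\<^esub> x i \<in> ?B"
        using submodule_cancel[OF span_submodule[OF Eic] _ rest, of "?g i \<odot>\<^bsub>M\<^esub> x i"] eq gi xc[OF i]
          submodule_zero[OF span_submodule[OF Eic]] by simp
      then show ?thesis using ind[OF _ gi] xE i by auto
    qed
    show "c = c'"
    proof
      fix i
      show "c i = c' i"
      proof (cases "i < ?r")
        case True
        then obtain s :: nat where s: "(f [^] s) \<otimes> ?g i = \<zero>" using kill by blast
        have carr: "d i \<in> carrier R" "d' i \<in> carrier R" using d d' True by auto
        have "(f [^] (s + t + k')) \<otimes> d i \<ominus> (f [^] (s + t + k)) \<otimes> d' i = (f [^] s) \<otimes> ?g i"
          using carr pw fc by (simp add: R.nat_pow_mult[symmetric] R.minus_eq R.r_distr R.r_minus R.m_assoc)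
        then have "(f [^] (s + t + k')) \<otimes> d i = (f [^] (s + t + k)) \<otimes> d' i"
          using s carr pw R.minus_zero_imp_eq[of "(f [^] (s + t + k')) \<otimes> d i" "(f [^] (s + t + k)) \<otimes> d' i"]
          by simp
        then have "L.fracR (d i) k = L.fracR (d' i) k'" using L.fracR_eq_iff[OF carr] by blast
        then show ?thesis using d(2) d'(2) True by simp
      next
        case False
        then show ?thesis using c c' by (auto simp: PiE_def extensional_def)
      qed
    qed
  qed
  have ec: "?e \<in> {..<?r} \<rightarrow> carrier L.Mf" unfolding L.carrier_Mf using xc by auto
  show ?thesis unfolding free_of_rank_def using ec by (intro bexI[where x = ?e] ballI ex1)
qed

text \<open>A covering family generates the unit ideal, so it is not contained in \<mm>; any member
  outside \<mm> can be used.\<close>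

lemma locally_free_imp_loc_basis:
  assumes m: "primeideal \<mm> R" and lf: "locally_free R M r"
  shows "\<exists>f\<in>carrier R - \<mm>. \<exists>E. loc_basis R M f E \<and> card E = r"
proof -
  interpret m: primeideal \<mm> R by (rule m)
  have mi: "ideal \<mm> R" ..
  obtain F where F: "F \<subseteq> carrier R" "Idl F = carrier R"
    "\<And>f. f \<in> F \<Longrightarrow> free_of_rank (loc_ring R f) (loc_module R M f) r"
    using lf unfolding locally_free_def by blast
  have "\<not> F \<subseteq> \<mm>"
  proof
    assume "F \<subseteq> \<mm>"
    then have "Idl F \<subseteq> \<mm>" using R.genideal_minimal[OF mi] by blast
    then show False using F(2) m.I_notcarr ideal_subset[OF mi] by blast
  qed
  then obtain f where f: "f \<in> F" "f \<notin> \<mm>" by blast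
  then have "f \<in> carrier R - \<mm>" using F by blast
  then show ?thesis using free_of_rank_imp_loc_basis[OF m _ F(3)[OF f(1)]] by blast
qed

end

section \<open>Polynomial rings\<close>

lemma finite_submultisets: "finite {v. v \<subseteq># (w :: 'b multiset)}"
proof (rule finite_subset)
  show "{v. v \<subseteq># w} \<subseteq> mset ` {xs. set xs \<subseteq> set_mset w \<and> length xs \<le> size w}"
  proof
    fix v assume "v \<in> {v. v \<subseteq># w}"
    then have v: "v \<subseteq># w" by simp
    obtain xs where xs: "v = mset xs" by (metis ex_mset)
    have "set xs \<subseteq> set_mset w" using v xs set_mset_mono by fastforce
    moreover have "length xs \<le> size w" using v xs size_mset_mono by fastforce
    ultimately show "v \<in> mset ` {xs. set xs \<subseteq> set_mset w \<and> length xs \<le> size w}" using xs by blast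
  qed
  show "finite (mset ` {xs. set xs \<subseteq> set_mset w \<and> length xs \<le> size w})"
    by (intro finite_imageI finite_lists_length_le) simp
qed

lemma add_subset_mset_iff: "s + t \<subseteq># w \<longleftrightarrow> s \<subseteq># w \<and> t \<subseteq># w - s"
proof -
  have "count s a + count t a \<le> count w a \<longleftrightarrow>
      count s a \<le> count w a \<and> count t a \<le> count w a - count s a" for a
    by arith
  then show ?thesis by (auto simp: subseteq_mset_def)
qed

lemma expo_empty [simp]: "{#} \<in> expo n"
  by (simp add: expo_def)

lemma expo_add [simp]: "u + v \<in> expo n \<longleftrightarrow> u \<in> expo n \<and> v \<in> expo n"
  by (auto simp: expo_def)

lemma expo_mono: "v \<in> expo n \<Longrightarrow> u \<subseteq># v \<Longrightarrow> u \<in> expo n"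
  by (auto simp: expo_def dest: mset_subset_eqD)

lemma expo_diff: "v \<in> expo n \<Longrightarrow> v - u \<in> expo n"
  using expo_mono[OF _ diff_subset_eq_self] .

lemma expo_lcm: "u \<in> expo n \<Longrightarrow> v \<in> expo n \<Longrightarrow> u \<union># v \<in> expo n"
  by (auto simp: expo_def)

locale poly = cring R for R (structure) +
  fixes n :: nat
begin

abbreviation "S \<equiv> mpoly_alg R n"

text \<open>Multiplication by x^t on coefficient functions (\<open>mon_mult\<close>). It replaces
  the convolution product wherever one factor is a monomial.\<close>

definition shift :: "nat multiset \<Rightarrow> (nat multiset \<Rightarrow> 'a) \<Rightarrow> nat multiset \<Rightarrow> 'a" where
  "shift t p = (\<lambda>w. if t \<subseteq># w then p (w - t) else \<zero>)"

lemma S_carrier: "p \<in> carrier S \<longleftrightarrow>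
    (\<forall>u. p u \<in> carrier R) \<and> finite {u. p u \<noteq> \<zero>} \<and> (\<forall>u. p u \<noteq> \<zero> \<longrightarrow> u \<in> expo n)"
  by (auto simp: mpoly_alg_def)

lemma S_ops: "\<zero>\<^bsub>S\<^esub> = (\<lambda>u. \<zero>)" "p \<oplus>\<^bsub>S\<^esub> q = (\<lambda>u. p u \<oplus> q u)" "c \<odot>\<^bsub>S\<^esub> p = (\<lambda>u. c \<otimes> p u)"
  "\<one>\<^bsub>S\<^esub> = mon R {#}"
  by (simp_all add: mpoly_alg_def mon_def)

lemma S_coeff: "p \<in> carrier S \<Longrightarrow> p u \<in> carrier R"
  by (simp add: S_carrier)

lemma S_zero_closed: "(\<lambda>u. \<zero>) \<in> carrier S"
  by (simp add: S_carrier)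

lemma S_add_closed:
  assumes "p \<in> carrier S" "q \<in> carrier S" shows "(\<lambda>u. p u \<oplus> q u) \<in> carrier S"
proof -
  have sub: "{u. p u \<oplus> q u \<noteq> \<zero>} \<subseteq> {u. p u \<noteq> \<zero>} \<union> {u. q u \<noteq> \<zero>}" by auto
  then have "finite {u. p u \<oplus> q u \<noteq> \<zero>}"
    using assms by (auto simp: S_carrier intro: finite_subset)
  then show ?thesis using assms sub by (auto simp: S_carrier)
qed

lemma S_map_closed:
  assumes "p \<in> carrier S" "\<And>u. g u (p u) \<in> carrier R" "\<And>u. g u \<zero> = \<zero>"
  shows "(\<lambda>u. g u (p u)) \<in> carrier S"
proof -
  have sub: "{u. g u (p u) \<noteq> \<zero>} \<subseteq> {u. p u \<noteq> \<zero>}" using assms(3) by force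
  then have "finite {u. g u (p u) \<noteq> \<zero>}"
    using assms by (auto simp: S_carrier intro: finite_subset)
  then show ?thesis using assms sub by (auto simp: S_carrier)
qed

lemma S_smult_closed: "c \<in> carrier R \<Longrightarrow> p \<in> carrier S \<Longrightarrow> (\<lambda>u. c \<otimes> p u) \<in> carrier S"
  by (rule S_map_closed) (auto simp: S_coeff)

lemma S_neg_closed: "p \<in> carrier S \<Longrightarrow> (\<lambda>u. \<ominus> p u) \<in> carrier S"
  by (rule S_map_closed) (auto simp: S_coeff)

lemma S_abelian_group: "abelian_group S"
proof (rule abelian_groupI)
  fix p assume "p \<in> carrier S"
  then show "\<exists>q\<in>carrier S. q \<oplus>\<^bsub>S\<^esub> p = \<zero>\<^bsub>S\<^esub>"
    by (intro bexI[of _ "\<lambda>u. \<ominus> p u"]) (auto simp: S_ops S_coeff l_neg S_neg_closed)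
qed (auto simp: S_ops S_zero_closed S_add_closed S_coeff a_ac)

lemma S_module: "module R S"
  by (rule moduleI[OF is_cring S_abelian_group])
    (auto simp: S_ops S_smult_closed S_coeff l_distr r_distr m_assoc)

sublocale M: module R S by (rule S_module)

lemma S_uminus: "p \<in> carrier S \<Longrightarrow> \<ominus>\<^bsub>S\<^esub> p = (\<lambda>u. \<ominus> p u)"
  by (rule M.M.minus_equality) (auto simp: S_ops S_coeff l_neg S_neg_closed)

lemma S_minus: "p \<in> carrier S \<Longrightarrow> q \<in> carrier S \<Longrightarrow> p \<ominus>\<^bsub>S\<^esub> q = (\<lambda>u. p u \<ominus> q u)"
  by (simp add: M.M.minus_eq S_ops S_uminus minus_eq)

lemma mon_closed: "u \<in> expo n \<Longrightarrow> mon R u \<in> carrier S"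
  by (auto simp: S_carrier mon_def)

text \<open>Because monomials are independent, membership in their span can be tested coefficient by
  coefficient, also when the coefficients are confined to an ideal such as \<mm>.\<close>

lemma lspan_mon:
  assumes C: "ideal C R" and Y: "Y \<subseteq> expo n"
  shows "lspan S C (mon R ` Y) = {p \<in> carrier S. \<forall>u. p u \<in> C \<and> (p u \<noteq> \<zero> \<longrightarrow> u \<in> Y)}"
proof (intro equalityI subsetI)
  have Cc: "C \<subseteq> carrier R" using ideal_subset[OF C] .
  have mc: "mon R ` Y \<subseteq> carrier S" using Y mon_closed by blast
  fix p assume "p \<in> lspan S C (mon R ` Y)"
  then show "p \<in> {p \<in> carrier S. \<forall>u. p u \<in> C \<and> (p u \<noteq> \<zero> \<longrightarrow> u \<in> Y)}"
  proof induction
    case lspan_zero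
    then show ?case using ideal_zero[OF C] by (simp add: S_ops S_zero_closed)
  next
    case (lspan_step c y x)
    then obtain v where v: "v \<in> Y" "y = mon R v" by blast
    have c: "c \<in> carrier R" using lspan_step(1) Cc by blast
    have "c \<odot>\<^bsub>S\<^esub> y \<oplus>\<^bsub>S\<^esub> x \<in> carrier S"
      using lspan_step(4) c v mc by auto
    moreover have "(c \<odot>\<^bsub>S\<^esub> y \<oplus>\<^bsub>S\<^esub> x) u \<in> C \<and> ((c \<odot>\<^bsub>S\<^esub> y \<oplus>\<^bsub>S\<^esub> x) u \<noteq> \<zero> \<longrightarrow> u \<in> Y)" for u
      using lspan_step(1,4) v c ideal_add[OF C] S_coeff[of x] ideal_zero[OF C] by (auto simp: S_ops mon_def)
    ultimately show ?case by blast
  qed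
next
  have Cc: "C \<subseteq> carrier R" using ideal_subset[OF C] .
  have mc: "mon R ` Y \<subseteq> carrier S" using Y mon_closed by blast
  fix p assume "p \<in> {p \<in> carrier S. \<forall>u. p u \<in> C \<and> (p u \<noteq> \<zero> \<longrightarrow> u \<in> Y)}"
  then have p: "p \<in> carrier S" "\<And>u. p u \<in> C" "\<And>u. p u \<noteq> \<zero> \<Longrightarrow> u \<in> Y" by auto
  have "finite A \<Longrightarrow> p \<in> carrier S \<Longrightarrow> (\<And>u. p u \<in> C) \<Longrightarrow> (\<And>u. p u \<noteq> \<zero> \<Longrightarrow> u \<in> Y) \<Longrightarrow>
      {u. p u \<noteq> \<zero>} \<subseteq> A \<Longrightarrow> p \<in> lspan S C (mon R ` Y)" for A p
  proof (induction A arbitrary: p rule: finite_induct)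
    case empty
    then have "p = \<zero>\<^bsub>S\<^esub>" by (auto simp: S_ops)
    then show ?case by (auto intro: lspan.intros)
  next
    case (insert v A)
    let ?q = "\<lambda>u. if u = v then \<zero> else p u"
    have q: "?q \<in> carrier S"
      using S_map_closed[OF insert.prems(1), of "\<lambda>u x. if u = v then \<zero> else x"] insert.prems(1) S_coeff
      by auto
    have "?q \<in> lspan S C (mon R ` Y)"
      using insert.prems ideal_zero[OF C] by (intro insert.IH[OF q]) (auto split: if_splits)
    show ?case
    proof (cases "p v = \<zero>")
      case True
      then have "p = ?q" by auto
      then show ?thesis using \<open>?q \<in> lspan S C (mon R ` Y)\<close> by simp
    next
      case False
      have "p = p v \<odot>\<^bsub>S\<^esub> mon R v \<oplus>\<^bsub>S\<^esub> ?q"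
        using S_coeff[OF insert.prems(1)] by (auto simp: S_ops mon_def)
      moreover have "p v \<odot>\<^bsub>S\<^esub> mon R v \<oplus>\<^bsub>S\<^esub> ?q \<in> lspan S C (mon R ` Y)"
        using insert.prems(2,3)[of v] False \<open>?q \<in> lspan S C (mon R ` Y)\<close>
        by (intro lspan_step) auto
      ultimately show ?thesis by simp
    qed
  qed
  from this[of "{u. p u \<noteq> \<zero>}" p] show "p \<in> lspan S C (mon R ` Y)"
    using p by (auto simp: S_carrier)
qed

lemma S_span_mon: "carrier S = lspan S (carrier R) (mon R ` expo n)"
  unfolding lspan_mon[OF oneideal subset_refl] by (auto simp: S_carrier)

lemma S_mult: "(p \<otimes>\<^bsub>S\<^esub> q) w = (\<Oplus>v\<in>{v. v \<subseteq># w}. p v \<otimes> q (w - v))"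
  by (simp add: mpoly_alg_def)

lemma S_mult_nonzero:
  assumes "p \<in> carrier S" "q \<in> carrier S" "(p \<otimes>\<^bsub>S\<^esub> q) w \<noteq> \<zero>"
  shows "\<exists>v. v \<subseteq># w \<and> p v \<noteq> \<zero> \<and> q (w - v) \<noteq> \<zero>"
proof (rule ccontr)
  assume neg: "\<not> ?thesis"
  then have "(p \<otimes>\<^bsub>S\<^esub> q) w = (\<Oplus>v\<in>{v. v \<subseteq># w}. \<zero>)"
    unfolding S_mult
  proof (intro finsum_cong')
    fix v assume "v \<in> {v. v \<subseteq># w}"
    then have "p v = \<zero> \<or> q (w - v) = \<zero>" using neg by blast
    then show "p v \<otimes> q (w - v) = \<zero>" using S_coeff[OF assms(1)] S_coeff[OF assms(2)] by auto
  qed auto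
  then show False using assms(3) by simp
qed

lemma S_mult_closed:
  assumes "p \<in> carrier S" "q \<in> carrier S" shows "p \<otimes>\<^bsub>S\<^esub> q \<in> carrier S"
proof -
  let ?A = "{u. p u \<noteq> \<zero>}" and ?B = "{u. q u \<noteq> \<zero>}"
  have sub: "{w. (p \<otimes>\<^bsub>S\<^esub> q) w \<noteq> \<zero>} \<subseteq> (\<lambda>(u, v). u + v) ` (?A \<times> ?B)"
  proof
    fix w assume "w \<in> {w. (p \<otimes>\<^bsub>S\<^esub> q) w \<noteq> \<zero>}"
    then obtain v where "v \<subseteq># w" "p v \<noteq> \<zero>" "q (w - v) \<noteq> \<zero>"
      using S_mult_nonzero[OF assms] by blast
    then show "w \<in> (\<lambda>(u, v). u + v) ` (?A \<times> ?B)"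
      by (intro image_eqI[of _ _ "(v, w - v)"]) auto
  qed
  have "finite ((\<lambda>(u, v). u + v) ` (?A \<times> ?B))" using assms by (simp add: S_carrier)
  then have "finite {w. (p \<otimes>\<^bsub>S\<^esub> q) w \<noteq> \<zero>}" using sub by (rule finite_subset[rotated])
  moreover have "(p \<otimes>\<^bsub>S\<^esub> q) w \<in> carrier R" for w
    unfolding S_mult using S_coeff[OF assms(1)] S_coeff[OF assms(2)] by (intro finsum_closed) auto
  moreover have "w \<in> expo n" if "(p \<otimes>\<^bsub>S\<^esub> q) w \<noteq> \<zero>" for w
  proof -
    have "w \<in> (\<lambda>(u, v). u + v) ` (?A \<times> ?B)" using sub that by blast
    then show ?thesis using assms by (auto simp: S_carrier)
  qed
  ultimately show ?thesis by (simp add: S_carrier)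
qed

lemma S_comm:
  assumes "p \<in> carrier S" "q \<in> carrier S" shows "p \<otimes>\<^bsub>S\<^esub> q = q \<otimes>\<^bsub>S\<^esub> p"
proof
  fix w :: "nat multiset"
  let ?A = "{v. v \<subseteq># w}"
  have im: "(\<lambda>v. w - v) ` ?A = ?A"
  proof (intro equalityI subsetI)
    fix v assume "v \<in> ?A"
    then show "v \<in> (\<lambda>v. w - v) ` ?A"
      by (intro image_eqI[of _ _ "w - v"]) (auto simp: subset_mset.diff_diff_right)
  qed auto
  have inj: "inj_on (\<lambda>v. w - v) ?A"
    by (rule inj_on_inverseI[of _ "\<lambda>v. w - v"]) (simp add: subset_mset.diff_diff_right)
  have "(q \<otimes>\<^bsub>S\<^esub> p) w = (\<Oplus>v\<in>(\<lambda>v. w - v) ` ?A. q v \<otimes> p (w - v))"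
    unfolding im by (rule S_mult)
  also have "\<dots> = (\<Oplus>v\<in>?A. q (w - v) \<otimes> p (w - (w - v)))"
    using S_coeff[OF assms(1)] S_coeff[OF assms(2)] inj by (intro add.finprod_reindex) auto
  also have "\<dots> = (\<Oplus>v\<in>?A. p v \<otimes> q (w - v))"
    using S_coeff[OF assms(1)] S_coeff[OF assms(2)]
    by (intro finsum_cong') (auto simp: m_comm subset_mset.diff_diff_right)
  finally show "(p \<otimes>\<^bsub>S\<^esub> q) w = (q \<otimes>\<^bsub>S\<^esub> p) w" by (simp add: S_mult)
qed

lemma S_l_distr:
  assumes "p \<in> carrier S" "q \<in> carrier S" "r \<in> carrier S"
  shows "(p \<oplus>\<^bsub>S\<^esub> q) \<otimes>\<^bsub>S\<^esub> r = p \<otimes>\<^bsub>S\<^esub> r \<oplus>\<^bsub>S\<^esub> q \<otimes>\<^bsub>S\<^esub> r"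
proof
  fix w :: "nat multiset"
  let ?A = "{v. v \<subseteq># w}"
  have "((p \<oplus>\<^bsub>S\<^esub> q) \<otimes>\<^bsub>S\<^esub> r) w = (\<Oplus>v\<in>?A. p v \<otimes> r (w - v) \<oplus> q v \<otimes> r (w - v))"
    unfolding S_mult using assms S_coeff by (intro finsum_cong') (auto simp: S_ops l_distr)
  also have "\<dots> = (p \<otimes>\<^bsub>S\<^esub> r \<oplus>\<^bsub>S\<^esub> q \<otimes>\<^bsub>S\<^esub> r) w"
    using assms S_coeff by (simp add: S_ops S_mult finsum_addf Pi_iff)
  finally show "((p \<oplus>\<^bsub>S\<^esub> q) \<otimes>\<^bsub>S\<^esub> r) w = (p \<otimes>\<^bsub>S\<^esub> r \<oplus>\<^bsub>S\<^esub> q \<otimes>\<^bsub>S\<^esub> r) w" .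
qed

lemma S_smult_assoc2:
  assumes "c \<in> carrier R" "p \<in> carrier S" "q \<in> carrier S"
  shows "(c \<odot>\<^bsub>S\<^esub> p) \<otimes>\<^bsub>S\<^esub> q = c \<odot>\<^bsub>S\<^esub> (p \<otimes>\<^bsub>S\<^esub> q)"
proof
  fix w :: "nat multiset"
  let ?A = "{v. v \<subseteq># w}"
  have "((c \<odot>\<^bsub>S\<^esub> p) \<otimes>\<^bsub>S\<^esub> q) w = (\<Oplus>v\<in>?A. c \<otimes> (p v \<otimes> q (w - v)))"
    unfolding S_mult using assms S_coeff by (intro finsum_cong') (auto simp: S_ops m_assoc)
  also have "\<dots> = (c \<odot>\<^bsub>S\<^esub> (p \<otimes>\<^bsub>S\<^esub> q)) w"
    using assms S_coeff by (simp add: S_ops S_mult finsum_rdistr[OF finite_submultisets] Pi_iff)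
  finally show "((c \<odot>\<^bsub>S\<^esub> p) \<otimes>\<^bsub>S\<^esub> q) w = (c \<odot>\<^bsub>S\<^esub> (p \<otimes>\<^bsub>S\<^esub> q)) w" .
qed

lemma mon_mult:
  assumes "t \<in> expo n" "p \<in> carrier S" shows "mon R t \<otimes>\<^bsub>S\<^esub> p = shift t p"
proof
  fix w :: "nat multiset"
  let ?A = "{v. v \<subseteq># w}"
  have "(mon R t \<otimes>\<^bsub>S\<^esub> p) w = (\<Oplus>v\<in>?A. if t = v then p (w - v) else \<zero>)"
    unfolding S_mult using S_coeff[OF assms(2)] by (intro finsum_cong') (auto simp: mon_def)
  also have "\<dots> = shift t p w"
  proof (cases "t \<subseteq># w")
    case True
    then show ?thesis using S_coeff[OF assms(2)] finite_submultisets
      by (subst add.finprod_singleton) (auto simp: shift_def)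
  next
    case False
    then have "(\<Oplus>v\<in>?A. if t = v then p (w - v) else \<zero>) = (\<Oplus>v\<in>?A. \<zero>)"
      by (intro finsum_cong') auto
    then show ?thesis using False by (simp add: shift_def)
  qed
  finally show "(mon R t \<otimes>\<^bsub>S\<^esub> p) w = shift t p w" .
qed

lemma shift_closed: "t \<in> expo n \<Longrightarrow> p \<in> carrier S \<Longrightarrow> shift t p \<in> carrier S"
  using S_mult_closed[OF mon_closed] mon_mult by metis

lemma shift_add: "shift t (p \<oplus>\<^bsub>S\<^esub> q) = shift t p \<oplus>\<^bsub>S\<^esub> shift t q"
  by (auto simp: shift_def S_ops)

lemma shift_smult: "c \<in> carrier R \<Longrightarrow> shift t (c \<odot>\<^bsub>S\<^esub> p) = c \<odot>\<^bsub>S\<^esub> shift t p"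
  by (auto simp: shift_def S_ops)

lemma shift_zero [simp]: "shift t (\<zero>\<^bsub>S\<^esub>) = \<zero>\<^bsub>S\<^esub>"
  by (auto simp: shift_def S_ops)

lemma shift_minus: "t \<in> expo n \<Longrightarrow> p \<in> carrier S \<Longrightarrow> q \<in> carrier S \<Longrightarrow>
    shift t (p \<ominus>\<^bsub>S\<^esub> q) = shift t p \<ominus>\<^bsub>S\<^esub> shift t q"
  using shift_closed[of t p] shift_closed[of t q]
  by (subst (1 2) S_minus) (auto simp: shift_def minus_eq)

lemma shift_shift: "shift s (shift t p) = shift (s + t) p"
proof
  fix w
  show "shift s (shift t p) w = shift (s + t) p w"
    using add_subset_mset_iff[of s t w] by (auto simp: shift_def)
qed

lemma shift_empty [simp]: "shift {#} p = p"
  by (auto simp: shift_def)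

lemma shift_mon: "shift t (mon R u) = mon R (t + u)"
  by (rule ext) (auto simp: shift_def mon_def)

lemma shift_eval: "shift t p (t + v) = p v"
  by (simp add: shift_def)

lemma shift_nonzeroE:
  assumes "shift t p w \<noteq> \<zero>" obtains v where "w = t + v" "p v \<noteq> \<zero>" "shift t p w = p v"
  using assms that[of "w - t"] by (auto simp: shift_def split: if_splits)

text \<open>This is associativity with a monomial as first factor. Here and in
  \<open>S_assoc\<close>, p is expanded in monomials by linearity, which avoids manipulating double
  convolution sums.\<close>

lemma shift_mult:
  assumes t: "t \<in> expo n" and p: "p \<in> carrier S" and q: "q \<in> carrier S"
  shows "shift t p \<otimes>\<^bsub>S\<^esub> q = shift t (p \<otimes>\<^bsub>S\<^esub> q)"
proof -
  have "p \<in> lspan S (carrier R) (mon R ` expo n)" using p S_span_mon by blast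
  then have "p \<in> carrier S \<and> shift t p \<otimes>\<^bsub>S\<^esub> q = shift t (p \<otimes>\<^bsub>S\<^esub> q)"
  proof induction
    \<comment> \<open>The ring laws are still to be proved, so zero times q is obtained from scalar
      multiplication by zero.\<close>
    case lspan_zero
    have "\<zero>\<^bsub>S\<^esub> \<otimes>\<^bsub>S\<^esub> q = \<zero>\<^bsub>S\<^esub>"
      using S_smult_assoc2[OF zero_closed p q] p q S_mult_closed by simp
    then show ?case by simp
  next
    case (lspan_step c y x)
    then obtain v where v: "v \<in> expo n" "y = mon R v" by blast
    have y: "y \<in> carrier S" and x: "x \<in> carrier S" using v mon_closed lspan_step by auto
    have "shift t (c \<odot>\<^bsub>S\<^esub> y) \<otimes>\<^bsub>S\<^esub> q = shift t ((c \<odot>\<^bsub>S\<^esub> y) \<otimes>\<^bsub>S\<^esub> q)"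
      using lspan_step(1) v t q mon_closed
      by (simp add: shift_smult S_smult_assoc2 shift_mon mon_mult shift_shift)
    then show ?case using lspan_step(1,4) y x t q
      by (simp add: shift_add S_l_distr shift_closed)
  qed
  then show ?thesis by blast
qed

lemma S_assoc:
  assumes "p \<in> carrier S" "q \<in> carrier S" "r \<in> carrier S"
  shows "(p \<otimes>\<^bsub>S\<^esub> q) \<otimes>\<^bsub>S\<^esub> r = p \<otimes>\<^bsub>S\<^esub> (q \<otimes>\<^bsub>S\<^esub> r)"
proof -
  have z: "\<zero>\<^bsub>S\<^esub> \<otimes>\<^bsub>S\<^esub> q = \<zero>\<^bsub>S\<^esub>" if "q \<in> carrier S" for q
    using S_smult_assoc2[OF zero_closed assms(1) that] assms that S_mult_closed by simp
  have "p \<in> lspan S (carrier R) (mon R ` expo n)" using assms S_span_mon by blast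
  then have "p \<in> carrier S \<and> (p \<otimes>\<^bsub>S\<^esub> q) \<otimes>\<^bsub>S\<^esub> r = p \<otimes>\<^bsub>S\<^esub> (q \<otimes>\<^bsub>S\<^esub> r)"
  proof induction
    case lspan_zero
    then show ?case using z assms S_mult_closed by simp
  next
    case (lspan_step c y x)
    then obtain v where v: "v \<in> expo n" "y = mon R v" by blast
    have y: "y \<in> carrier S" and x: "x \<in> carrier S" using v mon_closed lspan_step by auto
    have "((c \<odot>\<^bsub>S\<^esub> y) \<otimes>\<^bsub>S\<^esub> q) \<otimes>\<^bsub>S\<^esub> r = (c \<odot>\<^bsub>S\<^esub> y) \<otimes>\<^bsub>S\<^esub> (q \<otimes>\<^bsub>S\<^esub> r)"
      using lspan_step(1) v assms y S_mult_closed
      by (simp add: S_smult_assoc2 mon_mult shift_closed shift_mult)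
    then show ?case using lspan_step(1,4) y x assms
      by (simp add: S_l_distr S_mult_closed)
  qed
  then show ?thesis by blast
qed

lemma S_cring: "cring S"
proof (rule cringI[OF S_abelian_group])
  show "comm_monoid S"
  proof (rule comm_monoidI)
    fix x assume "x \<in> carrier S"
    then show "\<one>\<^bsub>S\<^esub> \<otimes>\<^bsub>S\<^esub> x = x" by (simp add: S_ops mon_mult)
  next
    show "x \<otimes>\<^bsub>S\<^esub> y = y \<otimes>\<^bsub>S\<^esub> x" if "x \<in> carrier S" "y \<in> carrier S" for x y
      using that by (rule S_comm)
  qed (simp_all add: S_mult_closed S_assoc S_ops mon_closed)
qed (rule S_l_distr)

end

section \<open>Graded pieces and homogeneous components\<close>

locale graded_poly = poly R n for R (structure) and n +
  fixes dg :: "nat multiset \<Rightarrow> 'g::ab_group_add"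
  assumes dg_add: "u \<in> expo n \<Longrightarrow> v \<in> expo n \<Longrightarrow> dg (u + v) = dg u + dg v"
begin

abbreviation "P \<equiv> graded_part R n dg"
abbreviation "Xc E \<equiv> carrier (P E)"

lemma Xc_iff: "p \<in> Xc E \<longleftrightarrow> p \<in> carrier S \<and> (\<forall>u. p u \<noteq> \<zero> \<longrightarrow> dg u \<in> E)"
  by (simp add: graded_part_def)

lemma Xc_sub: "Xc E \<subseteq> carrier S"
  by (auto simp: Xc_iff)

lemma P_ops: "\<zero>\<^bsub>P E\<^esub> = \<zero>\<^bsub>S\<^esub>" "(\<oplus>\<^bsub>P E\<^esub>) = (\<oplus>\<^bsub>S\<^esub>)" "(\<odot>\<^bsub>P E\<^esub>) = (\<odot>\<^bsub>S\<^esub>)"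
  by (simp_all add: graded_part_def)

lemma submodule_Xc: "submodule (Xc E) R S"
proof (rule M.submoduleI[OF Xc_sub])
  show "\<zero>\<^bsub>S\<^esub> \<in> Xc E" by (simp add: Xc_iff S_ops S_zero_closed)
next
  fix a assume "a \<in> Xc E"
  then show "\<ominus>\<^bsub>S\<^esub> a \<in> Xc E" by (auto simp: Xc_iff S_uminus S_neg_closed) (metis minus_zero)
next
  fix a b assume "a \<in> Xc E" "b \<in> Xc E"
  then show "a \<oplus>\<^bsub>S\<^esub> b \<in> Xc E"
    by (auto simp: Xc_iff S_ops S_add_closed) (metis add.l_cancel_one l_zero zero_closed)
next
  fix r a assume "r \<in> carrier R" "a \<in> Xc E"
  then show "r \<odot>\<^bsub>S\<^esub> a \<in> Xc E" by (auto simp: Xc_iff S_ops S_smult_closed) (metis r_null)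
qed

lemma P_module: "module R (P E)"
proof -
  have "P E = S\<lparr>carrier := Xc E\<rparr>" by (simp add: graded_part_def)
  then show ?thesis using submodule.submodule_is_module[OF submodule_Xc S_module] by metis
qed

lemma P_uminus: "p \<in> Xc E \<Longrightarrow> \<ominus>\<^bsub>P E\<^esub> p = \<ominus>\<^bsub>S\<^esub> p"
proof -
  interpret P: module R "P E" by (rule P_module)
  assume p: "p \<in> Xc E"
  then have "\<ominus>\<^bsub>S\<^esub> p \<in> Xc E" using M.submoduleE(3)[OF submodule_Xc] by blast
  then show ?thesis
    using p subsetD[OF Xc_sub p] by (intro P.M.minus_equality) (auto simp: P_ops M.M.l_neg)
qed

lemma submodule_P_iff: "submodule N R (P E) \<longleftrightarrow> submodule N R S \<and> N \<subseteq> Xc E"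
proof -
  interpret P: module R "P E" by (rule P_module)
  show ?thesis
  proof
    assume N: "submodule N R (P E)"
    have Nc: "N \<subseteq> Xc E" using P.submoduleE(1)[OF N] .
    have "submodule N R S"
    proof (rule M.submoduleI)
      show "N \<subseteq> carrier S" using Nc Xc_sub by blast
      show "\<zero>\<^bsub>S\<^esub> \<in> N" using P.submodule_zero[OF N] by (simp add: P_ops)
      show "\<ominus>\<^bsub>S\<^esub> a \<in> N" if "a \<in> N" for a
        using P.submoduleE(3)[OF N that] P_uminus[of a E] Nc that by auto
      show "a \<oplus>\<^bsub>S\<^esub> b \<in> N" if "a \<in> N" "b \<in> N" for a b
        using P.submoduleE(5)[OF N that] by (simp add: P_ops)
      show "r \<odot>\<^bsub>S\<^esub> b \<in> N" if "r \<in> carrier R" "b \<in> N" for r b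
        using P.submoduleE(4)[OF N that] by (simp add: P_ops)
    qed
    then show "submodule N R S \<and> N \<subseteq> Xc E" using Nc by blast
  next
    assume N: "submodule N R S \<and> N \<subseteq> Xc E"
    then have NS: "submodule N R S" and Nc: "N \<subseteq> Xc E" by auto
    show "submodule N R (P E)"
    proof (rule P.submoduleI[OF Nc])
      show "\<zero>\<^bsub>P E\<^esub> \<in> N" using M.submodule_zero[OF NS] by (simp add: P_ops)
      show "\<ominus>\<^bsub>P E\<^esub> a \<in> N" if "a \<in> N" for a
        using M.submoduleE(3)[OF NS that] P_uminus[of a E] Nc that by auto
      show "a \<oplus>\<^bsub>P E\<^esub> b \<in> N" if "a \<in> N" "b \<in> N" for a b
        using M.submoduleE(5)[OF NS that] by (simp add: P_ops)
      show "r \<odot>\<^bsub>P E\<^esub> b \<in> N" if "r \<in> carrier R" "b \<in> N" for r b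
        using M.submoduleE(4)[OF NS that] by (simp add: P_ops)
    qed
  qed
qed

lemma P_minus: "p \<in> Xc E \<Longrightarrow> q \<in> Xc E \<Longrightarrow> p \<ominus>\<^bsub>P E\<^esub> q = p \<ominus>\<^bsub>S\<^esub> q"
  by (simp add: a_minus_def P_uminus P_ops)

lemma dg_diff: "t \<in> expo n \<Longrightarrow> v \<subseteq># t \<Longrightarrow> dg (t - v) = dg t - dg v"
  using dg_add[of "t - v" v] expo_diff[of t n v] expo_mono[of t n v] by simp

lemma shift_Xc:
  assumes "t \<in> expo n" "p \<in> Xc {b}" "dg t + b = a" shows "shift t p \<in> Xc {a}"
proof -
  have "dg w \<in> {a}" if w: "shift t p w \<noteq> \<zero>" for w
  proof -
    obtain v where v: "w = t + v" "p v \<noteq> \<zero>" using w by (rule shift_nonzeroE)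
    then have "v \<in> expo n" "dg v = b" using assms(2) by (auto simp: Xc_iff S_carrier)
    then show ?thesis using v assms by (simp add: dg_add)
  qed
  then show ?thesis using assms shift_closed by (auto simp: Xc_iff)
qed

definition deg :: "'g \<Rightarrow> nat multiset set" where
  "deg a = {u \<in> expo n. dg u = a}"

lemma deg_expo: "u \<in> deg a \<Longrightarrow> u \<in> expo n" by (simp add: deg_def)

lemma deg_sub: "Y \<subseteq> deg a \<Longrightarrow> Y \<subseteq> expo n" using deg_expo by blast

lemma deg_add: "u \<in> deg a \<Longrightarrow> v \<in> deg b \<Longrightarrow> u + v \<in> deg (a + b)"
  by (simp add: deg_def dg_add)

text \<open>For an ideal C and a set Y of exponents this is the C-span of the monomials with
  exponents in Y (\<open>supp_in_lspan\<close>). The pointwise form makes restriction to a set of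
  monomials immediate.\<close>

definition supp_in :: "'a set \<Rightarrow> nat multiset set \<Rightarrow> (nat multiset \<Rightarrow> 'a) set" where
  "supp_in C Y = {p \<in> carrier S. \<forall>u. p u \<in> C \<and> (p u \<noteq> \<zero> \<longrightarrow> u \<in> Y)}"

lemma supp_in_lspan: "ideal C R \<Longrightarrow> Y \<subseteq> expo n \<Longrightarrow> supp_in C Y = lspan S C (mon R ` Y)"
  by (simp add: lspan_mon supp_in_def)

lemma mon_sub: "Y \<subseteq> expo n \<Longrightarrow> mon R ` Y \<subseteq> carrier S"
  using mon_closed by blast

lemma supp_in_submodule: "ideal C R \<Longrightarrow> Y \<subseteq> expo n \<Longrightarrow> submodule (supp_in C Y) R S"
  by (simp add: supp_in_lspan M.lspan_submodule mon_sub)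

lemma supp_in_mono: "C \<subseteq> C' \<Longrightarrow> Y \<subseteq> Y' \<Longrightarrow> supp_in C Y \<subseteq> supp_in C' Y'"
  by (auto simp: supp_in_def)

lemma supp_in_Xc: "Y \<subseteq> deg a \<Longrightarrow> supp_in C Y \<subseteq> Xc {a}"
  by (rule subsetI) (auto simp: supp_in_def Xc_iff deg_def)

lemma Xc_supp: "Xc {a} = supp_in (carrier R) (deg a)"
  by (auto simp: supp_in_def Xc_iff deg_def S_carrier)

lemma supp_in_sub: "supp_in C Y \<subseteq> carrier S"
  by (auto simp: supp_in_def)

lemma mon_supp_in: "u \<in> Y \<Longrightarrow> Y \<subseteq> expo n \<Longrightarrow> mon R u \<in> supp_in (carrier R) Y"
  using mon_closed[of u] by (auto simp: supp_in_def mon_def)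

lemma cmon_supp_in: "ideal C R \<Longrightarrow> c \<in> C \<Longrightarrow> u \<in> Y \<Longrightarrow> Y \<subseteq> expo n \<Longrightarrow> c \<odot>\<^bsub>S\<^esub> mon R u \<in> supp_in C Y"
  using M.lspan_base[OF ideal_subset mon_sub] by (simp add: supp_in_lspan)

lemma shift_supp_in:
  assumes "t \<in> expo n" "\<zero> \<in> C" "p \<in> supp_in C Y" "\<And>v. v \<in> Y \<Longrightarrow> t + v \<in> Y'"
  shows "shift t p \<in> supp_in C Y'"
proof -
  have "shift t p w \<in> C \<and> (shift t p w \<noteq> \<zero> \<longrightarrow> w \<in> Y')" for w
    using assms by (cases "shift t p w = \<zero>") (auto simp: supp_in_def elim: shift_nonzeroE)
  then show ?thesis using assms shift_closed by (auto simp: supp_in_def)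
qed

lemma component_closed:
  assumes "p \<in> carrier S" shows "component R dg a p \<in> Xc {a}"
proof -
  have "component R dg a p \<in> carrier S"
    unfolding component_def using S_coeff[OF assms]
    by (intro S_map_closed[OF assms, of "\<lambda>u x. if dg u = a then x else \<zero>"]) auto
  then show ?thesis by (auto simp: Xc_iff component_def)
qed

lemma component_self: "p \<in> Xc {a} \<Longrightarrow> component R dg a p = p"
  by (rule ext) (auto simp: Xc_iff component_def, metis)

lemma component_other: "p \<in> Xc {b} \<Longrightarrow> a \<noteq> b \<Longrightarrow> component R dg a p = \<zero>\<^bsub>S\<^esub>"
  by (rule ext) (auto simp: Xc_iff component_def S_ops)

lemma component_add: "component R dg a (p \<oplus>\<^bsub>S\<^esub> q) = component R dg a p \<oplus>\<^bsub>S\<^esub> component R dg a q"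
  by (auto simp: component_def S_ops)

lemma component_smult: "c \<in> carrier R \<Longrightarrow> component R dg a (c \<odot>\<^bsub>S\<^esub> q) = c \<odot>\<^bsub>S\<^esub> component R dg a q"
  by (auto simp: component_def S_ops)

lemma component_zero [simp]: "component R dg a \<zero>\<^bsub>S\<^esub> = \<zero>\<^bsub>S\<^esub>"
  by (auto simp: component_def S_ops)

lemma component_component: "component R dg a (component R dg b p) =
    (if a = b then component R dg a p else \<zero>\<^bsub>S\<^esub>)"
  by (auto simp: component_def S_ops)

lemma component_shift:
  assumes "t \<in> expo n" "p \<in> carrier S"
  shows "component R dg a (shift t p) = shift t (component R dg (a - dg t) p)"
proof
  fix w
  show "component R dg a (shift t p) w = shift t (component R dg (a - dg t) p) w"
  proof (cases "t \<subseteq># w \<and> p (w - t) \<noteq> \<zero>")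
    case True
    then have "w - t \<in> expo n" using assms by (auto simp: S_carrier)
    then have "dg w = dg t + dg (w - t)" using dg_add[OF assms(1), of "w - t"] True by simp
    then show ?thesis using True by (auto simp: component_def shift_def)
  qed (auto simp: component_def shift_def)
qed

text \<open>Only finitely many degrees occur in p. Induction over a finite set containing them peels
  off one component at a time, so no sum over the whole group is needed.\<close>

lemma sum_components:
  assumes "submodule N R S" "p \<in> carrier S" "\<And>a. component R dg a p \<in> N" shows "p \<in> N"
proof -
  have "finite A \<Longrightarrow> p \<in> carrier S \<Longrightarrow> (\<And>a. component R dg a p \<in> N) \<Longrightarrow>
      dg ` {u. p u \<noteq> \<zero>} \<subseteq> A \<Longrightarrow> p \<in> N" for A p
  proof (induction A arbitrary: p rule: finite_induct)
    case empty
    then have "p = \<zero>\<^bsub>S\<^esub>" by (auto simp: S_ops)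
    then show ?case using M.submodule_zero[OF assms(1)] by simp
  next
    case (insert a A)
    have ca: "component R dg a p \<in> carrier S" using component_closed[OF insert.prems(1)] Xc_sub by blast
    let ?q = "\<lambda>u. if dg u = a then \<zero> else p u"
    have q: "?q \<in> carrier S"
      using S_map_closed[OF insert.prems(1), of "\<lambda>u x. if dg u = a then \<zero> else x"] insert.prems(1) S_coeff
      by auto
    have dec: "p = component R dg a p \<oplus>\<^bsub>S\<^esub> ?q"
      using S_coeff[OF insert.prems(1)] by (auto simp: S_ops component_def)
    have "component R dg b ?q = (if b = a then \<zero>\<^bsub>S\<^esub> else component R dg b p)" for b
      by (auto simp: component_def S_ops)
    then have "component R dg b ?q \<in> N" for b
      using insert.prems(2) M.submodule_zero[OF assms(1)] by auto
    moreover have "dg ` {u. ?q u \<noteq> \<zero>} \<subseteq> A" using insert.prems(3) by auto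
    ultimately have "?q \<in> N" using insert.IH[OF q] by blast
    then show ?case using dec insert.prems(2) M.submoduleE(5)[OF assms(1)] by metis
  qed
  from this[of "dg ` {u. p u \<noteq> \<zero>}" p] show ?thesis using assms by (auto simp: S_carrier)
qed

lemma restrict_iff: "p \<in> restrict_degrees R n dg E N \<longleftrightarrow> p \<in> N \<and> p \<in> Xc E"
  by (simp add: restrict_degrees_def)

end

section \<open>Dickson's lemma\<close>

text \<open>Induction on the number of variables. Finitely many elements of A have projections, with
  the last variable dropped, that lie below all projections. They take care of every element whose
  last exponent is at least their maximum K; the remaining elements lie in finitely many slices of
  constant last exponent, each handled by the induction hypothesis.\<close>

lemma dickson:
  assumes "A \<subseteq> expo n"
  shows "\<exists>E. finite E \<and> E \<subseteq> A \<and> (\<forall>u\<in>A. \<exists>e\<in>E. e \<subseteq># u)"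
  using assms
proof (induction n arbitrary: A)
  case 0
  then have "A \<subseteq> {{#}}" by (auto simp: expo_def)
  then show ?case using finite_subset[of A "{{#}}"] by (intro exI[of _ A]) auto
next
  case (Suc n)
  define \<pi> where "\<pi> u = filter_mset (\<lambda>i. i \<noteq> n) u" for u :: "nat multiset"
  have \<pi>_le: "u \<subseteq># v \<longleftrightarrow> \<pi> u \<subseteq># \<pi> v \<and> count u n \<le> count v n" for u v
    unfolding \<pi>_def subseteq_mset_def by auto
  have \<pi>_expo: "\<pi> ` A \<subseteq> expo n"
    using Suc.prems by (fastforce simp: expo_def \<pi>_def less_Suc_eq)
  obtain E0 where E0: "finite E0" "E0 \<subseteq> \<pi> ` A" "\<forall>u\<in>\<pi> ` A. \<exists>e\<in>E0. e \<subseteq># u"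
    using Suc.IH[OF \<pi>_expo] by blast
  then obtain F where F: "finite F" "F \<subseteq> A" "E0 = \<pi> ` F" by (meson finite_subset_image)
  define K where "K = Max (insert 0 ((\<lambda>u. count u n) ` F))"
  have K: "count u n \<le> K" if "u \<in> F" for u unfolding K_def using F(1) that by (intro Max_ge) auto
  have "\<exists>E. finite E \<and> E \<subseteq> A \<and> (\<forall>u\<in>A. count u n = k \<longrightarrow> (\<exists>e\<in>E. e \<subseteq># u))" for k
  proof -
    let ?A = "{u \<in> A. count u n = k}"
    have A': "\<pi> ` ?A \<subseteq> expo n" using \<pi>_expo by blast
    obtain E1 where E1: "finite E1" "E1 \<subseteq> \<pi> ` ?A" "\<forall>u\<in>\<pi> ` ?A. \<exists>e\<in>E1. e \<subseteq># u"
      using Suc.IH[OF A'] by blast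
    then obtain F1 where F1: "finite F1" "F1 \<subseteq> ?A" "E1 = \<pi> ` F1" by (meson finite_subset_image)
    have "\<exists>e\<in>F1. e \<subseteq># u" if u: "u \<in> A" and k: "count u n = k" for u
    proof -
      have "\<pi> u \<in> \<pi> ` ?A" using u k by blast
      then obtain e where "e \<in> F1" "\<pi> e \<subseteq># \<pi> u" using bspec[OF E1(3), of "\<pi> u"] F1(3) by blast
      moreover have "count e n \<le> count u n" using \<open>e \<in> F1\<close> F1(2) k by auto
      ultimately show ?thesis using \<pi>_le[of e u] by blast
    qed
    then show ?thesis using F1 by blast
  qed
  then obtain G where G: "\<And>k. finite (G k)" "\<And>k. G k \<subseteq> A"
    "\<And>k u. u \<in> A \<Longrightarrow> count u n = k \<Longrightarrow> \<exists>e\<in>G k. e \<subseteq># u" by metis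
  let ?E = "F \<union> (\<Union>k\<le>K. G k)"
  have "\<exists>e\<in>?E. e \<subseteq># u" if u: "u \<in> A" for u
  proof (cases "count u n \<le> K")
    case True
    then show ?thesis using G(3)[OF u refl] by blast
  next
    case False
    obtain e where "e \<in> F" "\<pi> e \<subseteq># \<pi> u" using bspec[OF E0(3), of "\<pi> u"] F(3) u by blast
    then have "e \<subseteq># u" using \<pi>_le[of e u] K[of e] False by simp
    then show ?thesis using \<open>e \<in> F\<close> by blast
  qed
  moreover have "finite ?E" "?E \<subseteq> A" using F G by auto
  ultimately show ?case by blast
qed

section \<open>Monomial ideals\<close>

lemma (in module) submoduleI2:
  assumes "H \<subseteq> carrier M" "\<zero>\<^bsub>M\<^esub> \<in> H" "\<And>a b. a \<in> H \<Longrightarrow> b \<in> H \<Longrightarrow> a \<oplus>\<^bsub>M\<^esub> b \<in> H"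
    "\<And>a x. a \<in> carrier R \<Longrightarrow> x \<in> H \<Longrightarrow> a \<odot>\<^bsub>M\<^esub> x \<in> H"
  shows "submodule H R M"
proof (rule submoduleI)
  fix a assume a: "a \<in> H"
  have "(\<ominus> \<one>) \<odot>\<^bsub>M\<^esub> a = \<ominus>\<^bsub>M\<^esub> a" using a assms(1) by (simp add: smult_l_minus subset_iff)
  then show "\<ominus>\<^bsub>M\<^esub> a \<in> H" using assms(4)[OF _ a, of "\<ominus> \<one>"] by simp
qed (use assms in auto)

lemma (in cring) free_module_module: "module R (free_module R G)"
proof (rule moduleI)
  show "abelian_group (free_module R G)"
  proof (rule abelian_groupI)
    fix s assume s: "s \<in> carrier (free_module R G)"
    then show "\<exists>t\<in>carrier (free_module R G). t \<oplus>\<^bsub>free_module R G\<^esub> s = \<zero>\<^bsub>free_module R G\<^esub>"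
      by (intro bexI[of _ "\<lambda>g\<in>G. \<ominus> s g"])
        (auto simp: free_module_def PiE_def Pi_iff l_neg intro!: restrict_ext)
  qed (auto simp: free_module_def PiE_mem a_ac intro!: restrict_ext,
       auto simp: PiE_def extensional_def fun_eq_iff Pi_iff a_ac)
qed (auto simp: is_cring free_module_def PiE_mem l_distr r_distr m_assoc intro!: restrict_ext,
     auto simp: PiE_def extensional_def fun_eq_iff Pi_iff l_distr r_distr m_assoc)

context poly
begin

lemma shift_closed_ideal:
  assumes J: "submodule J R S" and sh: "\<And>t p. t \<in> expo n \<Longrightarrow> p \<in> J \<Longrightarrow> shift t p \<in> J"
  shows "ideal J S"
proof -
  interpret S: cring S by (rule S_cring)
  have Jc: "J \<subseteq> carrier S" using M.submoduleE(1)[OF J] .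
  have l: "q \<otimes>\<^bsub>S\<^esub> p \<in> J" if q: "q \<in> carrier S" and p: "p \<in> J" for p q
  proof -
    have pc: "p \<in> carrier S" using p Jc by blast
    have "q \<in> lspan S (carrier R) (mon R ` expo n)" using q S_span_mon by blast
    then have "q \<in> carrier S \<and> q \<otimes>\<^bsub>S\<^esub> p \<in> J"
    proof induction
      case lspan_zero
      then show ?case using M.submodule_zero[OF J] pc by simp
    next
      case (lspan_step c y x)
      then obtain v where v: "v \<in> expo n" "y = mon R v" by blast
      have y: "y \<in> carrier S" and x: "x \<in> carrier S" using v mon_closed lspan_step by auto
      have "(c \<odot>\<^bsub>S\<^esub> y \<oplus>\<^bsub>S\<^esub> x) \<otimes>\<^bsub>S\<^esub> p = c \<odot>\<^bsub>S\<^esub> shift v p \<oplus>\<^bsub>S\<^esub> x \<otimes>\<^bsub>S\<^esub> p"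
        using lspan_step(1) v x y pc by (simp add: S_l_distr S_smult_assoc2 mon_mult)
      then show ?case using lspan_step(1,4) y x sh[OF v(1) p] M.submoduleE(4,5)[OF J] by simp
    qed
    then show ?thesis by blast
  qed
  show ?thesis
  proof (rule idealI)
    show "ring S" ..
    show "subgroup J (add_monoid S)" using J by (rule submodule.axioms(1))
    show "x \<otimes>\<^bsub>S\<^esub> a \<in> J" if "a \<in> J" "x \<in> carrier S" for a x using l that by blast
    show "a \<otimes>\<^bsub>S\<^esub> x \<in> J" if "a \<in> J" "x \<in> carrier S" for a x
      using l[OF that(2,1)] S.m_comm that Jc by auto
  qed
qed

lemma ideal_shift:
  assumes "ideal J S" "t \<in> expo n" "p \<in> J" shows "shift t p \<in> J"
  using ideal.I_l_closed[OF assms(1,3) mon_closed[OF assms(2)]] mon_mult[OF assms(2)]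
    ideal.Icarr[OF assms(1,3)] by simp

lemma ideal_submodule:
  assumes J: "ideal J S" shows "submodule J R S"
proof (rule submodule.intro)
  show "subgroup J (add_monoid S)"
    using J additive_subgroup.a_subgroup ideal.axioms(1) by blast
  show "submodule_axioms J R S"
  proof
    fix a x assume a: "a \<in> carrier R" and x: "x \<in> J"
    have xc: "x \<in> carrier S" using ideal.Icarr[OF J x] .
    have "(a \<odot>\<^bsub>S\<^esub> mon R {#}) \<otimes>\<^bsub>S\<^esub> x = a \<odot>\<^bsub>S\<^esub> x"
      using a xc mon_closed by (simp add: S_smult_assoc2 mon_mult)
    then show "a \<odot>\<^bsub>S\<^esub> x \<in> J"
      using ideal.I_l_closed[OF J x, of "a \<odot>\<^bsub>S\<^esub> mon R {#}"] a mon_closed by simp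
  qed
qed

text \<open>The span of all monomials divisible by some member of U is already an ideal, which gives
  the nontrivial direction. Over every nonzero ring the criterion is the same, so the conditions on
  monomial ideals over k become conditions on exponents.\<close>

lemma mon_in_ideal_iff:
  assumes "\<one> \<noteq> \<zero>" "U \<subseteq> expo n" "w \<in> expo n"
  shows "mon R w \<in> Idl\<^bsub>S\<^esub> (mon R ` U) \<longleftrightarrow> (\<exists>u\<in>U. u \<subseteq># w)"
proof
  interpret S: cring S by (rule S_cring)
  have mU: "mon R ` U \<subseteq> carrier S" using assms mon_closed by blast
  {
    assume "\<exists>u\<in>U. u \<subseteq># w"
    then obtain u where u: "u \<in> U" "u \<subseteq># w" by blast
    have I: "ideal (Idl\<^bsub>S\<^esub> (mon R ` U)) S" using S.genideal_ideal[OF mU] .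
    have "mon R u \<in> Idl\<^bsub>S\<^esub> (mon R ` U)" using S.genideal_self[OF mU] u by blast
    then have "shift (w - u) (mon R u) \<in> Idl\<^bsub>S\<^esub> (mon R ` U)"
      using ideal_shift[OF I expo_diff[OF assms(3)]] by blast
    then show "mon R w \<in> Idl\<^bsub>S\<^esub> (mon R ` U)" using u(2) by (simp add: shift_mon)
  }
  let ?Y = "{w \<in> expo n. \<exists>u\<in>U. u \<subseteq># w}"
  let ?J = "lspan S (carrier R) (mon R ` ?Y)"
  have Ysub: "?Y \<subseteq> expo n" by blast
  have mY: "mon R ` ?Y \<subseteq> carrier S" using mon_closed by blast
  have "ideal ?J S"
  proof (rule shift_closed_ideal[OF M.span_submodule[OF mY]])
    fix t p assume t: "t \<in> expo n" and "p \<in> ?J"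
    then have p: "p \<in> carrier S" "\<And>u. p u \<noteq> \<zero> \<Longrightarrow> u \<in> ?Y"
      unfolding lspan_mon[OF oneideal Ysub] by auto
    have "w \<in> ?Y" if w: "shift t p w \<noteq> \<zero>" for w
    proof -
      obtain v where v: "w = t + v" "p v \<noteq> \<zero>" using w by (rule shift_nonzeroE)
      then obtain u where u: "u \<in> U" "u \<subseteq># v" "v \<in> expo n" using p(2) by blast
      then have "u \<subseteq># t + v" using subset_mset.order_trans[OF u(2) mset_subset_eq_add_right] by blast
      then show ?thesis using v t u by auto
    qed
    then show "shift t p \<in> ?J"
      unfolding lspan_mon[OF oneideal Ysub] using shift_closed[OF t p(1)] S_coeff by auto
  qed
  moreover have "mon R ` U \<subseteq> ?J"
  proof
    fix x assume "x \<in> mon R ` U"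
    then have "x \<in> mon R ` ?Y" using assms(2) by auto
    then show "x \<in> ?J" using M.lspan_base1[OF mY] by blast
  qed
  ultimately have sub: "Idl\<^bsub>S\<^esub> (mon R ` U) \<subseteq> ?J" by (rule S.genideal_minimal)
  assume "mon R w \<in> Idl\<^bsub>S\<^esub> (mon R ` U)"
  then have "mon R w \<in> ?J" using sub by blast
  then have "mon R w w \<noteq> \<zero> \<longrightarrow> w \<in> ?Y" unfolding lspan_mon[OF oneideal Ysub] by blast
  then show "\<exists>u\<in>U. u \<subseteq># w" using assms(1) by (simp add: mon_def)
qed

end

text \<open>Standard exponents are defined by divisibility alone, without a coefficient ring, so
  that information over k can be used for leading exponents over R modulo \<mm>.\<close>

definition std_mons :: "nat \<Rightarrow> (nat multiset \<Rightarrow> 'a) \<Rightarrow> nat multiset set \<Rightarrow> 'a \<Rightarrow> nat multiset set" where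
  "std_mons n dg U a = {w \<in> expo n. dg w = a \<and> \<not> (\<exists>u\<in>U. u \<subseteq># w)}"

definition min_mons :: "nat \<Rightarrow> nat multiset set \<Rightarrow> nat multiset set" where
  "min_mons n U = {u \<in> expo n. (\<exists>v\<in>U. v \<subseteq># u) \<and> (\<forall>v. v \<subset># u \<longrightarrow> \<not> (\<exists>u'\<in>U. u' \<subseteq># v))}"

text \<open>For each w this is a graph on the minimal generators dividing x^w. Condition (s) makes
  any two of them connected in it; in this form the condition no longer mentions
  coefficients.\<close>

definition lcm_edges ::
    "nat \<Rightarrow> (nat multiset \<Rightarrow> 'a) \<Rightarrow> 'a set \<Rightarrow> nat multiset set \<Rightarrow> nat multiset
      \<Rightarrow> (nat multiset \<times> nat multiset) set" where
  "lcm_edges n dg D U w = {(u, v). u \<in> min_mons n U \<and> v \<in> min_mons n U \<and>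
     u \<subseteq># w \<and> v \<subseteq># w \<and> dg (u \<union># v) \<in> D}"

lemma min_mons_sub: "min_mons n U \<subseteq> U"
proof
  fix u assume "u \<in> min_mons n U"
  then obtain v where v: "v \<in> U" "v \<subseteq># u" "v \<subset># u \<longrightarrow> \<not> (\<exists>u'\<in>U. u' \<subseteq># v)"
    unfolding min_mons_def by blast
  then have "v = u" by (metis subset_mset.le_neq_trans subset_mset.order_refl)
  then show "u \<in> U" using v by simp
qed

lemma min_mons_below:
  assumes "U \<subseteq> expo n" "u \<in> U" "u \<subseteq># w" shows "\<exists>g\<in>min_mons n U. g \<subseteq># w"
  using assms(2,3)
proof (induction "size u" arbitrary: u rule: less_induct)
  case less
  show ?case
  proof (cases "u \<in> min_mons n U")
    case False
    then obtain v u' where "v \<subset># u" "u' \<in> U" "u' \<subseteq># v"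
      using less.prems assms(1) unfolding min_mons_def by blast
    then have "u' \<subset># u" by (metis subset_mset.le_less_trans)
    then show ?thesis using less.hyps[of u'] \<open>u' \<in> U\<close> less.prems(2) mset_subset_size[of u' u]
      by (meson subset_mset.less_imp_le subset_mset.order_trans)
  qed (use less.prems in blast)
qed

lemma min_mons_finite:
  assumes "U \<subseteq> expo n" shows "finite (min_mons n U)"
proof -
  have sub: "min_mons n U \<subseteq> expo n" by (auto simp: min_mons_def)
  obtain E where E: "finite E" "E \<subseteq> min_mons n U" "\<forall>u\<in>min_mons n U. \<exists>e\<in>E. e \<subseteq># u"
    using dickson[OF sub] by (elim exE conjE)
  have "min_mons n U \<subseteq> E"
  proof
    fix u assume u: "u \<in> min_mons n U"
    then obtain e where e: "e \<in> E" "e \<subseteq># u" using bspec[OF E(3) u] by blast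
    then have "e \<in> U" using E min_mons_sub by blast
    then have "\<not> e \<subset># u" using u by (auto simp: min_mons_def)
    then show "u \<in> E" using e by (metis subset_mset.le_neq_trans)
  qed
  then show ?thesis using E finite_subset by blast
qed

context poly
begin

text \<open>Condition (h) in terms of exponents. The first conclusion keeps the ideal-theoretic form
  because condition (s) asks for it as a premise.\<close>

lemma very_supportive_hilb_fun:
  assumes ne: "\<one> \<noteq> \<zero>" and vs: "very_supportive R n dg h D"
    and U: "U \<subseteq> {u \<in> expo n. dg u \<in> D}"
    and hD: "\<And>a. a \<in> D \<Longrightarrow> finite (std_mons n dg U a) \<and> card (std_mons n dg U a) = h a"
  shows "hilb_fun_eq R n dg h (Idl\<^bsub>S\<^esub> (mon R ` U)) a"
    "finite (std_mons n dg U a) \<and> card (std_mons n dg U a) = h a"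
proof -
  have Ue: "U \<subseteq> expo n" using U by blast
  have eq: "hilb_fun_eq R n dg h (Idl\<^bsub>S\<^esub> (mon R ` U)) a \<longleftrightarrow>
    finite (std_mons n dg U a) \<and> card (std_mons n dg U a) = h a" for a
  proof -
    have "{u \<in> expo n. dg u = a \<and> mon R u \<notin> Idl\<^bsub>S\<^esub> (mon R ` U)} = std_mons n dg U a"
      unfolding std_mons_def using mon_in_ideal_iff[OF ne Ue] by blast
    then show ?thesis by (simp add: hilb_fun_eq_def Let_def)
  qed
  have "monomial_generated_in R n dg D (Idl\<^bsub>S\<^esub> (mon R ` U))"
    unfolding monomial_generated_in_def using U by blast
  then show 1: "hilb_fun_eq R n dg h (Idl\<^bsub>S\<^esub> (mon R ` U)) a"
    using vs hD eq unfolding very_supportive_def by blast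
  show "finite (std_mons n dg U a) \<and> card (std_mons n dg U a) = h a" using 1 eq by blast
qed

lemma min_gens_eq:
  assumes ne: "\<one> \<noteq> \<zero>" and U: "U \<subseteq> expo n"
  shows "min_gens R n (Idl\<^bsub>S\<^esub> (mon R ` U)) = min_mons n U"
proof -
  have "v \<in> expo n" if "v \<subset># u" "u \<in> expo n" for u v
    using that expo_mono subset_mset.less_imp_le by blast
  then show ?thesis
    unfolding min_gens_def min_mons_def using mon_in_ideal_iff[OF ne U] by blast
qed

lemma pair_syzygy_eq:
  assumes "g \<in> G" "u \<in> expo n" "v \<in> expo n"
  shows "pair_syzygy R n G u v g = (if g = u then mon R (u \<union># v - u) else \<zero>\<^bsub>S\<^esub>)
    \<oplus>\<^bsub>S\<^esub> (if g = v then \<ominus>\<^bsub>S\<^esub> mon R (u \<union># v - v) else \<zero>\<^bsub>S\<^esub>)"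
proof -
  have z: "\<ominus>\<^bsub>S\<^esub> \<zero>\<^bsub>S\<^esub> = \<zero>\<^bsub>S\<^esub>" by (rule M.M.minus_equality) simp_all
  show ?thesis using assms by (auto simp: pair_syzygy_def Let_def a_minus_def z)
qed

lemma pair_syzygy_syzygy:
  assumes G: "finite G" "G \<subseteq> expo n" and u: "u \<in> G" and v: "v \<in> G"
  shows "pair_syzygy R n G u v \<in> syzygies R n G"
proof -
  interpret S: cring S by (rule S_cring)
  have uv: "u \<in> expo n" "v \<in> expo n" using u v G by auto
  have l: "u \<union># v - u \<in> expo n" "u \<union># v - v \<in> expo n" "u \<union># v \<in> expo n"
    using uv by (auto intro!: expo_diff expo_lcm)
  have ml: "mon R (u \<union># v - u) \<in> carrier S" "mon R (u \<union># v - v) \<in> carrier S" "mon R (u \<union># v) \<in> carrier S"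
    using l mon_closed by auto
  let ?a = "\<lambda>g. if g = u then mon R (u \<union># v - u) else \<zero>\<^bsub>S\<^esub>"
  let ?b = "\<lambda>g. if g = v then \<ominus>\<^bsub>S\<^esub> mon R (u \<union># v - v) else \<zero>\<^bsub>S\<^esub>"
  let ?s = "pair_syzygy R n G u v"
  have "?s \<in> G \<rightarrow> carrier S"
    using pair_syzygy_eq[OF _ uv] ml by (intro funcsetI) auto
  then have carr: "?s \<in> carrier (free_module S G)"
    by (simp add: free_module_def PiE_def pair_syzygy_def Let_def)
  have "(\<Oplus>\<^bsub>S\<^esub>g\<in>G. ?s g \<otimes>\<^bsub>S\<^esub> mon R g) = (\<Oplus>\<^bsub>S\<^esub>g\<in>G. (if u = g then mon R (u \<union># v) else \<zero>\<^bsub>S\<^esub>)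
      \<oplus>\<^bsub>S\<^esub> (if v = g then \<ominus>\<^bsub>S\<^esub> mon R (u \<union># v) else \<zero>\<^bsub>S\<^esub>))"
  proof (rule M.M.finsum_cong')
    fix g assume g: "g \<in> G"
    then have gm: "mon R g \<in> carrier S" using G mon_closed by auto
    have "u + (u \<union># v - u) = u \<union># v" "v + (u \<union># v - v) = u \<union># v" by simp_all
    then have 1: "mon R (u \<union># v - u) \<otimes>\<^bsub>S\<^esub> mon R u = mon R (u \<union># v)"
      and 2: "mon R (u \<union># v - v) \<otimes>\<^bsub>S\<^esub> mon R v = mon R (u \<union># v)"
      using l mon_mult mon_closed uv by (simp_all add: shift_mon add.commute)
    have "?s g \<otimes>\<^bsub>S\<^esub> mon R g = ?a g \<otimes>\<^bsub>S\<^esub> mon R g \<oplus>\<^bsub>S\<^esub> ?b g \<otimes>\<^bsub>S\<^esub> mon R g"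
      unfolding pair_syzygy_eq[OF g uv] using gm ml by (intro S.l_distr) auto
    then show "?s g \<otimes>\<^bsub>S\<^esub> mon R g = (if u = g then mon R (u \<union># v) else \<zero>\<^bsub>S\<^esub>)
      \<oplus>\<^bsub>S\<^esub> (if v = g then \<ominus>\<^bsub>S\<^esub> mon R (u \<union># v) else \<zero>\<^bsub>S\<^esub>)"
      using gm ml 1 2 by (auto simp: S.l_minus)
  qed (use ml in auto)
  also have "\<dots> = (\<Oplus>\<^bsub>S\<^esub>g\<in>G. if u = g then mon R (u \<union># v) else \<zero>\<^bsub>S\<^esub>)
      \<oplus>\<^bsub>S\<^esub> (\<Oplus>\<^bsub>S\<^esub>g\<in>G. if v = g then \<ominus>\<^bsub>S\<^esub> mon R (u \<union># v) else \<zero>\<^bsub>S\<^esub>)"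
    using ml by (intro M.M.finsum_addf) auto
  also have "\<dots> = \<zero>\<^bsub>S\<^esub>"
    using ml M.M.add.finprod_singleton[OF u G(1), of "\<lambda>_. mon R (u \<union># v)"]
      M.M.add.finprod_singleton[OF v G(1), of "\<lambda>_. \<ominus>\<^bsub>S\<^esub> mon R (u \<union># v)"]
    by (simp add: M.M.r_neg)
  finally show ?thesis using carr by (simp add: syzygies_def Let_def)
qed

text \<open>A functional that is constant on the connected components of the graph of lcm edges
  annihilates all pair syzygies of degree in \<open>D\<close>.\<close>

lemma syzygies_generated_connected:
  assumes ne: "\<one> \<noteq> \<zero>" and U: "U \<subseteq> expo n"
    and sg: "syzygies_generated_in R n dg D (Idl\<^bsub>S\<^esub> (mon R ` U))"
    and g: "g \<in> min_mons n U" "g \<subseteq># w" and g': "g' \<in> min_mons n U" "g' \<subseteq># w"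
  shows "(g, g') \<in> (lcm_edges n dg D U w)\<^sup>*"
proof (rule ccontr)
  assume nc: "(g, g') \<notin> (lcm_edges n dg D U w)\<^sup>*"
  interpret S: cring S by (rule S_cring)
  let ?G = "min_mons n U" and ?E = "lcm_edges n dg D U w"
  let ?F = "free_module S ?G"
  interpret F: module S ?F by (rule S.free_module_module)
  have Ge: "?G \<subseteq> expo n" by (auto simp: min_mons_def)
  have Gf: "finite ?G" using min_mons_finite[OF U] .
  define C where "C = {x. (g, x) \<in> ?E\<^sup>*}"
  have CG: "C \<subseteq> ?G"
  proof
    fix x assume "x \<in> C"
    then have "(g, x) \<in> ?E\<^sup>*" by (simp add: C_def)
    then show "x \<in> ?G" by induction (use g in \<open>auto simp: lcm_edges_def\<close>)
  qed
  define A where "A w' = {x \<in> C. x \<subseteq># w'}" for w'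
  have Af: "finite (A w')" for w' using CG Gf by (auto simp: A_def intro: finite_subset)
  have AG: "A w' \<subseteq> ?G" for w' using CG by (auto simp: A_def)
  define \<phi> where "\<phi> s w' = (\<Oplus>x\<in>A w'. s x (w' - x))" for s :: "nat multiset \<Rightarrow> nat multiset \<Rightarrow> 'a" and w'
  \<comment> \<open>\<open>\<phi> s w'\<close> is the coefficient of x^w' in the partial sum of s_x
    x^x over the component C of g. Vanishing is demanded at all divisors of w, not only at w, so
    that N is stable under multiplication by monomials, which moves w' to w' - t.\<close>
  define N where "N = {s \<in> carrier ?F. \<forall>w'. w' \<subseteq># w \<longrightarrow> \<phi> s w' = \<zero>}"
  have Fc: "s x \<in> carrier S" "s x u \<in> carrier R" if "s \<in> carrier ?F" "x \<in> ?G" for s x u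
    using that S_coeff by (auto simp: free_module_def)
  have \<phi>_add: "\<phi> (s \<oplus>\<^bsub>?F\<^esub> t) w' = \<phi> s w' \<oplus> \<phi> t w'" if "s \<in> carrier ?F" "t \<in> carrier ?F" for s t w'
  proof -
    have "\<phi> (s \<oplus>\<^bsub>?F\<^esub> t) w' = (\<Oplus>x\<in>A w'. s x (w' - x) \<oplus> t x (w' - x))"
      unfolding \<phi>_def using AG[of w'] Fc that
      by (intro finsum_cong') (auto simp: free_module_def S_ops subset_iff)
    also have "\<dots> = \<phi> s w' \<oplus> \<phi> t w'"
      unfolding \<phi>_def using AG[of w'] Fc that by (intro finsum_addf) (auto simp: subset_iff)
    finally show ?thesis .
  qed
  have zeroN: "\<zero>\<^bsub>?F\<^esub> \<in> N"
  proof -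
    have "\<phi> (\<zero>\<^bsub>?F\<^esub>) w' = (\<Oplus>x\<in>A w'. \<zero>)" for w'
      unfolding \<phi>_def using AG[of w']
      by (intro finsum_cong') (auto simp: free_module_def S_ops subset_iff)
    then show ?thesis by (simp add: N_def)
  qed
  have addN: "s \<oplus>\<^bsub>?F\<^esub> t \<in> N" if "s \<in> N" "t \<in> N" for s t
    using that \<phi>_add by (auto simp: N_def)
  have smultN: "p \<odot>\<^bsub>?F\<^esub> s \<in> N" if p: "p \<in> carrier S" and s: "s \<in> N" for p s
  proof -
    have sc: "s \<in> carrier ?F" using s by (simp add: N_def)
    have "p \<in> lspan S (carrier R) (mon R ` expo n)" using p S_span_mon by blast
    then have "p \<in> carrier S \<and> p \<odot>\<^bsub>?F\<^esub> s \<in> N"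
    proof induction
      case lspan_zero
      have "\<zero>\<^bsub>S\<^esub> \<odot>\<^bsub>?F\<^esub> s = \<zero>\<^bsub>?F\<^esub>" using sc by simp
      then show ?case using zeroN by simp
    next
      case (lspan_step c y q)
      then obtain t where t: "t \<in> expo n" "y = mon R t" by blast
      have c: "c \<in> carrier R" and q: "q \<in> carrier S" "q \<odot>\<^bsub>?F\<^esub> s \<in> N" using lspan_step by auto
      have cy: "c \<odot>\<^bsub>S\<^esub> y \<in> carrier S" using c t mon_closed by simp
      have ev: "((c \<odot>\<^bsub>S\<^esub> y) \<odot>\<^bsub>?F\<^esub> s) x = c \<odot>\<^bsub>S\<^esub> shift t (s x)" if "x \<in> ?G" for x
        using that Fc[OF sc that] c t mon_closed
        by (simp add: free_module_def S_smult_assoc2 mon_mult)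
      have "\<phi> ((c \<odot>\<^bsub>S\<^esub> y) \<odot>\<^bsub>?F\<^esub> s) w' = \<zero>" if w': "w' \<subseteq># w" for w'
      proof -
        have "\<phi> ((c \<odot>\<^bsub>S\<^esub> y) \<odot>\<^bsub>?F\<^esub> s) w' = (\<Oplus>x\<in>A w'. c \<otimes> shift t (s x) (w' - x))"
          unfolding \<phi>_def using AG[of w'] ev Fc[OF sc] c t shift_closed S_coeff
          by (intro finsum_cong') (auto simp: S_ops subset_iff)
        also have "\<dots> = c \<otimes> (\<Oplus>x\<in>A w'. shift t (s x) (w' - x))"
          using AG[of w'] Fc[OF sc] c t shift_closed S_coeff
          by (intro finsum_rdistr[symmetric, OF Af]) (auto simp: subset_iff)
        also have "(\<Oplus>x\<in>A w'. shift t (s x) (w' - x)) = \<zero>"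
        proof (cases "t \<subseteq># w'")
          case True
          have sub: "A (w' - t) \<subseteq> A w'"
            using subset_mset.order_trans[OF _ diff_subset_eq_self] by (auto simp: A_def)
          have "(\<Oplus>x\<in>A w'. shift t (s x) (w' - x)) = (\<Oplus>x\<in>A (w' - t). shift t (s x) (w' - x))"
          proof (rule add.finprod_mono_neutral_cong_right)
            show "shift t (s x) (w' - x) = \<zero>" if x: "x \<in> A w' - A (w' - t)" for x
            proof -
              have "\<not> (t \<subseteq># w' - x)"
                using x add_subset_mset_iff[of t x w'] add_subset_mset_iff[of x t w']
                by (auto simp: A_def add.commute)
              then show "shift t (s x) (w' - x) = \<zero>" by (simp add: shift_def)
            qed
          qed (use Af sub AG[of w'] Fc[OF sc] t shift_closed S_coeff in \<open>auto simp: subset_iff\<close>)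
          also have "\<dots> = \<phi> s (w' - t)"
            unfolding \<phi>_def
          proof (rule finsum_cong')
            fix x assume x: "x \<in> A (w' - t)"
            then have "x \<subseteq># w' - t" by (simp add: A_def)
            then have "t + x \<subseteq># w'" using add_subset_mset_iff[of t x w'] True by blast
            then have "t \<subseteq># w' - x" using add_subset_mset_iff[of x t w'] by (simp add: add.commute)
            then show "shift t (s x) (w' - x) = s x (w' - t - x)"
              by (simp add: shift_def add.commute)
          qed (use AG[of "w' - t"] Fc[OF sc] in \<open>auto simp: subset_iff\<close>)
          also have "\<dots> = \<zero>"
            using s w' subset_mset.order_trans[OF diff_subset_eq_self w'] by (simp add: N_def)
          finally show ?thesis .
        next
          case False
          have "(\<Oplus>x\<in>A w'. shift t (s x) (w' - x)) = (\<Oplus>x\<in>A w'. \<zero>)"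
          proof (rule finsum_cong')
            fix x
            have "\<not> t \<subseteq># w' - x"
              using False subset_mset.order_trans[OF _ diff_subset_eq_self, of t w' x] by blast
            then show "shift t (s x) (w' - x) = \<zero>" by (simp add: shift_def)
          qed auto
          then show ?thesis by simp
        qed
        finally show ?thesis using c by simp
      qed
      then have "(c \<odot>\<^bsub>S\<^esub> y) \<odot>\<^bsub>?F\<^esub> s \<in> N" using cy sc by (simp add: N_def)
      then have "(c \<odot>\<^bsub>S\<^esub> y) \<odot>\<^bsub>?F\<^esub> s \<oplus>\<^bsub>?F\<^esub> q \<odot>\<^bsub>?F\<^esub> s \<in> N" using q addN by blast
      then show ?case using cy q sc by (simp add: F.smult_l_distr)
    qed
    then show ?thesis by blast
  qed
  have subN: "submodule N S ?F"
    by (rule F.submoduleI2) (use zeroN addN smultN in \<open>auto simp: N_def\<close>)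
  have \<phi>_pair: "\<phi> (pair_syzygy R n ?G u v) w' =
      (if u \<in> A w' \<and> w' = u \<union># v then \<one> else \<zero>) \<oplus> (if v \<in> A w' \<and> w' = u \<union># v then \<ominus> \<one> else \<zero>)"
    if u: "u \<in> ?G" and v: "v \<in> ?G" for u v w'
  proof -
    have uv: "u \<in> expo n" "v \<in> expo n" using u v Ge by auto
    have l: "u \<union># v - u \<in> expo n" "u \<union># v - v \<in> expo n"
      using uv by (auto intro!: expo_diff expo_lcm)
    have w'eq: "w' - u = u \<union># v - u \<longleftrightarrow> w' = u \<union># v" if "u \<subseteq># w'" for u v
      using subset_mset.diff_add[OF that] subset_mset.diff_add[of u "u \<union># v"] by auto
    have "\<phi> (pair_syzygy R n ?G u v) w' = (\<Oplus>x\<in>A w'. (if u = x then (if w' = u \<union># v then \<one> else \<zero>) else \<zero>) \<oplus>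
      (if v = x then (if w' = u \<union># v then \<ominus> \<one> else \<zero>) else \<zero>))"
      unfolding \<phi>_def
    proof (rule finsum_cong')
      fix x assume x: "x \<in> A w'"
      then have xG: "x \<in> ?G" and xw: "x \<subseteq># w'" using AG by (auto simp: A_def)
      show "pair_syzygy R n ?G u v x (w' - x) = (if u = x then (if w' = u \<union># v then \<one> else \<zero>) else \<zero>) \<oplus>
        (if v = x then (if w' = u \<union># v then \<ominus> \<one> else \<zero>) else \<zero>)"
        using mon_closed[OF l(1)] mon_closed[OF l(2)] xw w'eq[of u v] w'eq[of v u]
        by (auto simp: pair_syzygy_eq[OF xG uv] S_ops S_uminus mon_def subset_mset.sup_commute)
    qed auto
    also have "\<dots> = (\<Oplus>x\<in>A w'. if u = x then (if w' = u \<union># v then \<one> else \<zero>) else \<zero>) \<oplus>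
      (\<Oplus>x\<in>A w'. if v = x then (if w' = u \<union># v then \<ominus> \<one> else \<zero>) else \<zero>)"
      by (intro finsum_addf) auto
    also have "(\<Oplus>x\<in>A w'. if u = x then (if w' = u \<union># v then \<one> else \<zero>) else \<zero>) =
       (if u \<in> A w' \<and> w' = u \<union># v then \<one> else \<zero>)"
    proof (cases "u \<in> A w'")
      case True
      then show ?thesis
        using add.finprod_singleton[OF True Af, of "\<lambda>_. if w' = u \<union># v then \<one> else \<zero>"] by simp
    next
      case False
      then have "(\<Oplus>x\<in>A w'. if u = x then (if w' = u \<union># v then \<one> else \<zero>) else \<zero>) = (\<Oplus>x\<in>A w'. \<zero>)"
        by (intro finsum_cong') auto
      then show ?thesis using False by simp
    qed
    also have "(\<Oplus>x\<in>A w'. if v = x then (if w' = u \<union># v then \<ominus> \<one> else \<zero>) else \<zero>) =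
       (if v \<in> A w' \<and> w' = u \<union># v then \<ominus> \<one> else \<zero>)"
    proof (cases "v \<in> A w'")
      case True
      then show ?thesis
        using add.finprod_singleton[OF True Af, of "\<lambda>_. if w' = u \<union># v then \<ominus> \<one> else \<zero>"] by simp
    next
      case False
      then have "(\<Oplus>x\<in>A w'. if v = x then (if w' = u \<union># v then \<ominus> \<one> else \<zero>) else \<zero>) = (\<Oplus>x\<in>A w'. \<zero>)"
        by (intro finsum_cong') auto
      then show ?thesis using False by simp
    qed
    finally show ?thesis .
  qed
  have pairF: "pair_syzygy R n ?G u v \<in> carrier ?F" if "u \<in> ?G" "v \<in> ?G" for u v
    using pair_syzygy_syzygy[OF Gf Ge that] by (simp add: syzygies_def Let_def)
  have gens: "{pair_syzygy R n ?G u v | u v. u \<in> ?G \<and> v \<in> ?G \<and> dg (u \<union># v) \<in> D} \<subseteq> N"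
  proof
    fix s assume "s \<in> {pair_syzygy R n ?G u v | u v. u \<in> ?G \<and> v \<in> ?G \<and> dg (u \<union># v) \<in> D}"
    then obtain u v where uv: "s = pair_syzygy R n ?G u v" "u \<in> ?G" "v \<in> ?G" "dg (u \<union># v) \<in> D" by blast
    \<comment> \<open>At the lcm the contributions 1 and -1 occur together or not at all, since the
      two ends of an edge lie in the same component; at any other exponent there is no
      contribution.\<close>
    have "\<phi> s w' = \<zero>" if w': "w' \<subseteq># w" for w'
    proof (cases "w' = u \<union># v")
      case True
      then have "u \<subseteq># w" "v \<subseteq># w" 
        using w' subset_mset.order_trans[OF subset_mset.sup_ge1] subset_mset.order_trans[OF subset_mset.sup_ge2]
        by blast+
      then have "(u, v) \<in> ?E" "(v, u) \<in> ?E" using uv by (auto simp: lcm_edges_def subset_mset.sup_commute)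
      then have "u \<in> C \<longleftrightarrow> v \<in> C" unfolding C_def by (auto intro: rtrancl_into_rtrancl)
      then have "u \<in> A w' \<longleftrightarrow> v \<in> A w'" using True by (auto simp: A_def)
      then show ?thesis using \<phi>_pair[OF uv(2,3), of w'] uv(1) True
        by (cases "v \<in> A w'") (auto simp: r_neg)
    next
      case False
      then show ?thesis using \<phi>_pair[OF uv(2,3), of w'] uv(1) by simp
    qed
    then show "s \<in> N" using pairF uv by (simp add: N_def)
  qed
  have "syzygies R n ?G = gen_submodule S ?F {pair_syzygy R n ?G u v | u v. u \<in> ?G \<and> v \<in> ?G \<and> dg (u \<union># v) \<in> D}"
    using sg unfolding syzygies_generated_in_def Let_def min_gens_eq[OF ne U] by simp
  also have "\<dots> \<subseteq> N" unfolding gen_submodule_def using subN gens by blast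
  \<comment> \<open>The contradiction: for a disconnected pair only g lies in C, so the functional
    takes the value 1 at the lcm of g and g'.\<close>
  finally have "pair_syzygy R n ?G g g' \<in> N" using pair_syzygy_syzygy[OF Gf Ge g(1) g'(1)] by blast
  moreover have lw: "g \<union># g' \<subseteq># w" using g g' by simp
  ultimately have "\<phi> (pair_syzygy R n ?G g g') (g \<union># g') = \<zero>" by (simp add: N_def)
  moreover have "g \<in> A (g \<union># g')" "g' \<notin> A (g \<union># g')" using nc by (auto simp: A_def C_def)
  ultimately show False using \<phi>_pair[OF g(1) g'(1), of "g \<union># g'"] ne by simp
qed

end

section \<open>Standard monomials at a maximal ideal\<close>

lemma (in cring) exists_maximalideal:
  assumes I: "ideal I R" "I \<noteq> carrier R" shows "\<exists>\<mm>. maximalideal \<mm> R \<and> I \<subseteq> \<mm>"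
proof -
  \<comment> \<open>Properness is written as absence of the unit, a form that passes to unions of
    chains.\<close>
  let ?A = "{J. ideal J R \<and> I \<subseteq> J \<and> \<one> \<notin> J}"
  have one: "\<one> \<notin> J \<longleftrightarrow> J \<noteq> carrier R" if "ideal J R" for J
    using ideal.one_imp_carrier[OF that] by auto
  have "\<exists>M\<in>?A. \<forall>X\<in>?A. M \<subseteq> X \<longrightarrow> X = M"
  proof (rule subset_Zorn_nonempty)
    show "?A \<noteq> {}" using I one[OF I(1)] by (intro notI) auto
  next
    fix \<C> assume C: "\<C> \<noteq> {}" "subset.chain ?A \<C>"
    have CA: "\<And>J. J \<in> \<C> \<Longrightarrow> ideal J R \<and> I \<subseteq> J \<and> \<one> \<notin> J"
      using C(2) by (auto simp: subset.chain_def)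
    have comp: "J \<subseteq> K \<or> K \<subseteq> J" if "J \<in> \<C>" "K \<in> \<C>" for J K
      using C(2) that by (auto simp: subset_chain_def)
    have "ideal (\<Union>\<C>) R"
    proof (rule idealI)
      show "ring R" by (rule ring_axioms)
      show "subgroup (\<Union>\<C>) (add_monoid R)"
      proof (rule add.subgroupI)
        show "\<Union>\<C> \<subseteq> carrier R" by (rule Union_least, rule ideal_subset) (simp add: CA)
        obtain J0 where J0: "J0 \<in> \<C>" using C(1) by blast
        then have "\<zero> \<in> J0" using ideal_zero[of J0] CA[OF J0] by simp
        then show "\<Union>\<C> \<noteq> {}" using J0 by blast
        fix a assume "a \<in> \<Union>\<C>"
        then obtain J where J: "J \<in> \<C>" "a \<in> J" by blast
        then show "\<ominus> a \<in> \<Union>\<C>" using ideal_minus[of J a] CA[OF J(1)] by blast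
        fix b assume "b \<in> \<Union>\<C>"
        then obtain K where K: "K \<in> \<C>" "b \<in> K" by blast
        show "a \<oplus> b \<in> \<Union>\<C>"
        proof (cases "J \<subseteq> K")
          case True
          then show ?thesis using J K CA[OF K(1)] ideal_add[of K a b] by blast
        next
          case False
          then show ?thesis using J K CA[OF J(1)] ideal_add[of J a b] comp[OF J(1) K(1)] by blast
        qed
      qed
      fix a x assume "a \<in> \<Union>\<C>" and x: "x \<in> carrier R"
      then obtain J where J: "J \<in> \<C>" "a \<in> J" by blast
      have JI: "ideal J R" using CA[OF J(1)] by simp
      show "x \<otimes> a \<in> \<Union>\<C>" using ideal.I_l_closed[OF JI J(2) x] J(1) by (rule UnionI[rotated])
      show "a \<otimes> x \<in> \<Union>\<C>" using ideal.I_r_closed[OF JI J(2) x] J(1) by (rule UnionI[rotated])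
    qed
    moreover obtain J0 where J0: "J0 \<in> \<C>" using C(1) by blast
    moreover have "I \<subseteq> J0" using CA[OF J0] by simp
    moreover have "\<one> \<notin> \<Union>\<C>" using CA by auto
    ultimately show "\<Union>\<C> \<in> ?A" by (intro CollectI conjI) auto
  qed
  then obtain M where MA: "M \<in> ?A" and max: "\<forall>X\<in>?A. M \<subseteq> X \<longrightarrow> X = M" by (rule bexE)
  have M: "ideal M R" "I \<subseteq> M" "\<one> \<notin> M" using MA by simp_all
  have "maximalideal M R"
  proof (rule maximalidealI[OF M(1)])
    show "carrier R \<noteq> M" using M by auto
    fix J assume J: "ideal J R" "M \<subseteq> J" "J \<subseteq> carrier R"
    show "J = M \<or> J = carrier R"
    proof (cases "\<one> \<in> J")
      case True
      then show ?thesis using one[OF J(1)] by simp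
    next
      case False
      then have "J \<in> ?A" using J(1) subset_trans[OF M(2) J(2)] by simp
      then show ?thesis using bspec[OF max] J(2) by simp
    qed
  qed
  then show ?thesis using M(2) by (intro exI conjI)
qed

lemma (in cring) maximal_inverse:
  assumes m: "maximalideal \<mm> R" and a: "a \<in> carrier R" "a \<notin> \<mm>"
  shows "\<exists>c\<in>carrier R. c \<otimes> a \<ominus> \<one> \<in> \<mm>"
proof -
  interpret m: maximalideal \<mm> R by (rule m)
  have mi: "ideal \<mm> R" ..
  have id: "ideal (\<mm> <+>\<^bsub>R\<^esub> PIdl a) R" using add_ideals[OF mi cgenideal_ideal[OF a(1)]] .
  have mem: "x \<in> \<mm> <+>\<^bsub>R\<^esub> PIdl a" if "x \<in> \<mm>" for x
  proof -
    have "\<zero> \<in> PIdl a" using ideal_zero[OF cgenideal_ideal[OF a(1)]] .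
    moreover have "x = x \<oplus> \<zero>" using that m.Icarr by simp
    ultimately show ?thesis using that unfolding set_add_def' by blast
  qed
  have "a \<in> \<mm> <+>\<^bsub>R\<^esub> PIdl a"
  proof -
    have "a \<in> PIdl a" using cgenideal_self[OF a(1)] .
    moreover have "a = \<zero> \<oplus> a" using a by simp
    ultimately show ?thesis using ideal_zero[OF mi] unfolding set_add_def' by blast
  qed
  then have "\<mm> <+>\<^bsub>R\<^esub> PIdl a = carrier R"
    using m.I_maximal[OF id] mem ideal_subset[OF id] a by blast
  then have "\<one> \<in> \<mm> <+>\<^bsub>R\<^esub> PIdl a" by simp
  then obtain \<mu> c where c: "\<mu> \<in> \<mm>" "c \<in> carrier R" "\<one> = \<mu> \<oplus> c \<otimes> a"
    unfolding set_add_def' cgenideal_def by blast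
  have "\<mu> \<in> carrier R" using c m.Icarr by blast
  then have "c \<otimes> a \<ominus> \<one> = \<ominus> \<mu>"
    unfolding c(3) using c(2) a by (simp add: minus_eq minus_add r_neg r_neg1 a_ac r_neg2)
  then show ?thesis using c ideal_minus[OF mi] by metis
qed

text \<open>If the elements over which M becomes free generated a proper ideal, a maximal ideal
  above it would contain all of them.\<close>

lemma (in module) locally_freeI:
  assumes "\<And>\<mm>. maximalideal \<mm> R \<Longrightarrow>
    \<exists>f\<in>carrier R - \<mm>. free_of_rank (loc_ring R f) (loc_module R M f) r"
  shows "locally_free R M r"
proof -
  let ?F = "{f \<in> carrier R. free_of_rank (loc_ring R f) (loc_module R M f) r}"
  have id: "ideal (Idl ?F) R" by (rule R.genideal_ideal) blast
  have "Idl ?F = carrier R"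
  proof (rule ccontr)
    assume "Idl ?F \<noteq> carrier R"
    then obtain \<mm> where m: "maximalideal \<mm> R" "Idl ?F \<subseteq> \<mm>" using R.exists_maximalideal[OF id] by blast
    then obtain f where "f \<in> carrier R - \<mm>" "f \<in> ?F" using assms[OF m(1)] by blast
    moreover have "?F \<subseteq> Idl ?F" by (rule R.genideal_self) blast
    ultimately show False using m(2) by blast
  qed
  then show ?thesis unfolding locally_free_def by (intro exI[of _ ?F]) blast
qed

lemma (in quot_mod) lspan_quot:
  assumes "C \<subseteq> carrier R" "Z \<subseteq> carrier M"
  shows "lspan (quot_module M N) C ((\<lambda>x. N +>\<^bsub>M\<^esub> x) ` Z) = (\<lambda>x. N +>\<^bsub>M\<^esub> x) ` lspan M C Z"
proof (intro equalityI subsetI)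
  fix y assume "y \<in> lspan (quot_module M N) C ((\<lambda>x. N +>\<^bsub>M\<^esub> x) ` Z)"
  then show "y \<in> (\<lambda>x. N +>\<^bsub>M\<^esub> x) ` lspan M C Z"
  proof induction
    case lspan_zero
    show ?case unfolding zero_quot by (auto intro: lspan.intros)
  next
    case (lspan_step c y x)
    then obtain z x' where z: "z \<in> Z" "y = N +>\<^bsub>M\<^esub> z" "x' \<in> lspan M C Z" "x = N +>\<^bsub>M\<^esub> x'" by blast
    have carr: "c \<in> carrier R" "z \<in> carrier M" "x' \<in> carrier M"
      using lspan_step(1) z assms lspan_carrier[OF assms] by auto
    have "c \<odot>\<^bsub>quot_module M N\<^esub> y \<oplus>\<^bsub>quot_module M N\<^esub> x = N +>\<^bsub>M\<^esub> (c \<odot>\<^bsub>M\<^esub> z \<oplus>\<^bsub>M\<^esub> x')"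
      using carr z by (simp add: smult_quot add_quot)
    moreover have "c \<odot>\<^bsub>M\<^esub> z \<oplus>\<^bsub>M\<^esub> x' \<in> lspan M C Z"
      using lspan_step(1) z by (auto intro: lspan.intros)
    ultimately show ?case by blast
  qed
next
  fix y assume "y \<in> (\<lambda>x. N +>\<^bsub>M\<^esub> x) ` lspan M C Z"
  then obtain x where x: "x \<in> lspan M C Z" "y = N +>\<^bsub>M\<^esub> x" by blast
  from x(1) have "x \<in> carrier M \<and> N +>\<^bsub>M\<^esub> x \<in> lspan (quot_module M N) C ((\<lambda>x. N +>\<^bsub>M\<^esub> x) ` Z)"
  proof induction
    case lspan_zero
    show ?case using lspan.lspan_zero[of "quot_module M N"] unfolding zero_quot by auto
  next
    case (lspan_step c z x)
    have carr: "c \<in> carrier R" "z \<in> carrier M" "x \<in> carrier M"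
      using lspan_step assms by auto
    have "c \<odot>\<^bsub>quot_module M N\<^esub> (N +>\<^bsub>M\<^esub> z) \<oplus>\<^bsub>quot_module M N\<^esub> (N +>\<^bsub>M\<^esub> x) =
        N +>\<^bsub>M\<^esub> (c \<odot>\<^bsub>M\<^esub> z \<oplus>\<^bsub>M\<^esub> x)"
      using carr by (simp add: smult_quot add_quot)
    then show ?case
      using lspan.lspan_step[of c C "N +>\<^bsub>M\<^esub> z" "(\<lambda>x. N +>\<^bsub>M\<^esub> x) ` Z" "N +>\<^bsub>M\<^esub> x" "quot_module M N"]
        lspan_step carr by auto
  qed
  then show "y \<in> lspan (quot_module M N) C ((\<lambda>x. N +>\<^bsub>M\<^esub> x) ` Z)" using x by simp
qed

context graded_poly
begin

lemma lspan_P: "lspan (P E) C Y = lspan S C Y"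
proof (intro equalityI subsetI)
  fix x assume "x \<in> lspan (P E) C Y"
  then show "x \<in> lspan S C Y" by induction (auto simp: P_ops intro: lspan.intros)
next
  fix x assume "x \<in> lspan S C Y"
  then show "x \<in> lspan (P E) C Y"
  proof induction
    case lspan_zero
    then show ?case using lspan.lspan_zero[of "P E" C Y] by (simp add: P_ops)
  next
    case (lspan_step c y x)
    then show ?case using lspan.lspan_step[of c C y Y x "P E"] by (simp add: P_ops)
  qed
qed

text \<open>Leading exponents after reduction modulo \<mm>. The order is the multiset order, which
  is total, well-founded and compatible with addition, so it serves as a monomial order.\<close>

definition lead :: "'a set \<Rightarrow> (nat multiset \<Rightarrow> 'a) set \<Rightarrow> nat multiset set" where
  "lead \<mm> N = {u. \<exists>p\<in>N. p u \<notin> \<mm> \<and> (\<forall>v>u. p v \<in> \<mm>)}"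

text \<open>The form that \<open>loc_basis\<close> takes for the cosets of the monomials B in S_a/N,
  stated with polynomials instead of cosets; see \<open>poly_basis_loc_basis\<close>.\<close>

definition poly_basis :: "'a \<Rightarrow> 'g \<Rightarrow> (nat multiset \<Rightarrow> 'a) set \<Rightarrow> nat multiset set \<Rightarrow> bool" where
  "poly_basis f a N B \<longleftrightarrow> finite B \<and> B \<subseteq> deg a \<and>
    (\<forall>p\<in>Xc {a}. \<exists>t::nat. \<exists>q\<in>supp_in (carrier R) B. (f [^] t) \<odot>\<^bsub>S\<^esub> p \<ominus>\<^bsub>S\<^esub> q \<in> N) \<and>
    N \<inter> supp_in (carrier R) B \<subseteq> sat R S f {\<zero>\<^bsub>S\<^esub>}"

lemma sat_zeroD: "p \<in> sat R S f {\<zero>\<^bsub>S\<^esub>} \<Longrightarrow> \<exists>t::nat. (f [^] t) \<otimes> p u = \<zero>"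
  by (auto simp: sat_def S_ops fun_eq_iff)

lemma sat_zeroI:
  assumes f: "f \<in> carrier R" and p: "p \<in> carrier S" and k: "\<And>u. \<exists>t::nat. (f [^] t) \<otimes> p u = \<zero>"
  shows "p \<in> sat R S f {\<zero>\<^bsub>S\<^esub>}"
proof -
  let ?Y = "{u. p u \<noteq> \<zero>}"
  have sub: "submodule (sat R S f {\<zero>\<^bsub>S\<^esub>}) R S" using M.sat_submodule[OF f M.zero_submodule] .
  have Y: "?Y \<subseteq> expo n" using p by (auto simp: S_carrier)
  obtain t where t: "\<And>u. (f [^] (t u :: nat)) \<otimes> p u = \<zero>" using k by metis
  define T where "T = sum t ?Y"
  have "(f [^] T) \<otimes> p u = \<zero>" for u
  proof (cases "p u = \<zero>")
    case False
    then have "t u \<le> T" using p unfolding T_def S_carrier by (intro member_le_sum) auto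
    then have "f [^] T = f [^] (T - t u) \<otimes> f [^] t u" using f by (simp add: nat_pow_mult)
    then show ?thesis using t[of u] f S_coeff[OF p] by (simp add: m_assoc)
  qed (use f in simp)
  then have "(f [^] T) \<odot>\<^bsub>S\<^esub> p = \<zero>\<^bsub>S\<^esub>" by (simp add: S_ops)
  then show ?thesis using p by (intro M.satI[where t = T]) auto
qed

lemma coset_mod:
  assumes "submodule N R S" "N \<subseteq> Xc {a}" shows "quot_mod R (P {a}) N"
  using assms by (simp add: quot_mod_def quot_mod_axioms_def P_module submodule_P_iff)

text \<open>Spanning is a direct translation of cosets, and dependences among the cosets are the
  elements of N supported on B. That no power of f vanishes ensures that distinct independent
  monomials have distinct cosets.\<close>

lemma poly_basis_loc_basis:
  assumes N: "submodule N R S" "N \<subseteq> Xc {a}" and f: "f \<in> carrier R" "\<And>t::nat. f [^] t \<noteq> \<zero>"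
    and B: "B \<subseteq> deg a"
  shows "poly_basis f a N B \<longleftrightarrow>
    loc_basis R (quot_module (P {a}) N) f ((\<lambda>u. N +>\<^bsub>P {a}\<^esub> mon R u) ` B) \<and>
    inj_on (\<lambda>u. N +>\<^bsub>P {a}\<^esub> mon R u) B"
proof -
  interpret Q: quot_mod R "P {a}" N by (rule coset_mod[OF N])
  let ?T = "quot_module (P {a}) N"
  interpret T: module R ?T by (rule Q.quot_module)
  let ?c = "\<lambda>x. N +>\<^bsub>P {a}\<^esub> x"
  have Be: "B \<subseteq> expo n" using deg_sub[OF B] .
  have mX: "mon R u \<in> Xc {a}" if "u \<in> B" for u
    using that B mon_closed by (auto simp: Xc_iff mon_def deg_def)
  have lsp: "lspan ?T (carrier R) ((\<lambda>u. ?c (mon R u)) ` Z) = ?c ` supp_in (carrier R) Z" if "Z \<subseteq> B" for Z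
  proof -
    have "mon R ` Z \<subseteq> Xc {a}" using mX that by blast
    then have "lspan ?T (carrier R) (?c ` mon R ` Z) = ?c ` lspan S (carrier R) (mon R ` Z)"
      using Q.lspan_quot[of "carrier R" "mon R ` Z"] by (simp add: lspan_P)
    then show ?thesis using supp_in_lspan[OF oneideal] that Be by (simp add: image_image)
  qed
  have suppX: "supp_in (carrier R) Z \<subseteq> Xc {a}" if "Z \<subseteq> B" for Z
    using supp_in_Xc[of Z a] that B by blast
  have ceq: "?c x = ?c y \<longleftrightarrow> x \<ominus>\<^bsub>S\<^esub> y \<in> N" if "x \<in> Xc {a}" "y \<in> Xc {a}" for x y
    using Q.coset_eq_iff[OF that] P_minus[OF that] by simp
  have sm: "r \<odot>\<^bsub>?T\<^esub> ?c x = ?c (r \<odot>\<^bsub>S\<^esub> x)" if "r \<in> carrier R" "x \<in> Xc {a}" for r x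
    using Q.smult_quot[OF that] by (simp add: P_ops)
  have Xsm: "r \<odot>\<^bsub>S\<^esub> x \<in> Xc {a}" if "r \<in> carrier R" "x \<in> Xc {a}" for r x
    using M.submoduleE(4)[OF submodule_Xc that] .
  have pw: "f [^] (t::nat) \<in> carrier R" for t using f by simp
  have span: "(\<forall>p\<in>Xc {a}. \<exists>t::nat. \<exists>q\<in>supp_in (carrier R) B. (f [^] t) \<odot>\<^bsub>S\<^esub> p \<ominus>\<^bsub>S\<^esub> q \<in> N) \<longleftrightarrow>
      carrier ?T \<subseteq> sat R ?T f (lspan ?T (carrier R) ((\<lambda>u. ?c (mon R u)) ` B))"
  proof -
    have "(\<exists>t::nat. \<exists>q\<in>supp_in (carrier R) B. (f [^] t) \<odot>\<^bsub>S\<^esub> p \<ominus>\<^bsub>S\<^esub> q \<in> N) \<longleftrightarrow>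
        ?c p \<in> sat R ?T f (lspan ?T (carrier R) ((\<lambda>u. ?c (mon R u)) ` B))" if p: "p \<in> Xc {a}" for p
    proof -
      have "?c p \<in> carrier ?T" using p unfolding Q.carrier_quot by blast
      then have "?c p \<in> sat R ?T f (lspan ?T (carrier R) ((\<lambda>u. ?c (mon R u)) ` B)) \<longleftrightarrow>
          (\<exists>t::nat. ?c ((f [^] t) \<odot>\<^bsub>S\<^esub> p) \<in> ?c ` supp_in (carrier R) B)"
        unfolding sat_def lsp[OF subset_refl] using sm[OF pw p] by simp
      also have "\<dots> \<longleftrightarrow> (\<exists>t::nat. \<exists>q\<in>supp_in (carrier R) B. ?c ((f [^] t) \<odot>\<^bsub>S\<^esub> p) = ?c q)"
        by blast
      also have "\<dots> \<longleftrightarrow> (\<exists>t::nat. \<exists>q\<in>supp_in (carrier R) B. (f [^] t) \<odot>\<^bsub>S\<^esub> p \<ominus>\<^bsub>S\<^esub> q \<in> N)"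
        using ceq Xsm[OF pw p] suppX[OF subset_refl] by (intro ex_cong1 bex_cong refl) auto
      finally show ?thesis by blast
    qed
    then show ?thesis unfolding Q.carrier_quot by blast
  qed
  let ?ind = "\<forall>x\<in>(\<lambda>u. ?c (mon R u)) ` B. \<forall>c\<in>carrier R.
      c \<odot>\<^bsub>?T\<^esub> x \<in> lspan ?T (carrier R) ((\<lambda>u. ?c (mon R u)) ` B - {x}) \<longrightarrow> (\<exists>t::nat. (f [^] t) \<otimes> c = \<zero>)"
  have ind: "?ind \<longleftrightarrow> N \<inter> supp_in (carrier R) B \<subseteq> sat R S f {\<zero>\<^bsub>S\<^esub>}"
    if inj: "inj_on (\<lambda>u. ?c (mon R u)) B"
  proof -
    \<comment> \<open>A dependence of u on the others is the same as an element of N supported on B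
      whose coefficient at u is c: move the combination of the other monomials to the left.\<close>
    have key: "c \<odot>\<^bsub>?T\<^esub> ?c (mon R u) \<in> lspan ?T (carrier R) ((\<lambda>u. ?c (mon R u)) ` B - {?c (mon R u)}) \<longleftrightarrow>
      (\<exists>q\<in>N \<inter> supp_in (carrier R) B. q u = c)" if u: "u \<in> B" and c: "c \<in> carrier R" for u c
    proof -
      have "(\<lambda>u. ?c (mon R u)) ` B - {?c (mon R u)} = (\<lambda>u. ?c (mon R u)) ` (B - {u})"
        using inj u by (auto simp: inj_on_def)
      then have "c \<odot>\<^bsub>?T\<^esub> ?c (mon R u) \<in> lspan ?T (carrier R) ((\<lambda>u. ?c (mon R u)) ` B - {?c (mon R u)})
        \<longleftrightarrow> ?c (c \<odot>\<^bsub>S\<^esub> mon R u) \<in> ?c ` supp_in (carrier R) (B - {u})"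
        using sm[OF c mX[OF u]] lsp[of "B - {u}"] by simp
      also have "\<dots> \<longleftrightarrow> (\<exists>q\<in>supp_in (carrier R) (B - {u}). c \<odot>\<^bsub>S\<^esub> mon R u \<ominus>\<^bsub>S\<^esub> q \<in> N)"
        using ceq[OF Xsm[OF c mX[OF u]]] suppX[of "B - {u}"] by blast
      also have "\<dots> \<longleftrightarrow> (\<exists>q\<in>N \<inter> supp_in (carrier R) B. q u = c)"
      proof
        assume "\<exists>q\<in>supp_in (carrier R) (B - {u}). c \<odot>\<^bsub>S\<^esub> mon R u \<ominus>\<^bsub>S\<^esub> q \<in> N"
        then obtain q where q: "q \<in> supp_in (carrier R) (B - {u})" "c \<odot>\<^bsub>S\<^esub> mon R u \<ominus>\<^bsub>S\<^esub> q \<in> N" by blast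
        have cm: "c \<odot>\<^bsub>S\<^esub> mon R u \<in> supp_in (carrier R) B" using cmon_supp_in[OF oneideal c u Be] .
        have qB: "q \<in> supp_in (carrier R) B" using q(1) supp_in_mono[of "carrier R" "carrier R" "B - {u}" B] by blast
        have "c \<odot>\<^bsub>S\<^esub> mon R u \<ominus>\<^bsub>S\<^esub> q \<in> supp_in (carrier R) B"
          using M.submodule_diff[OF supp_in_submodule[OF oneideal Be] cm qB] .
        moreover have "(c \<odot>\<^bsub>S\<^esub> mon R u \<ominus>\<^bsub>S\<^esub> q) u = c"
        proof -
          have "q u = \<zero>" using q(1) by (auto simp: supp_in_def)
          moreover have "(c \<odot>\<^bsub>S\<^esub> mon R u) u = c" using c by (simp add: S_ops mon_def)
          ultimately show ?thesis
            using S_minus[OF subsetD[OF supp_in_sub cm] subsetD[OF supp_in_sub qB]] c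
            by (simp add: minus_eq)
        qed
        ultimately show "\<exists>q\<in>N \<inter> supp_in (carrier R) B. q u = c" using q(2) by blast
      next
        assume "\<exists>q\<in>N \<inter> supp_in (carrier R) B. q u = c"
        then obtain q where q: "q \<in> N" "q \<in> supp_in (carrier R) B" "q u = c" by blast
        have qc: "q \<in> carrier S" using q supp_in_sub by blast
        have cm: "c \<odot>\<^bsub>S\<^esub> mon R u \<in> carrier S" using c u Be mon_closed by auto
        let ?r = "c \<odot>\<^bsub>S\<^esub> mon R u \<ominus>\<^bsub>S\<^esub> q"
        have rc: "?r \<in> carrier S" using qc cm by simp
        have "?r v = (if v = u then \<zero> else \<ominus> q v)" for v
          using S_minus[OF cm qc] q(3) S_coeff[OF qc] c by (auto simp: S_ops mon_def minus_eq r_neg)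
        then have "?r \<in> supp_in (carrier R) (B - {u})"
          using q(2) rc S_coeff[OF qc] by (auto simp: supp_in_def split: if_splits)
        moreover have "c \<odot>\<^bsub>S\<^esub> mon R u \<ominus>\<^bsub>S\<^esub> ?r = q"
          using cm qc S_coeff[OF qc] S_coeff[OF cm]
          by (simp add: M.M.minus_eq M.M.minus_add M.M.r_neg1 M.M.a_assoc[symmetric] M.M.r_neg)
        ultimately show "\<exists>q\<in>supp_in (carrier R) (B - {u}). c \<odot>\<^bsub>S\<^esub> mon R u \<ominus>\<^bsub>S\<^esub> q \<in> N"
          using q(1) by metis
      qed
      finally show ?thesis .
    qed
    show ?thesis
    proof
      assume i: ?ind
      show "N \<inter> supp_in (carrier R) B \<subseteq> sat R S f {\<zero>\<^bsub>S\<^esub>}"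
      proof
        fix q assume q: "q \<in> N \<inter> supp_in (carrier R) B"
        then have qc: "q \<in> carrier S" using supp_in_sub by blast
        have "\<exists>t::nat. (f [^] t) \<otimes> q u = \<zero>" for u
        proof (cases "u \<in> B")
          case True
          have "q u \<odot>\<^bsub>?T\<^esub> ?c (mon R u) \<in> lspan ?T (carrier R) ((\<lambda>u. ?c (mon R u)) ` B - {?c (mon R u)})"
            using key[OF True S_coeff[OF qc]] q by blast
          then show ?thesis using i True S_coeff[OF qc] by blast
        next
          case False
          then have "q u = \<zero>" using q by (auto simp: supp_in_def)
          then show ?thesis using pw by auto
        qed
        then show "q \<in> sat R S f {\<zero>\<^bsub>S\<^esub>}" using sat_zeroI[OF f(1) qc] by blast
      qed
    next
      assume i: "N \<inter> supp_in (carrier R) B \<subseteq> sat R S f {\<zero>\<^bsub>S\<^esub>}"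
      show ?ind
      proof (intro ballI impI)
        fix x c assume x: "x \<in> (\<lambda>u. ?c (mon R u)) ` B" and c: "c \<in> carrier R"
          and m: "c \<odot>\<^bsub>?T\<^esub> x \<in> lspan ?T (carrier R) ((\<lambda>u. ?c (mon R u)) ` B - {x})"
        obtain u where u: "u \<in> B" "x = ?c (mon R u)" using x by blast
        obtain q where q: "q \<in> N \<inter> supp_in (carrier R) B" "q u = c" using key[OF u(1) c] m u(2) by blast
        then have "q \<in> sat R S f {\<zero>\<^bsub>S\<^esub>}" using i by blast
        then show "\<exists>t::nat. (f [^] t) \<otimes> c = \<zero>" using sat_zeroD q(2) by blast
      qed
    qed
  qed
  have injp: "inj_on (\<lambda>u. ?c (mon R u)) B" if pb: "N \<inter> supp_in (carrier R) B \<subseteq> sat R S f {\<zero>\<^bsub>S\<^esub>}"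
  proof (rule inj_onI, rule ccontr)
    fix u v assume uv: "u \<in> B" "v \<in> B" "?c (mon R u) = ?c (mon R v)" "u \<noteq> v"
    let ?q = "mon R u \<ominus>\<^bsub>S\<^esub> mon R v"
    have "?q \<in> N" using ceq[OF mX mX] uv by blast
    moreover have "?q \<in> supp_in (carrier R) B"
      using M.submodule_diff[OF supp_in_submodule[OF oneideal Be]] mon_supp_in[OF _ Be] uv by blast
    ultimately have "?q \<in> sat R S f {\<zero>\<^bsub>S\<^esub>}" using pb by blast
    then obtain t :: nat where "(f [^] t) \<otimes> ?q u = \<zero>" using sat_zeroD by blast
    moreover have "?q u = \<one>"
    proof -
      have "mon R u \<in> carrier S" "mon R v \<in> carrier S" using mon_closed uv Be by auto
      from S_minus[OF this] show ?thesis using uv(4) by (simp add: mon_def minus_eq)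
    qed
    ultimately show False using f pw by simp
  qed
  have Tc: "(\<lambda>u. ?c (mon R u)) ` B \<subseteq> carrier ?T" unfolding Q.carrier_quot using mX by blast
  show ?thesis
  proof
    assume pb: "poly_basis f a N B"
    have inj: "inj_on (\<lambda>u. ?c (mon R u)) B" using injp pb unfolding poly_basis_def by blast
    then show "loc_basis R ?T f ((\<lambda>u. ?c (mon R u)) ` B) \<and> inj_on (\<lambda>u. ?c (mon R u)) B"
      using pb Tc span ind[OF inj] unfolding poly_basis_def loc_basis_def by simp
  next
    assume lb: "loc_basis R ?T f ((\<lambda>u. ?c (mon R u)) ` B) \<and> inj_on (\<lambda>u. ?c (mon R u)) B"
    then have "finite B" unfolding loc_basis_def by (meson finite_imageD)
    then show "poly_basis f a N B"
      using lb B span ind unfolding poly_basis_def loc_basis_def by simp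
  qed
qed

end

section \<open>Division with respect to leading exponents modulo a maximal ideal\<close>

context graded_poly
begin

definition std :: "'a set \<Rightarrow> 'g \<Rightarrow> (nat multiset \<Rightarrow> 'a) set \<Rightarrow> nat multiset set" where
  "std \<mm> a N = deg a - lead \<mm> N"

lemma restrict_monomials_closed:
  "p \<in> carrier S \<Longrightarrow> (\<lambda>u. if u \<in> Z then p u else \<zero>) \<in> carrier S"
  using S_map_closed[of p "\<lambda>u x. if u \<in> Z then x else \<zero>"] S_coeff by auto

lemma restrict_monomials_split:
  "p \<in> carrier S \<Longrightarrow> p = (\<lambda>u. if u \<in> Z then p u else \<zero>) \<oplus>\<^bsub>S\<^esub> (\<lambda>u. if u \<in> - Z then p u else \<zero>)"
  using S_coeff by (auto simp: S_ops)

text \<open>Division with remainder over the residue field. The polynomials for which it succeeds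
  form a submodule T, so monomials suffice. A non-leading monomial is its own remainder; a leading
  one is reduced by an element of N made monic modulo \<mm>, and well-founded induction treats what
  is left.\<close>

lemma reduce_mod:
  assumes m: "maximalideal \<mm> R" and N: "submodule N R S" "N \<subseteq> Xc {a}" and p: "p \<in> Xc {a}"
  shows "\<exists>q\<in>N. \<forall>u\<in>lead \<mm> N. p u \<ominus> q u \<in> \<mm>"
proof -
  interpret m: maximalideal \<mm> R by (rule m)
  have mi: "ideal \<mm> R" ..
  have NS: "N \<subseteq> carrier S" using N M.submoduleE(1) by blast
  define T where "T = {p \<in> Xc {a}. \<exists>q\<in>N. \<forall>u\<in>lead \<mm> N. p u \<ominus> q u \<in> \<mm>}"
  have Xcoeff: "p u \<in> carrier R" if "p \<in> Xc {a}" for p u using that Xc_sub S_coeff by blast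
  have Ncoeff: "p u \<in> carrier R" if "p \<in> N" for p u using that NS S_coeff by blast
  have T: "submodule T R S"
  proof (rule M.submoduleI2)
    show "T \<subseteq> carrier S" using Xc_sub by (auto simp: T_def)
    have "\<zero>\<^bsub>S\<^esub> \<in> N" "\<zero>\<^bsub>S\<^esub> \<in> Xc {a}" using M.submodule_zero N submodule_Xc by auto
    then show "\<zero>\<^bsub>S\<^esub> \<in> T" unfolding T_def using ideal_zero[OF mi]
      by (intro CollectI conjI bexI[of _ "\<zero>\<^bsub>S\<^esub>"]) (auto simp: S_ops minus_eq)
  next
    fix x y assume "x \<in> T" "y \<in> T"
    then obtain q r where q: "x \<in> Xc {a}" "q \<in> N" "\<And>u. u \<in> lead \<mm> N \<Longrightarrow> x u \<ominus> q u \<in> \<mm>"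
      and r: "y \<in> Xc {a}" "r \<in> N" "\<And>u. u \<in> lead \<mm> N \<Longrightarrow> y u \<ominus> r u \<in> \<mm>"
      unfolding T_def by blast
    have "(x \<oplus>\<^bsub>S\<^esub> y) u \<ominus> (q \<oplus>\<^bsub>S\<^esub> r) u \<in> \<mm>" if u: "u \<in> lead \<mm> N" for u
    proof -
      have "(x \<oplus>\<^bsub>S\<^esub> y) u \<ominus> (q \<oplus>\<^bsub>S\<^esub> r) u = (x u \<ominus> q u) \<oplus> (y u \<ominus> r u)"
        using Xcoeff q r Ncoeff by (simp add: S_ops minus_eq minus_add a_ac)
      then show ?thesis using ideal_add[OF mi q(3)[OF u] r(3)[OF u]] by simp
    qed
    moreover have "x \<oplus>\<^bsub>S\<^esub> y \<in> Xc {a}" "q \<oplus>\<^bsub>S\<^esub> r \<in> N"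
      using M.submoduleE(5)[OF submodule_Xc q(1) r(1)] M.submoduleE(5)[OF N(1) q(2) r(2)] by auto
    ultimately show "x \<oplus>\<^bsub>S\<^esub> y \<in> T" unfolding T_def by blast
  next
    fix c x assume c: "c \<in> carrier R" and "x \<in> T"
    then obtain q where q: "x \<in> Xc {a}" "q \<in> N" "\<And>u. u \<in> lead \<mm> N \<Longrightarrow> x u \<ominus> q u \<in> \<mm>"
      unfolding T_def by blast
    have "(c \<odot>\<^bsub>S\<^esub> x) u \<ominus> (c \<odot>\<^bsub>S\<^esub> q) u \<in> \<mm>" if u: "u \<in> lead \<mm> N" for u
    proof -
      have "(c \<odot>\<^bsub>S\<^esub> x) u \<ominus> (c \<odot>\<^bsub>S\<^esub> q) u = c \<otimes> (x u \<ominus> q u)"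
        using Xcoeff q Ncoeff c by (simp add: S_ops minus_eq r_distr r_minus)
      then show ?thesis using ideal_mult_left[OF mi c q(3)[OF u]] by simp
    qed
    moreover have "c \<odot>\<^bsub>S\<^esub> x \<in> Xc {a}" "c \<odot>\<^bsub>S\<^esub> q \<in> N"
      using M.submoduleE(4)[OF submodule_Xc c q(1)] M.submoduleE(4)[OF N(1) c q(2)] by auto
    ultimately show "c \<odot>\<^bsub>S\<^esub> x \<in> T" unfolding T_def by blast
  qed
  have NT: "N \<subseteq> T"
  proof
    fix q assume q: "q \<in> N"
    have "q u \<ominus> q u \<in> \<mm>" for u using Ncoeff[OF q] ideal_zero[OF mi] by (simp add: minus_eq r_neg)
    then show "q \<in> T" unfolding T_def using q N(2) by blast
  qed
  have KT: "x \<in> T" if x: "x \<in> Xc {a}" "\<And>u. u \<in> lead \<mm> N \<Longrightarrow> x u \<in> \<mm>" for x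
  proof -
    have "x u \<ominus> \<zero>\<^bsub>S\<^esub> u \<in> \<mm>" if "u \<in> lead \<mm> N" for u
      using x(2)[OF that] Xcoeff[OF x(1)] by (simp add: S_ops minus_eq)
    then show ?thesis using x(1) M.submodule_zero[OF N(1)] unfolding T_def by blast
  qed
  have mon: "mon R w \<in> T" if "w \<in> deg a" for w
    using that
  proof (induction w rule: less_induct)
    case (less w)
    have wX: "mon R w \<in> Xc {a}" using less.prems mon_closed by (auto simp: Xc_iff mon_def deg_def)
    show ?case
    proof (cases "w \<in> lead \<mm> N")
      case False
      then show ?thesis using wX ideal_zero[OF mi] by (intro KT) (auto simp: mon_def)
    next
      case True
      then obtain p where p: "p \<in> N" "p w \<notin> \<mm>" "\<And>v. v > w \<Longrightarrow> p v \<in> \<mm>" unfolding lead_def by blast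
      obtain c where c: "c \<in> carrier R" "c \<otimes> p w \<ominus> \<one> \<in> \<mm>"
        using maximal_inverse[OF m Ncoeff[OF p(1)] p(2)] by blast
      let ?q = "c \<odot>\<^bsub>S\<^esub> p"
      have q: "?q \<in> N" using M.submoduleE(4)[OF N(1) c(1) p(1)] .
      have qX: "?q \<in> Xc {a}" using q N by blast
      let ?r = "mon R w \<ominus>\<^bsub>S\<^esub> ?q"
      have rX: "?r \<in> Xc {a}" using M.submodule_diff[OF submodule_Xc wX qX] .
      have rS: "?r \<in> carrier S" using rX Xc_sub by blast
      have rv: "?r v = mon R w v \<ominus> c \<otimes> p v" for v
        using S_minus[OF subsetD[OF Xc_sub wX] subsetD[OF Xc_sub qX]] by (simp add: S_ops)
      \<comment> \<open>The remainder is split at w: below w the induction hypothesis applies to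
        each monomial, and from w upwards all coefficients lie in \<mm>, so nothing has to be
        subtracted.\<close>
      let ?r1 = "\<lambda>v. if v \<in> {v. v < w} then ?r v else \<zero>" and ?r2 = "\<lambda>v. if v \<in> - {v. v < w} then ?r v else \<zero>"
      have r1S: "?r1 \<in> carrier S" and r2S: "?r2 \<in> carrier S"
        using restrict_monomials_closed[OF rS] by blast+
      have "?r1 \<in> supp_in (carrier R) {v \<in> deg a. v < w}"
        using r1S rX S_coeff[OF r1S] unfolding supp_in_def by (auto simp: Xc_iff deg_def S_carrier)
      then have "?r1 \<in> lspan S (carrier R) (mon R ` {v \<in> deg a. v < w})"
        by (simp add: supp_in_lspan[OF oneideal] deg_def)
      moreover have "mon R ` {v \<in> deg a. v < w} \<subseteq> T" using less.IH by blast
      ultimately have r1T: "?r1 \<in> T" using M.span_subset[OF T] by blast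
      have r2T: "?r2 \<in> T"
      proof (rule KT)
        show "?r2 \<in> Xc {a}" using r2S rX by (auto simp: Xc_iff)
        fix u
        have "?r u \<in> \<mm>" if "\<not> u < w"
        proof (cases "u = w")
          case True
          then have "?r u = \<ominus> (c \<otimes> p w \<ominus> \<one>)"
            unfolding rv using c Ncoeff[OF p(1)] True by (simp add: mon_def minus_eq minus_add a_ac)
          then show ?thesis using ideal_minus[OF mi c(2)] by simp
        next
          case False
          then have "p u \<in> \<mm>" using that p(3) by (meson linorder_neqE)
          moreover have "?r u = \<ominus> (c \<otimes> p u)"
            unfolding rv using False c Ncoeff[OF p(1)] by (simp add: mon_def minus_eq)
          ultimately show ?thesis using ideal_minus[OF mi] ideal_mult_left[OF mi c(1)] by simp
        qed
        then show "?r2 u \<in> \<mm>" using ideal_zero[OF mi] by simp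
      qed
      have "?r \<in> T"
        using restrict_monomials_split[OF rS, of "{v. v < w}"] M.submoduleE(5)[OF T r1T r2T] by simp
      moreover have "?q \<in> T" using q NT by blast
      moreover have "mon R w = ?r \<oplus>\<^bsub>S\<^esub> ?q"
        using subsetD[OF Xc_sub wX] subsetD[OF Xc_sub qX] by (simp add: M.M.minus_eq M.M.a_assoc M.M.l_neg)
      ultimately show ?thesis using M.submoduleE(5)[OF T] by metis
    qed
  qed
  have "Xc {a} \<subseteq> T"
    unfolding Xc_supp supp_in_lspan[OF oneideal deg_sub[OF subset_refl]]
    using M.span_subset[OF T] mon by blast
  then show ?thesis using p unfolding T_def by blast
qed

text \<open>Otherwise the largest exponent with a coefficient outside \<mm> would be a leading
  exponent, where the coefficient is in \<mm> by assumption.\<close>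

lemma lead_coeff_mod:
  assumes mi: "ideal \<mm> R" and N: "N \<subseteq> carrier S" and q: "q \<in> N" "\<And>u. u \<in> lead \<mm> N \<Longrightarrow> q u \<in> \<mm>"
  shows "q u \<in> \<mm>"
proof (rule ccontr)
  assume "q u \<notin> \<mm>"
  let ?A = "{u. q u \<notin> \<mm>}"
  have "?A \<subseteq> {u. q u \<noteq> \<zero>}" using ideal_zero[OF mi] by auto
  moreover have "finite {u. q u \<noteq> \<zero>}" using q(1) N by (auto simp: S_carrier)
  ultimately have fin: "finite ?A" by (rule finite_subset)
  have ne: "?A \<noteq> {}" using \<open>q u \<notin> \<mm>\<close> by blast
  have "Max ?A \<in> ?A" using Max_in[OF fin ne] .
  moreover have "q v \<in> \<mm>" if "v > Max ?A" for v using Max_ge[OF fin, of v] that leD by blast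
  ultimately have "Max ?A \<in> lead \<mm> N" unfolding lead_def using q(1) by blast
  then show False using q(2) \<open>Max ?A \<in> ?A\<close> by blast
qed

text \<open>Over the residue field the standard monomials span S_a/N by \<open>reduce_mod\<close>
  and are independent by \<open>lead_coeff_mod\<close>. Steinitz exchange against a local basis
  provided by local freeness gives the cardinality and lifts the statement to a neighbourhood of
  \<mm>.\<close>

lemma std_basis:
  assumes m: "maximalideal \<mm> R" and N: "submodule N R S" "N \<subseteq> Xc {a}"
    and lf: "locally_free R (quot_module (P {a}) N) r"
  shows "card (std \<mm> a N) = r" "\<exists>f\<in>carrier R - \<mm>. poly_basis f a N (std \<mm> a N)"
proof -
  interpret m: maximalideal \<mm> R by (rule m)
  have mi: "ideal \<mm> R" ..
  have mp: "primeideal \<mm> R" using maximalideal_prime[OF m] .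
  interpret mp: primeideal \<mm> R by (rule mp)
  have mc: "\<mm> \<subseteq> carrier R" using ideal_subset[OF mi] .
  interpret Q: quot_mod R "P {a}" N by (rule coset_mod[OF N])
  let ?T = "quot_module (P {a}) N"
  interpret T: module R ?T by (rule Q.quot_module)
  let ?c = "\<lambda>x. N +>\<^bsub>P {a}\<^esub> x"
  let ?B = "std \<mm> a N"
  have NS: "N \<subseteq> carrier S" using N M.submoduleE(1) by blast
  have Bd: "?B \<subseteq> deg a" by (auto simp: std_def)
  have Be: "?B \<subseteq> expo n" using deg_sub[OF Bd] .
  have mX: "mon R u \<in> Xc {a}" if "u \<in> deg a" for u
    using that mon_closed by (auto simp: Xc_iff mon_def deg_def)
  have lsp: "lspan ?T C ((\<lambda>u. ?c (mon R u)) ` Z) = ?c ` supp_in C Z" if Z: "Z \<subseteq> deg a" and C: "ideal C R" for Z C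
  proof -
    have "mon R ` Z \<subseteq> Xc {a}" using mX that by blast
    then have "lspan ?T C (?c ` mon R ` Z) = ?c ` lspan S C (mon R ` Z)"
      using Q.lspan_quot[OF ideal_subset[OF C], of "mon R ` Z"] by (simp add: lspan_P)
    then show ?thesis using supp_in_lspan[OF C deg_sub[OF Z]] by (simp add: image_image)
  qed
  have ceq: "?c x = ?c y \<longleftrightarrow> x \<ominus>\<^bsub>S\<^esub> y \<in> N" if "x \<in> Xc {a}" "y \<in> Xc {a}" for x y
    using Q.coset_eq_iff[OF that] P_minus[OF that] by simp
  have Bl: "u \<notin> lead \<mm> N" if "u \<in> ?B" for u using that by (simp add: std_def)
  have inj: "inj_on (\<lambda>u. ?c (mon R u)) ?B"
  proof (rule inj_onI, rule ccontr)
    fix u v assume uv: "u \<in> ?B" "v \<in> ?B" "?c (mon R u) = ?c (mon R v)" "u \<noteq> v"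
    let ?q = "mon R u \<ominus>\<^bsub>S\<^esub> mon R v"
    have qN: "?q \<in> N" using ceq[OF mX mX] uv Bd by blast
    have qw: "?q w = mon R u w \<ominus> mon R v w" for w
      using S_minus[OF mon_closed mon_closed, of u v] uv(1,2) Be by (metis subsetD)
    have "?q w \<in> \<mm>" if "w \<in> lead \<mm> N" for w
      using Bl[OF uv(1)] Bl[OF uv(2)] that ideal_zero[OF mi] unfolding qw
      by (auto simp: mon_def minus_eq)
    then have "?q u \<in> \<mm>" using lead_coeff_mod[OF mi NS qN] by blast
    moreover have "?q u = \<one>" unfolding qw using uv(4) by (simp add: mon_def minus_eq)
    ultimately show False using mp.one_notin by simp
  qed
  have spm: "\<exists>x1\<in>lspan ?T (carrier R) ((\<lambda>u. ?c (mon R u)) ` ?B). \<exists>x2\<in>lspan ?T \<mm> (carrier ?T).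
      x = x1 \<oplus>\<^bsub>?T\<^esub> x2" if xT: "x \<in> carrier ?T" for x
  proof -
    obtain p where p: "p \<in> Xc {a}" "x = ?c p" using xT unfolding Q.carrier_quot by blast
    obtain q where q: "q \<in> N" "\<And>u. u \<in> lead \<mm> N \<Longrightarrow> p u \<ominus> q u \<in> \<mm>"
      using reduce_mod[OF m N p(1)] by blast
    have pS: "p \<in> carrier S" and qS: "q \<in> carrier S" using p(1) Xc_sub q(1) NS by auto
    have qX: "q \<in> Xc {a}" using q N by blast
    let ?d = "p \<ominus>\<^bsub>S\<^esub> q"
    have dX: "?d \<in> Xc {a}" using M.submodule_diff[OF submodule_Xc p(1) qX] .
    have dS: "?d \<in> carrier S" using dX Xc_sub by blast
    let ?d1 = "\<lambda>u. if u \<in> ?B then ?d u else \<zero>" and ?d2 = "\<lambda>u. if u \<in> - ?B then ?d u else \<zero>"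
    have d1S: "?d1 \<in> carrier S" and d2S: "?d2 \<in> carrier S"
      using restrict_monomials_closed[OF dS] by blast+
    have d1: "?d1 \<in> supp_in (carrier R) ?B"
      using d1S S_coeff[OF d1S] by (auto simp: supp_in_def)
    have d2: "?d2 \<in> supp_in \<mm> (deg a)"
    proof -
      have "?d2 u \<in> \<mm> \<and> (?d2 u \<noteq> \<zero> \<longrightarrow> u \<in> deg a)" for u
      proof (cases "u \<in> deg a")
        case True
        then show ?thesis using q(2)[of u] S_minus[OF pS qS] ideal_zero[OF mi] by (auto simp: std_def)
      next
        case False
        then have "?d u = \<zero>" using dX by (auto simp: Xc_iff deg_def S_carrier)
        then show ?thesis using ideal_zero[OF mi] by simp
      qed
      then show ?thesis using d2S unfolding supp_in_def by blast
    qed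
    have d1X: "?d1 \<in> Xc {a}" using d1 supp_in_Xc[OF Bd] by blast
    have d2X: "?d2 \<in> Xc {a}" using d2 supp_in_Xc[OF subset_refl] by blast
    have "p \<ominus>\<^bsub>S\<^esub> ?d = q" using pS qS
      by (simp add: M.M.minus_eq M.M.minus_add M.M.a_assoc[symmetric] M.M.r_neg)
    then have "x = ?c ?d" using ceq[OF p(1) dX] q(1) p(2) by simp
    also have "\<dots> = ?c ?d1 \<oplus>\<^bsub>?T\<^esub> ?c ?d2"
      using Q.add_quot[OF d1X d2X] restrict_monomials_split[OF dS, of ?B] by (simp add: P_ops)
    finally have "x = ?c ?d1 \<oplus>\<^bsub>?T\<^esub> ?c ?d2" .
    moreover have "?c ?d1 \<in> lspan ?T (carrier R) ((\<lambda>u. ?c (mon R u)) ` ?B)"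
      unfolding lsp[OF Bd oneideal] using d1 by (rule imageI)
    moreover have "?c ?d2 \<in> lspan ?T \<mm> (carrier ?T)"
    proof -
      have "?c ?d2 \<in> lspan ?T \<mm> ((\<lambda>u. ?c (mon R u)) ` deg a)"
        unfolding lsp[OF subset_refl mi] using d2 by (rule imageI)
      moreover have "(\<lambda>u. ?c (mon R u)) ` deg a \<subseteq> carrier ?T" unfolding Q.carrier_quot using mX by blast
      then have "lspan ?T \<mm> ((\<lambda>u. ?c (mon R u)) ` deg a) \<subseteq> lspan ?T \<mm> (carrier ?T)"
        by (rule lspan_mono[OF subset_refl])
      ultimately show ?thesis by (rule subsetD[rotated])
    qed
    ultimately show ?thesis by (intro bexI)
  qed
  have indm: "c \<in> \<mm>" if x: "x \<in> (\<lambda>u. ?c (mon R u)) ` ?B" and c: "c \<in> carrier R"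
    and x1: "x1 \<in> lspan ?T (carrier R) ((\<lambda>u. ?c (mon R u)) ` ?B - {x})"
    and x2: "x2 \<in> lspan ?T \<mm> (carrier ?T)" and eq: "c \<odot>\<^bsub>?T\<^esub> x = x1 \<oplus>\<^bsub>?T\<^esub> x2" for x c x1 x2
  proof -
    obtain u where u: "u \<in> ?B" "x = ?c (mon R u)" using x by blast
    have ud: "u \<in> deg a" using u Bd by blast
    have "(\<lambda>u. ?c (mon R u)) ` ?B - {x} = (\<lambda>u. ?c (mon R u)) ` (?B - {u})"
      using inj u by (auto simp: inj_on_def)
    moreover have Bu: "?B - {u} \<subseteq> deg a" using Bd by blast
    ultimately have "x1 \<in> ?c ` supp_in (carrier R) (?B - {u})" using x1 lsp[OF _ oneideal, of "?B - {u}"] by simp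
    then obtain d where d: "d \<in> supp_in (carrier R) (?B - {u})" "x1 = ?c d" by (rule imageE) 
    \<comment> \<open>Elements of the quotient that lie in \<mm> times it are cosets of polynomials
      with all coefficients in \<mm>; so the relation becomes an element of N whose coefficients can
      be compared modulo \<mm>.\<close>
    have "lspan ?T \<mm> (carrier ?T) = ?c ` lspan S \<mm> (Xc {a})"
      unfolding Q.carrier_quot using Q.lspan_quot[OF mc subset_refl] by (simp add: lspan_P)
    moreover have "lspan S \<mm> (Xc {a}) \<subseteq> supp_in \<mm> (deg a)"
    proof (rule M.lspan_subset[OF supp_in_submodule[OF mi deg_sub[OF subset_refl]]])
      fix c y assume c: "c \<in> \<mm>" and y: "y \<in> Xc {a}"
      have cR: "c \<in> carrier R" using c mc by blast
      have "c \<odot>\<^bsub>S\<^esub> y \<in> Xc {a}" using M.submoduleE(4)[OF submodule_Xc cR y] .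
      then have "c \<odot>\<^bsub>S\<^esub> y \<in> supp_in (carrier R) (deg a)" by (simp add: Xc_supp)
      moreover have "(c \<odot>\<^bsub>S\<^esub> y) u \<in> \<mm>" for u
        using m.I_r_closed[OF c S_coeff[OF subsetD[OF Xc_sub y]]] by (simp add: S_ops)
      ultimately show "c \<odot>\<^bsub>S\<^esub> y \<in> supp_in \<mm> (deg a)" by (simp add: supp_in_def)
    qed
    ultimately obtain e where e: "e \<in> supp_in \<mm> (deg a)" "x2 = ?c e" using x2 by blast
    have dX: "d \<in> Xc {a}" using d(1) supp_in_Xc[OF Bu] by blast
    have eX: "e \<in> Xc {a}" using e(1) supp_in_Xc[OF subset_refl] by blast
    have cX: "c \<odot>\<^bsub>S\<^esub> mon R u \<in> Xc {a}" using M.submoduleE(4)[OF submodule_Xc c mX[OF ud]] .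
    have deX: "d \<oplus>\<^bsub>S\<^esub> e \<in> Xc {a}" using M.submoduleE(5)[OF submodule_Xc dX eX] .
    have "?c (c \<odot>\<^bsub>S\<^esub> mon R u) = ?c (d \<oplus>\<^bsub>S\<^esub> e)"
      using eq Q.smult_quot[OF c mX[OF ud]] Q.add_quot[OF dX eX] by (simp add: P_ops u(2) d(2) e(2))
    then have qN: "c \<odot>\<^bsub>S\<^esub> mon R u \<ominus>\<^bsub>S\<^esub> (d \<oplus>\<^bsub>S\<^esub> e) \<in> N" (is "?q \<in> N") using ceq[OF cX deX] by blast
    have qw: "?q w = c \<otimes> mon R u w \<ominus> (d w \<oplus> e w)" for w
      using S_minus[OF subsetD[OF Xc_sub cX] subsetD[OF Xc_sub deX]] by (simp add: S_ops)
    have em: "e w \<in> \<mm>" for w using e(1) by (simp add: supp_in_def)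
    have eR: "e w \<in> carrier R" for w using em mc by blast
    have "?q w \<in> \<mm>" if w: "w \<in> lead \<mm> N" for w
    proof -
      have "w \<noteq> u" "w \<notin> ?B" using w Bl[OF u(1)] by (auto simp: std_def)
      then have "d w = \<zero>" "mon R u w = \<zero>" using d(1) by (auto simp: supp_in_def mon_def)
      then have "?q w = \<ominus> e w" unfolding qw using c eR by (simp add: minus_eq)
      then show ?thesis using ideal_minus[OF mi em] by simp
    qed
    then have "?q u \<in> \<mm>" using lead_coeff_mod[OF mi NS qN] by blast
    moreover have "d u = \<zero>" using d(1) by (auto simp: supp_in_def)
    then have "?q u = c \<ominus> e u" unfolding qw using c eR by (simp add: mon_def)
    ultimately have "(c \<ominus> e u) \<oplus> e u \<in> \<mm>" using ideal_add[OF mi _ em] by simp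
    then show "c \<in> \<mm>" using c eR by (simp add: minus_eq a_assoc l_neg)
  qed
  obtain f E where f: "f \<in> carrier R - \<mm>" "loc_basis R ?T f E" "card E = r"
    using T.locally_free_imp_loc_basis[OF mp lf] by blast
  have Tc: "(\<lambda>u. ?c (mon R u)) ` ?B \<subseteq> carrier ?T" unfolding Q.carrier_quot using mX Bd by blast
  have res: "finite ((\<lambda>u. ?c (mon R u)) ` ?B) \<and> card ((\<lambda>u. ?c (mon R u)) ` ?B) = card E \<and>
      (\<exists>f'\<in>carrier R - \<mm>. loc_basis R ?T f' ((\<lambda>u. ?c (mon R u)) ` ?B))"
    by (rule T.loc_basis_exchange[OF mp f(1,2) Tc spm indm])
  then show "card ?B = r" using f(3) inj by (simp add: card_image)
  obtain f' where f': "f' \<in> carrier R - \<mm>" "loc_basis R ?T f' ((\<lambda>u. ?c (mon R u)) ` ?B)" using res by blast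
  have "f' [^] t \<noteq> \<zero>" for t :: nat using mp.pow_notin[OF f'(1), of t] ideal_zero[OF mi] by auto
  then have "poly_basis f' a N ?B"
    using poly_basis_loc_basis[OF N, of f' ?B] f' inj Bd by simp
  then show "\<exists>f\<in>carrier R - \<mm>. poly_basis f a N ?B" using f'(1) by blast
qed

end

section \<open>The ideal generated by a point of the truncated Hilbert functor\<close>

text \<open>The denominators commute with the coefficients, and C is an ideal, so rewriting the
  generators in Y by those in Z keeps the coefficients in C. With C = \<mm> this preserves smallness
  of coefficients.\<close>

lemma (in module) sat_lspan:
  assumes f: "f \<in> carrier R" and C: "ideal C R" and Z: "Z \<subseteq> carrier M"
    and Y: "Y \<subseteq> sat R M f (lspan M (carrier R) Z)"
  shows "lspan M C Y \<subseteq> sat R M f (lspan M C Z)"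
proof (rule lspan_subset[OF sat_submodule[OF f lspan_submodule[OF C Z]]])
  fix c y assume c: "c \<in> C" and y: "y \<in> Y"
  have cR: "c \<in> carrier R" using c ideal_subset[OF C] by blast
  obtain t :: nat where t: "y \<in> carrier M" "(f [^] t) \<odot>\<^bsub>M\<^esub> y \<in> lspan M (carrier R) Z"
    using Y y satE by (metis subsetD)
  have "c \<odot>\<^bsub>M\<^esub> ((f [^] t) \<odot>\<^bsub>M\<^esub> y) \<in> lspan M C Z"
    using lspan_smult_gen[OF subset_refl Z t(2) cR _ ideal_subset[OF C]] ideal.I_r_closed[OF C c] by blast
  then show "c \<odot>\<^bsub>M\<^esub> y \<in> sat R M f (lspan M C Z)"
    using cR t f by (intro satI[where t=t]) (auto simp: smult_comm)
qed

context poly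
begin

lemma lspan_shift:
  assumes C: "C \<subseteq> carrier R" and x: "x \<in> lspan S C Y"
  shows "shift e x \<in> lspan S C (shift e ` Y)"
  using x
proof induction
  case lspan_zero
  then show ?case by (simp add: lspan.intros)
next
  case (lspan_step c y x)
  then have "shift e (c \<odot>\<^bsub>S\<^esub> y \<oplus>\<^bsub>S\<^esub> x) = c \<odot>\<^bsub>S\<^esub> shift e y \<oplus>\<^bsub>S\<^esub> shift e x"
    using C by (auto simp: shift_add shift_smult)
  then show ?case using lspan_step by (auto intro: lspan.intros)
qed

end

locale hilb_data = graded_poly R n dg for R (structure) and n and dg :: "nat multiset \<Rightarrow> 'g::ab_group_add" +
  fixes D :: "'g set" and L :: "(nat multiset \<Rightarrow> 'a) set"
  assumes finD: "finite D"
    and L_sub: "submodule L R S" and L_D: "L \<subseteq> Xc D" and L_hom: "homogeneous R dg L"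
    and L_shift: "a \<in> D \<Longrightarrow> b \<in> D \<Longrightarrow> t \<in> expo n \<Longrightarrow> dg t = b - a \<Longrightarrow> p \<in> L \<Longrightarrow> p \<in> Xc {a} \<Longrightarrow>
      shift t p \<in> L"
begin

definition "Lc b = L \<inter> Xc {b}"

definition "gens a = {shift t p | t p b. b \<in> D \<and> p \<in> Lc b \<and> t \<in> expo n \<and> dg t + b = a}"

definition "J a = lspan S (carrier R) (gens a)"

lemma Lc_submodule: "submodule (Lc b) R S"
proof (rule M.submoduleI2)
  show "Lc b \<subseteq> carrier S" using Xc_sub by (auto simp: Lc_def)
qed (use M.submodule_zero[OF L_sub] M.submodule_zero[OF submodule_Xc] M.submoduleE(4,5)[OF L_sub]
      M.submoduleE(4,5)[OF submodule_Xc] in \<open>auto simp: Lc_def\<close>)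

lemma Lc_Xc: "Lc b \<subseteq> Xc {b}"
  by (simp add: Lc_def)

lemma Lc_S: "Lc b \<subseteq> carrier S"
  using Lc_Xc Xc_sub by blast

lemma Lc_shift:
  assumes "a \<in> D" "b \<in> D" "t \<in> expo n" "dg t + a = b" "p \<in> Lc a" shows "shift t p \<in> Lc b"
  using assms L_shift[of a b t p] shift_Xc[of t p a b] by (auto simp: Lc_def)

lemma gens_Xc: "gens a \<subseteq> Xc {a}"
  using shift_Xc Lc_Xc by (auto simp: gens_def) blast

lemma gens_S: "gens a \<subseteq> carrier S"
  using gens_Xc Xc_sub by blast

lemma J_submodule: "submodule (J a) R S"
  unfolding J_def using M.span_submodule[OF gens_S] .

lemma J_Xc: "J a \<subseteq> Xc {a}"
  unfolding J_def using M.span_subset[OF submodule_Xc gens_Xc] .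

lemma J_S: "J a \<subseteq> carrier S"
  using J_Xc Xc_sub by blast

lemma J_gen: "b \<in> D \<Longrightarrow> p \<in> Lc b \<Longrightarrow> t \<in> expo n \<Longrightarrow> dg t + b = a \<Longrightarrow> shift t p \<in> J a"
  unfolding J_def by (rule M.lspan_base1[OF gens_S]) (unfold gens_def, blast)

text \<open>Generation adds nothing in the degrees of D, because a multiple x^t p between two such
  degrees is already in L.\<close>

lemma J_D: "b \<in> D \<Longrightarrow> J b = Lc b"
proof
  assume b: "b \<in> D"
  have "gens b \<subseteq> Lc b" using Lc_shift b by (auto simp: gens_def)
  then show "J b \<subseteq> Lc b" unfolding J_def using M.span_subset[OF Lc_submodule] by blast
  have dg0: "dg {#} = 0" using dg_add[of "{#}" "{#}"] by simp
  show "Lc b \<subseteq> J b"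
  proof
    fix p assume "p \<in> Lc b"
    then show "p \<in> J b" using J_gen[OF b, of p "{#}" b] dg0 by simp
  qed
qed

lemma J_shift:
  assumes t: "t \<in> expo n" "dg t + a = c" and p: "p \<in> J a" shows "shift t p \<in> J c"
proof -
  have "shift t p \<in> lspan S (carrier R) (shift t ` gens a)"
    using lspan_shift[OF subset_refl] p by (simp add: J_def)
  moreover have "shift t ` gens a \<subseteq> gens c"
  proof
    fix x assume "x \<in> shift t ` gens a"
    then obtain s q b where x: "x = shift t (shift s q)" "b \<in> D" "q \<in> Lc b" "s \<in> expo n" "dg s + b = a"
      by (auto simp: gens_def)
    then have "x = shift (t + s) q" "dg (t + s) + b = c" "t + s \<in> expo n"
      using t by (auto simp: shift_shift dg_add add.assoc)
    then show "x \<in> gens c" using x unfolding gens_def by blast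
  qed
  ultimately show ?thesis unfolding J_def using lspan_mono[OF subset_refl] by (metis subsetD)
qed

text \<open>The ideal generated by L, assembled from its graded pieces. Testing membership on
  components makes it homogeneous by construction.\<close>

definition "J_ideal = {p \<in> carrier S. \<forall>a. component R dg a p \<in> J a}"

lemma J_ideal_ideal: "ideal J_ideal S"
proof (rule shift_closed_ideal)
  show "submodule J_ideal R S"
  proof (rule M.submoduleI2)
    show "J_ideal \<subseteq> carrier S" by (auto simp: J_ideal_def)
  qed (use M.submodule_zero[OF J_submodule] M.submoduleE(4,5)[OF J_submodule] in
      \<open>auto simp: J_ideal_def component_add component_smult\<close>)
  fix t p assume t: "t \<in> expo n" and p: "p \<in> J_ideal"
  then have "component R dg a (shift t p) \<in> J a" for a
    using J_shift[OF t, of "a - dg t" a "component R dg (a - dg t) p"] component_shift[OF t, of p a]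
    by (simp add: J_ideal_def)
  then show "shift t p \<in> J_ideal" using t p shift_closed by (simp add: J_ideal_def)
qed

lemma J_ideal_homogeneous: "homogeneous R dg J_ideal"
proof -
  have "component R dg a p \<in> J_ideal" if "p \<in> J_ideal" for p a
    using that component_component[of _ a p] M.submodule_zero[OF J_submodule]
      subsetD[OF Xc_sub component_closed[of p a]] by (auto simp: J_ideal_def)
  then show ?thesis unfolding homogeneous_def by blast
qed

lemma J_ideal_component: "J_ideal \<inter> Xc {a} = J a"
proof (intro equalityI subsetI)
  fix p assume "p \<in> J_ideal \<inter> Xc {a}"
  then show "p \<in> J a" using component_self[of p a] by (auto simp: J_ideal_def) metis
next
  fix p assume p: "p \<in> J a"
  then have pX: "p \<in> Xc {a}" using J_Xc by blast
  have "component R dg b p \<in> J b" for b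
    using component_self[OF pX] component_other[OF pX, of b] p M.submodule_zero[OF J_submodule]
    by (cases "b = a") auto
  then show "p \<in> J_ideal \<inter> Xc {a}" using pX Xc_sub by (auto simp: J_ideal_def)
qed

lemma J_ideal_D: "restrict_degrees R n dg D J_ideal = L"
proof (intro equalityI subsetI)
  fix p assume "p \<in> restrict_degrees R n dg D J_ideal"
  then have p: "p \<in> J_ideal" "p \<in> Xc D" by (auto simp: restrict_iff)
  have "component R dg a p \<in> L" for a
  proof (cases "a \<in> D")
    case True
    then show ?thesis using p J_D by (auto simp: J_ideal_def Lc_def)
  next
    case False
    then have "component R dg a p = \<zero>\<^bsub>S\<^esub>"
      using p(2) by (intro ext) (auto simp: Xc_iff component_def S_ops)
    then show ?thesis using M.submodule_zero[OF L_sub] by simp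
  qed
  then show "p \<in> L" using sum_components[OF L_sub] p Xc_sub by blast
next
  fix p assume p: "p \<in> L"
  have pS: "p \<in> carrier S" using p L_D Xc_sub by blast
  have "component R dg a p \<in> J a" for a
  proof (cases "a \<in> D")
    case True
    have "component R dg a p \<in> L" using L_hom p unfolding homogeneous_def by blast
    then show ?thesis using True J_D component_closed[OF pS] by (simp add: Lc_def)
  next
    case False
    then have "component R dg a p = \<zero>\<^bsub>S\<^esub>"
      using subsetD[OF L_D p] by (intro ext) (auto simp: Xc_iff component_def S_ops)
    then show ?thesis using M.submodule_zero[OF J_submodule] by simp
  qed
  then show "p \<in> restrict_degrees R n dg D J_ideal"
    using p L_D pS by (auto simp: restrict_iff J_ideal_def)
qed

lemma J_minimal:
  assumes I: "ideal I S" and LI: "L \<subseteq> I" shows "J a \<subseteq> I"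
proof -
  have "gens a \<subseteq> I" using ideal_shift[OF I] LI by (auto simp: gens_def Lc_def)
  then show ?thesis unfolding J_def using M.span_subset[OF ideal_submodule[OF I]] by blast
qed

end

section \<open>Leading exponents and Buchberger's criterion at a maximal ideal\<close>

locale hilb_max = hilb_data R n dg D L + m: maximalideal \<mm> R
  for R (structure) and n and dg :: "nat multiset \<Rightarrow> 'g::ab_group_add" and D L and \<mm> +
  fixes U
  defines "U \<equiv> \<Union>b\<in>D. lead \<mm> (Lc b)"
begin

abbreviation "B \<equiv> std_mons n dg U"

lemma mi: "ideal \<mm> R" ..

lemma mp: "primeideal \<mm> R" using maximalideal_prime m.is_maximalideal .

lemma mc: "\<mm> \<subseteq> carrier R" using ideal_subset[OF mi] .

lemma B_deg: "B a \<subseteq> deg a" by (auto simp: std_mons_def deg_def)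

lemma B_expo: "B a \<subseteq> expo n" using deg_sub[OF B_deg] .

lemma lead_deg:
  assumes "N \<subseteq> Xc {b}" shows "lead \<mm> N \<subseteq> deg b"
proof
  fix u assume "u \<in> lead \<mm> N"
  then obtain p where p: "p \<in> N" "p u \<notin> \<mm>" by (auto simp: lead_def)
  then have "p u \<noteq> \<zero>" using ideal_zero[OF mi] by auto
  then show "u \<in> deg b" using p(1) assms by (auto simp: Xc_iff S_carrier deg_def)
qed

lemma U_iff: "u \<in> U \<longleftrightarrow> u \<in> expo n \<and> dg u \<in> D \<and> u \<in> lead \<mm> (Lc (dg u))"
proof
  assume "u \<in> U"
  then obtain b where b: "b \<in> D" "u \<in> lead \<mm> (Lc b)" by (auto simp: U_def)
  then have "u \<in> deg b" using lead_deg[OF Lc_Xc] by blast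
  then show "u \<in> expo n \<and> dg u \<in> D \<and> u \<in> lead \<mm> (Lc (dg u))" using b by (auto simp: deg_def)
qed (auto simp: U_def)

lemma U_sub: "U \<subseteq> {u \<in> expo n. dg u \<in> D}" using U_iff by blast

lemma U_expo: "U \<subseteq> expo n" using U_iff by blast

lemma lead_shift:
  assumes p: "p u \<notin> \<mm>" "\<And>v. v > u \<Longrightarrow> p v \<in> \<mm>"
  shows "shift t p (t + u) \<notin> \<mm>" "w > t + u \<Longrightarrow> shift t p w \<in> \<mm>"
proof -
  show "shift t p (t + u) \<notin> \<mm>" using p by (simp add: shift_eval)
  show "shift t p w \<in> \<mm>" if w: "w > t + u"
  proof (cases "shift t p w = \<zero>")
    case True
    then show ?thesis using ideal_zero[OF mi] by simp
  next
    case False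
    then obtain v where v: "w = t + v" "shift t p w = p v" by (rule shift_nonzeroE)
    then have "v > u" using w by simp
    then show ?thesis using v p by simp
  qed
qed

lemma deg_not_B: "w \<in> deg a \<Longrightarrow> w \<notin> B a \<longleftrightarrow> (\<exists>u\<in>U. u \<subseteq># w)"
  by (auto simp: std_mons_def deg_def)

text \<open>The order is compatible with addition, so a multiple of an element of L with leading
  exponent u has the correspondingly shifted leading exponent. Hence any N above J has at most the
  standard monomials \<open>B a\<close>.\<close>

lemma lead_J: "w \<in> deg a \<Longrightarrow> w \<notin> B a \<Longrightarrow> J a \<subseteq> N \<Longrightarrow> w \<in> lead \<mm> N"
proof -
  assume w: "w \<in> deg a" "w \<notin> B a" and JN: "J a \<subseteq> N"
  then obtain u where u: "u \<in> U" "u \<subseteq># w" using deg_not_B by blast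
  then have ul: "u \<in> expo n" "dg u \<in> D" "u \<in> lead \<mm> (Lc (dg u))" using U_iff by auto
  obtain p where p: "p \<in> Lc (dg u)" "p u \<notin> \<mm>" "\<And>v. v > u \<Longrightarrow> p v \<in> \<mm>"
    using ul(3) unfolding lead_def by blast
  have t: "w - u \<in> expo n" "dg (w - u) + dg u = a"
    using w u dg_diff[of w u] by (auto simp: deg_def expo_diff)
  have "shift (w - u) p \<in> N" using J_gen[OF ul(2) p(1) t] JN by blast
  moreover have "w - u + u = w" using u(2) by simp
  ultimately show "w \<in> lead \<mm> N" unfolding lead_def using lead_shift[of p u, OF p(2,3), where t = "w - u"] by auto
qed

lemma std_sub_B: "J a \<subseteq> N \<Longrightarrow> std \<mm> a N \<subseteq> B a"
  using lead_J by (auto simp: std_def)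

text \<open>In a degree b of D the multiples of leading exponents from other degrees are leading
  exponents of L already, since J b = L_b. So local freeness of S_b/L_b counts the standard
  monomials there.\<close>

lemma B_eq_std: "b \<in> D \<Longrightarrow> B b = std \<mm> b (Lc b)"
proof
  assume b: "b \<in> D"
  show "std \<mm> b (Lc b) \<subseteq> B b" using std_sub_B[of b "Lc b"] J_D[OF b] by simp
  show "B b \<subseteq> std \<mm> b (Lc b)"
  proof
    fix w assume w: "w \<in> B b"
    then have "w \<in> deg b" using B_deg by blast
    moreover have "w \<notin> lead \<mm> (Lc b)" using w b by (auto simp: U_def std_mons_def)
    ultimately show "w \<in> std \<mm> b (Lc b)" by (simp add: std_def)
  qed
qed

text \<open>Top-reduction modulo \<open>\<mm>\<close>: \<open>span_in a Y\<close> is spanned by the multiples \<open>x\<^sup>t p\<close> with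
  \<open>p\<close> in \<open>L\<close> all of whose monomials with coefficient outside \<open>\<mm>\<close> lie in \<open>Y\<close>.\<close>

definition "mults_in a Y = {shift t p | t p b. b \<in> D \<and> p \<in> Lc b \<and> t \<in> expo n \<and> dg t + b = a \<and>
  (\<forall>v. p v \<notin> \<mm> \<longrightarrow> t + v \<in> Y)}"

definition "span_in a Y = lspan S (carrier R) (mults_in a Y)"

lemma mults_in_gens: "mults_in a Y \<subseteq> gens a"
  unfolding mults_in_def gens_def by blast

lemma mults_in_S: "mults_in a Y \<subseteq> carrier S"
  using mults_in_gens gens_S by blast

lemma span_in_submodule: "submodule (span_in a Y) R S"
  unfolding span_in_def using M.span_submodule[OF mults_in_S] .

lemma span_in_S: "span_in a Y \<subseteq> carrier S"
  using M.submoduleE(1)[OF span_in_submodule] .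

lemma span_in_mono: "Y \<subseteq> Y' \<Longrightarrow> span_in a Y \<subseteq> span_in a Y'"
  unfolding span_in_def by (rule lspan_mono) (auto simp: mults_in_def, blast)

lemma span_in_UNIV: "span_in a UNIV = J a"
  unfolding span_in_def J_def mults_in_def gens_def by simp

lemma span_in_coeff:
  assumes "x \<in> span_in a Y" "w \<notin> Y" shows "x w \<in> \<mm>"
  using assms(1) unfolding span_in_def
proof induction
  case lspan_zero
  then show ?case using ideal_zero[OF mi] by (simp add: S_ops)
next
  case (lspan_step c y x)
  then obtain t p where y: "y = shift t p" "\<And>v. p v \<notin> \<mm> \<Longrightarrow> t + v \<in> Y" unfolding mults_in_def by blast
  have "y w \<in> \<mm>"
  proof (cases "shift t p w = \<zero>")
    case True
    then show ?thesis using y(1) ideal_zero[OF mi] by simp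
  next
    case False
    then obtain v where v: "w = t + v" "shift t p w = p v" by (rule shift_nonzeroE)
    then show ?thesis using y assms(2) by auto
  qed
  then show ?case using lspan_step(1,4) ideal_add[OF mi] ideal_mult_left[OF mi] by (simp add: S_ops)
qed

text \<open>Only finitely many multiples occur, and each has only finitely many coefficients outside
  \<mm>; w is the largest exponent among these. The first alternative is the case where there are
  none.\<close>

lemma span_in_split:
  assumes "x \<in> span_in a Y" shows "x \<in> span_in a {} \<or> (\<exists>w\<in>Y. x \<in> span_in a {..w})"
  using assms unfolding span_in_def[of a Y]
proof induction
  case lspan_zero
  then show ?case using M.submodule_zero[OF span_in_submodule] by blast
next
  case (lspan_step c y x)
  have gen: "y \<in> mults_in a Z \<Longrightarrow> c \<odot>\<^bsub>S\<^esub> y \<in> span_in a Z" for Z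
    unfolding span_in_def using M.lspan_base[OF subset_refl mults_in_S lspan_step(1)] .
  from lspan_step(2) obtain t p b where y: "y = shift t p" "b \<in> D" "p \<in> Lc b" "t \<in> expo n" "dg t + b = a"
    "\<And>v. p v \<notin> \<mm> \<Longrightarrow> t + v \<in> Y" unfolding mults_in_def by blast
  let ?Z = "{t + v | v. p v \<notin> \<mm>}"
  have "?Z \<subseteq> (\<lambda>v. t + v) ` {v. p v \<noteq> \<zero>}" using ideal_zero[OF mi] by auto
  moreover have "finite {v. p v \<noteq> \<zero>}" using subsetD[OF Lc_S y(3)] by (simp add: S_carrier)
  ultimately have fin: "finite ?Z" using finite_surj by blast
  have cy: "c \<odot>\<^bsub>S\<^esub> y \<in> span_in a {} \<or> (\<exists>w\<in>Y. c \<odot>\<^bsub>S\<^esub> y \<in> span_in a {..w})"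
  proof (cases "?Z = {}")
    case True
    then have "y \<in> mults_in a {}" unfolding mults_in_def using y by blast
    then show ?thesis using gen by blast
  next
    case False
    have "Max ?Z \<in> Y" using Max_in[OF fin False] y(6) by auto
    moreover have "t + v \<in> {..Max ?Z}" if "p v \<notin> \<mm>" for v
      using Max_ge[OF fin, of "t + v"] that by blast
    then have "y \<in> mults_in a {..Max ?Z}" unfolding mults_in_def using y(1-5) by blast
    ultimately show ?thesis using gen by blast
  qed
  have add: "c \<odot>\<^bsub>S\<^esub> y \<oplus>\<^bsub>S\<^esub> x \<in> span_in a Z" if "c \<odot>\<^bsub>S\<^esub> y \<in> span_in a Z" "x \<in> span_in a Z" for Z
    using M.submoduleE(5)[OF span_in_submodule that] .
  have up: "span_in a {} \<subseteq> span_in a Z" for Z by (rule span_in_mono) simp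
  have up2: "span_in a {..w} \<subseteq> span_in a {..w'}" if "w \<le> w'" for w w' using that by (intro span_in_mono) auto
  from cy lspan_step(4) show ?case
  proof (elim disjE bexE)
    fix w w' assume w: "w \<in> Y" "c \<odot>\<^bsub>S\<^esub> y \<in> span_in a {..w}" "w' \<in> Y" "x \<in> span_in a {..w'}"
    show ?thesis
    proof (cases "w \<le> w'")
      case True
      then show ?thesis using add[of "{..w'}"] up2[OF True] w by blast
    next
      case False
      then have "w' \<le> w" by simp
      then show ?thesis using add[of "{..w}"] up2[of w' w] w by blast
    qed
  qed (use add up in blast)+
qed

lemma span_in_gen_less:
  assumes "d \<in> D" "r \<in> Lc d" "\<And>v. r v \<notin> \<mm> \<Longrightarrow> v < l" "\<tau> \<in> expo n" "dg \<tau> + d = a" "\<tau> + l = w"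
  shows "shift \<tau> r \<in> span_in a {..<w}"
proof -
  have "\<tau> + v \<in> {..<w}" if "r v \<notin> \<mm>" for v using assms(3)[OF that] assms(6) by auto
  then have "shift \<tau> r \<in> mults_in a {..<w}" unfolding mults_in_def using assms by blast
  then show ?thesis unfolding span_in_def using M.lspan_base1[OF mults_in_S] by blast
qed

abbreviation "G \<equiv> min_mons n U"

lemma G_facts: "g \<in> G \<Longrightarrow> g \<in> expo n \<and> dg g \<in> D"
  using min_mons_sub U_iff by blast

lemma G_poly:
  assumes "g \<in> G"
  shows "\<exists>p\<in>Lc (dg g). p g \<ominus> \<one> \<in> \<mm> \<and> (\<forall>v>g. p v \<in> \<mm>)"
proof -
  have "g \<in> lead \<mm> (Lc (dg g))" using assms min_mons_sub U_iff by blast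
  then obtain p where p: "p \<in> Lc (dg g)" "p g \<notin> \<mm>" "\<And>v. v > g \<Longrightarrow> p v \<in> \<mm>"
    unfolding lead_def by blast
  have pR: "p v \<in> carrier R" for v using p(1) Lc_S S_coeff by blast
  obtain c where c: "c \<in> carrier R" "c \<otimes> p g \<ominus> \<one> \<in> \<mm>"
    using maximal_inverse[OF m.is_maximalideal pR p(2)] by blast
  have "c \<odot>\<^bsub>S\<^esub> p \<in> Lc (dg g)" using M.submoduleE(4)[OF Lc_submodule c(1) p(1)] .
  moreover have "(c \<odot>\<^bsub>S\<^esub> p) v \<in> \<mm>" if "v > g" for v
    using p(3)[OF that] ideal_mult_left[OF mi c(1)] by (simp add: S_ops)
  ultimately show ?thesis using c(2) by (intro bexI[of _ "c \<odot>\<^bsub>S\<^esub> p"]) (auto simp: S_ops)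
qed

text \<open>An element of L that is monic modulo \<mm> with leading exponent the minimal generator
  g; these are the Groebner basis elements to be tested by Buchberger's criterion.\<close>

definition "lead_gen g = (SOME p. p \<in> Lc (dg g) \<and> p g \<ominus> \<one> \<in> \<mm> \<and> (\<forall>v>g. p v \<in> \<mm>))"

lemma lead_gen:
  assumes "g \<in> G" shows "lead_gen g \<in> Lc (dg g)" "lead_gen g g \<ominus> \<one> \<in> \<mm>" "v > g \<Longrightarrow> lead_gen g v \<in> \<mm>"
proof -
  have "\<exists>p. p \<in> Lc (dg g) \<and> p g \<ominus> \<one> \<in> \<mm> \<and> (\<forall>v>g. p v \<in> \<mm>)" using G_poly[OF assms] by blast
  from someI_ex[OF this] show "lead_gen g \<in> Lc (dg g)" "lead_gen g g \<ominus> \<one> \<in> \<mm>" "v > g \<Longrightarrow> lead_gen g v \<in> \<mm>"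
    by (auto simp: lead_gen_def)
qed

lemma lead_gen_coeff: "g \<in> G \<Longrightarrow> lead_gen g v \<in> carrier R"
  using lead_gen(1) Lc_S S_coeff by blast

lemma shift_pg_above:
  assumes g: "g \<in> G" and v: "v > t + g" shows "shift t (lead_gen g) v \<in> \<mm>"
proof (cases "shift t (lead_gen g) v = \<zero>")
  case True
  then show ?thesis using ideal_zero[OF mi] by simp
next
  case False
  then obtain u where u: "v = t + u" "shift t (lead_gen g) v = lead_gen g u" by (rule shift_nonzeroE)
  then show ?thesis using lead_gen(3)[OF g, of u] v by simp
qed

text \<open>The S-polynomial of two generators joined by an lcm edge lies in \<open>L\<close> itself, so it is
  already a combination of smaller multiples.\<close>

lemma edge_diff:
  assumes w: "w \<in> deg a" and e: "(g, g') \<in> lcm_edges n dg D U w"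
  shows "shift (w - g) (lead_gen g) \<ominus>\<^bsub>S\<^esub> shift (w - g') (lead_gen g') \<in> span_in a {..<w}"
proof -
  have g: "g \<in> G" "g' \<in> G" "g \<subseteq># w" "g' \<subseteq># w" "dg (g \<union># g') \<in> D" using e by (auto simp: lcm_edges_def)
  let ?l = "g \<union># g'"
  have we: "w \<in> expo n" "dg w = a" using w by (auto simp: deg_def)
  have ge: "g \<in> expo n" "g' \<in> expo n" "dg g \<in> D" "dg g' \<in> D" using G_facts g by auto
  have le: "?l \<in> expo n" using ge expo_lcm by blast
  have lw: "?l \<subseteq># w" using g by simp
  have s: "?l - g \<in> expo n" "?l - g' \<in> expo n" "dg (?l - g) + dg g = dg ?l" "dg (?l - g') + dg g' = dg ?l"
    using dg_diff[OF le, of g] dg_diff[OF le, of g'] expo_diff[OF le] by auto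
  have lg: "?l - g + g = ?l" "?l - g' + g' = ?l" by auto
  let ?p = "shift (?l - g) (lead_gen g)" and ?p' = "shift (?l - g') (lead_gen g')"
  have pL: "?p \<in> Lc (dg ?l)" "?p' \<in> Lc (dg ?l)"
    using Lc_shift[OF ge(3) g(5) s(1,3) lead_gen(1)[OF g(1)]] Lc_shift[OF ge(4) g(5) s(2,4) lead_gen(1)[OF g(2)]] by auto
  let ?r = "?p \<ominus>\<^bsub>S\<^esub> ?p'"
  have r: "?r \<in> Lc (dg ?l)" using M.submodule_diff[OF Lc_submodule pL] .
  have pS: "?p \<in> carrier S" "?p' \<in> carrier S" using pL Lc_S by auto
  have rv: "?r v = ?p v \<ominus> ?p' v" for v using S_minus[OF pS] by simp
  have "v < ?l" if "?r v \<notin> \<mm>" for v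
  proof (rule ccontr)
    assume "\<not> v < ?l"
    then consider "v = ?l" | "v > ?l" by fastforce
    then have "?r v \<in> \<mm>"
    proof cases
      case 1
      have "?p ?l = lead_gen g g" "?p' ?l = lead_gen g' g'"
        using shift_eval[of "?l - g" "lead_gen g" g] shift_eval[of "?l - g'" "lead_gen g'" g'] lg by simp_all
      then have "?r v = (lead_gen g g \<ominus> \<one>) \<ominus> (lead_gen g' g' \<ominus> \<one>)"
        unfolding rv 1 using lead_gen_coeff[OF g(1)] lead_gen_coeff[OF g(2)]
        by (simp add: minus_eq minus_add a_ac r_neg1 r_neg2)
      then show ?thesis using ideal_diff[OF mi] lead_gen(2) g by simp
    next
      case 2
      have "?p v \<in> \<mm>" "?p' v \<in> \<mm>"
        using shift_pg_above[OF g(1), of "?l - g" v] shift_pg_above[OF g(2), of "?l - g'" v] 2 lg by simp_all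
      then show ?thesis unfolding rv by (rule ideal_diff[OF mi])
    qed
    then show False using that by blast
  qed
  then have "shift (w - ?l) ?r \<in> span_in a {..<w}"
    using expo_diff[OF we(1)] dg_diff[OF we(1) lw] we(2) lw
    by (intro span_in_gen_less[OF g(5) r]) auto
  moreover have "w - ?l + (?l - g) = w - g" "w - ?l + (?l - g') = w - g'"
    using lw lg by (metis add_diff_cancel_right' add.assoc subset_mset.diff_add)+
  then have "shift (w - ?l) ?r = shift (w - g) (lead_gen g) \<ominus>\<^bsub>S\<^esub> shift (w - g') (lead_gen g')"
    using shift_minus[OF expo_diff[OF we(1)] pS] by (simp add: shift_shift)
  ultimately show ?thesis by simp
qed

text \<open>The differences telescope along a path of lcm edges. This is where connectedness
  replaces S-polynomials whose degree is outside D.\<close>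

lemma chain_diff:
  assumes w: "w \<in> deg a" and g: "g \<in> G" "g \<subseteq># w" and c: "(g, g') \<in> (lcm_edges n dg D U w)\<^sup>*"
  shows "shift (w - g) (lead_gen g) \<ominus>\<^bsub>S\<^esub> shift (w - g') (lead_gen g') \<in> span_in a {..<w}"
proof -
  have we: "w \<in> expo n" using w by (auto simp: deg_def)
  have sS: "shift (w - g) (lead_gen g) \<in> carrier S" if "g \<in> G" for g
    using shift_closed[OF expo_diff[OF we]] lead_gen(1)[OF that] Lc_S by blast
  from c have "g' \<in> G \<and> shift (w - g) (lead_gen g) \<ominus>\<^bsub>S\<^esub> shift (w - g') (lead_gen g') \<in> span_in a {..<w}"
  proof induction
    case base
    then show ?case using g sS[OF g(1)] M.submodule_zero[OF span_in_submodule] by (simp add: M.M.minus_eq M.M.r_neg)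
  next
    case (step x y)
    then have xy: "x \<in> G" "y \<in> G" by (auto simp: lcm_edges_def)
    have "(shift (w - g) (lead_gen g) \<ominus>\<^bsub>S\<^esub> shift (w - x) (lead_gen x)) \<oplus>\<^bsub>S\<^esub> (shift (w - x) (lead_gen x) \<ominus>\<^bsub>S\<^esub> shift (w - y) (lead_gen y))
      = shift (w - g) (lead_gen g) \<ominus>\<^bsub>S\<^esub> shift (w - y) (lead_gen y)"
      using sS[OF g(1)] sS[OF xy(1)] sS[OF xy(2)]
      by (simp add: M.M.minus_eq M.M.a_assoc M.M.r_neg1)
    then show ?case using step edge_diff[OF w step(2)] M.submoduleE(5)[OF span_in_submodule] xy by metis
  qed
  then show ?thesis by blast
qed

text \<open>Up to smaller multiples there is only one multiple of an element of L with leading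
  exponent w, apart from scalars: each one can be compared with a multiple of some
  \<open>lead_gen\<close>, and these agree with each other by \<open>chain_diff\<close>.\<close>

lemma span_in_top:
  assumes conn: "\<And>g g'. g \<in> G \<Longrightarrow> g \<subseteq># w \<Longrightarrow> g' \<in> G \<Longrightarrow> g' \<subseteq># w \<Longrightarrow> (g, g') \<in> (lcm_edges n dg D U w)\<^sup>*"
    and x: "x \<in> span_in a {..w}"
  shows "x \<in> span_in a {..<w} \<or> (w \<in> deg a \<and> (\<exists>g\<in>G. g \<subseteq># w \<and>
    (\<exists>c\<in>carrier R. x \<ominus>\<^bsub>S\<^esub> c \<odot>\<^bsub>S\<^esub> shift (w - g) (lead_gen g) \<in> span_in a {..<w})))"
proof (cases "w \<in> deg a \<and> (\<exists>g\<in>G. g \<subseteq># w)")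
  case True
  then obtain g0 where w: "w \<in> deg a" and g0: "g0 \<in> G" "g0 \<subseteq># w" by blast
  have we: "w \<in> expo n" "dg w = a" using w by (auto simp: deg_def)
  have sS: "shift (w - g) (lead_gen g) \<in> carrier S" if "g \<in> G" for g
    using shift_closed[OF expo_diff[OF we(1)]] lead_gen(1)[OF that] Lc_S by blast
  let ?x0 = "shift (w - g0) (lead_gen g0)"
  let ?N = "lspan S (carrier R) (insert ?x0 (span_in a {..<w}))"
  have x0S: "?x0 \<in> carrier S" using sS[OF g0(1)] .
  have insS: "insert ?x0 (span_in a {..<w}) \<subseteq> carrier S" using x0S span_in_S by blast
  have N: "submodule ?N R S" using M.span_submodule[OF insS] .
  have x0N: "?x0 \<in> ?N" and IN: "span_in a {..<w} \<subseteq> ?N" using M.lspan_base1[OF insS] by blast+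
  have "mults_in a {..w} \<subseteq> ?N"
  proof
    fix y assume "y \<in> mults_in a {..w}"
    then obtain t p b where y: "y = shift t p" "b \<in> D" "p \<in> Lc b" "t \<in> expo n" "dg t + b = a"
      "\<And>v. p v \<notin> \<mm> \<Longrightarrow> t + v \<le> w" unfolding mults_in_def by auto
    show "y \<in> ?N"
    proof (cases "\<exists>v. p v \<notin> \<mm> \<and> t + v = w")
      case False
      then have "t + v \<in> {..<w}" if "p v \<notin> \<mm>" for v using y(6)[OF that] that by fastforce
      then have "y \<in> mults_in a {..<w}" unfolding mults_in_def using y(1-5) by blast
      then have "y \<in> span_in a {..<w}" unfolding span_in_def using M.lspan_base1[OF mults_in_S] by blast
      then show ?thesis using IN by blast
    next
      case True
      then obtain v where v: "p v \<notin> \<mm>" "t + v = w" by blast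
      have vtop: "p u \<in> \<mm>" if "u > v" for u
      proof (rule ccontr)
        assume "p u \<notin> \<mm>"
        then have "t + u \<le> t + v" using y(6) v by blast
        then show False using that by auto
      qed
      have "v \<in> lead \<mm> (Lc b)" unfolding lead_def using y(3) v(1) vtop by blast
      then have vU: "v \<in> U" using y(2) by (auto simp: U_def)
      have ve: "v \<in> expo n" and dv: "dg v = b" using lead_deg[OF Lc_Xc] \<open>v \<in> lead \<mm> (Lc b)\<close>
        by (auto simp: deg_def)
      obtain g1 where g1: "g1 \<in> G" "g1 \<subseteq># v" using min_mons_below[OF U_expo vU] by blast
      have g1w: "g1 \<subseteq># w" using subset_mset.order_trans[OF g1(2), of w] v(2) by auto
      have pR: "p u \<in> carrier R" for u using y(3) Lc_S S_coeff by blast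
      let ?s = "shift (v - g1) (lead_gen g1)"
      have vg: "v - g1 + g1 = v" using g1(2) by simp
      have dg1: "dg (v - g1) + dg g1 = b" using dg_diff[OF ve g1(2)] dv by simp
      have sL: "?s \<in> Lc b"
        using Lc_shift[OF _ y(2) expo_diff[OF ve] dg1 lead_gen(1)[OF g1(1)]] G_facts[OF g1(1)] by blast
      \<comment> \<open>The leading term is cancelled inside L_b, before multiplying by x^t: since b
        is in D, the multiple of \<open>lead_gen g1\<close> that is subtracted belongs to L_b. The
        multiple of the difference is therefore again one of the allowed multiples, with smaller
        leading exponent.\<close>
      let ?r = "p \<ominus>\<^bsub>S\<^esub> p v \<odot>\<^bsub>S\<^esub> ?s"
      have csL: "p v \<odot>\<^bsub>S\<^esub> ?s \<in> Lc b" using M.submoduleE(4)[OF Lc_submodule pR sL] .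
      have rL: "?r \<in> Lc b" using M.submodule_diff[OF Lc_submodule y(3) csL] .
      have sR: "?s u \<in> carrier R" for u using sL Lc_S S_coeff by blast
      have rv: "?r u = p u \<ominus> p v \<otimes> ?s u" for u
        using S_minus[OF subsetD[OF Lc_S y(3)] subsetD[OF Lc_S csL]] by (simp add: S_ops)
      have "u < v" if "?r u \<notin> \<mm>" for u
      proof (rule ccontr)
        assume "\<not> u < v"
        then consider "u = v" | "u > v" by fastforce
        then have "?r u \<in> \<mm>"
        proof cases
          case 1
          have "?s v = lead_gen g1 g1" using shift_eval[of "v - g1" "lead_gen g1" g1] vg by simp
          then have "?r u = \<ominus> (p v \<otimes> (lead_gen g1 g1 \<ominus> \<one>))"
            unfolding rv 1 using pR lead_gen_coeff[OF g1(1)] by (simp add: minus_eq r_distr r_minus minus_add a_ac)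
          then show ?thesis using ideal_minus[OF mi ideal_mult_left[OF mi pR lead_gen(2)[OF g1(1)]]] by simp
        next
          case 2
          have "?s u \<in> \<mm>" using shift_pg_above[OF g1(1), of "v - g1" u] 2 vg by simp
          then show ?thesis unfolding rv using vtop[OF 2] ideal_mult_left[OF mi pR]
            by (intro ideal_diff[OF mi])
        qed
        then show False using that by blast
      qed
      then have "shift t ?r \<in> span_in a {..<w}" using span_in_gen_less[OF y(2) rL _ y(4,5) v(2)] by blast
      moreover have tv: "t + (v - g1) = w - g1"
        using v(2) vg by (metis add_diff_cancel_right' add.assoc)
      have "shift t ?r = y \<ominus>\<^bsub>S\<^esub> p v \<odot>\<^bsub>S\<^esub> shift (w - g1) (lead_gen g1)"
        using shift_minus[OF y(4) subsetD[OF Lc_S y(3)] subsetD[OF Lc_S csL]] pR y(1)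
        by (simp add: shift_smult shift_shift tv)
      ultimately have 1: "y \<ominus>\<^bsub>S\<^esub> p v \<odot>\<^bsub>S\<^esub> shift (w - g1) (lead_gen g1) \<in> ?N" using IN by auto
      have "shift (w - g1) (lead_gen g1) \<ominus>\<^bsub>S\<^esub> ?x0 \<in> ?N"
        using chain_diff[OF w g1(1) g1w conn[OF g1(1) g1w g0]] IN by blast
      then have "(shift (w - g1) (lead_gen g1) \<ominus>\<^bsub>S\<^esub> ?x0) \<oplus>\<^bsub>S\<^esub> ?x0 \<in> ?N"
        using M.submoduleE(5)[OF N _ x0N] by blast
      moreover have "(shift (w - g1) (lead_gen g1) \<ominus>\<^bsub>S\<^esub> ?x0) \<oplus>\<^bsub>S\<^esub> ?x0 = shift (w - g1) (lead_gen g1)"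
        using sS[OF g1(1)] x0S by (simp add: M.M.minus_eq M.M.a_assoc M.M.l_neg)
      ultimately have "p v \<odot>\<^bsub>S\<^esub> shift (w - g1) (lead_gen g1) \<in> ?N"
        using M.submoduleE(4)[OF N pR] by simp
      then have "(y \<ominus>\<^bsub>S\<^esub> p v \<odot>\<^bsub>S\<^esub> shift (w - g1) (lead_gen g1)) \<oplus>\<^bsub>S\<^esub> p v \<odot>\<^bsub>S\<^esub> shift (w - g1) (lead_gen g1) \<in> ?N"
        using M.submoduleE(5)[OF N 1] by blast
      moreover have "y \<in> carrier S" using y shift_closed Lc_S by blast
      ultimately show ?thesis using sS[OF g1(1)] pR by (simp add: M.M.minus_eq M.M.a_assoc M.M.l_neg)
    qed
  qed
  then have "span_in a {..w} \<subseteq> ?N" unfolding span_in_def[of a "{..w}"] using M.span_subset[OF N] by blast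
  then have "x \<in> ?N" using x by blast
  then obtain c y where c: "c \<in> carrier R" "y \<in> lspan S (carrier R) (span_in a {..<w})" "x = c \<odot>\<^bsub>S\<^esub> ?x0 \<oplus>\<^bsub>S\<^esub> y"
    using M.lspan_insert[OF oneideal x0S span_in_S] by blast
  have yI: "y \<in> span_in a {..<w}" using M.span_subset[OF span_in_submodule subset_refl] c(2) by blast
  then have "y \<in> carrier S" using span_in_S by blast
  then have "x \<ominus>\<^bsub>S\<^esub> c \<odot>\<^bsub>S\<^esub> ?x0 = y"
    using c x0S by (simp add: M.M.minus_eq M.M.a_ac M.M.r_neg M.M.r_neg2)
  then show ?thesis using w g0 c(1) yI by metis
next
  case False
  \<comment> \<open>A multiple that reaches w would give it degree a and an element of U dividing
    it, hence a minimal generator below it. So the bound w can be made strict.\<close>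
  have "mults_in a {..w} \<subseteq> mults_in a {..<w}"
  proof
    fix y assume "y \<in> mults_in a {..w}"
    then obtain t p b where y: "y = shift t p" "b \<in> D" "p \<in> Lc b" "t \<in> expo n" "dg t + b = a"
      "\<And>v. p v \<notin> \<mm> \<Longrightarrow> t + v \<le> w" unfolding mults_in_def by auto
    have "t + v < w" if v: "p v \<notin> \<mm>" for v
    proof (rule ccontr)
      assume "\<not> t + v < w"
      then have vw: "t + v = w" using y(6)[OF v] by simp
      have "p u \<in> \<mm>" if "u > v" for u
      proof (rule ccontr)
        assume "p u \<notin> \<mm>"
        then have "t + u \<le> t + v" using y(6) vw by blast
        then show False using that by auto
      qed
      then have vl: "v \<in> lead \<mm> (Lc b)" unfolding lead_def using y(3) v(1) by blast
      then have vU: "v \<in> U" using y(2) by (auto simp: U_def)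
      have "v \<in> deg b" using vl lead_deg[OF Lc_Xc] by blast
      then have "w \<in> deg a" using vw y(4,5) by (auto simp: deg_def dg_add)
      moreover have "\<exists>g\<in>G. g \<subseteq># w" using min_mons_below[OF U_expo vU, of w] vw by auto
      ultimately show False using False by blast
    qed
    then show "y \<in> mults_in a {..<w}" unfolding mults_in_def using y(1-5) by blast
  qed
  then have "span_in a {..w} \<subseteq> span_in a {..<w}" unfolding span_in_def by (rule lspan_mono[OF subset_refl])
  then show ?thesis using x by blast
qed

text \<open>Induction on the largest exponent w at which the multiples have coefficients outside
  \<mm>. If such a w is non-standard, the coefficient of x there forces the scalar c of the top
  multiple into \<mm>. Then c is absorbed into the element of L being multiplied, all of whose
  coefficients thus lie in \<mm>. In the end only multiples of elements of L with coefficients in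
  \<mm> remain, which is the form that allows a second use of Nakayama.\<close>

lemma span_in_reduce:
  assumes conn: "\<And>w g g'. g \<in> G \<Longrightarrow> g \<subseteq># w \<Longrightarrow> g' \<in> G \<Longrightarrow> g' \<subseteq># w \<Longrightarrow> (g, g') \<in> (lcm_edges n dg D U w)\<^sup>*"
    and x: "x \<in> J a" "\<And>u. u \<notin> B a \<Longrightarrow> x u \<in> \<mm>"
  shows "x \<in> span_in a {}"
proof -
  have key: "x \<in> span_in a {..w} \<Longrightarrow> (\<And>u. u \<notin> B a \<Longrightarrow> x u \<in> \<mm>) \<Longrightarrow> x \<in> span_in a {}" for w x
  proof (induction w arbitrary: x rule: less_induct)
    case (less w)
    have low: "y \<in> span_in a {}" if y: "y \<in> span_in a {..<w}" "\<And>u. u \<notin> B a \<Longrightarrow> y u \<in> \<mm>" for y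
      using span_in_split[OF y(1)] less.IH y(2) by blast
    from span_in_top[OF conn less.prems(1)] show ?case
    proof
      assume "x \<in> span_in a {..<w}"
      then show ?thesis using low less.prems(2) by blast
    next
      assume "w \<in> deg a \<and> (\<exists>g\<in>G. g \<subseteq># w \<and>
        (\<exists>c\<in>carrier R. x \<ominus>\<^bsub>S\<^esub> c \<odot>\<^bsub>S\<^esub> shift (w - g) (lead_gen g) \<in> span_in a {..<w}))"
      then obtain g c where w: "w \<in> deg a" and g: "g \<in> G" "g \<subseteq># w" and c: "c \<in> carrier R"
        and y: "x \<ominus>\<^bsub>S\<^esub> c \<odot>\<^bsub>S\<^esub> shift (w - g) (lead_gen g) \<in> span_in a {..<w}" by blast
      let ?x0 = "shift (w - g) (lead_gen g)" and ?y = "x \<ominus>\<^bsub>S\<^esub> c \<odot>\<^bsub>S\<^esub> shift (w - g) (lead_gen g)"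
      have we: "w \<in> expo n" "dg w = a" using w by (auto simp: deg_def)
      have xS: "x \<in> carrier S" using less.prems(1) span_in_S by blast
      have pS: "lead_gen g \<in> carrier S" using lead_gen(1)[OF g(1)] Lc_S by blast
      have x0S: "?x0 \<in> carrier S" using shift_closed[OF expo_diff[OF we(1)] pS] .
      have cxS: "c \<odot>\<^bsub>S\<^esub> ?x0 \<in> carrier S" using c x0S by simp
      have yv: "?y v = x v \<ominus> c \<otimes> ?x0 v" for v using S_minus[OF xS cxS] by (simp add: S_ops)
      have xR: "x v \<in> carrier R" "?x0 v \<in> carrier R" for v using xS x0S S_coeff by auto
      have "g \<in> U" using g min_mons_sub by blast
      then have "w \<notin> B a" using deg_not_B[OF w] g(2) by blast
      then have xw: "x w \<in> \<mm>" using less.prems(2) by blast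
      have yw: "?y w \<in> \<mm>" using span_in_coeff[OF y, of w] by simp
      have "w - g + g = w" using g(2) by simp
      then have x0w: "?x0 w = lead_gen g g" using shift_eval[of "w - g" "lead_gen g" g] by simp
      \<comment> \<open>Both coefficients on the right are in \<mm>, and x0 has coefficient 1 modulo
        \<mm> at w, so c is in \<mm>.\<close>
      have "c \<otimes> ?x0 w = x w \<ominus> ?y w" unfolding yv using xR c by (simp add: minus_eq minus_add r_neg1 r_neg2 a_ac r_neg)
      then have "c \<otimes> lead_gen g g \<in> \<mm>" using ideal_diff[OF mi xw yw] x0w by simp
      moreover have "c \<otimes> (lead_gen g g \<ominus> \<one>) \<in> \<mm>" using ideal_mult_left[OF mi c lead_gen(2)[OF g(1)]] .
      ultimately have "c \<otimes> lead_gen g g \<ominus> c \<otimes> (lead_gen g g \<ominus> \<one>) \<in> \<mm>" by (rule ideal_diff[OF mi])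
      moreover have "c \<otimes> lead_gen g g \<ominus> c \<otimes> (lead_gen g g \<ominus> \<one>) = c"
        using c lead_gen_coeff[OF g(1)] by (simp add: minus_eq r_distr r_minus minus_add r_neg1 r_neg2 r_neg a_ac)
      ultimately have cm: "c \<in> \<mm>" by simp
      have "c \<odot>\<^bsub>S\<^esub> ?x0 = shift (w - g) (c \<odot>\<^bsub>S\<^esub> lead_gen g)" using c by (simp add: shift_smult)
      moreover have "c \<odot>\<^bsub>S\<^esub> lead_gen g \<in> Lc (dg g)" using M.submoduleE(4)[OF Lc_submodule c lead_gen(1)[OF g(1)]] .
      moreover have "(c \<odot>\<^bsub>S\<^esub> lead_gen g) v \<in> \<mm>" for v
        using m.I_r_closed[OF cm lead_gen_coeff[OF g(1)]] by (simp add: S_ops)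
      moreover have "dg (w - g) + dg g = a" using dg_diff[OF we(1) g(2)] we by simp
      ultimately have "c \<odot>\<^bsub>S\<^esub> ?x0 \<in> mults_in a {}"
        unfolding mults_in_def using G_facts[OF g(1)] expo_diff[OF we(1)] by blast
      then have cx0: "c \<odot>\<^bsub>S\<^esub> ?x0 \<in> span_in a {}" unfolding span_in_def using M.lspan_base1[OF mults_in_S] by blast
      have "?y u \<in> \<mm>" if "u \<notin> B a" for u
        unfolding yv using less.prems(2)[OF that] m.I_r_closed[OF cm xR(2)] by (rule ideal_diff[OF mi])
      then have "?y \<in> span_in a {}" using low[OF y] by blast
      then have "?y \<oplus>\<^bsub>S\<^esub> c \<odot>\<^bsub>S\<^esub> ?x0 \<in> span_in a {}" using M.submoduleE(5)[OF span_in_submodule _ cx0] by blast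
      then show ?thesis using xS cxS by (simp add: M.M.minus_eq M.M.a_assoc M.M.l_neg)
    qed
  qed
  have "x \<in> span_in a UNIV" using x(1) span_in_UNIV by simp
  then show ?thesis using span_in_split[of x a UNIV] key x(2) by blast
qed

end

section \<open>Local freeness of the generated ideal\<close>

lemma (in module) span_sum:
  assumes "submodule X R M" "submodule Y R M"
  shows "x \<in> lspan M (carrier R) (X \<union> Y) \<longleftrightarrow> (\<exists>j\<in>X. \<exists>q\<in>Y. x = j \<oplus>\<^bsub>M\<^esub> q)"
proof
  have c: "X \<subseteq> carrier M" "Y \<subseteq> carrier M" using submoduleE(1) assms by auto
  {
    assume "x \<in> lspan M (carrier R) (X \<union> Y)"
    then obtain a b where "a \<in> lspan M (carrier R) X" "b \<in> lspan M (carrier R) Y" "x = a \<oplus>\<^bsub>M\<^esub> b"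
      using lspan_un[OF subset_refl c] by blast
    then show "\<exists>j\<in>X. \<exists>q\<in>Y. x = j \<oplus>\<^bsub>M\<^esub> q"
      using span_subset[OF assms(1) subset_refl] span_subset[OF assms(2) subset_refl] by blast
  next
    assume "\<exists>j\<in>X. \<exists>q\<in>Y. x = j \<oplus>\<^bsub>M\<^esub> q"
    then obtain j q where jq: "j \<in> X" "q \<in> Y" "x = j \<oplus>\<^bsub>M\<^esub> q" by blast
    have XY: "X \<union> Y \<subseteq> carrier M" using c by blast
    have "j \<in> lspan M (carrier R) (X \<union> Y)" "q \<in> lspan M (carrier R) (X \<union> Y)"
      using lspan_base1[OF XY] jq by auto
    then show "x \<in> lspan M (carrier R) (X \<union> Y)"
      using submoduleE(5)[OF span_submodule[OF XY]] jq(3) by simp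
  }
qed

lemma (in module) span_sumI:
  assumes "submodule X R M" "submodule Y R M" "j \<in> X" "q \<in> Y"
  shows "j \<oplus>\<^bsub>M\<^esub> q \<in> lspan M (carrier R) (X \<union> Y)"
  using assms span_sum by blast

lemma (in module) sat_zero_subset:
  assumes "f \<in> carrier R" "submodule N R M" shows "sat R M f {\<zero>\<^bsub>M\<^esub>} \<subseteq> sat R M f N"
  using submodule_zero[OF assms(2)] by (intro sat_mono) simp

context graded_poly
begin

text \<open>As \<open>x + \<eta>\<close> has no monomial in \<open>Y\<close>, a power of \<open>f\<close> kills the coefficients of \<open>x\<close>.\<close>

lemma eliminate_monomials:
  assumes f: "f \<in> carrier R" and C: "ideal C R" and Z: "Z \<subseteq> expo n"
    and Y: "finite Y" "Y \<subseteq> expo n" "Y \<inter> Z = {}"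
    and H: "submodule H R S" "H \<subseteq> supp_in (carrier R) Z"
    and k: "\<And>w. w \<in> Y \<Longrightarrow> \<exists>t::nat. \<exists>\<nu>\<in>supp_in (carrier R) Z. \<kappa> w = (f [^] t) \<odot>\<^bsub>S\<^esub> mon R w \<oplus>\<^bsub>S\<^esub> \<nu>"
    and d: "x \<in> lspan S C (\<kappa> ` Y)" "\<eta> \<in> H" "x \<oplus>\<^bsub>S\<^esub> \<eta> \<in> supp_in (carrier R) Z"
  shows "x \<oplus>\<^bsub>S\<^esub> \<eta> \<in> sat R S f H"
  using Y k d
proof (induction Y arbitrary: x \<eta> rule: finite_induct)
  case empty
  then have "x = \<zero>\<^bsub>S\<^esub>" by (auto elim: lspan.cases)
  moreover have "\<eta> \<in> carrier S" using subsetD[OF M.submoduleE(1)[OF H(1)] empty.prems(5)] .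
  ultimately show ?case using subsetD[OF M.sat_incl[OF f H(1)] empty.prems(5)] by simp
next
  case (insert w Y)
  have CR: "C \<subseteq> carrier R" using ideal_subset[OF C] .
  have ZZ: "Z \<union> Y \<subseteq> expo n" and Yd: "Y \<inter> Z = {}" "Y \<subseteq> expo n" using insert Z by auto
  have zsub: "supp_in (carrier R) Z \<subseteq> supp_in (carrier R) (Z \<union> Y)" by (rule supp_in_mono) auto
  have kc: "\<kappa> v \<in> carrier S" if v: "v \<in> insert w Y" for v
  proof -
    obtain t \<nu> where "\<nu> \<in> supp_in (carrier R) Z" "\<kappa> v = (f [^] (t::nat)) \<odot>\<^bsub>S\<^esub> mon R v \<oplus>\<^bsub>S\<^esub> \<nu>"
      using insert.prems(3)[OF v] by blast
    moreover have "mon R v \<in> carrier S" using v insert.prems(1) mon_closed by blast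
    moreover have "f [^] t \<in> carrier R" using f by simp
    ultimately show ?thesis using subsetD[OF supp_in_sub, of \<nu>] by auto
  qed
  then have kY: "\<kappa> ` Y \<subseteq> carrier S" and kw: "\<kappa> w \<in> carrier S" by auto
  obtain c x' where c: "c \<in> C" "x' \<in> lspan S C (\<kappa> ` Y)" "x = c \<odot>\<^bsub>S\<^esub> \<kappa> w \<oplus>\<^bsub>S\<^esub> x'"
    using M.lspan_insert[OF C kw kY, of x] insert.prems(4) by auto
  have cR: "c \<in> carrier R" using c CR by blast
  have lsub: "lspan S C (\<kappa> ` Y) \<subseteq> supp_in (carrier R) (Z \<union> Y)"
  proof (rule M.lspan_subset[OF supp_in_submodule[OF oneideal ZZ]])
    fix c y assume cC: "c \<in> C" and "y \<in> \<kappa> ` Y"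
    then obtain v where v: "v \<in> Y" "y = \<kappa> v" by blast
    obtain t \<nu> where t: "\<nu> \<in> supp_in (carrier R) Z" "\<kappa> v = (f [^] (t::nat)) \<odot>\<^bsub>S\<^esub> mon R v \<oplus>\<^bsub>S\<^esub> \<nu>"
      using insert.prems(3)[of v] v by blast
    have "(f [^] t) \<odot>\<^bsub>S\<^esub> mon R v \<in> supp_in (carrier R) (Z \<union> Y)"
      using v f by (intro cmon_supp_in[OF oneideal _ _ ZZ]) auto
    then have "y \<in> supp_in (carrier R) (Z \<union> Y)"
      using M.submoduleE(5)[OF supp_in_submodule[OF oneideal ZZ]] t zsub v by auto
    then show "c \<odot>\<^bsub>S\<^esub> y \<in> supp_in (carrier R) (Z \<union> Y)"
      using M.submoduleE(4)[OF supp_in_submodule[OF oneideal ZZ]] cC CR by blast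
  qed
  have x'S: "x' \<in> carrier S" using c(2) lsub supp_in_sub by blast
  have \<eta>S: "\<eta> \<in> carrier S" using insert.prems(5) H(2) supp_in_sub by blast
  have wn: "w \<notin> Z \<union> Y" using insert by blast
  have x'w: "x' w = \<zero>" using c(2) lsub wn by (auto simp: supp_in_def)
  have zw: "p w = \<zero>" if "p \<in> supp_in (carrier R) Z" for p using that wn by (auto simp: supp_in_def)
  obtain t \<nu> where t: "\<nu> \<in> supp_in (carrier R) Z" "\<kappa> w = (f [^] (t::nat)) \<odot>\<^bsub>S\<^esub> mon R w \<oplus>\<^bsub>S\<^esub> \<nu>"
    using insert.prems(3)[of w] by blast
  have pw: "f [^] t \<in> carrier R" using f by simp
  \<comment> \<open>The monomial w occurs in no other summand, neither in the remaining generators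
    nor in Z. So its coefficient in the total is c f^t, and this must vanish.\<close>
  have "\<kappa> w w = f [^] t" using t zw[OF t(1)] pw by (simp add: S_ops mon_def)
  then have "(x \<oplus>\<^bsub>S\<^esub> \<eta>) w = c \<otimes> f [^] t"
    using c(3) x'w zw[of \<eta>] insert.prems(5) H(2) cR pw by (auto simp: S_ops)
  then have ck: "c \<otimes> f [^] t = \<zero>" using zw[OF insert.prems(6)] by simp
  have "(f [^] t) \<odot>\<^bsub>S\<^esub> (c \<odot>\<^bsub>S\<^esub> \<kappa> w) = \<zero>\<^bsub>S\<^esub>"
    using ck cR pw kw by (simp add: M.smult_assoc1[symmetric] m_comm)
  then have eq: "(f [^] t) \<odot>\<^bsub>S\<^esub> (x \<oplus>\<^bsub>S\<^esub> \<eta>) = (f [^] t) \<odot>\<^bsub>S\<^esub> x' \<oplus>\<^bsub>S\<^esub> (f [^] t) \<odot>\<^bsub>S\<^esub> \<eta>"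
    using c(3) cR pw kw x'S \<eta>S by (simp add: M.smult_r_distr)
  have 1: "(f [^] t) \<odot>\<^bsub>S\<^esub> x' \<in> lspan S C (\<kappa> ` Y)"
    using M.submoduleE(4)[OF M.lspan_submodule[OF C kY] pw c(2)] .
  have 2: "(f [^] t) \<odot>\<^bsub>S\<^esub> \<eta> \<in> H" using M.submoduleE(4)[OF H(1) pw insert.prems(5)] .
  have 3: "(f [^] t) \<odot>\<^bsub>S\<^esub> (x \<oplus>\<^bsub>S\<^esub> \<eta>) \<in> supp_in (carrier R) Z"
    using M.submoduleE(4)[OF supp_in_submodule[OF oneideal Z] pw insert.prems(6)] .
  have "(f [^] t) \<odot>\<^bsub>S\<^esub> (x \<oplus>\<^bsub>S\<^esub> \<eta>) \<in> sat R S f H"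
    using insert.IH[OF Yd(2,1) insert.prems(3) 1 2] 3 unfolding eq by blast
  moreover have "x \<oplus>\<^bsub>S\<^esub> \<eta> \<in> carrier S" using insert.prems(6) supp_in_sub by blast
  ultimately show ?case using M.sat_pow_cancel[OF f H(1)] by blast
qed

end

text \<open>A single f works for all degrees of the finite set D. In other degrees only finiteness
  of the standard monomials is assumed; that they form a local basis there is the goal.\<close>

locale hilb_loc = hilb_max R n dg D L \<mm> U
  for R (structure) and n and dg :: "nat multiset \<Rightarrow> 'g::ab_group_add" and D L \<mm> U +
  fixes f
  assumes finB: "finite (B a)"
    and f: "f \<in> carrier R - \<mm>" and bas: "b \<in> D \<Longrightarrow> poly_basis f b (Lc b) (B b)"
begin

lemma fc: "f \<in> carrier R" using f by simp

lemma pw: "f [^] (t::nat) \<in> carrier R" using fc by simp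

abbreviation "PB a \<equiv> supp_in (carrier R) (B a)"
abbreviation "spn \<equiv> lspan S (carrier R)"

lemma PB_sub: "submodule (PB a) R S" using supp_in_submodule[OF oneideal B_expo] .

lemma bas_span:
  assumes "b \<in> D" "p \<in> Xc {b}"
  obtains t :: nat and q l where "q \<in> PB b" "l \<in> Lc b" "(f [^] t) \<odot>\<^bsub>S\<^esub> p = l \<oplus>\<^bsub>S\<^esub> q"
proof -
  obtain t q where q: "q \<in> PB b" "(f [^] (t::nat)) \<odot>\<^bsub>S\<^esub> p \<ominus>\<^bsub>S\<^esub> q \<in> Lc b"
    using bas[OF assms(1)] assms(2) unfolding poly_basis_def by blast
  have "(f [^] t) \<odot>\<^bsub>S\<^esub> p = ((f [^] t) \<odot>\<^bsub>S\<^esub> p \<ominus>\<^bsub>S\<^esub> q) \<oplus>\<^bsub>S\<^esub> q"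
    using q(1) supp_in_sub assms(2) Xc_sub pw by (auto simp: M.M.minus_eq M.M.a_assoc M.M.l_neg subset_iff)
  then show ?thesis using that q by blast
qed

lemma bas_ind: "b \<in> D \<Longrightarrow> Lc b \<inter> PB b \<subseteq> sat R S f {\<zero>\<^bsub>S\<^esub>}"
  using bas unfolding poly_basis_def by blast

lemma mon_Xc: "w \<in> deg a \<Longrightarrow> mon R w \<in> Xc {a}"
  using mon_closed by (auto simp: Xc_iff mon_def deg_def)

text \<open>Dickson's lemma is applied to the exponents of degree a - b for each of the finitely
  many b. Requiring e and t to have the same degree makes x^(t - e) a monomial of degree 0, which
  maps L_b to itself.\<close>

lemma cover:
  "\<exists>E. finite E \<and> E \<subseteq> expo n \<and> (\<forall>e\<in>E. a - dg e \<in> D) \<and>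
    (\<forall>t\<in>expo n. a - dg t \<in> D \<longrightarrow> (\<exists>e\<in>E. e \<subseteq># t \<and> dg e = dg t))"
proof -
  have "\<exists>E. finite E \<and> E \<subseteq> deg (a - b) \<and> (\<forall>u\<in>deg (a - b). \<exists>e\<in>E. e \<subseteq># u)" for b
    by (rule dickson[OF deg_sub[OF subset_refl]])
  then obtain E where E: "\<And>b. finite (E b)" "\<And>b. E b \<subseteq> deg (a - b)"
    "\<And>b u. u \<in> deg (a - b) \<Longrightarrow> \<exists>e\<in>E b. e \<subseteq># u" by metis
  let ?E = "\<Union>b\<in>D. E b"
  have "\<exists>e\<in>?E. e \<subseteq># t \<and> dg e = dg t" if "t \<in> expo n" "a - dg t \<in> D" for t
  proof -
    have "t \<in> deg (a - (a - dg t))" using that by (simp add: deg_def)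
    then obtain e where "e \<in> E (a - dg t)" "e \<subseteq># t" using E(3) by blast
    moreover have "dg e = dg t" using E(2)[of "a - dg t"] \<open>e \<in> E (a - dg t)\<close> by (auto simp: deg_def)
    ultimately show ?thesis using that by blast
  qed
  moreover have "finite ?E" using finD E(1) by blast
  moreover have "?E \<subseteq> expo n" using E(2) deg_expo by blast
  moreover have "a - dg e \<in> D" if e: "e \<in> ?E" for e   proof -
    obtain b where b: "b \<in> D" "e \<in> E b" using e by blast
    then have "dg e = a - b" using E(2)[of b] by (auto simp: deg_def)
    then show ?thesis using b by simp
  qed
  ultimately show ?thesis by (intro exI[of _ ?E] conjI ballI impI)
qed

text \<open>A finite set of exponents generating, over \<open>S\<^sub>0\<close>, all monomials of degree \<open>a - b\<close>
  with \<open>b \<in> D\<close>.\<close>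

definition "E a = (SOME E. finite E \<and> E \<subseteq> expo n \<and> (\<forall>e\<in>E. a - dg e \<in> D) \<and>
    (\<forall>t\<in>expo n. a - dg t \<in> D \<longrightarrow> (\<exists>e\<in>E. e \<subseteq># t \<and> dg e = dg t)))"

lemma E: "finite (E a)" "E a \<subseteq> expo n" "e \<in> E a \<Longrightarrow> a - dg e \<in> D"
    "t \<in> expo n \<Longrightarrow> a - dg t \<in> D \<Longrightarrow> \<exists>e\<in>E a. e \<subseteq># t \<and> dg e = dg t"
  using someI_ex[OF cover[of a]] unfolding E_def[symmetric] by auto

text \<open>A finite set of monomials to which all of S_a can be reduced locally: the standard ones,
  and the products of a chosen x^e with the standard monomials of the complementary degree in
  D.\<close>

definition "W a = B a \<union> (\<Union>e\<in>E a. (\<lambda>v. e + v) ` B (a - dg e))"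

lemma W: "finite (W a)" "W a \<subseteq> deg a" "B a \<subseteq> W a"
proof -
  show "finite (W a)" using E(1) finB by (auto simp: W_def)
  show "B a \<subseteq> W a" by (auto simp: W_def)
  have "e + v \<in> deg a" if "e \<in> E a" "v \<in> B (a - dg e)" for e v
    using subsetD[OF E(2) that(1)] subsetD[OF B_deg that(2)] by (simp add: deg_def dg_add)
  then show "W a \<subseteq> deg a" using B_deg by (auto simp: W_def)
qed

lemma W_expo: "W a \<subseteq> expo n" using deg_sub[OF W(2)] .

lemma shift_PB_W: "e \<in> E a \<Longrightarrow> p \<in> PB (a - dg e) \<Longrightarrow> shift e p \<in> supp_in (carrier R) (W a)"
  using E(2) by (intro shift_supp_in[of e "carrier R" p "B (a - dg e)"]) (auto simp: W_def)

lemma shift_J: "e \<in> E a \<Longrightarrow> l \<in> Lc (a - dg e) \<Longrightarrow> shift e l \<in> J a"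
  using E(2,3) by (intro J_gen[of "a - dg e"]) auto

lemma deg_E:
  assumes "w \<in> deg a" "w \<notin> B a" shows "\<exists>e\<in>E a. e \<subseteq># w \<and> w - e \<in> deg (a - dg e)"
proof -
  obtain u where u: "u \<in> U" "u \<subseteq># w" using deg_not_B assms by blast
  have w: "w \<in> expo n" "dg w = a" using assms by (auto simp: deg_def)
  have "dg u \<in> D" using u U_iff by blast
  then obtain e where e: "e \<in> E a" "e \<subseteq># w - u" "dg e = dg (w - u)"
    using E(4)[OF expo_diff[OF w(1)], of a u] dg_diff[OF w(1) u(2)] w by auto
  have ew: "e \<subseteq># w" using e(2) subset_mset.order_trans[OF _ diff_subset_eq_self] by blast
  then have "w - e \<in> deg (a - dg e)" using w dg_diff[OF w(1) ew] expo_diff[OF w(1)] by (simp add: deg_def)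
  then show ?thesis using e ew by blast
qed

text \<open>A non-standard x^w is x^e times a monomial whose degree is in D, where the local basis
  rewrites it modulo L; multiplying back by x^e lands in \<open>W a\<close> modulo J. The
  coefficient ideal C is kept general because both C = R and C = \<mm> are needed.\<close>

lemma reduce_W:
  assumes C: "ideal C R"
  shows "supp_in C (deg a) \<subseteq> sat R S f (spn (J a \<union> supp_in C (W a)))"
proof -
  let ?T = "spn (J a \<union> supp_in C (W a))"
  have JW: "J a \<union> supp_in C (W a) \<subseteq> carrier S" using J_S supp_in_sub by auto
  have T: "submodule ?T R S" using M.span_submodule[OF JW] .
  have CR: "C \<subseteq> carrier R" using ideal_subset[OF C] .
  have WC: "submodule (supp_in C (W a)) R S" using supp_in_submodule[OF C W_expo] .
  have "c \<odot>\<^bsub>S\<^esub> mon R w \<in> sat R S f ?T" if c: "c \<in> C" and w: "w \<in> deg a" for c w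
  proof (cases "w \<in> B a")
    case True
    then have "c \<odot>\<^bsub>S\<^esub> mon R w \<in> supp_in C (W a)"
      using cmon_supp_in[OF C c _ W_expo] W(3) by blast
    then have "c \<odot>\<^bsub>S\<^esub> mon R w \<in> ?T" using M.lspan_base1[OF JW] by blast
    then show ?thesis using M.sat_incl[OF fc T] by blast
  next
    case False
    have cR: "c \<in> carrier R" using c CR by blast
    obtain e where e: "e \<in> E a" "e \<subseteq># w" "w - e \<in> deg (a - dg e)" using deg_E[OF w False] by blast
    have ee: "e \<in> expo n" using e E(2) by blast
    obtain t q l where q: "q \<in> PB (a - dg e)" "l \<in> Lc (a - dg e)"
      "(f [^] (t::nat)) \<odot>\<^bsub>S\<^esub> mon R (w - e) = l \<oplus>\<^bsub>S\<^esub> q"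
      using bas_span[OF E(3)[OF e(1)] mon_Xc[OF e(3)]] by blast
    have lS: "l \<in> carrier S" and qS: "q \<in> carrier S"
      using subsetD[OF Lc_S q(2)] subsetD[OF supp_in_sub q(1)] by auto
    have "shift e ((f [^] t) \<odot>\<^bsub>S\<^esub> mon R (w - e)) = shift e l \<oplus>\<^bsub>S\<^esub> shift e q"
      by (simp only: q(3) shift_add)
    then have eq: "(f [^] t) \<odot>\<^bsub>S\<^esub> mon R w = shift e l \<oplus>\<^bsub>S\<^esub> shift e q"
      using e(2) pw by (simp add: shift_smult shift_mon)
    have "(f [^] t) \<odot>\<^bsub>S\<^esub> (c \<odot>\<^bsub>S\<^esub> mon R w) = c \<odot>\<^bsub>S\<^esub> shift e l \<oplus>\<^bsub>S\<^esub> c \<odot>\<^bsub>S\<^esub> shift e q"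
      using eq cR pw shift_closed[OF ee] lS qS w mon_closed
      by (simp add: M.smult_comm[of _ c] M.smult_r_distr deg_def)
    moreover have "c \<odot>\<^bsub>S\<^esub> shift e l \<in> J a"
      using M.submoduleE(4)[OF J_submodule cR shift_J[OF e(1) q(2)]] .
    moreover have "c \<odot>\<^bsub>S\<^esub> shift e q \<in> supp_in C (W a)"
    proof -
      have "shift e q \<in> supp_in (carrier R) (W a)" using shift_PB_W[OF e(1) q(1)] .
      then have sq: "shift e q \<in> spn (mon R ` W a)" by (simp add: supp_in_lspan[OF oneideal W_expo])
      show ?thesis unfolding supp_in_lspan[OF C W_expo]
        by (rule M.lspan_smult_gen[OF subset_refl mon_sub[OF W_expo] sq cR _ CR])
          (rule ideal.I_r_closed[OF C c])
    qed
    ultimately have "(f [^] t) \<odot>\<^bsub>S\<^esub> (c \<odot>\<^bsub>S\<^esub> mon R w) \<in> ?T"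
      unfolding M.span_sum[OF J_submodule WC] by blast
    then show ?thesis using cR w mon_closed by (intro M.satI) (auto simp: deg_def)
  qed
  then show ?thesis
    unfolding supp_in_lspan[OF C deg_sub[OF subset_refl]]
    using M.lspan_subset[OF M.sat_submodule[OF fc T]] by blast
qed

text \<open>The first use of Nakayama, on the finite set \<open>W a\<close>. Modulo \<mm>, division
  by J leaves standard monomials; the error has coefficients in \<mm> on arbitrary monomials of
  degree a, and \<open>reduce_W\<close> brings it back to \<mm> times \<open>W a\<close>.\<close>

lemma span_B:
  "\<exists>s\<in>carrier R - \<mm>. Xc {a} \<subseteq> sat R S (f \<otimes> s) (spn (J a \<union> PB a))"
proof -
  let ?N = "spn (J a \<union> PB a)"
  have JB: "J a \<union> PB a \<subseteq> carrier S" using J_S supp_in_sub by auto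
  have N: "submodule ?N R S" using M.span_submodule[OF JB] .
  have W\<mm>: "submodule (supp_in \<mm> (W a)) R S" using supp_in_submodule[OF mi W_expo] .
  interpret mpr: primeideal \<mm> R by (rule mp)
  have dec: "\<exists>g\<in>carrier R - \<mm>. \<exists>\<nu>\<in>?N. \<exists>y\<in>lspan S \<mm> (mon R ` W a). g \<odot>\<^bsub>S\<^esub> x = \<nu> \<oplus>\<^bsub>S\<^esub> y"
    if x: "x \<in> mon R ` W a" for x
  proof -
    obtain w where w: "w \<in> W a" "x = mon R w" using x by blast
    have xX: "x \<in> Xc {a}" using mon_Xc W(2) w by blast
    obtain q where q: "q \<in> J a" "\<And>u. u \<in> lead \<mm> (J a) \<Longrightarrow> x u \<ominus> q u \<in> \<mm>"
      using reduce_mod[OF m.is_maximalideal J_submodule J_Xc xX] by blast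
    have qX: "q \<in> Xc {a}" using q J_Xc by blast
    have xS: "x \<in> carrier S" and qS: "q \<in> carrier S" using xX qX Xc_sub by auto
    let ?d = "x \<ominus>\<^bsub>S\<^esub> q"
    have dX: "?d \<in> Xc {a}" using M.submodule_diff[OF submodule_Xc xX qX] .
    have dS: "?d \<in> carrier S" using dX Xc_sub by blast
    let ?d1 = "\<lambda>u. if u \<in> B a then ?d u else \<zero>" and ?d2 = "\<lambda>u. if u \<in> - B a then ?d u else \<zero>"
    have d1S: "?d1 \<in> carrier S" and d2S: "?d2 \<in> carrier S"
      using restrict_monomials_closed[OF dS] by blast+
    have d1: "?d1 \<in> PB a" using d1S S_coeff[OF d1S] by (auto simp: supp_in_def)
    \<comment> \<open>Every non-standard exponent is leading for J a by \<open>lead_J\<close>, so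
      division leaves a coefficient in \<mm> there.\<close>
    have "?d2 \<in> supp_in \<mm> (deg a)"
    proof -
      have "?d2 u \<in> \<mm> \<and> (?d2 u \<noteq> \<zero> \<longrightarrow> u \<in> deg a)" for u
      proof (cases "u \<in> deg a")
        case True
        then show ?thesis
          using q(2)[of u] lead_J[OF True _ subset_refl] S_minus[OF xS qS] ideal_zero[OF mi] by auto
      next
        case False
        then have "?d u = \<zero>" using dX by (auto simp: Xc_iff deg_def S_carrier)
        then show ?thesis using ideal_zero[OF mi] by simp
      qed
      then show ?thesis using d2S unfolding supp_in_def by blast
    qed
    then have "?d2 \<in> sat R S f (spn (J a \<union> supp_in \<mm> (W a)))" using reduce_W[OF mi] by blast
    then obtain t :: nat where "(f [^] t) \<odot>\<^bsub>S\<^esub> ?d2 \<in> spn (J a \<union> supp_in \<mm> (W a))" by (rule M.satE)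
    then obtain j y where jy: "j \<in> J a" "y \<in> supp_in \<mm> (W a)" "(f [^] t) \<odot>\<^bsub>S\<^esub> ?d2 = j \<oplus>\<^bsub>S\<^esub> y"
      unfolding M.span_sum[OF J_submodule W\<mm>] by blast
    let ?\<nu> = "((f [^] t) \<odot>\<^bsub>S\<^esub> q \<oplus>\<^bsub>S\<^esub> j) \<oplus>\<^bsub>S\<^esub> (f [^] t) \<odot>\<^bsub>S\<^esub> ?d1"
    have jS: "j \<in> carrier S" "y \<in> carrier S"
      using subsetD[OF J_S jy(1)] subsetD[OF supp_in_sub jy(2)] by auto
    have "?d \<oplus>\<^bsub>S\<^esub> q = x" using xS qS by (simp add: M.M.minus_eq M.M.a_assoc M.M.l_neg)
    then have "x = q \<oplus>\<^bsub>S\<^esub> ?d" using M.M.a_comm[OF dS qS] by simp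
    also have "\<dots> = q \<oplus>\<^bsub>S\<^esub> (?d1 \<oplus>\<^bsub>S\<^esub> ?d2)" using restrict_monomials_split[OF dS, of "B a"] by simp
    finally have "(f [^] t) \<odot>\<^bsub>S\<^esub> x = (f [^] t) \<odot>\<^bsub>S\<^esub> (q \<oplus>\<^bsub>S\<^esub> (?d1 \<oplus>\<^bsub>S\<^esub> ?d2))"
      by (rule arg_cong)
    also have "\<dots> = (f [^] t) \<odot>\<^bsub>S\<^esub> q \<oplus>\<^bsub>S\<^esub> ((f [^] t) \<odot>\<^bsub>S\<^esub> ?d1 \<oplus>\<^bsub>S\<^esub> (f [^] t) \<odot>\<^bsub>S\<^esub> ?d2)"
      using pw qS d1S d2S by (simp add: M.smult_r_distr)
    also have "\<dots> = (f [^] t) \<odot>\<^bsub>S\<^esub> q \<oplus>\<^bsub>S\<^esub> ((f [^] t) \<odot>\<^bsub>S\<^esub> ?d1 \<oplus>\<^bsub>S\<^esub> (j \<oplus>\<^bsub>S\<^esub> y))"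
      by (simp only: jy(3))
    also have "\<dots> = ?\<nu> \<oplus>\<^bsub>S\<^esub> y" using pw qS d1S jS by (simp add: M.M.a_ac)
    finally have "(f [^] t) \<odot>\<^bsub>S\<^esub> x = ?\<nu> \<oplus>\<^bsub>S\<^esub> y" .
    moreover have "?\<nu> \<in> ?N"
    proof -
      have "(f [^] t) \<odot>\<^bsub>S\<^esub> q \<oplus>\<^bsub>S\<^esub> j \<in> J a"
        by (rule M.submoduleE(5)[OF J_submodule M.submoduleE(4)[OF J_submodule pw q(1)] jy(1)])
      moreover have "(f [^] t) \<odot>\<^bsub>S\<^esub> ?d1 \<in> PB a" by (rule M.submoduleE(4)[OF PB_sub pw d1])
      ultimately show ?thesis
        by (rule M.span_sumI[OF J_submodule PB_sub])
    qed
    moreover have "y \<in> lspan S \<mm> (mon R ` W a)" using jy(2) by (simp add: supp_in_lspan[OF mi W_expo])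
    moreover have "f [^] t \<in> carrier R - \<mm>" using mpr.pow_notin[OF f] .
    ultimately show ?thesis by (intro bexI[where x = y] bexI[where x = ?\<nu>] bexI[where x = "f [^] t"])
  qed
  from M.nakayama[OF mp finite_imageI[OF W(1)] mon_sub[OF W_expo] N dec]
  obtain s where s: "s \<in> carrier R - \<mm>" "\<And>x. x \<in> mon R ` W a \<Longrightarrow> s \<odot>\<^bsub>S\<^esub> x \<in> ?N"
    by blast
  have sc: "s \<in> carrier R" using s by simp
  let ?g = "f \<otimes> s"
  have gc: "?g \<in> carrier R" using fc sc by simp
  have gN: "submodule (sat R S ?g ?N) R S" using M.sat_submodule[OF gc N] .
  have "mon R ` W a \<subseteq> sat R S ?g ?N"
  proof
    fix x assume x: "x \<in> mon R ` W a"
    then have xS: "x \<in> carrier S" using mon_sub[OF W_expo] by blast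
    have "?g \<odot>\<^bsub>S\<^esub> x = f \<odot>\<^bsub>S\<^esub> (s \<odot>\<^bsub>S\<^esub> x)" using fc sc xS by (simp add: M.smult_assoc1)
    then have "?g \<odot>\<^bsub>S\<^esub> x \<in> ?N" using M.submoduleE(4)[OF N fc s(2)[OF x]] by simp
    then show "x \<in> sat R S ?g ?N" using xS gc by (intro M.satI[where t=1]) auto
  qed
  then have "supp_in (carrier R) (W a) \<subseteq> sat R S ?g ?N"
    unfolding supp_in_lspan[OF oneideal W_expo] by (rule M.span_subset[OF gN])
  moreover have "J a \<subseteq> sat R S ?g ?N"
    using M.lspan_base1[OF JB] M.sat_incl[OF gc N] by blast
  ultimately have TN: "spn (J a \<union> supp_in (carrier R) (W a)) \<subseteq> sat R S ?g ?N"
    by (intro M.span_subset[OF gN]) blast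
  have "Xc {a} \<subseteq> sat R S f (spn (J a \<union> supp_in (carrier R) (W a)))"
    using reduce_W[OF oneideal] by (simp add: Xc_supp)
  also have "\<dots> \<subseteq> sat R S f (sat R S ?g ?N)" using TN by (rule M.sat_mono)
  also have "\<dots> \<subseteq> sat R S ?g (sat R S ?g ?N)" using M.sat_mult[OF fc sc gN] .
  also have "\<dots> \<subseteq> sat R S ?g ?N" using M.sat_sat[OF gc gN N] by blast
  finally show ?thesis using s(1) by blast
qed

text \<open>The standard part of \<open>f\<^sup>t p\<close> lies in \<open>L\<close>, so it vanishes locally.\<close>

lemma sat_drop_PB:
  assumes b: "b \<in> D" and N0: "submodule N0 R S" "N0 \<subseteq> Lc b" and p: "p \<in> Lc b"
    and s: "p \<in> sat R S f (spn (N0 \<union> PB b))"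
  shows "p \<in> sat R S f N0"
proof -
  obtain t :: nat where "(f [^] t) \<odot>\<^bsub>S\<^esub> p \<in> spn (N0 \<union> PB b)" using s by (rule M.satE)
  then obtain y q where y: "y \<in> N0" "q \<in> PB b" "(f [^] t) \<odot>\<^bsub>S\<^esub> p = y \<oplus>\<^bsub>S\<^esub> q"
    unfolding M.span_sum[OF N0(1) PB_sub] by blast
  have "(f [^] t) \<odot>\<^bsub>S\<^esub> p \<in> Lc b" using M.submoduleE(4)[OF Lc_submodule pw p] .
  then have "q \<in> Lc b" 
    using M.submodule_cancel[OF Lc_submodule _ subsetD[OF N0(2) y(1)]] y(3) subsetD[OF supp_in_sub y(2)] by simp
  then have "q \<in> sat R S f {\<zero>\<^bsub>S\<^esub>}" using bas_ind[OF b] y(2) by blast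
  then have "q \<in> sat R S f N0" using M.sat_zero_subset[OF fc N0(1)] by blast
  moreover have "y \<in> sat R S f N0" using M.sat_incl[OF fc N0(1)] y(1) by blast
  ultimately have "(f [^] t) \<odot>\<^bsub>S\<^esub> p \<in> sat R S f N0"
    using M.submoduleE(5)[OF M.sat_submodule[OF fc N0(1)]] y(3) by simp
  then show ?thesis using M.sat_pow_cancel[OF fc N0(1)] p Lc_S by blast
qed

lemma sat_shift:
  assumes "e \<in> expo n" "x \<in> sat R S f N" "\<And>y. y \<in> N \<Longrightarrow> shift e y \<in> N'"
  shows "shift e x \<in> sat R S f N'"
proof -
  obtain t :: nat where t: "x \<in> carrier S" "(f [^] t) \<odot>\<^bsub>S\<^esub> x \<in> N" using assms(2) by (rule M.satE)
  have "(f [^] t) \<odot>\<^bsub>S\<^esub> shift e x \<in> N'" using assms(3)[OF t(2)] pw by (simp add: shift_smult)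
  then show ?thesis using shift_closed[OF assms(1) t(1)] by (rule M.satI[rotated])
qed

definition "gens1 a = {shift e l | e l. e \<in> E a \<and> l \<in> Lc (a - dg e)}"

lemma gens1_S: "gens1 a \<subseteq> carrier S"
  using shift_closed E(2) Lc_S by (auto simp: gens1_def) blast

text \<open>This is the flatness of S_b/L_b: locally, L_b \<inter> \<mm> S_b = \<mm> L_b. Expand p
  in monomials with coefficients in \<mm>, rewrite each monomial as an element of L_b plus a
  standard part, and drop the standard part by \<open>sat_drop_PB\<close>.\<close>

lemma Lc_mod:
  assumes b: "b \<in> D" and p: "p \<in> Lc b" "\<And>v. p v \<in> \<mm>"
  shows "p \<in> sat R S f (lspan S \<mm> (Lc b))"
proof (rule sat_drop_PB[OF b _ _ p(1)])
  let ?N = "lspan S \<mm> (Lc b)"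
  show N: "submodule ?N R S" using M.lspan_submodule[OF mi Lc_S] .
  show NL: "?N \<subseteq> Lc b" using M.lspan_subset[OF Lc_submodule] M.submoduleE(4)[OF Lc_submodule] mc by blast
  have NP: "?N \<union> PB b \<subseteq> carrier S" using NL Lc_S supp_in_sub by blast
  have T: "submodule (spn (?N \<union> PB b)) R S" using M.span_submodule[OF NP] .
  have "lspan S \<mm> (mon R ` deg b) \<subseteq> sat R S f (spn (?N \<union> PB b))"
  proof (rule M.lspan_subset[OF M.sat_submodule[OF fc T]])
    fix c y assume c: "c \<in> \<mm>" and "y \<in> mon R ` deg b"
    then obtain s where s: "s \<in> deg b" "y = mon R s" by blast
    have cR: "c \<in> carrier R" using c mc by blast
    obtain t q l where q: "q \<in> PB b" "l \<in> Lc b" "(f [^] (t::nat)) \<odot>\<^bsub>S\<^esub> y = l \<oplus>\<^bsub>S\<^esub> q"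
      using bas_span[OF b mon_Xc[OF s(1)]] s(2) by blast
    have yS: "y \<in> carrier S" using s mon_closed by (simp add: deg_def)
    have "(f [^] t) \<odot>\<^bsub>S\<^esub> (c \<odot>\<^bsub>S\<^esub> y) = c \<odot>\<^bsub>S\<^esub> l \<oplus>\<^bsub>S\<^esub> c \<odot>\<^bsub>S\<^esub> q"
      using M.smult_comm[OF pw cR yS] q cR subsetD[OF Lc_S q(2)] subsetD[OF supp_in_sub q(1)]
      by (simp add: M.smult_r_distr)
    moreover have "c \<odot>\<^bsub>S\<^esub> l \<in> ?N" using M.lspan_base[OF mc Lc_S c q(2)] .
    moreover have "c \<odot>\<^bsub>S\<^esub> q \<in> PB b" using M.submoduleE(4)[OF PB_sub cR q(1)] .
    ultimately have "(f [^] t) \<odot>\<^bsub>S\<^esub> (c \<odot>\<^bsub>S\<^esub> y) \<in> spn (?N \<union> PB b)"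
      unfolding M.span_sum[OF N PB_sub] by blast
    then show "c \<odot>\<^bsub>S\<^esub> y \<in> sat R S f (spn (?N \<union> PB b))" using cR yS by (intro M.satI) auto
  qed
  moreover have "p \<in> supp_in \<mm> (deg b)"
    using p(2) subsetD[OF Lc_Xc p(1)] by (auto simp: supp_in_def Xc_iff deg_def S_carrier)
  ultimately show "p \<in> sat R S f (spn (?N \<union> PB b))"
    using supp_in_lspan[OF mi deg_sub[OF subset_refl]] by auto
qed

text \<open>The multiplier splits as x^e x^(t - e), with e from the finite set and t - e of degree
  0. The second factor keeps p in L_b with coefficients in \<mm>, so \<open>Lc_mod\<close> turns
  small coefficients of the polynomial into small coefficients of a combination.\<close>

lemma span_in_empty_sat: "span_in a {} \<subseteq> sat R S f (lspan S \<mm> (gens1 a))"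
proof -
  have N: "submodule (lspan S \<mm> (gens1 a)) R S" using M.lspan_submodule[OF mi gens1_S] .
  have "mults_in a {} \<subseteq> sat R S f (lspan S \<mm> (gens1 a))"
  proof
    fix y assume "y \<in> mults_in a {}"
    then obtain t p b where y: "y = shift t p" "b \<in> D" "p \<in> Lc b" "t \<in> expo n" "dg t + b = a"
      "\<And>v. p v \<in> \<mm>" unfolding mults_in_def by blast
    have ab: "a - dg t = b" using y(5) by auto
    then obtain e where e: "e \<in> E a" "e \<subseteq># t" "dg e = dg t" using E(4)[OF y(4), of a] y(2) by auto
    have ee: "e \<in> expo n" using e E(2) by blast
    have et: "e + (t - e) = t" using e(2) by simp
    have dg0: "dg (t - e) + b = b" using dg_diff[OF y(4) e(2)] e(3) by simp
    let ?p = "shift (t - e) p"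
    have pL: "?p \<in> Lc b" using Lc_shift[OF y(2,2) expo_diff[OF y(4)] dg0 y(3)] .
    have "?p v \<in> \<mm>" for v using y(6) ideal_zero[OF mi] by (simp add: shift_def)
    then have "?p \<in> sat R S f (lspan S \<mm> (Lc b))" using Lc_mod[OF y(2) pL] by blast
    moreover have "shift e x \<in> lspan S \<mm> (gens1 a)" if "x \<in> lspan S \<mm> (Lc b)" for x
    proof -
      have "shift e x \<in> lspan S \<mm> (shift e ` Lc b)" using lspan_shift[OF mc that] .
      moreover have "shift e ` Lc b \<subseteq> gens1 a" unfolding gens1_def using e(1,3) ab by fastforce
      ultimately show ?thesis using lspan_mono[OF subset_refl] by (metis subsetD)
    qed
    ultimately have "shift e ?p \<in> sat R S f (lspan S \<mm> (gens1 a))" by (rule sat_shift[OF ee])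
    then show "y \<in> sat R S f (lspan S \<mm> (gens1 a))" using y(1) et by (simp add: shift_shift)
  qed
  then show ?thesis unfolding span_in_def by (rule M.span_subset[OF M.sat_submodule[OF fc N]])
qed

end

section \<open>Independence of the standard monomials\<close>

context module
begin

lemma diff_add:
  assumes "submodule N R M" "a \<in> carrier M" "b \<in> carrier M" "c \<in> carrier M" "d \<in> carrier M"
    "a \<ominus>\<^bsub>M\<^esub> b \<in> N" "c \<ominus>\<^bsub>M\<^esub> d \<in> N"
  shows "(a \<oplus>\<^bsub>M\<^esub> c) \<ominus>\<^bsub>M\<^esub> (b \<oplus>\<^bsub>M\<^esub> d) \<in> N"
proof -
  have "(a \<oplus>\<^bsub>M\<^esub> c) \<ominus>\<^bsub>M\<^esub> (b \<oplus>\<^bsub>M\<^esub> d) = (a \<ominus>\<^bsub>M\<^esub> b) \<oplus>\<^bsub>M\<^esub> (c \<ominus>\<^bsub>M\<^esub> d)"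
    using assms(2-5) by (simp add: M.minus_eq M.minus_add M.a_ac)
  then show ?thesis using submoduleE(5)[OF assms(1,6,7)] by simp
qed

lemma diff_smult:
  assumes "submodule N R M" "a \<in> carrier M" "b \<in> carrier M" "r \<in> carrier R" "a \<ominus>\<^bsub>M\<^esub> b \<in> N"
  shows "r \<odot>\<^bsub>M\<^esub> a \<ominus>\<^bsub>M\<^esub> r \<odot>\<^bsub>M\<^esub> b \<in> N"
proof -
  have "r \<odot>\<^bsub>M\<^esub> a \<ominus>\<^bsub>M\<^esub> r \<odot>\<^bsub>M\<^esub> b = r \<odot>\<^bsub>M\<^esub> (a \<ominus>\<^bsub>M\<^esub> b)"
    using assms(2-4) by (simp add: M.minus_eq smult_r_distr smult_r_minus)
  then show ?thesis using submoduleE(4)[OF assms(1,4,5)] by simp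
qed

lemma diff_trans:
  assumes "submodule N R M" "a \<in> carrier M" "b \<in> carrier M" "c \<in> carrier M"
    "a \<ominus>\<^bsub>M\<^esub> b \<in> N" "b \<ominus>\<^bsub>M\<^esub> c \<in> N"
  shows "a \<ominus>\<^bsub>M\<^esub> c \<in> N"
proof -
  have "a \<ominus>\<^bsub>M\<^esub> c = (a \<ominus>\<^bsub>M\<^esub> b) \<oplus>\<^bsub>M\<^esub> (b \<ominus>\<^bsub>M\<^esub> c)"
    using assms(2-4) by (simp add: M.minus_eq M.a_assoc M.r_neg1)
  then show ?thesis using submoduleE(5)[OF assms(1,5,6)] by simp
qed

lemma diff_sym:
  assumes "submodule N R M" "a \<in> carrier M" "b \<in> carrier M" "a \<ominus>\<^bsub>M\<^esub> b \<in> N"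
  shows "b \<ominus>\<^bsub>M\<^esub> a \<in> N"
proof -
  have "b \<ominus>\<^bsub>M\<^esub> a = \<ominus>\<^bsub>M\<^esub> (a \<ominus>\<^bsub>M\<^esub> b)"
    using assms(2,3) by (simp add: M.minus_eq M.minus_add M.a_comm)
  then show ?thesis using submoduleE(3)[OF assms(1,4)] by simp
qed

lemma diff_refl: "submodule N R M \<Longrightarrow> a \<in> carrier M \<Longrightarrow> a \<ominus>\<^bsub>M\<^esub> a \<in> N"
  using submodule_zero by (simp add: M.minus_eq M.r_neg)

lemma diff_add_cancel: "a \<in> carrier M \<Longrightarrow> b \<in> carrier M \<Longrightarrow> (a \<ominus>\<^bsub>M\<^esub> b) \<oplus>\<^bsub>M\<^esub> b = a"
  by (simp add: M.minus_eq M.a_assoc M.l_neg)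

end

section \<open>Normal forms and the comparison of factorizations\<close>

context hilb_loc
begin

text \<open>An exponent t together with a standard polynomial congruent to f^t x^s modulo L, for s
  of a degree in D. \<open>ft\<close> is the denominator, \<open>nf\<close> the normal form and
  \<open>lf\<close> the element of L that witnesses the congruence.\<close>

definition "nft s = (SOME tq. snd tq \<in> PB (dg s) \<and>
    (f [^] (fst tq :: nat)) \<odot>\<^bsub>S\<^esub> mon R s \<ominus>\<^bsub>S\<^esub> snd tq \<in> Lc (dg s))"

abbreviation "ft s \<equiv> f [^] fst (nft s)"
abbreviation "nf s \<equiv> snd (nft s)"
abbreviation "lf s \<equiv> ft s \<odot>\<^bsub>S\<^esub> mon R s \<ominus>\<^bsub>S\<^esub> nf s"

lemma nf:
  assumes "s \<in> deg b" "b \<in> D" shows "nf s \<in> PB b" "lf s \<in> Lc b"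
proof -
  have dgs: "dg s = b" using assms by (simp add: deg_def)
  obtain t q where "q \<in> PB b" "(f [^] (t::nat)) \<odot>\<^bsub>S\<^esub> mon R s \<ominus>\<^bsub>S\<^esub> q \<in> Lc b"
    using bas[OF assms(2)] mon_Xc[OF assms(1)] unfolding poly_basis_def by blast
  then have "\<exists>tq. snd tq \<in> PB (dg s) \<and> (f [^] (fst tq :: nat)) \<odot>\<^bsub>S\<^esub> mon R s \<ominus>\<^bsub>S\<^esub> snd tq \<in> Lc (dg s)"
    unfolding dgs by (intro exI[of _ "(t, q)"]) simp
  then have "snd (nft s) \<in> PB (dg s) \<and> (f [^] (fst (nft s) :: nat)) \<odot>\<^bsub>S\<^esub> mon R s \<ominus>\<^bsub>S\<^esub> snd (nft s) \<in> Lc (dg s)"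
    unfolding nft_def by (rule someI_ex)
  then show "nf s \<in> PB b" "lf s \<in> Lc b" unfolding dgs by blast+
qed

lemma nf_S: "s \<in> deg b \<Longrightarrow> b \<in> D \<Longrightarrow> nf s \<in> carrier S"
  using nf(1) supp_in_sub by blast

lemma mon_S: "s \<in> deg b \<Longrightarrow> mon R s \<in> carrier S"
  by (simp add: deg_def mon_closed)

text \<open>With \<open>x\<^sup>e x\<^sup>s = x\<^sup>e\<^sup>' x\<^sup>s\<^sup>'\<close>, this compares the two reductions of this monomial through \<open>x\<^sup>e\<close> and
  through \<open>x\<^sup>e\<^sup>'\<close>; denominators are cleared.\<close>

definition "nf_diff e s e' s' = ft s \<odot>\<^bsub>S\<^esub> shift e' (nf s') \<ominus>\<^bsub>S\<^esub> ft s' \<odot>\<^bsub>S\<^esub> shift e (nf s)"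

text \<open>The common monomial x^(e + s) cancels after the denominators are exchanged, so the
  comparison is a difference of multiples of elements of L. It is supported on \<open>W a\<close>
  because only shifted normal forms are left.\<close>

lemma nf_diff:
  assumes e: "e \<in> E a" "e' \<in> E a" and s: "s \<in> deg (a - dg e)" "s' \<in> deg (a - dg e')" and w: "e + s = e' + s'"
  shows "nf_diff e s e' s' \<in> supp_in (carrier R) (W a)" "nf_diff e s e' s' \<in> J a"
    "ft s' \<odot>\<^bsub>S\<^esub> shift e (lf s) = ft s \<odot>\<^bsub>S\<^esub> shift e' (lf s') \<oplus>\<^bsub>S\<^esub> nf_diff e s e' s'"
proof -
  have D: "a - dg e \<in> D" "a - dg e' \<in> D" using E(3) e by auto
  have ee: "e \<in> expo n" "e' \<in> expo n" using E(2) e by auto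
  have WS: "submodule (supp_in (carrier R) (W a)) R S" using supp_in_submodule[OF oneideal W_expo] .
  show "nf_diff e s e' s' \<in> supp_in (carrier R) (W a)"
    unfolding nf_diff_def
    using M.submodule_diff[OF WS] M.submoduleE(4)[OF WS pw] shift_PB_W[OF e(1) nf(1)[OF s(1) D(1)]]
      shift_PB_W[OF e(2) nf(1)[OF s(2) D(2)]] by blast
  let ?x = "shift e (nf s)" and ?x' = "shift e' (nf s')" and ?m = "mon R (e + s)"
  have xS: "?x \<in> carrier S" "?x' \<in> carrier S" using shift_closed ee nf_S s D by auto
  have mS: "?m \<in> carrier S" using ee s by (intro mon_closed) (simp add: deg_def)
  have l: "shift e (lf s) = ft s \<odot>\<^bsub>S\<^esub> ?m \<ominus>\<^bsub>S\<^esub> ?x"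
    using shift_minus[OF ee(1), of "ft s \<odot>\<^bsub>S\<^esub> mon R s" "nf s"] nf_S[OF s(1) D(1)] mon_S[OF s(1)] pw
    by (simp add: shift_smult shift_mon)
  have l': "shift e' (lf s') = ft s' \<odot>\<^bsub>S\<^esub> ?m \<ominus>\<^bsub>S\<^esub> ?x'"
    using shift_minus[OF ee(2), of "ft s' \<odot>\<^bsub>S\<^esub> mon R s'" "nf s'"] nf_S[OF s(2) D(2)] mon_S[OF s(2)] pw w
    by (simp add: shift_smult shift_mon)
  have 1: "ft s' \<odot>\<^bsub>S\<^esub> shift e (lf s) = ft s' \<odot>\<^bsub>S\<^esub> (ft s \<odot>\<^bsub>S\<^esub> ?m) \<oplus>\<^bsub>S\<^esub> \<ominus>\<^bsub>S\<^esub> (ft s' \<odot>\<^bsub>S\<^esub> ?x)"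
    unfolding l using pw mS xS by (simp add: M.M.minus_eq M.smult_r_distr M.smult_r_minus)
  have 2: "ft s \<odot>\<^bsub>S\<^esub> shift e' (lf s') = ft s' \<odot>\<^bsub>S\<^esub> (ft s \<odot>\<^bsub>S\<^esub> ?m) \<oplus>\<^bsub>S\<^esub> \<ominus>\<^bsub>S\<^esub> (ft s \<odot>\<^bsub>S\<^esub> ?x')"
    unfolding l' using pw mS xS by (simp add: M.M.minus_eq M.smult_r_distr M.smult_r_minus M.smult_comm[of "ft s"])
  show eq: "ft s' \<odot>\<^bsub>S\<^esub> shift e (lf s) = ft s \<odot>\<^bsub>S\<^esub> shift e' (lf s') \<oplus>\<^bsub>S\<^esub> nf_diff e s e' s'"
    unfolding 1 2 nf_diff_def using pw mS xS by (simp add: M.M.minus_eq M.M.a_assoc M.M.r_neg1)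
  have gS: "nf_diff e s e' s' \<in> carrier S" using pw xS by (simp add: nf_diff_def)
  have "ft s' \<odot>\<^bsub>S\<^esub> shift e (lf s) \<in> J a"
    using M.submoduleE(4)[OF J_submodule pw shift_J[OF e(1) nf(2)[OF s(1) D(1)]]] .
  moreover have "ft s \<odot>\<^bsub>S\<^esub> shift e' (lf s') \<in> J a"
    using M.submoduleE(4)[OF J_submodule pw shift_J[OF e(2) nf(2)[OF s(2) D(2)]]] .
  ultimately show "nf_diff e s e' s' \<in> J a"
    unfolding eq using M.submodule_cancel[OF J_submodule _ _ gS] by blast
qed

definition "min_exps c = (SOME Q. finite Q \<and> Q \<subseteq> deg c \<and> (\<forall>u\<in>deg c. \<exists>q\<in>Q. q \<subseteq># u))"

lemma min_exps: "finite (min_exps c)" "min_exps c \<subseteq> deg c" "u \<in> deg c \<Longrightarrow> \<exists>q\<in>min_exps c. q \<subseteq># u"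
  using someI_ex[OF dickson[OF deg_sub[OF subset_refl[of "deg c"]]]] unfolding min_exps_def[symmetric] by auto

text \<open>Finitely many comparisons generate all others locally (lemma \<open>nf_diff_in_rels\<close> below): it suffices to take
  the monomials \<open>lcm(x\<^sup>e, x\<^sup>e\<^sup>') x\<^sup>q x\<^sup>z\<close> with \<open>x\<^sup>q\<close> from a Dickson basis and \<open>x\<^sup>z\<close> standard of degree \<open>0\<close>.\<close>

definition "nf_diffs a = (\<Union>e\<in>E a. \<Union>e'\<in>E a. \<Union>q\<in>min_exps (a - dg (e \<union># e')).
   (\<lambda>z. nf_diff e (e \<union># e' - e + q + z) e' (e \<union># e' - e' + q + z)) ` B 0)"

lemma nf_diffs_finite: "finite (nf_diffs a)"
  using E(1) min_exps(1) finB by (auto simp: nf_diffs_def)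

lemma lcm_shift:
  assumes e: "e \<in> E a" "e' \<in> E a" and q: "q \<in> deg (a - dg (e \<union># e'))"
  shows "e \<union># e' - e + q \<in> deg (a - dg e)" "e + (e \<union># e' - e + q) = e \<union># e' + q"
proof -
  have le: "e \<union># e' \<in> expo n" using E(2) e expo_lcm by blast
  have "e \<union># e' - e \<in> deg (dg (e \<union># e') - dg e)"
    using dg_diff[OF le, of e] expo_diff[OF le] by (simp add: deg_def)
  from deg_add[OF this q] show "e \<union># e' - e + q \<in> deg (a - dg e)"
    by (simp only: add_diff_eq diff_add_cancel add.commute) simp
  have "e + (e \<union># e' - e) = e \<union># e'" by simp
  then show "e + (e \<union># e' - e + q) = e \<union># e' + q" by (metis add.assoc)
qed

lemma deg_0_add: "u \<in> deg b \<Longrightarrow> z \<in> deg 0 \<Longrightarrow> u + z \<in> deg b"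
  using deg_add[of u b z 0] by simp

lemma nf_diffs_elem:
  assumes "e \<in> E a" "e' \<in> E a" "q \<in> min_exps (a - dg (e \<union># e'))" "z \<in> B 0"
  shows "nf_diff e (e \<union># e' - e + q + z) e' (e \<union># e' - e' + q + z) \<in> nf_diffs a"
  using assms unfolding nf_diffs_def by blast

lemma nf_diffs_props: "nf_diffs a \<subseteq> supp_in (carrier R) (W a)" "nf_diffs a \<subseteq> J a"
proof -
  have "x \<in> supp_in (carrier R) (W a) \<and> x \<in> J a" if "x \<in> nf_diffs a" for x
  proof -
    from that obtain e e' q z where x: "e \<in> E a" "e' \<in> E a" "q \<in> min_exps (a - dg (e \<union># e'))" "z \<in> B 0"
      "x = nf_diff e (e \<union># e' - e + q + z) e' (e \<union># e' - e' + q + z)" unfolding nf_diffs_def by blast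
    have q: "q \<in> deg (a - dg (e \<union># e'))" and q': "q \<in> deg (a - dg (e' \<union># e))"
      using x min_exps(2) by (auto simp: subset_mset.sup_commute)
    have z: "z \<in> deg 0" using x(4) B_deg by blast
    have s: "e \<union># e' - e + q + z \<in> deg (a - dg e)" "e \<union># e' - e' + q + z \<in> deg (a - dg e')"
      using deg_0_add[OF lcm_shift(1)[OF x(1,2) q] z] deg_0_add[OF lcm_shift(1)[OF x(2,1) q'] z]
      by (auto simp: subset_mset.sup_commute)
    have "e + (e \<union># e' - e + q + z) = e' + (e \<union># e' - e' + q + z)"
      using lcm_shift(2)[OF x(1,2) q] lcm_shift(2)[OF x(2,1) q']
      by (simp add: add.assoc[symmetric] subset_mset.sup_commute)
    then show ?thesis using nf_diff(1,2)[OF x(1,2) s] x(5) by blast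
  qed
  then show "nf_diffs a \<subseteq> supp_in (carrier R) (W a)" "nf_diffs a \<subseteq> J a" by blast+
qed

lemma nf_diffs_S: "nf_diffs a \<subseteq> carrier S" using nf_diffs_props(2) J_S by blast

text \<open>Saturated, so that powers of f can be cancelled when further comparisons are shown to
  belong to it.\<close>

definition "nf_rels a = sat R S f (spn (nf_diffs a))"

lemma nf_rels: "submodule (nf_rels a) R S"
  unfolding nf_rels_def using M.sat_submodule[OF fc M.span_submodule[OF nf_diffs_S]] .

text \<open>The element \<open>y\<close> represents the value of \<open>x\<^sup>e p\<close> in the free module on \<open>W\<close>, up to the
  finitely many relations in \<open>nf_diffs\<close>.\<close>

definition "represents a e p y \<longleftrightarrow> p \<in> carrier S \<and> y \<in> carrier S \<and>
  (\<exists>x\<in>PB (a - dg e). p \<ominus>\<^bsub>S\<^esub> x \<in> Lc (a - dg e) \<and> y \<ominus>\<^bsub>S\<^esub> shift e x \<in> nf_rels a)"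

lemma shift_PB_S: "e \<in> E a \<Longrightarrow> x \<in> PB b \<Longrightarrow> shift e x \<in> carrier S"
  using shift_closed E(2) supp_in_sub by blast

lemma represents_add:
  assumes e: "e \<in> E a" and r: "represents a e p y" "represents a e p' y'"
  shows "represents a e (p \<oplus>\<^bsub>S\<^esub> p') (y \<oplus>\<^bsub>S\<^esub> y')"
proof -
  obtain x where x: "x \<in> PB (a - dg e)" "p \<ominus>\<^bsub>S\<^esub> x \<in> Lc (a - dg e)" "y \<ominus>\<^bsub>S\<^esub> shift e x \<in> nf_rels a"
    "p \<in> carrier S" "y \<in> carrier S" using r(1) unfolding represents_def by blast
  obtain x' where x': "x' \<in> PB (a - dg e)" "p' \<ominus>\<^bsub>S\<^esub> x' \<in> Lc (a - dg e)" "y' \<ominus>\<^bsub>S\<^esub> shift e x' \<in> nf_rels a"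
    "p' \<in> carrier S" "y' \<in> carrier S" using r(2) unfolding represents_def by blast
  have xS: "x \<in> carrier S" "x' \<in> carrier S" using subsetD[OF supp_in_sub] x(1) x'(1) by auto
  have "x \<oplus>\<^bsub>S\<^esub> x' \<in> PB (a - dg e)" using M.submoduleE(5)[OF PB_sub x(1) x'(1)] .
  moreover have "(p \<oplus>\<^bsub>S\<^esub> p') \<ominus>\<^bsub>S\<^esub> (x \<oplus>\<^bsub>S\<^esub> x') \<in> Lc (a - dg e)"
    using M.diff_add[OF Lc_submodule] x x' xS by blast
  moreover have "(y \<oplus>\<^bsub>S\<^esub> y') \<ominus>\<^bsub>S\<^esub> shift e (x \<oplus>\<^bsub>S\<^esub> x') \<in> nf_rels a"
    unfolding shift_add
    using M.diff_add[OF nf_rels x(5) shift_PB_S[OF e x(1)] x'(5) shift_PB_S[OF e x'(1)] x(3) x'(3)] .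
  ultimately show ?thesis using x(4,5) x'(4,5) unfolding represents_def by auto
qed

lemma represents_smult:
  assumes e: "e \<in> E a" and r: "represents a e p y" and c: "c \<in> carrier R"
  shows "represents a e (c \<odot>\<^bsub>S\<^esub> p) (c \<odot>\<^bsub>S\<^esub> y)"
proof -
  obtain x where x: "x \<in> PB (a - dg e)" "p \<ominus>\<^bsub>S\<^esub> x \<in> Lc (a - dg e)" "y \<ominus>\<^bsub>S\<^esub> shift e x \<in> nf_rels a"
    "p \<in> carrier S" "y \<in> carrier S" using r(1) unfolding represents_def by blast
  have xS: "x \<in> carrier S" using subsetD[OF supp_in_sub] x(1) by auto
  have "c \<odot>\<^bsub>S\<^esub> x \<in> PB (a - dg e)" using M.submoduleE(4)[OF PB_sub c x(1)] .
  moreover have "c \<odot>\<^bsub>S\<^esub> p \<ominus>\<^bsub>S\<^esub> c \<odot>\<^bsub>S\<^esub> x \<in> Lc (a - dg e)"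
    using M.diff_smult[OF Lc_submodule x(4) xS c x(2)] .
  moreover have "c \<odot>\<^bsub>S\<^esub> y \<ominus>\<^bsub>S\<^esub> shift e (c \<odot>\<^bsub>S\<^esub> x) \<in> nf_rels a"
    unfolding shift_smult[OF c] using M.diff_smult[OF nf_rels x(5) shift_PB_S[OF e x(1)] c x(3)] .
  ultimately show ?thesis using x(4,5) c unfolding represents_def by auto
qed

lemma represents_L:
  assumes "l \<in> Lc (a - dg e)" shows "represents a e l \<zero>\<^bsub>S\<^esub>"
proof -
  have lS: "l \<in> carrier S" using assms Lc_S by blast
  have "\<zero>\<^bsub>S\<^esub> \<in> PB (a - dg e)" using M.submodule_zero[OF PB_sub] .
  moreover have "l \<ominus>\<^bsub>S\<^esub> \<zero>\<^bsub>S\<^esub> \<in> Lc (a - dg e)"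
    using M.submodule_diff[OF Lc_submodule assms M.submodule_zero[OF Lc_submodule]] .
  moreover have "\<zero>\<^bsub>S\<^esub> \<ominus>\<^bsub>S\<^esub> shift e \<zero>\<^bsub>S\<^esub> \<in> nf_rels a" using M.diff_refl[OF nf_rels, of "\<zero>\<^bsub>S\<^esub>" a] by simp
  ultimately show ?thesis using lS unfolding represents_def by auto
qed

lemma represents_mon:
  assumes e: "e \<in> E a" and s: "s \<in> deg (a - dg e)"
  shows "represents a e (ft s \<odot>\<^bsub>S\<^esub> mon R s) (shift e (nf s))"
  using nf[OF s E(3)[OF e]] mon_S[OF s] pw shift_PB_S[OF e nf(1)[OF s E(3)[OF e]]] M.diff_refl[OF nf_rels]
  unfolding represents_def by auto

lemma represents_cong:
  assumes e: "e \<in> E a" and r: "represents a e p y" and y': "y' \<in> carrier S" "y' \<ominus>\<^bsub>S\<^esub> y \<in> nf_rels a"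
  shows "represents a e p y'"
proof -
  obtain x where x: "x \<in> PB (a - dg e)" "p \<ominus>\<^bsub>S\<^esub> x \<in> Lc (a - dg e)" "y \<ominus>\<^bsub>S\<^esub> shift e x \<in> nf_rels a"
    "p \<in> carrier S" "y \<in> carrier S" using r(1) unfolding represents_def by blast
  have "y' \<ominus>\<^bsub>S\<^esub> shift e x \<in> nf_rels a"
    using M.diff_trans[OF nf_rels y'(1) x(5) shift_PB_S[OF e x(1)] y'(2) x(3)] .
  then show ?thesis using x y' unfolding represents_def by auto
qed

text \<open>Two standard polynomials congruent to p modulo L differ by a standard element of L,
  which vanishes locally by \<open>bas_ind\<close>; so their multiples by x^e agree up to the
  relations.\<close>

lemma represents_unique:
  assumes e: "e \<in> E a" and r: "represents a e p y" "represents a e p y'"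
  shows "y \<ominus>\<^bsub>S\<^esub> y' \<in> nf_rels a"
proof -
  obtain x where x: "x \<in> PB (a - dg e)" "p \<ominus>\<^bsub>S\<^esub> x \<in> Lc (a - dg e)" "y \<ominus>\<^bsub>S\<^esub> shift e x \<in> nf_rels a"
    "p \<in> carrier S" "y \<in> carrier S" using r(1) unfolding represents_def by blast
  obtain x' where x': "x' \<in> PB (a - dg e)" "p \<ominus>\<^bsub>S\<^esub> x' \<in> Lc (a - dg e)" "y' \<ominus>\<^bsub>S\<^esub> shift e x' \<in> nf_rels a"
    "y' \<in> carrier S" using r(2) unfolding represents_def by blast
  have xS: "x \<in> carrier S" "x' \<in> carrier S" using subsetD[OF supp_in_sub] x(1) x'(1) by auto
  have "x \<ominus>\<^bsub>S\<^esub> x' \<in> Lc (a - dg e)"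
    using M.diff_trans[OF Lc_submodule xS(1) x(4) xS(2) M.diff_sym[OF Lc_submodule x(4) xS(1) x(2)] x'(2)] .
  moreover have "x \<ominus>\<^bsub>S\<^esub> x' \<in> PB (a - dg e)" using M.submodule_diff[OF PB_sub x(1) x'(1)] .
  ultimately have "x \<ominus>\<^bsub>S\<^esub> x' \<in> sat R S f {\<zero>\<^bsub>S\<^esub>}" using bas_ind[OF E(3)[OF e]] by blast
  then have "shift e (x \<ominus>\<^bsub>S\<^esub> x') \<in> sat R S f {\<zero>\<^bsub>S\<^esub>}"
    using sat_shift[of e _ "{\<zero>\<^bsub>S\<^esub>}" "{\<zero>\<^bsub>S\<^esub>}"] E(2) e by auto
  then have "shift e (x \<ominus>\<^bsub>S\<^esub> x') \<in> nf_rels a"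
    unfolding nf_rels_def using M.sat_zero_subset[OF fc M.span_submodule[OF nf_diffs_S]] by blast
  then have "shift e x \<ominus>\<^bsub>S\<^esub> shift e x' \<in> nf_rels a" using shift_minus[OF subsetD[OF E(2) e] xS] by simp
  then have "y \<ominus>\<^bsub>S\<^esub> shift e x' \<in> nf_rels a"
    using M.diff_trans[OF nf_rels x(5) shift_PB_S[OF e x(1)] shift_PB_S[OF e x'(1)] x(3)] by blast
  then show ?thesis
    using M.diff_trans[OF nf_rels x(5) shift_PB_S[OF e x'(1)] x'(4)] 
      M.diff_sym[OF nf_rels x'(4) shift_PB_S[OF e x'(1)] x'(3)] by blast
qed

text \<open>For a single standard monomial of degree 0 the two sides are compared by one of the
  finitely many \<open>nf_diffs\<close>. Linearity extends this to \<zeta>, once a common power of f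
  has been chosen.\<close>

lemma represents_common:
  assumes e: "e \<in> E a" "e' \<in> E a" and q: "q \<in> min_exps (a - dg (e \<union># e'))" and \<zeta>: "\<zeta> \<in> PB 0"
  shows "\<exists>(t::nat) y. represents a e ((f [^] t) \<odot>\<^bsub>S\<^esub> shift (e \<union># e' - e + q) \<zeta>) y \<and>
    represents a e' ((f [^] t) \<odot>\<^bsub>S\<^esub> shift (e \<union># e' - e' + q) \<zeta>) y"
proof -
  let ?r = "e \<union># e' - e + q" and ?r' = "e \<union># e' - e' + q"
  have qd: "q \<in> deg (a - dg (e \<union># e'))" "q \<in> deg (a - dg (e' \<union># e))"
    using q min_exps(2) by (auto simp: subset_mset.sup_commute)
  have r: "?r \<in> deg (a - dg e)" "?r' \<in> deg (a - dg e')"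
    using lcm_shift(1)[OF e qd(1)] lcm_shift(1)[OF e(2,1) qd(2)] by (auto simp: subset_mset.sup_commute)
  have re: "?r \<in> expo n" "?r' \<in> expo n" using r deg_expo by blast+
  have "\<zeta> \<in> spn (mon R ` B 0)" using \<zeta> supp_in_lspan[OF oneideal B_expo] by blast
  then have "\<zeta> \<in> carrier S \<and> (\<exists>(t::nat) y. represents a e ((f [^] t) \<odot>\<^bsub>S\<^esub> shift ?r \<zeta>) y \<and>
    represents a e' ((f [^] t) \<odot>\<^bsub>S\<^esub> shift ?r' \<zeta>) y)"
  proof induction
    case lspan_zero
    have "represents a e \<zero>\<^bsub>S\<^esub> \<zero>\<^bsub>S\<^esub>" "represents a e' \<zero>\<^bsub>S\<^esub> \<zero>\<^bsub>S\<^esub>" using represents_L M.submodule_zero[OF Lc_submodule] by auto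
    then show ?case using pw by (intro conjI exI[of _ 0] exI[of _ "\<zero>\<^bsub>S\<^esub>"]) auto
  next
    case (lspan_step c m \<zeta>)
    then obtain z where z: "z \<in> B 0" "m = mon R z" by blast
    obtain T y where Ty: "represents a e ((f [^] (T::nat)) \<odot>\<^bsub>S\<^esub> shift ?r \<zeta>) y" "represents a e' ((f [^] T) \<odot>\<^bsub>S\<^esub> shift ?r' \<zeta>) y"
      and \<zeta>S: "\<zeta> \<in> carrier S" using lspan_step(4) by blast
    have zd: "z \<in> deg 0" using z B_deg by blast
    have c: "c \<in> carrier R" using lspan_step(1) .
    let ?s = "?r + z" and ?s' = "?r' + z"
    have s: "?s \<in> deg (a - dg e)" "?s' \<in> deg (a - dg e')" using deg_0_add[OF r(1) zd] deg_0_add[OF r(2) zd] .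
    have mS: "m \<in> carrier S" "mon R ?s \<in> carrier S" "mon R ?s' \<in> carrier S"
      using mon_S z(2) zd s by auto
    let ?y1 = "ft ?s' \<odot>\<^bsub>S\<^esub> shift e (nf ?s)" and ?y2 = "ft ?s \<odot>\<^bsub>S\<^esub> shift e' (nf ?s')"
    have nfS: "shift e (nf ?s) \<in> carrier S" "shift e' (nf ?s') \<in> carrier S"
      using shift_PB_S[OF e(1) nf(1)[OF s(1) E(3)[OF e(1)]]] shift_PB_S[OF e(2) nf(1)[OF s(2) E(3)[OF e(2)]]] .
    have yS: "?y1 \<in> carrier S" "?y2 \<in> carrier S" using nfS pw by auto
    have "nf_diff e ?s e' ?s' \<in> nf_rels a"
      unfolding nf_rels_def using M.sat_incl[OF fc M.span_submodule[OF nf_diffs_S]] M.lspan_base1[OF nf_diffs_S]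
        nf_diffs_elem[OF e q z(1)] by blast
    then have gO: "?y2 \<ominus>\<^bsub>S\<^esub> ?y1 \<in> nf_rels a" by (simp add: nf_diff_def)
    have r1: "represents a e (ft ?s' \<odot>\<^bsub>S\<^esub> (ft ?s \<odot>\<^bsub>S\<^esub> mon R ?s)) ?y1"
      using represents_smult[OF e(1) represents_mon[OF e(1) s(1)] pw] .
    have "represents a e' (ft ?s \<odot>\<^bsub>S\<^esub> (ft ?s' \<odot>\<^bsub>S\<^esub> mon R ?s')) ?y2"
      using represents_smult[OF e(2) represents_mon[OF e(2) s(2)] pw] .
    then have "represents a e' (ft ?s \<odot>\<^bsub>S\<^esub> (ft ?s' \<odot>\<^bsub>S\<^esub> mon R ?s')) ?y1"
      by (rule represents_cong[OF e(2) _ yS(1) M.diff_sym[OF nf_rels yS(2,1) gO]])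
    then have r2: "represents a e' (ft ?s' \<odot>\<^bsub>S\<^esub> (ft ?s \<odot>\<^bsub>S\<^esub> mon R ?s')) ?y1"
      using M.smult_comm[OF pw pw mS(3)] by simp
    let ?N = "fst (nft ?s') + fst (nft ?s)"
    have fN: "ft ?s' \<odot>\<^bsub>S\<^esub> (ft ?s \<odot>\<^bsub>S\<^esub> x) = (f [^] ?N) \<odot>\<^bsub>S\<^esub> x" if "x \<in> carrier S" for x
      using M.pow_smult[OF fc that, of "fst (nft ?s')" "fst (nft ?s)"] by simp
    \<comment> \<open>The new monomial comes with f^N and the rest of \<zeta> with f^T, so each part
      is multiplied by the power of the other.\<close>
    have comb: "represents a e0 ((f [^] (T + ?N)) \<odot>\<^bsub>S\<^esub> shift r0 (c \<odot>\<^bsub>S\<^esub> m \<oplus>\<^bsub>S\<^esub> \<zeta>))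
        (((f [^] T) \<otimes> c) \<odot>\<^bsub>S\<^esub> ?y1 \<oplus>\<^bsub>S\<^esub> (f [^] ?N) \<odot>\<^bsub>S\<^esub> y)"
      if e0: "e0 \<in> E a" "r0 \<in> expo n" and ra: "represents a e0 ((f [^] ?N) \<odot>\<^bsub>S\<^esub> mon R (r0 + z)) ?y1"
        and rb: "represents a e0 ((f [^] T) \<odot>\<^bsub>S\<^esub> shift r0 \<zeta>) y" for e0 r0
    proof -
      have S0: "mon R (r0 + z) \<in> carrier S" "shift r0 \<zeta> \<in> carrier S"
        using e0(2) zd shift_closed[OF e0(2) \<zeta>S] by (auto intro!: mon_closed simp: deg_def)
      have fTc: "(f [^] T) \<otimes> c \<in> carrier R" using pw c by simp
      have "represents a e0 (((f [^] T) \<otimes> c) \<odot>\<^bsub>S\<^esub> ((f [^] ?N) \<odot>\<^bsub>S\<^esub> mon R (r0 + z)) \<oplus>\<^bsub>S\<^esub>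
          (f [^] ?N) \<odot>\<^bsub>S\<^esub> ((f [^] T) \<odot>\<^bsub>S\<^esub> shift r0 \<zeta>))
          (((f [^] T) \<otimes> c) \<odot>\<^bsub>S\<^esub> ?y1 \<oplus>\<^bsub>S\<^esub> (f [^] ?N) \<odot>\<^bsub>S\<^esub> y)"
        using represents_add[OF e0(1) represents_smult[OF e0(1) ra fTc] represents_smult[OF e0(1) rb pw]] .
      moreover have "((f [^] T) \<otimes> c) \<odot>\<^bsub>S\<^esub> ((f [^] ?N) \<odot>\<^bsub>S\<^esub> mon R (r0 + z)) =
          (f [^] (T + ?N)) \<odot>\<^bsub>S\<^esub> (c \<odot>\<^bsub>S\<^esub> mon R (r0 + z))"
        using S0 pw c by (simp add: M.pow_smult[OF fc] M.smult_assoc1 M.smult_comm[of c])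
      moreover have "(f [^] ?N) \<odot>\<^bsub>S\<^esub> ((f [^] T) \<odot>\<^bsub>S\<^esub> shift r0 \<zeta>) = (f [^] (T + ?N)) \<odot>\<^bsub>S\<^esub> shift r0 \<zeta>"
        using M.pow_smult[OF fc S0(2), of ?N T] by (simp add: add.commute)
      moreover have "shift r0 (c \<odot>\<^bsub>S\<^esub> m \<oplus>\<^bsub>S\<^esub> \<zeta>) = c \<odot>\<^bsub>S\<^esub> mon R (r0 + z) \<oplus>\<^bsub>S\<^esub> shift r0 \<zeta>"
        using c z(2) by (simp add: shift_add shift_smult shift_mon)
      ultimately show ?thesis using S0 pw c by (simp add: M.smult_r_distr)
    qed
    have "represents a e ((f [^] ?N) \<odot>\<^bsub>S\<^esub> mon R ?s) ?y1" using r1 fN[OF mS(2)] by simp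
    moreover have "represents a e' ((f [^] ?N) \<odot>\<^bsub>S\<^esub> mon R ?s') ?y1" using r2 fN[OF mS(3)] by simp
    ultimately show ?case
      using comb[OF e(1) re(1) _ Ty(1)] comb[OF e(2) re(2) _ Ty(2)] c mS \<zeta>S by blast
  qed
  then show ?thesis by blast
qed

text \<open>The common monomial is lcm(x^e, x^e') x^q x^s0 with s0 of degree 0. By
  \<open>sp0\<close> the factor x^s0 is locally a standard polynomial \<zeta> modulo J_0, and J_0
  times a monomial of a degree leading into D falls into L. So both reductions can be computed from
  the same \<zeta>, where they agree by \<open>represents_common\<close>, and
  \<open>represents_unique\<close> returns to the chosen normal forms.\<close>

lemma nf_diff_in_rels:
  assumes sp0: "Xc {0} \<subseteq> sat R S f (spn (J 0 \<union> PB 0))"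
    and e: "e \<in> E a" "e' \<in> E a" and s: "s \<in> deg (a - dg e)" "s' \<in> deg (a - dg e')" and w: "e + s = e' + s'"
  shows "nf_diff e s e' s' \<in> nf_rels a"
proof -
  let ?l = "e \<union># e'"
  have ee: "e \<in> expo n" "e' \<in> expo n" using E(2) e by auto
  have se: "s \<in> expo n" "s' \<in> expo n" using s deg_expo by auto
  have we: "e + s \<in> expo n" using ee se by simp
  have "e \<subseteq># e + s" "e' \<subseteq># e + s" by simp (simp add: w)
  then have lw: "?l \<subseteq># e + s" by simp
  have dw: "dg (e + s) = a" using s ee by (simp add: dg_add deg_def)
  have "e + s - ?l \<in> deg (a - dg ?l)" using dg_diff[OF we lw] expo_diff[OF we] dw by (simp add: deg_def)
  then obtain q where q: "q \<in> min_exps (a - dg ?l)" "q \<subseteq># e + s - ?l" using min_exps(3) by blast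
  define s0 where "s0 = e + s - ?l - q"
  have s0: "?l + q + s0 = e + s" using q(2) lw unfolding s0_def
    by (metis add.assoc subset_mset.add_diff_inverse)
  let ?r = "?l - e + q" and ?r' = "?l - e' + q"
  have qd: "q \<in> deg (a - dg ?l)" "q \<in> deg (a - dg (e' \<union># e))"
    using q min_exps(2) by (auto simp: subset_mset.sup_commute)
  have r: "?r \<in> deg (a - dg e)" "?r' \<in> deg (a - dg e')"
    using lcm_shift(1)[OF e qd(1)] lcm_shift(1)[OF e(2,1) qd(2)] by (auto simp: subset_mset.sup_commute)
  have rl: "e + ?r = ?l + q" "e' + ?r' = ?l + q"
    using lcm_shift(2)[OF e qd(1)] lcm_shift(2)[OF e(2,1) qd(2)] by (auto simp: subset_mset.sup_commute)
  have rs: "s = ?r + s0" "s' = ?r' + s0"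
    using rl s0 w by (metis add.assoc add_left_cancel)+
  have s0d: "s0 \<in> deg 0"
    using rs(1) s(1) r(1) by (auto simp: deg_def dg_add)
  have D: "a - dg e \<in> D" "a - dg e' \<in> D" using E(3) e by auto
  have "mon R s0 \<in> sat R S f (spn (J 0 \<union> PB 0))" using sp0 mon_Xc[OF s0d] by blast
  then obtain t0 :: nat where "(f [^] t0) \<odot>\<^bsub>S\<^esub> mon R s0 \<in> spn (J 0 \<union> PB 0)" by (rule M.satE)
  then obtain i \<zeta> where i: "i \<in> J 0" "\<zeta> \<in> PB 0" "(f [^] t0) \<odot>\<^bsub>S\<^esub> mon R s0 = i \<oplus>\<^bsub>S\<^esub> \<zeta>"
    unfolding M.span_sum[OF J_submodule PB_sub] by blast
  obtain T y where Ty: "represents a e ((f [^] (T::nat)) \<odot>\<^bsub>S\<^esub> shift ?r \<zeta>) y" "represents a e' ((f [^] T) \<odot>\<^bsub>S\<^esub> shift ?r' \<zeta>) y"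
    using represents_common[OF e q(1) i(2)] by blast
  have yS: "y \<in> carrier S" using Ty(1) unfolding represents_def by blast
  let ?M = "T + t0"
  \<comment> \<open>Replacing x^s0 by \<zeta> changes the polynomial only by x^r0 times an element
    of J_0. Its degree is in D, so it lies in L and is represented by zero.\<close>
  have main: "represents a e0 ((f [^] ?M) \<odot>\<^bsub>S\<^esub> mon R (r0 + s0)) y"
    if e0: "e0 \<in> E a" "r0 \<in> deg (a - dg e0)" and r0: "represents a e0 ((f [^] T) \<odot>\<^bsub>S\<^esub> shift r0 \<zeta>) y" for e0 r0
  proof -
    have r0e: "r0 \<in> expo n" and r0d: "dg r0 + 0 = a - dg e0" using e0(2) by (auto simp: deg_def)
    have iL: "shift r0 i \<in> Lc (a - dg e0)" using J_shift[OF r0e r0d i(1)] J_D[OF E(3)[OF e0(1)]] by simp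
    have S0: "shift r0 i \<in> carrier S" "shift r0 \<zeta> \<in> carrier S" "mon R (r0 + s0) \<in> carrier S"
      using shift_closed[OF r0e subsetD[OF J_S i(1)]] shift_closed[OF r0e subsetD[OF supp_in_sub i(2)]]
        mon_S[OF deg_0_add[OF e0(2) s0d]] .
    have "(f [^] t0) \<odot>\<^bsub>S\<^esub> mon R (r0 + s0) = shift r0 ((f [^] t0) \<odot>\<^bsub>S\<^esub> mon R s0)"
      using pw by (simp add: shift_smult shift_mon)
    also have "\<dots> = shift r0 i \<oplus>\<^bsub>S\<^esub> shift r0 \<zeta>" by (simp only: i(3) shift_add)
    finally have "(f [^] ?M) \<odot>\<^bsub>S\<^esub> mon R (r0 + s0) = (f [^] T) \<odot>\<^bsub>S\<^esub> shift r0 i \<oplus>\<^bsub>S\<^esub> (f [^] T) \<odot>\<^bsub>S\<^esub> shift r0 \<zeta>"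
      using S0 pw by (simp add: M.pow_smult[OF fc] M.smult_r_distr)
    moreover have "represents a e0 ((f [^] T) \<odot>\<^bsub>S\<^esub> shift r0 i \<oplus>\<^bsub>S\<^esub> (f [^] T) \<odot>\<^bsub>S\<^esub> shift r0 \<zeta>) (\<zero>\<^bsub>S\<^esub> \<oplus>\<^bsub>S\<^esub> y)"
      using represents_add[OF e0(1) represents_L[OF M.submoduleE(4)[OF Lc_submodule pw iL]] r0] .
    ultimately show ?thesis using yS by simp
  qed
  \<comment> \<open>The same polynomial is represented by a multiple of y and by a multiple of the
    shifted normal form; uniqueness compares them.\<close>
  have fin: "(f [^] ?M) \<odot>\<^bsub>S\<^esub> shift e0 (nf (r0 + s0)) \<ominus>\<^bsub>S\<^esub> ft (r0 + s0) \<odot>\<^bsub>S\<^esub> y \<in> nf_rels a"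
    if e0: "e0 \<in> E a" "r0 \<in> deg (a - dg e0)" and r0: "represents a e0 ((f [^] T) \<odot>\<^bsub>S\<^esub> shift r0 \<zeta>) y" for e0 r0
  proof -
    have sd: "r0 + s0 \<in> deg (a - dg e0)" using deg_0_add[OF e0(2) s0d] .
    have "represents a e0 (ft (r0 + s0) \<odot>\<^bsub>S\<^esub> ((f [^] ?M) \<odot>\<^bsub>S\<^esub> mon R (r0 + s0))) (ft (r0 + s0) \<odot>\<^bsub>S\<^esub> y)"
      using represents_smult[OF e0(1) main[OF e0 r0] pw] .
    then have "represents a e0 ((f [^] ?M) \<odot>\<^bsub>S\<^esub> (ft (r0 + s0) \<odot>\<^bsub>S\<^esub> mon R (r0 + s0))) (ft (r0 + s0) \<odot>\<^bsub>S\<^esub> y)"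
      using M.smult_comm[OF pw pw mon_S[OF sd]] by simp
    then show ?thesis
      using represents_unique[OF e0(1) represents_smult[OF e0(1) represents_mon[OF e0(1) sd] pw]] by blast
  qed
  let ?y1 = "shift e (nf s)" and ?y2 = "shift e' (nf s')"
  have S12: "?y1 \<in> carrier S" "?y2 \<in> carrier S"
    using shift_PB_S[OF e(1) nf(1)[OF s(1) D(1)]] shift_PB_S[OF e(2) nf(1)[OF s(2) D(2)]] .
  have 1: "(f [^] ?M) \<odot>\<^bsub>S\<^esub> ?y1 \<ominus>\<^bsub>S\<^esub> ft s \<odot>\<^bsub>S\<^esub> y \<in> nf_rels a"
    using fin[OF e(1) r(1) Ty(1)] rs(1) by simp
  have 2: "(f [^] ?M) \<odot>\<^bsub>S\<^esub> ?y2 \<ominus>\<^bsub>S\<^esub> ft s' \<odot>\<^bsub>S\<^esub> y \<in> nf_rels a"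
    using fin[OF e(2) r(2) Ty(2)] rs(2) by simp
  have c: "(f [^] ?M) \<odot>\<^bsub>S\<^esub> ?y1 \<in> carrier S" "(f [^] ?M) \<odot>\<^bsub>S\<^esub> ?y2 \<in> carrier S"
    "ft s \<odot>\<^bsub>S\<^esub> y \<in> carrier S" "ft s' \<odot>\<^bsub>S\<^esub> y \<in> carrier S" using S12 yS pw by auto
  have 3: "ft s' \<odot>\<^bsub>S\<^esub> ((f [^] ?M) \<odot>\<^bsub>S\<^esub> ?y1) \<ominus>\<^bsub>S\<^esub> ft s' \<odot>\<^bsub>S\<^esub> (ft s \<odot>\<^bsub>S\<^esub> y) \<in> nf_rels a"
    using M.diff_smult[OF nf_rels c(1,3) pw 1] .
  have "ft s \<odot>\<^bsub>S\<^esub> ((f [^] ?M) \<odot>\<^bsub>S\<^esub> ?y2) \<ominus>\<^bsub>S\<^esub> ft s \<odot>\<^bsub>S\<^esub> (ft s' \<odot>\<^bsub>S\<^esub> y) \<in> nf_rels a"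
    using M.diff_smult[OF nf_rels c(2,4) pw 2] .
  then have 4: "ft s \<odot>\<^bsub>S\<^esub> ((f [^] ?M) \<odot>\<^bsub>S\<^esub> ?y2) \<ominus>\<^bsub>S\<^esub> ft s' \<odot>\<^bsub>S\<^esub> (ft s \<odot>\<^bsub>S\<^esub> y) \<in> nf_rels a"
    using M.smult_comm[OF pw pw yS] by simp
  have c': "ft s \<odot>\<^bsub>S\<^esub> ((f [^] ?M) \<odot>\<^bsub>S\<^esub> ?y2) \<in> carrier S" "ft s' \<odot>\<^bsub>S\<^esub> ((f [^] ?M) \<odot>\<^bsub>S\<^esub> ?y1) \<in> carrier S"
    "ft s' \<odot>\<^bsub>S\<^esub> (ft s \<odot>\<^bsub>S\<^esub> y) \<in> carrier S" using c pw by auto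
  have "ft s \<odot>\<^bsub>S\<^esub> ((f [^] ?M) \<odot>\<^bsub>S\<^esub> ?y2) \<ominus>\<^bsub>S\<^esub> ft s' \<odot>\<^bsub>S\<^esub> ((f [^] ?M) \<odot>\<^bsub>S\<^esub> ?y1) \<in> nf_rels a"
    using M.diff_trans[OF nf_rels c'(1,3,2) 4 M.diff_sym[OF nf_rels c'(2,3) 3]] .
  moreover have "(f [^] ?M) \<odot>\<^bsub>S\<^esub> nf_diff e s e' s' =
      ft s \<odot>\<^bsub>S\<^esub> ((f [^] ?M) \<odot>\<^bsub>S\<^esub> ?y2) \<ominus>\<^bsub>S\<^esub> ft s' \<odot>\<^bsub>S\<^esub> ((f [^] ?M) \<odot>\<^bsub>S\<^esub> ?y1)"
    unfolding nf_diff_def using S12 pw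
    by (simp add: M.M.minus_eq M.smult_r_distr M.smult_r_minus M.smult_comm[of "f [^] ?M"])
  ultimately have "(f [^] ?M) \<odot>\<^bsub>S\<^esub> nf_diff e s e' s' \<in> nf_rels a" by simp
  moreover have "nf_diff e s e' s' \<in> carrier S" using S12 pw by (simp add: nf_diff_def)
  ultimately show ?thesis
    unfolding nf_rels_def using M.sat_pow_cancel[OF fc M.span_submodule[OF nf_diffs_S]] by blast
qed

end

section \<open>Reduction to finitely many relations and local independence\<close>

context hilb_loc
begin

definition "reducible a = {w. \<exists>e\<in>E a. e \<subseteq># w \<and> w - e \<in> deg (a - dg e)}"
text \<open>One factorization is fixed for each reducible w, which yields a single relation
  \<open>lead_rel a w\<close> with leading monomial x^w; every other factorization gives the same
  relation up to a comparison \<open>nf_diff\<close>.\<close>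

definition "red_exp a w = (SOME e. e \<in> E a \<and> e \<subseteq># w \<and> w - e \<in> deg (a - dg e))"
definition "lead_rel a w = shift (red_exp a w) (lf (w - red_exp a w))"

lemma red_exp:
  assumes "w \<in> reducible a" shows "red_exp a w \<in> E a" "red_exp a w \<subseteq># w" "w - red_exp a w \<in> deg (a - dg (red_exp a w))"
proof -
  have "\<exists>e. e \<in> E a \<and> e \<subseteq># w \<and> w - e \<in> deg (a - dg e)" using assms unfolding reducible_def by blast
  then have "red_exp a w \<in> E a \<and> red_exp a w \<subseteq># w \<and> w - red_exp a w \<in> deg (a - dg (red_exp a w))"
    unfolding red_exp_def by (rule someI_ex)
  then show "red_exp a w \<in> E a" "red_exp a w \<subseteq># w" "w - red_exp a w \<in> deg (a - dg (red_exp a w))" by auto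
qed

lemma reducible_expo: "reducible a \<subseteq> expo n"
proof
  fix w assume "w \<in> reducible a"
  note e = red_exp[OF this]
  have "red_exp a w + (w - red_exp a w) = w" using e(2) by simp
  moreover have "red_exp a w + (w - red_exp a w) \<in> expo n"
    using subsetD[OF E(2) e(1)] e(3) by (simp only: expo_add deg_def mem_Collect_eq)
  ultimately show "w \<in> expo n" by simp
qed

lemma lead_rel_J: "w \<in> reducible a \<Longrightarrow> lead_rel a w \<in> J a"
  unfolding lead_rel_def using shift_J[OF red_exp(1) nf(2)[OF red_exp(3) E(3)[OF red_exp(1)]]] by blast

lemma lead_rel_lead:
  assumes "w \<in> reducible a"
  shows "\<exists>t::nat. \<exists>\<nu>\<in>supp_in (carrier R) (W a). lead_rel a w = (f [^] t) \<odot>\<^bsub>S\<^esub> mon R w \<oplus>\<^bsub>S\<^esub> \<nu>"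
proof -
  note e = red_exp[OF assms]
  let ?e = "red_exp a w" and ?s = "w - red_exp a w"
  have ee: "?e \<in> expo n" using e(1) E(2) by blast
  have D: "a - dg ?e \<in> D" using E(3) e(1) .
  have WS: "submodule (supp_in (carrier R) (W a)) R S" using supp_in_submodule[OF oneideal W_expo] .
  have "lead_rel a w = shift ?e (ft ?s \<odot>\<^bsub>S\<^esub> mon R ?s) \<ominus>\<^bsub>S\<^esub> shift ?e (nf ?s)"
    unfolding lead_rel_def using shift_minus[OF ee] mon_S[OF e(3)] nf_S[OF e(3) D] pw by simp
  also have "shift ?e (ft ?s \<odot>\<^bsub>S\<^esub> mon R ?s) = ft ?s \<odot>\<^bsub>S\<^esub> mon R w"
    using pw e(2) by (simp add: shift_smult shift_mon)
  finally have "lead_rel a w = ft ?s \<odot>\<^bsub>S\<^esub> mon R w \<oplus>\<^bsub>S\<^esub> \<ominus>\<^bsub>S\<^esub> shift ?e (nf ?s)"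
    by (simp add: M.M.minus_eq)
  moreover have "\<ominus>\<^bsub>S\<^esub> shift ?e (nf ?s) \<in> supp_in (carrier R) (W a)"
    using M.submoduleE(3)[OF WS shift_PB_W[OF e(1) nf(1)[OF e(3) D]]] .
  ultimately show ?thesis by blast
qed

text \<open>Each monomial is locally a multiple of an \<open>lf\<close> plus its normal form, so an
  element of L_b is a combination of the \<open>lf\<close> plus a standard part, which
  \<open>sat_drop_PB\<close> removes.\<close>

lemma Lc_lf:
  assumes b: "b \<in> D" shows "Lc b \<subseteq> sat R S f (spn (lf ` deg b))"
proof
  fix p assume p: "p \<in> Lc b"
  let ?N = "spn (lf ` deg b)"
  have lL: "lf ` deg b \<subseteq> Lc b" using nf(2) b by blast
  have N: "submodule ?N R S" using M.span_submodule[OF subset_trans[OF lL Lc_S]] .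
  have NL: "?N \<subseteq> Lc b" using M.span_subset[OF Lc_submodule lL] .
  have T: "submodule (spn (?N \<union> PB b)) R S"
    using M.span_submodule NL Lc_S supp_in_sub by (meson Un_least subset_trans)
  have "mon R ` deg b \<subseteq> sat R S f (spn (?N \<union> PB b))"
  proof
    fix x assume "x \<in> mon R ` deg b"
    then obtain s where s: "s \<in> deg b" "x = mon R s" by blast
    have "lf s \<in> ?N" using M.lspan_base1[OF subset_trans[OF lL Lc_S]] s(1) by blast
    then have "lf s \<oplus>\<^bsub>S\<^esub> nf s \<in> spn (?N \<union> PB b)"
      using M.span_sumI[OF N PB_sub _ nf(1)[OF s(1) b]] by blast
    moreover have "lf s \<oplus>\<^bsub>S\<^esub> nf s = ft s \<odot>\<^bsub>S\<^esub> x"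
      using M.diff_add_cancel[of "ft s \<odot>\<^bsub>S\<^esub> mon R s" "nf s"] mon_S[OF s(1)] nf_S[OF s(1) b] pw s(2) by simp
    ultimately show "x \<in> sat R S f (spn (?N \<union> PB b))" using mon_S[OF s(1)] s(2) by (intro M.satI) auto
  qed
  then have "Xc {b} \<subseteq> sat R S f (spn (?N \<union> PB b))"
    unfolding Xc_supp supp_in_lspan[OF oneideal deg_sub[OF subset_refl]]
    by (rule M.span_subset[OF M.sat_submodule[OF fc T]])
  then show "p \<in> sat R S f ?N" using sat_drop_PB[OF b N NL p] Lc_Xc p by blast
qed

text \<open>The finite set for the second use of Nakayama. The relations for w outside
  \<open>W a\<close> can be left out: each is the only one that involves its own monomial x^w, so it
  cannot contribute to an element supported on \<open>W a\<close>.\<close>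

definition "core_rels a = lead_rel a ` (reducible a \<inter> W a) \<union> nf_diffs a"

lemma core_rels_finite: "finite (core_rels a)" unfolding core_rels_def using W(1) nf_diffs_finite by blast

lemma core_rels_J: "core_rels a \<subseteq> J a" unfolding core_rels_def using lead_rel_J nf_diffs_props(2) by blast

lemma core_rels_supp: "core_rels a \<subseteq> supp_in (carrier R) (W a)"
proof -
  have WS: "submodule (supp_in (carrier R) (W a)) R S" using supp_in_submodule[OF oneideal W_expo] .
  have "lead_rel a w \<in> supp_in (carrier R) (W a)" if w: "w \<in> reducible a" "w \<in> W a" for w
  proof -
    obtain t \<nu> where "\<nu> \<in> supp_in (carrier R) (W a)" "lead_rel a w = (f [^] (t::nat)) \<odot>\<^bsub>S\<^esub> mon R w \<oplus>\<^bsub>S\<^esub> \<nu>"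
      using lead_rel_lead[OF w(1)] by blast
    then show ?thesis using M.submoduleE(5)[OF WS cmon_supp_in[OF oneideal pw w(2) W_expo]] by simp
  qed
  then show ?thesis unfolding core_rels_def using nf_diffs_props(1) by blast
qed

context
  fixes a :: 'g
  assumes sp0: "Xc {0} \<subseteq> sat R S f (spn (J 0 \<union> PB 0))"
begin

text \<open>By \<open>Lc_lf\<close> it is enough to treat x^e times an \<open>lf\<close>. This is
  one factorization of a reducible monomial and differs from the chosen one by a comparison, which
  \<open>nf_diff_in_rels\<close> accounts for.\<close>

lemma gens1_sat: "gens1 a \<subseteq> sat R S f (spn (lead_rel a ` reducible a \<union> nf_diffs a))"
proof -
  let ?Z = "lead_rel a ` reducible a \<union> nf_diffs a"
  have ZS: "?Z \<subseteq> carrier S" using lead_rel_J J_S nf_diffs_S by blast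
  have Z: "submodule (spn ?Z) R S" using M.span_submodule[OF ZS] .
  have sZ: "submodule (sat R S f (spn ?Z)) R S" using M.sat_submodule[OF fc Z] .
  have ZZ: "?Z \<subseteq> sat R S f (spn ?Z)" using M.lspan_base1[OF ZS] M.sat_incl[OF fc Z] by blast
  have OZ: "nf_rels a \<subseteq> sat R S f (spn ?Z)" unfolding nf_rels_def by (intro M.sat_mono lspan_mono) auto
  have l: "shift e (lf s) \<in> sat R S f (spn ?Z)" if e: "e \<in> E a" and s: "s \<in> deg (a - dg e)" for e s
  proof -
    let ?w = "e + s"
    have w: "?w \<in> reducible a" unfolding reducible_def using e s by (intro CollectI bexI[of _ e]) auto
    note e' = red_exp[OF w]
    let ?e' = "red_exp a ?w" and ?s' = "?w - red_exp a ?w"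
    have ww: "e + s = ?e' + ?s'" using e'(2) by simp
    note g = nf_diff(3)[OF e e'(1) s e'(3) ww]
    have "nf_diff e s ?e' ?s' \<in> sat R S f (spn ?Z)" using nf_diff_in_rels[OF sp0 e e'(1) s e'(3) ww] OZ by blast
    moreover have "shift ?e' (lf ?s') \<in> sat R S f (spn ?Z)" using ZZ w unfolding lead_rel_def by blast
    ultimately have "ft ?s' \<odot>\<^bsub>S\<^esub> shift e (lf s) \<in> sat R S f (spn ?Z)"
      unfolding g by (intro M.submoduleE(5)[OF sZ] M.submoduleE(4)[OF sZ pw])
    moreover have "shift e (lf s) \<in> carrier S"
      using shift_closed[OF subsetD[OF E(2) e]] nf(2)[OF s E(3)[OF e]] Lc_S by blast
    ultimately show ?thesis using M.sat_pow_cancel[OF fc Z] by blast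
  qed
  show ?thesis
  proof
    fix y assume "y \<in> gens1 a"
    then obtain e p where y: "y = shift e p" "e \<in> E a" "p \<in> Lc (a - dg e)" unfolding gens1_def by blast
    have ee: "e \<in> expo n" using y(2) E(2) by blast
    have "shift e ` (lf ` deg (a - dg e)) \<subseteq> sat R S f (spn ?Z)" using l[OF y(2)] by blast
    from M.span_subset[OF sZ this]
    have "shift e x \<in> sat R S f (spn ?Z)" if "x \<in> spn (lf ` deg (a - dg e))" for x
      using lspan_shift[OF subset_refl that, of e] by blast
    then have "y \<in> sat R S f (sat R S f (spn ?Z))"
      unfolding y(1) using sat_shift[OF ee] Lc_lf[OF E(3)[OF y(2)]] y(3) by blast
    then show "y \<in> sat R S f (spn ?Z)" using M.sat_sat[OF fc sZ Z subset_refl] by blast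
  qed
qed

context
  assumes conn: "\<And>w g g'. g \<in> G \<Longrightarrow> g \<subseteq># w \<Longrightarrow> g' \<in> G \<Longrightarrow> g' \<subseteq># w \<Longrightarrow>
      (g, g') \<in> (lcm_edges n dg D U w)\<^sup>*"
begin

text \<open>The key step: by the condition on syzygies, an element of \<open>J\<close> supported on standard monomials is a
  combination with coefficients in \<open>\<mm>\<close> of finitely many such relations.\<close>

lemma J_PB_sat:
  assumes \<delta>: "\<delta> \<in> J a" "\<delta> \<in> PB a" shows "\<delta> \<in> sat R S f (lspan S \<mm> (core_rels a))"
proof -
  let ?Z = "lead_rel a ` reducible a \<union> nf_diffs a" and ?H = "lspan S \<mm> (core_rels a)"
  have ZS: "?Z \<subseteq> carrier S" using lead_rel_J J_S nf_diffs_S by blast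
  have Zm: "submodule (lspan S \<mm> ?Z) R S" using M.lspan_submodule[OF mi ZS] .
  have X1m: "submodule (lspan S \<mm> (gens1 a)) R S" using M.lspan_submodule[OF mi gens1_S] .
  have H: "submodule ?H R S" using M.lspan_submodule[OF mi subset_trans[OF core_rels_J J_S]] .
  have WS: "submodule (supp_in (carrier R) (W a)) R S" using supp_in_submodule[OF oneideal W_expo] .
  have HW: "?H \<subseteq> supp_in (carrier R) (W a)"
    by (rule M.lspan_subset[OF WS], rule M.submoduleE(4)[OF WS]) (use core_rels_supp mc in blast)+
  have \<delta>S: "\<delta> \<in> carrier S" using \<delta>(1) J_S by blast
  have "\<delta> \<in> span_in a {}"
  proof (rule span_in_reduce[OF conn \<delta>(1)])
    fix u assume "u \<notin> B a"
    then have "\<delta> u = \<zero>" using \<delta>(2) by (auto simp: supp_in_def)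
    then show "\<delta> u \<in> \<mm>" using ideal_zero[OF mi] by simp
  qed
  then have "\<delta> \<in> sat R S f (lspan S \<mm> (gens1 a))" using span_in_empty_sat by blast
  moreover have "lspan S \<mm> (gens1 a) \<subseteq> sat R S f (lspan S \<mm> ?Z)"
    using M.sat_lspan[OF fc mi ZS gens1_sat] .
  ultimately have "\<delta> \<in> sat R S f (lspan S \<mm> ?Z)" using M.sat_sat[OF fc X1m Zm] by blast
  then obtain t :: nat where "(f [^] t) \<odot>\<^bsub>S\<^esub> \<delta> \<in> lspan S \<mm> ?Z" by (rule M.satE)
  \<comment> \<open>The infinite part, with leading monomials outside \<open>W a\<close>, is
    separated from the finite one. A finite subset of it occurs in the relation and is removed by
    \<open>eliminate_monomials\<close>.\<close>
  moreover have "?Z = lead_rel a ` (reducible a - W a) \<union> core_rels a" unfolding core_rels_def by blast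
  ultimately have "(f [^] t) \<odot>\<^bsub>S\<^esub> \<delta> \<in> lspan S \<mm> (lead_rel a ` (reducible a - W a) \<union> core_rels a)" by simp
  moreover have "lead_rel a ` (reducible a - W a) \<subseteq> carrier S" "core_rels a \<subseteq> carrier S"
    using lead_rel_J J_S core_rels_J by blast+
  ultimately obtain x \<eta> where x: "x \<in> lspan S \<mm> (lead_rel a ` (reducible a - W a))" "\<eta> \<in> ?H"
    "(f [^] t) \<odot>\<^bsub>S\<^esub> \<delta> = x \<oplus>\<^bsub>S\<^esub> \<eta>" using M.lspan_un[OF mc] by metis
  obtain Y0 where Y0: "finite Y0" "Y0 \<subseteq> lead_rel a ` (reducible a - W a)" "x \<in> lspan S \<mm> Y0"
    using lspan_finite_subset[OF x(1)] by blast
  then obtain Y where Y: "Y \<subseteq> reducible a - W a" "finite Y" "Y0 = lead_rel a ` Y" by (meson finite_subset_image)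
  have \<delta>W: "\<delta> \<in> supp_in (carrier R) (W a)" using \<delta>(2) supp_in_mono[OF subset_refl W(3)] by blast
  have "x \<oplus>\<^bsub>S\<^esub> \<eta> \<in> sat R S f ?H"
  proof (rule eliminate_monomials[OF fc mi W_expo Y(2) _ _ H HW])
    show "Y \<subseteq> expo n" "Y \<inter> W a = {}" using Y(1) reducible_expo by blast+
    show "x \<in> lspan S \<mm> (lead_rel a ` Y)" using Y0(3) Y(3) by simp
    show "x \<oplus>\<^bsub>S\<^esub> \<eta> \<in> supp_in (carrier R) (W a)" using M.submoduleE(4)[OF WS pw[of t] \<delta>W] unfolding x(3) .
  qed (use lead_rel_lead Y(1) x(2) in blast)+
  then show ?thesis using M.sat_pow_cancel[OF fc H \<delta>S] x(3) by metis
qed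

text \<open>Let N be spanned by one relation for each non-standard monomial of \<open>W a\<close>,
  with a power of f times this monomial as leading part and a standard rest. Nakayama shows that the
  core relations lie in N locally, hence so does every standard element of J. But N is triangular on
  the non-standard monomials, so its standard elements vanish locally.\<close>

lemma indep_B:
  assumes spa: "Xc {a} \<subseteq> sat R S f (spn (J a \<union> PB a))"
  shows "\<exists>s\<in>carrier R - \<mm>. J a \<inter> PB a \<subseteq> sat R S (f \<otimes> s) {\<zero>\<^bsub>S\<^esub>}"
proof -
  interpret mpr: primeideal \<mm> R by (rule mp)
  let ?Y = "W a - B a"
  have "\<exists>j. j \<in> J a \<and> (\<exists>t::nat. \<exists>\<nu>\<in>PB a. j = (f [^] t) \<odot>\<^bsub>S\<^esub> mon R w \<oplus>\<^bsub>S\<^esub> \<nu>)" if w: "w \<in> ?Y" for w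
  proof -
    have wd: "w \<in> deg a" using w W(2) by blast
    then have "mon R w \<in> sat R S f (spn (J a \<union> PB a))" using spa mon_Xc by blast
    then obtain t :: nat where "(f [^] t) \<odot>\<^bsub>S\<^esub> mon R w \<in> spn (J a \<union> PB a)" by (rule M.satE)
    then obtain j q where j: "j \<in> J a" "q \<in> PB a" "(f [^] t) \<odot>\<^bsub>S\<^esub> mon R w = j \<oplus>\<^bsub>S\<^esub> q"
      unfolding M.span_sum[OF J_submodule PB_sub] by blast
    have "j = (f [^] t) \<odot>\<^bsub>S\<^esub> mon R w \<oplus>\<^bsub>S\<^esub> \<ominus>\<^bsub>S\<^esub> q"
      unfolding j(3) using subsetD[OF J_S j(1)] subsetD[OF supp_in_sub j(2)]
      by (simp add: M.M.a_assoc M.M.r_neg)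
    then show ?thesis using j(1) M.submoduleE(3)[OF PB_sub j(2)] by blast
  qed
  then obtain j where jJ: "\<And>w. w \<in> ?Y \<Longrightarrow> j w \<in> J a"
    and jl: "\<And>w. w \<in> ?Y \<Longrightarrow> \<exists>t::nat. \<exists>\<nu>\<in>PB a. j w = (f [^] t) \<odot>\<^bsub>S\<^esub> mon R w \<oplus>\<^bsub>S\<^esub> \<nu>" by metis
  let ?N = "spn (j ` ?Y)"
  have jS: "j ` ?Y \<subseteq> carrier S" using jJ J_S by blast
  have N: "submodule ?N R S" using M.span_submodule[OF jS] .
  have NJ: "?N \<subseteq> J a" by (rule M.span_subset[OF J_submodule]) (use jJ in blast)
  have NP: "?N \<union> PB a \<subseteq> carrier S" using NJ J_S supp_in_sub by blast
  have T: "submodule (spn (?N \<union> PB a)) R S" using M.span_submodule[OF NP] .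
  have "mon R ` W a \<subseteq> sat R S f (spn (?N \<union> PB a))"
  proof
    fix x assume "x \<in> mon R ` W a"
    then obtain w where w: "w \<in> W a" "x = mon R w" by blast
    have xS: "x \<in> carrier S" using w mon_sub[OF W_expo] by blast
    show "x \<in> sat R S f (spn (?N \<union> PB a))"
    proof (cases "w \<in> B a")
      case True
      then have "x \<in> PB a" using mon_supp_in[OF True B_expo] w(2) by simp
      then have "x \<in> spn (?N \<union> PB a)" using M.lspan_base1[OF NP] by blast
      then show ?thesis using M.sat_incl[OF fc T] by blast
    next
      case False
      then have wY: "w \<in> ?Y" using w by blast
      then obtain t \<nu> where t: "\<nu> \<in> PB a" "j w = (f [^] (t::nat)) \<odot>\<^bsub>S\<^esub> x \<oplus>\<^bsub>S\<^esub> \<nu>" using jl w(2) by blast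
      have "j w \<oplus>\<^bsub>S\<^esub> \<ominus>\<^bsub>S\<^esub> \<nu> \<in> spn (?N \<union> PB a)"
        using M.span_sumI[OF N PB_sub _ M.submoduleE(3)[OF PB_sub t(1)]] M.lspan_base1[OF jS] wY by blast
      moreover have "j w \<oplus>\<^bsub>S\<^esub> \<ominus>\<^bsub>S\<^esub> \<nu> = (f [^] t) \<odot>\<^bsub>S\<^esub> x"
        unfolding t(2) using xS pw subsetD[OF supp_in_sub t(1)] by (simp add: M.M.a_assoc M.M.r_neg)
      ultimately show ?thesis using xS by (intro M.satI) auto
    qed
  qed
  then have WN: "supp_in (carrier R) (W a) \<subseteq> sat R S f (spn (?N \<union> PB a))"
    unfolding supp_in_lspan[OF oneideal W_expo] by (rule M.span_subset[OF M.sat_submodule[OF fc T]])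
  have GS: "core_rels a \<subseteq> carrier S" using core_rels_J J_S by blast
  \<comment> \<open>After subtracting an element of N, a core relation becomes a standard element of
    J, and \<open>J_PB_sat\<close> writes this as an \<mm>-combination of core relations: exactly
    the hypothesis of Nakayama.\<close>
  have dec: "\<exists>h\<in>carrier R - \<mm>. \<exists>\<nu>\<in>?N. \<exists>y\<in>lspan S \<mm> (core_rels a). h \<odot>\<^bsub>S\<^esub> g = \<nu> \<oplus>\<^bsub>S\<^esub> y" if g: "g \<in> core_rels a" for g
  proof -
    have gS: "g \<in> carrier S" and gJ: "g \<in> J a" using g GS core_rels_J by auto
    have "g \<in> sat R S f (spn (?N \<union> PB a))" using g core_rels_supp WN by blast
    then obtain t :: nat where "(f [^] t) \<odot>\<^bsub>S\<^esub> g \<in> spn (?N \<union> PB a)" by (rule M.satE)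
    then obtain \<nu> q where q: "\<nu> \<in> ?N" "q \<in> PB a" "(f [^] t) \<odot>\<^bsub>S\<^esub> g = \<nu> \<oplus>\<^bsub>S\<^esub> q"
      unfolding M.span_sum[OF N PB_sub] by blast
    have qS: "q \<in> carrier S" and \<nu>S: "\<nu> \<in> carrier S"
      using subsetD[OF supp_in_sub q(2)] subsetD[OF NP, of \<nu>] q(1) by auto
    have "q \<in> J a"
      using M.submodule_cancel[OF J_submodule _ subsetD[OF NJ q(1)] qS] M.submoduleE(4)[OF J_submodule pw gJ]
        q(3) by metis
    then have "q \<in> sat R S f (lspan S \<mm> (core_rels a))" using J_PB_sat q(2) by blast
    then obtain t' :: nat where t': "(f [^] t') \<odot>\<^bsub>S\<^esub> q \<in> lspan S \<mm> (core_rels a)" by (rule M.satE)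
    have "(f [^] (t' + t)) \<odot>\<^bsub>S\<^esub> g = (f [^] t') \<odot>\<^bsub>S\<^esub> \<nu> \<oplus>\<^bsub>S\<^esub> (f [^] t') \<odot>\<^bsub>S\<^esub> q"
      using M.pow_smult[OF fc gS] q(3) pw \<nu>S qS by (simp add: M.smult_r_distr)
    moreover have "(f [^] t') \<odot>\<^bsub>S\<^esub> \<nu> \<in> ?N" using M.submoduleE(4)[OF N pw q(1)] .
    ultimately show ?thesis using mpr.pow_notin[OF f, of "t' + t"] t' by blast
  qed
  from M.nakayama[OF mp core_rels_finite GS N dec]
  obtain s where s: "s \<in> carrier R - \<mm>" "\<And>x. x \<in> core_rels a \<Longrightarrow> s \<odot>\<^bsub>S\<^esub> x \<in> ?N" by blast
  have sc: "s \<in> carrier R" using s by simp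
  let ?g = "f \<otimes> s"
  have gc: "?g \<in> carrier R" using fc sc by simp
  have Gm: "submodule (spn (core_rels a)) R S" using M.span_submodule[OF GS] .
  have "core_rels a \<subseteq> sat R S ?g ?N"
  proof
    fix x assume x: "x \<in> core_rels a"
    then have xS: "x \<in> carrier S" using GS by blast
    have "?g \<odot>\<^bsub>S\<^esub> x = f \<odot>\<^bsub>S\<^esub> (s \<odot>\<^bsub>S\<^esub> x)" using fc sc xS by (simp add: M.smult_assoc1)
    then have "?g \<odot>\<^bsub>S\<^esub> x \<in> ?N" using M.submoduleE(4)[OF N fc s(2)[OF x]] by simp
    then show "x \<in> sat R S ?g ?N" using xS gc by (intro M.satI[where t=1]) auto
  qed
  then have GN: "spn (core_rels a) \<subseteq> sat R S ?g ?N" by (rule M.span_subset[OF M.sat_submodule[OF gc N]])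
  have "\<delta> \<in> sat R S ?g {\<zero>\<^bsub>S\<^esub>}" if \<delta>: "\<delta> \<in> J a \<inter> PB a" for \<delta>
  proof -
    have \<delta>S: "\<delta> \<in> carrier S" using \<delta> J_S by blast
    have "\<delta> \<in> sat R S f (lspan S \<mm> (core_rels a))" using J_PB_sat \<delta> by blast
    then have "\<delta> \<in> sat R S f (spn (core_rels a))" using M.sat_mono[OF lspan_mono[OF mc subset_refl]] by blast
    then have "\<delta> \<in> sat R S ?g (spn (core_rels a))" using M.sat_mult[OF fc sc Gm] by blast
    then have "\<delta> \<in> sat R S ?g ?N" using M.sat_sat[OF gc Gm N GN] by blast
    then obtain t :: nat where t: "(?g [^] t) \<odot>\<^bsub>S\<^esub> \<delta> \<in> ?N" by (rule M.satE)
    have gp: "?g [^] t \<in> carrier R" using gc by simp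
    have "(?g [^] t) \<odot>\<^bsub>S\<^esub> \<delta> \<oplus>\<^bsub>S\<^esub> \<zero>\<^bsub>S\<^esub> \<in> sat R S f {\<zero>\<^bsub>S\<^esub>}"
    \<comment> \<open>Here the remaining term and H are zero and the coefficients are arbitrary;
      elimination removes all of N from a standard element.\<close>
    proof (rule eliminate_monomials[OF fc oneideal B_expo _ _ _ M.zero_submodule _ jl t])
      show "finite ?Y" "?Y \<subseteq> expo n" "?Y \<inter> B a = {}" using W(1) W_expo by blast+
      show "{\<zero>\<^bsub>S\<^esub>} \<subseteq> PB a" using M.submodule_zero[OF PB_sub] by blast
      show "(?g [^] t) \<odot>\<^bsub>S\<^esub> \<delta> \<oplus>\<^bsub>S\<^esub> \<zero>\<^bsub>S\<^esub> \<in> PB a"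
        using M.submoduleE(4)[OF PB_sub gp, of \<delta>] \<delta> gp \<delta>S by simp
    qed auto
    then have "(?g [^] t) \<odot>\<^bsub>S\<^esub> \<delta> \<in> sat R S f {\<zero>\<^bsub>S\<^esub>}" using gp \<delta>S by simp
    then have "(?g [^] t) \<odot>\<^bsub>S\<^esub> \<delta> \<in> sat R S ?g {\<zero>\<^bsub>S\<^esub>}" using M.sat_mult[OF fc sc M.zero_submodule] by blast
    then show ?thesis using M.sat_pow_cancel[OF gc M.zero_submodule \<delta>S] by blast
  qed
  then show ?thesis using s(1) by blast
qed

end

end

end

section \<open>Bases at the maximal ideals\<close>

lemma (in graded_poly) poly_basis_mult:
  assumes f: "f \<in> carrier R" "g \<in> carrier R" and N: "submodule N R S" and p: "poly_basis f a N B"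
  shows "poly_basis (f \<otimes> g) a N B"
proof -
  have Be: "B \<subseteq> expo n" using p deg_sub unfolding poly_basis_def by blast
  have BS: "submodule (supp_in (carrier R) B) R S" using supp_in_submodule[OF oneideal Be] .
  have "\<exists>t::nat. \<exists>q\<in>supp_in (carrier R) B. ((f \<otimes> g) [^] t) \<odot>\<^bsub>S\<^esub> x \<ominus>\<^bsub>S\<^esub> q \<in> N" if x: "x \<in> Xc {a}" for x
  proof -
    obtain t q where q: "q \<in> supp_in (carrier R) B" "(f [^] (t::nat)) \<odot>\<^bsub>S\<^esub> x \<ominus>\<^bsub>S\<^esub> q \<in> N"
      using p x unfolding poly_basis_def by blast
    have xS: "x \<in> carrier S" and qS: "q \<in> carrier S" using subsetD[OF Xc_sub x] subsetD[OF supp_in_sub q(1)] .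
    have pw: "g [^] t \<in> carrier R" "f [^] t \<in> carrier R" using f by auto
    have "(g [^] t) \<odot>\<^bsub>S\<^esub> ((f [^] t) \<odot>\<^bsub>S\<^esub> x) \<ominus>\<^bsub>S\<^esub> (g [^] t) \<odot>\<^bsub>S\<^esub> q \<in> N"
      using M.diff_smult[OF N _ qS pw(1) q(2)] xS pw by simp
    moreover have "(g [^] t) \<odot>\<^bsub>S\<^esub> ((f [^] t) \<odot>\<^bsub>S\<^esub> x) = ((f \<otimes> g) [^] t) \<odot>\<^bsub>S\<^esub> x"
      using f xS pw by (simp add: nat_pow_distrib M.smult_assoc1 M.smult_comm)
    moreover have "(g [^] t) \<odot>\<^bsub>S\<^esub> q \<in> supp_in (carrier R) B" using M.submoduleE(4)[OF BS pw(1) q(1)] .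
    ultimately show ?thesis by (metis (lifting))
  qed
  moreover have "N \<inter> supp_in (carrier R) B \<subseteq> sat R S (f \<otimes> g) {\<zero>\<^bsub>S\<^esub>}"
    using M.sat_mult[OF f M.zero_submodule] p unfolding poly_basis_def by blast
  ultimately show ?thesis using p unfolding poly_basis_def by blast
qed

context hilb_max
begin

lemma common_denominator:
  assumes "\<And>b. b \<in> D \<Longrightarrow> \<exists>f\<in>carrier R - \<mm>. poly_basis f b (Lc b) (B b)"
  shows "\<exists>f\<in>carrier R - \<mm>. \<forall>b\<in>D. poly_basis f b (Lc b) (B b)"
proof -
  interpret mpr: primeideal \<mm> R by (rule mp)
  have "finite D' \<Longrightarrow> D' \<subseteq> D \<Longrightarrow> \<exists>f\<in>carrier R - \<mm>. \<forall>b\<in>D'. poly_basis f b (Lc b) (B b)" for D'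
  proof (induction D' rule: finite_induct)
    case empty
    then show ?case using mpr.one_notin by blast
  next
    case (insert b D')
    obtain f where f: "f \<in> carrier R - \<mm>" "\<And>b. b \<in> D' \<Longrightarrow> poly_basis f b (Lc b) (B b)"
      using insert by blast
    obtain g where g: "g \<in> carrier R - \<mm>" "poly_basis g b (Lc b) (B b)" using assms insert by blast
    have c: "f \<in> carrier R" "g \<in> carrier R" using f g by auto
    have "poly_basis (f \<otimes> g) b' (Lc b') (B b')" if b': "b' \<in> insert b D'" for b'
    proof (cases "b' = b")
      case True
      then show ?thesis using poly_basis_mult[OF c(2,1) Lc_submodule g(2)] m_comm[OF c] by simp
    next
      case False
      then show ?thesis using poly_basis_mult[OF c Lc_submodule f(2)] b' by blast
    qed
    then show ?case using mpr.mult_notin[OF f(1) g(1)] by blast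
  qed
  then show ?thesis using finD by blast
qed

text \<open>Spanning in degree 0 is needed along with degree a, because comparisons of
  factorizations leave monomials of degree 0.\<close>

lemma basis_J:
  assumes finB: "\<And>a. finite (B a)"
    and ex: "\<And>b. b \<in> D \<Longrightarrow> \<exists>f\<in>carrier R - \<mm>. poly_basis f b (Lc b) (B b)"
    and conn: "\<And>w g g'. g \<in> G \<Longrightarrow> g \<subseteq># w \<Longrightarrow> g' \<in> G \<Longrightarrow> g' \<subseteq># w \<Longrightarrow>
      (g, g') \<in> (lcm_edges n dg D U w)\<^sup>*"
  shows "\<exists>g\<in>carrier R - \<mm>. poly_basis g a (J a) (B a)"
proof -
  interpret mpr: primeideal \<mm> R by (rule mp)
  let ?PB = "\<lambda>a. supp_in (carrier R) (B a)"
  let ?N = "\<lambda>a. lspan S (carrier R) (J a \<union> ?PB a)"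
  have N: "submodule (?N a) R S" for a
    using M.span_submodule J_S supp_in_sub by (meson Un_least)
  have PBs: "submodule (?PB a) R S" using supp_in_submodule[OF oneideal B_expo] .
  obtain f where f: "f \<in> carrier R - \<mm>" "\<And>b. b \<in> D \<Longrightarrow> poly_basis f b (Lc b) (B b)"
    using common_denominator[OF ex] by blast
  interpret F: hilb_loc R n dg D L \<mm> U f
    by unfold_locales (use finB f U_def in auto)
  obtain s0 where s0: "s0 \<in> carrier R - \<mm>" "Xc {0} \<subseteq> sat R S (f \<otimes> s0) (?N 0)" using F.span_B by blast
  obtain sa where sa: "sa \<in> carrier R - \<mm>" "Xc {a} \<subseteq> sat R S (f \<otimes> sa) (?N a)" using F.span_B by blast
  let ?f = "f \<otimes> s0 \<otimes> sa"
  have c: "f \<in> carrier R" "s0 \<in> carrier R" "sa \<in> carrier R" "f \<otimes> s0 \<in> carrier R" "f \<otimes> sa \<in> carrier R"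
    using f(1) s0(1) sa(1) by auto
  have fm: "?f \<in> carrier R - \<mm>" using mpr.mult_notin[OF mpr.mult_notin[OF f(1) s0(1)] sa(1)] .
  have fe: "?f = (f \<otimes> sa) \<otimes> s0" using c by (simp add: m_ac)
  \<comment> \<open>\<open>indep_B\<close> expects one element over which D has its bases and both
    degrees 0 and a are spanned. The elements found by \<open>span_B\<close> are therefore
    multiplied into f and the setting is entered again.\<close>
  interpret F2: hilb_loc R n dg D L \<mm> U ?f
    by unfold_locales
      (use finB fm U_def poly_basis_mult[OF c(4,3) Lc_submodule poly_basis_mult[OF c(1,2) Lc_submodule f(2)]] in auto)
  have sp0: "Xc {0} \<subseteq> sat R S ?f (?N 0)" using s0(2) M.sat_mult[OF c(4,3) N] by blast
  have spa: "Xc {a} \<subseteq> sat R S ?f (?N a)" unfolding fe using sa(2) M.sat_mult[OF c(5,2) N] by blast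
  obtain s where s: "s \<in> carrier R - \<mm>" "J a \<inter> ?PB a \<subseteq> sat R S (?f \<otimes> s) {\<zero>\<^bsub>S\<^esub>}"
    using F2.indep_B[OF sp0 conn spa] by blast
  let ?g = "?f \<otimes> s"
  have gm: "?g \<in> carrier R - \<mm>" using mpr.mult_notin[OF fm s(1)] .
  have fc: "?f \<in> carrier R" "s \<in> carrier R" using fm s(1) by auto
  have "\<exists>t::nat. \<exists>q\<in>?PB a. (?g [^] t) \<odot>\<^bsub>S\<^esub> p \<ominus>\<^bsub>S\<^esub> q \<in> J a" if p: "p \<in> Xc {a}" for p
  proof -
    have "p \<in> sat R S ?g (?N a)" using p spa M.sat_mult[OF fc N] by blast
    then obtain t :: nat where "(?g [^] t) \<odot>\<^bsub>S\<^esub> p \<in> ?N a" by (rule M.satE)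
    then obtain j q where j: "j \<in> J a" "q \<in> ?PB a" "(?g [^] t) \<odot>\<^bsub>S\<^esub> p = j \<oplus>\<^bsub>S\<^esub> q"
      unfolding M.span_sum[OF J_submodule PBs] by blast
    have "(?g [^] t) \<odot>\<^bsub>S\<^esub> p \<ominus>\<^bsub>S\<^esub> q = j"
      unfolding j(3) using subsetD[OF J_S j(1)] subsetD[OF supp_in_sub j(2)]
      by (simp add: M.M.minus_eq M.M.a_assoc M.M.r_neg)
    then show ?thesis using j(1,2) by (intro exI[of _ t] bexI[of _ q]) auto
  qed
  then have "poly_basis ?g a (J a) (B a)"
    unfolding poly_basis_def using finB B_deg s(2) by blast
  then show ?thesis using gm by blast
qed

end

text \<open>The assumption \<open>supportive\<close> collects what very supportiveness contributes,
  stated for exponents only; the base ring k no longer appears.\<close>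

locale hilb_point = hilb_data R n dg D L
  for R (structure) and n and dg :: "nat multiset \<Rightarrow> 'g::ab_group_add" and D L +
  fixes h :: "'g \<Rightarrow> nat"
  assumes L_free: "b \<in> D \<Longrightarrow> locally_free R (quot_module (P {b}) (Lc b)) (h b)"
    and supportive: "\<one> \<noteq> \<zero> \<Longrightarrow> U \<subseteq> {u \<in> expo n. dg u \<in> D} \<Longrightarrow>
      (\<And>b. b \<in> D \<Longrightarrow> finite (std_mons n dg U b) \<and> card (std_mons n dg U b) = h b) \<Longrightarrow>
      finite (std_mons n dg U a) \<and> card (std_mons n dg U a) = h a \<and>
      (\<forall>w. \<forall>g\<in>min_mons n U. \<forall>g'\<in>min_mons n U. g \<subseteq># w \<longrightarrow> g' \<subseteq># w \<longrightarrow>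
        (g, g') \<in> (lcm_edges n dg D U w)\<^sup>*)"
begin

text \<open>One B serves two purposes: its independence and spanning give local freeness of S_a/J_a,
  and the bound on standard monomials of larger N gives uniqueness.\<close>

lemma local_basis:
  assumes m: "maximalideal \<mm> R"
  obtains B g where "finite B" "card B = h a" "B \<subseteq> deg a"
    "g \<in> carrier R - \<mm>" "poly_basis g a (J a) B" "\<And>N. J a \<subseteq> N \<Longrightarrow> std \<mm> a N \<subseteq> B"
proof -
  interpret m: maximalideal \<mm> R by (rule m)
  interpret M: hilb_max R n dg D L \<mm> "\<Union>b\<in>D. lead \<mm> (Lc b)" by unfold_locales
  let ?U = "\<Union>b\<in>D. lead \<mm> (Lc b)"
  interpret mpr: primeideal \<mm> R by (rule M.mp)
  have ne: "\<one> \<noteq> \<zero>" using mpr.one_notin ideal_zero[OF M.mi] by auto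
  have bD: "card (M.B b) = h b" "\<exists>f\<in>carrier R - \<mm>. poly_basis f b (Lc b) (M.B b)" if b: "b \<in> D" for b
    unfolding M.B_eq_std[OF b] using std_basis[OF m Lc_submodule Lc_Xc L_free[OF b]] by auto
  have fD: "finite (M.B b) \<and> card (M.B b) = h b" if b: "b \<in> D" for b
    using bD[OF b] unfolding poly_basis_def by blast
  have sup: "finite (M.B c) \<and> card (M.B c) = h c" for c
    using supportive[OF ne M.U_sub fD, of c] by blast
  have conn: "\<And>w g g'. g \<in> M.G \<Longrightarrow> g \<subseteq># w \<Longrightarrow> g' \<in> M.G \<Longrightarrow> g' \<subseteq># w \<Longrightarrow>
      (g, g') \<in> (lcm_edges n dg D ?U w)\<^sup>*"
    using supportive[OF ne M.U_sub fD] by blast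
  have "\<exists>g\<in>carrier R - \<mm>. poly_basis g a (J a) (M.B a)"
    using M.basis_J[OF _ bD(2) conn] sup by blast
  then obtain g where "g \<in> carrier R - \<mm>" "poly_basis g a (J a) (M.B a)" by blast
  note g = this
  show ?thesis
    by (rule that[OF _ _ M.B_deg g M.std_sub_B]) (use sup[of a] in blast)+
qed

lemma J_free: "locally_free R (quot_module (P {a}) (J a)) (h a)"
proof -
  interpret Q: quot_mod R "P {a}" "J a" by (rule coset_mod[OF J_submodule J_Xc])
  let ?T = "quot_module (P {a}) (J a)"
  interpret T: module R ?T by (rule Q.quot_module)
  let ?c = "\<lambda>u. J a +>\<^bsub>P {a}\<^esub> mon R u"
  show ?thesis
  proof (rule T.locally_freeI)
    fix \<mm> assume m: "maximalideal \<mm> R"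
    interpret m: maximalideal \<mm> R by (rule m)
    interpret mpr: primeideal \<mm> R using maximalideal_prime[OF m] .
    have mi: "ideal \<mm> R" ..
    obtain B g where B: "finite B" "card B = h a" "B \<subseteq> deg a" "g \<in> carrier R - \<mm>" "poly_basis g a (J a) B"
      using local_basis[OF m] by metis
    have gc: "g \<in> carrier R" using B(4) by simp
    have "g [^] (t::nat) \<noteq> \<zero>" for t using mpr.pow_notin[OF B(4), of t] ideal_zero[OF mi] by auto
    then have l: "loc_basis R ?T g (?c ` B)" and i: "inj_on ?c B"
      using poly_basis_loc_basis[OF J_submodule J_Xc gc _ B(3)] B(5) by blast+
    have "free_of_rank (loc_ring R g) (loc_module R ?T g) (h a)"
      using T.loc_basis_imp_free_of_rank[OF gc l] card_image[OF i] B(2) by simp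
    then show "\<exists>f\<in>carrier R - \<mm>. free_of_rank (loc_ring R f) (loc_module R ?T f) (h a)" using B(4) by blast
  qed
qed

text \<open>For p in N, the scalars that move p into J form an ideal, and it suffices that no
  maximal ideal contains it. At \<mm> the standard monomials of N and J coincide, so p is locally
  congruent modulo J to a standard element of N, which vanishes locally.\<close>

lemma J_unique:
  assumes N: "submodule N R S" "N \<subseteq> Xc {a}" "J a \<subseteq> N" and lf: "locally_free R (quot_module (P {a}) N) (h a)"
  shows "N = J a"
proof
  show "N \<subseteq> J a"
  proof
    fix p assume p: "p \<in> N"
    have pS: "p \<in> carrier S" using p N(2) Xc_sub by blast
    let ?A = "{r \<in> carrier R. r \<odot>\<^bsub>S\<^esub> p \<in> J a}"
    have A: "ideal ?A R"
    proof (rule idealI)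
      show "subgroup ?A (add_monoid R)"
      proof (rule add.subgroupI)
        have "\<zero> \<odot>\<^bsub>S\<^esub> p = \<zero>\<^bsub>S\<^esub>" using pS by simp
        then have "\<zero> \<in> ?A" using M.submodule_zero[OF J_submodule] by simp
        then show "?A \<noteq> {}" by blast
        fix x assume x: "x \<in> ?A"
        then show "\<ominus> x \<in> ?A" using M.submoduleE(3)[OF J_submodule] pS by (simp add: M.smult_l_minus)
        fix y assume "y \<in> ?A"
        then show "x \<oplus> y \<in> ?A" using x M.submoduleE(5)[OF J_submodule] pS by (simp add: M.smult_l_distr)
      qed auto
      fix a x assume x: "a \<in> ?A" "x \<in> carrier R"
      then show "x \<otimes> a \<in> ?A" using M.submoduleE(4)[OF J_submodule] pS by (simp add: M.smult_assoc1)
      then show "a \<otimes> x \<in> ?A" using x by (simp add: m_comm)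
    qed (rule ring_axioms)
    have "?A = carrier R"
    proof (rule ccontr)
      assume "?A \<noteq> carrier R"
      then obtain \<mm> where m: "maximalideal \<mm> R" and Am: "?A \<subseteq> \<mm>" using exists_maximalideal[OF A] by blast
      interpret m: maximalideal \<mm> R by (rule m)
      interpret mpr: primeideal \<mm> R using maximalideal_prime[OF m] .
      obtain B g where B: "finite B" "card B = h a" "B \<subseteq> deg a" "g \<in> carrier R - \<mm>"
        "poly_basis g a (J a) B" "\<And>N. J a \<subseteq> N \<Longrightarrow> std \<mm> a N \<subseteq> B" using local_basis[OF m] by metis
      note sb = std_basis[OF m N(1,2) lf]
      \<comment> \<open>One inclusion holds because N contains J; equality follows because both sets
        have h(a) elements.\<close>
      have "std \<mm> a N = B" using card_subset_eq[OF B(1) B(6)[OF N(3)]] sb(1) B(2) by simp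
      then obtain f where f: "f \<in> carrier R - \<mm>" "poly_basis f a N B" using sb(2) by blast
      have c: "f \<in> carrier R" "g \<in> carrier R" using f(1) B(4) by auto
      obtain t q where q: "q \<in> supp_in (carrier R) B" "(g [^] (t::nat)) \<odot>\<^bsub>S\<^esub> p \<ominus>\<^bsub>S\<^esub> q \<in> J a"
        using B(5) p N(2) unfolding poly_basis_def by blast
      have qS: "q \<in> carrier S" using subsetD[OF supp_in_sub q(1)] .
      have pw: "g [^] t \<in> carrier R" using c by simp
      have gpN: "(g [^] t) \<odot>\<^bsub>S\<^esub> p \<in> N" using M.submoduleE(4)[OF N(1) pw p] .
      have "((g [^] t) \<odot>\<^bsub>S\<^esub> p \<ominus>\<^bsub>S\<^esub> q) \<oplus>\<^bsub>S\<^esub> q \<in> N"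
        using gpN M.diff_add_cancel[of "(g [^] t) \<odot>\<^bsub>S\<^esub> p" q] pw pS qS by simp
      then have "q \<in> N" using M.submodule_cancel[OF N(1) _ subsetD[OF N(3) q(2)] qS] by blast
      then have "q \<in> sat R S f {\<zero>\<^bsub>S\<^esub>}" using f(2) q(1) unfolding poly_basis_def by blast
      then obtain s :: nat where s: "(f [^] s) \<odot>\<^bsub>S\<^esub> q = \<zero>\<^bsub>S\<^esub>" by (rule M.satE) simp
      have fw: "f [^] s \<in> carrier R" using c by simp
      have "(f [^] s) \<odot>\<^bsub>S\<^esub> ((g [^] t) \<odot>\<^bsub>S\<^esub> p \<ominus>\<^bsub>S\<^esub> q) \<in> J a" using M.submoduleE(4)[OF J_submodule fw q(2)] .
      moreover have "(f [^] s) \<odot>\<^bsub>S\<^esub> ((g [^] t) \<odot>\<^bsub>S\<^esub> p \<ominus>\<^bsub>S\<^esub> q) = (f [^] s \<otimes> g [^] t) \<odot>\<^bsub>S\<^esub> p"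
        using s fw pw pS qS by (simp add: M.M.minus_eq M.smult_r_distr M.smult_r_minus M.smult_assoc1)
      ultimately have "f [^] s \<otimes> g [^] t \<in> ?A" using fw pw by simp
      moreover have "f [^] s \<otimes> g [^] t \<in> carrier R - \<mm>"
        using mpr.mult_notin[OF mpr.pow_notin[OF f(1)] mpr.pow_notin[OF B(4)]] .
      ultimately show False using Am by blast
    qed
    then have "\<one> \<in> ?A" by simp
    then show "p \<in> J a" using pS by simp
  qed
qed (rule N(3))

end

section \<open>The restriction of degrees is an isomorphism\<close>

lemma (in module) submodule_Int:
  assumes "submodule N R M" "submodule N' R M" shows "submodule (N \<inter> N') R M"
  using submoduleE[OF assms(1)] submoduleE[OF assms(2)] submodule_zero[OF assms(1)] submodule_zero[OF assms(2)]
  by (intro submoduleI2) auto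

lemma (in module) gen_submodule_eq_lspan:
  assumes "Y \<subseteq> carrier M" shows "gen_submodule R M Y = lspan M (carrier R) Y"
proof
  have "Y \<subseteq> lspan M (carrier R) Y" using lspan_base1[OF assms] by blast
  then show "gen_submodule R M Y \<subseteq> lspan M (carrier R) Y"
    unfolding gen_submodule_def using span_submodule[OF assms] by (intro Inter_lower) simp
  have "lspan M (carrier R) Y \<subseteq> N" if "N \<in> {N. submodule N R M \<and> Y \<subseteq> N}" for N
    using that by (intro span_subset) simp_all
  then show "lspan M (carrier R) Y \<subseteq> gen_submodule R M Y"
    unfolding gen_submodule_def by (rule Inter_greatest)
qed

context graded_poly
begin

lemma component_Xc: "p \<in> Xc E \<Longrightarrow> component R dg a p \<in> Xc E"
proof -
  assume p: "p \<in> Xc E"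
  have "component R dg a p \<in> carrier S"
    using subsetD[OF Xc_sub component_closed[OF subsetD[OF Xc_sub p]]] .
  moreover have "dg u \<in> E" if "component R dg a p u \<noteq> \<zero>" for u
    using p that by (auto simp: Xc_iff component_def split: if_splits)
  ultimately show ?thesis unfolding Xc_iff[of _ E] by blast
qed

lemma restrict_eq: "restrict_degrees R n dg E N = N \<inter> Xc E"
  by (simp add: restrict_degrees_def)

lemma hilb_degD:
  assumes fin: "finite D" and L: "L \<in> hilb_deg R n dg h D"
  shows "hilb_data R n dg D L" "b \<in> D \<Longrightarrow> locally_free R (quot_module (P {b}) (L \<inter> Xc {b})) (h b)"
proof -
  have sub: "submodule L R S" "L \<subseteq> Xc D" using L submodule_P_iff by (auto simp: hilb_deg_def)
  have sh: "shift t p \<in> L"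
    if "a \<in> D" "b \<in> D" "t \<in> expo n" "dg t = b - a" "p \<in> L" "p \<in> Xc {a}" for a b t p
  proof -
    have "mon R t \<otimes>\<^bsub>S\<^esub> p \<in> L" using that L by (auto simp: hilb_deg_def restrict_eq)
    then show ?thesis using mon_mult[OF that(3) subsetD[OF Xc_sub that(6)]] by simp
  qed
  have "homogeneous R dg L" using L by (simp add: hilb_deg_def)
  then show "hilb_data R n dg D L"
    by (rule hilb_data.intro[OF graded_poly_axioms hilb_data_axioms.intro[OF fin sub _ sh]])
  show "b \<in> D \<Longrightarrow> locally_free R (quot_module (P {b}) (L \<inter> Xc {b})) (h b)"
    using L by (auto simp: hilb_deg_def quot_locally_free_def restrict_eq)
qed

lemma hilb_restrict:
  assumes I: "I \<in> hilb R n dg h" shows "restrict_degrees R n dg D I \<in> hilb_deg R n dg h D"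
proof -
  have id: "ideal I S" and hom: "homogeneous R dg I" and lf: "\<And>a. quot_locally_free R n dg h I a"
    using I by (auto simp: hilb_def)
  have "submodule (I \<inter> Xc D) R (P D)"
    using M.submodule_Int[OF ideal_submodule[OF id] submodule_Xc] by (simp add: submodule_P_iff)
  moreover have "homogeneous R dg (I \<inter> Xc D)"
    using hom component_Xc by (auto simp: homogeneous_def)
  moreover have "mon R u \<otimes>\<^bsub>S\<^esub> p \<in> I \<inter> Xc D \<inter> Xc {b}"
    if "a \<in> D" "b \<in> D" "u \<in> expo n" "dg u = b - a" "p \<in> I \<inter> Xc D \<inter> Xc {a}" for a b u p
  proof -
    have "shift u p \<in> I" using ideal_shift[OF id that(3)] that(5) by blast
    moreover have "shift u p \<in> Xc {b}" using shift_Xc[OF that(3), of p a b] that(4,5) by simp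
    moreover have "Xc {b} \<subseteq> Xc D" using that(2) by (auto simp: Xc_iff)
    moreover have "mon R u \<otimes>\<^bsub>S\<^esub> p = shift u p" using mon_mult[OF that(3)] that(5) Xc_sub by blast
    ultimately show ?thesis by auto
  qed
  moreover have "quot_locally_free R n dg h (I \<inter> Xc D) a" if a: "a \<in> D" for a
  proof -
    have "I \<inter> Xc D \<inter> Xc {a} = I \<inter> Xc {a}" using a by (auto simp: Xc_iff)
    then show ?thesis using lf[of a] by (simp add: quot_locally_free_def restrict_eq)
  qed
  ultimately show ?thesis unfolding hilb_deg_def restrict_eq by blast
qed

end

context hilb_point
begin

lemma J_ideal_hilb: "J_ideal \<in> hilb R n dg h"
  using J_ideal_ideal J_ideal_homogeneous J_free
  by (simp add: hilb_def quot_locally_free_def restrict_eq J_ideal_component)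

lemma hilb_unique:
  assumes I: "I \<in> hilb R n dg h" and L: "restrict_degrees R n dg D I = L" shows "I = J_ideal"
proof -
  have id: "ideal I S" and hom: "homogeneous R dg I" and lf: "\<And>a. quot_locally_free R n dg h I a"
    using I by (auto simp: hilb_def)
  note Is = ideal_submodule[OF id]
  have Ia: "I \<inter> Xc {a} = J a" for a
  proof (rule J_unique)
    show "submodule (I \<inter> Xc {a}) R S" using M.submodule_Int[OF Is submodule_Xc] .
    show "J a \<subseteq> I \<inter> Xc {a}" using J_minimal[OF id] L J_Xc by (auto simp: restrict_eq)
    show "locally_free R (quot_module (P {a}) (I \<inter> Xc {a})) (h a)"
      using lf[of a] by (simp add: quot_locally_free_def restrict_eq)
  qed blast
  show ?thesis
  proof (intro equalityI subsetI)
    fix p assume p: "p \<in> I"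
    then have pS: "p \<in> carrier S" using M.submoduleE(1)[OF Is] by blast
    have "component R dg a p \<in> I \<inter> Xc {a}" for a
      using hom p component_closed[OF pS] by (auto simp: homogeneous_def)
    then show "p \<in> J_ideal" using pS Ia by (simp add: J_ideal_def)
  next
    fix p assume "p \<in> J_ideal"
    then have "p \<in> carrier S" "\<And>a. component R dg a p \<in> I" using Ia by (auto simp: J_ideal_def)
    then show "p \<in> I" using sum_components[OF Is] by blast
  qed
qed

end

lemma (in graded_poly) bij_betw_hilb:
  assumes pt: "\<And>L. L \<in> hilb_deg R n dg h D \<Longrightarrow> hilb_point R n dg D L h"
  shows "bij_betw (restrict_degrees R n dg D) (hilb R n dg h) (hilb_deg R n dg h D)"
proof (rule bij_betwI'[rotated])
  fix L assume "L \<in> hilb_deg R n dg h D"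
  then interpret hilb_point R n dg D L h by (rule pt)
  show "\<exists>I\<in>hilb R n dg h. L = restrict_degrees R n dg D I" using J_ideal_hilb J_ideal_D by blast
next
  fix I I' assume I: "I \<in> hilb R n dg h" "I' \<in> hilb R n dg h"
  interpret hilb_point R n dg D "restrict_degrees R n dg D I" h using pt hilb_restrict I(1) by blast
  show "restrict_degrees R n dg D I = restrict_degrees R n dg D I' \<longleftrightarrow> I = I'"
    using hilb_unique[OF I(1)] hilb_unique[OF I(2)] by auto
qed (rule hilb_restrict)

text \<open>Condition (s) speaks only of ideals with the right Hilbert function in all degrees;
  condition (h) supplies this from the degrees in D.\<close>

lemma (in poly) very_supportive_connected:
  assumes ne: "\<one> \<noteq> \<zero>" and vs: "very_supportive R n dg h D"
    and U: "U \<subseteq> {u \<in> expo n. dg u \<in> D}"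
    and hD: "\<And>a. a \<in> D \<Longrightarrow> finite (std_mons n dg U a) \<and> card (std_mons n dg U a) = h a"
    and g: "g \<in> min_mons n U" "g \<subseteq># w" "g' \<in> min_mons n U" "g' \<subseteq># w"
  shows "(g, g') \<in> (lcm_edges n dg D U w)\<^sup>*"
proof (rule syzygies_generated_connected[OF ne _ _ g])
  show Ue: "U \<subseteq> expo n" using U by blast
  have "monomial_ideal R n (Idl\<^bsub>S\<^esub> (mon R ` U))" unfolding monomial_ideal_def using Ue by blast
  then show "syzygies_generated_in R n dg D (Idl\<^bsub>S\<^esub> (mon R ` U))"
    using vs very_supportive_hilb_fun(1)[OF ne vs U hD] unfolding very_supportive_def by blast
qed

text \<open>The images of I are stable under monomials, so their linear span over R' is already the
  extended ideal. As I is homogeneous, taking components commutes with this span, and its part in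
  degrees D is spanned by the images of the part of I in degrees D.\<close>

lemma restrict_hilb_map:
  assumes "graded_poly R n dg" "graded_poly R' n dg" and \<psi>: "\<psi> \<in> ring_hom R R'"
    and I: "ideal I (mpoly_alg R n)" and hom: "homogeneous R dg I"
  shows "restrict_degrees R' n dg D (hilb_map R' n \<psi> I) =
    hilb_deg_map R' n dg D \<psi> (restrict_degrees R n dg D I)"
proof -
  interpret A: graded_poly R n dg by (rule assms(1))
  interpret B: graded_poly R' n dg by (rule assms(2))
  interpret BS: cring B.S by (rule B.S_cring)
  interpret BP: module R' "B.P D" by (rule B.P_module)
  interpret h: ring_hom_cring R R' \<psi> by unfold_locales (rule \<psi>)
  define \<phi> where "\<phi> = (\<lambda>p. \<psi> \<circ> (p :: nat multiset \<Rightarrow> _))"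
  have IS: "I \<subseteq> carrier A.S" using A.M.submoduleE(1)[OF A.ideal_submodule[OF I]] .
  have \<phi>c: "\<phi> p \<in> carrier B.S" if p: "p \<in> carrier A.S" for p
  proof -
    have "{u. \<phi> p u \<noteq> \<zero>\<^bsub>R'\<^esub>} \<subseteq> {u. p u \<noteq> \<zero>\<^bsub>R\<^esub>}" unfolding \<phi>_def by auto
    then show ?thesis using p finite_subset unfolding A.S_carrier B.S_carrier \<phi>_def by fastforce
  qed
  have \<phi>X: "\<phi> p \<in> B.Xc E" if p: "p \<in> A.Xc E" for p E
    using p \<phi>c unfolding A.Xc_iff B.Xc_iff \<phi>_def by force
  have \<phi>sh: "B.shift t (\<phi> p) = \<phi> (A.shift t p)" for t p
    by (auto simp: A.shift_def B.shift_def \<phi>_def)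
  have \<phi>co: "component R' dg a (\<phi> p) = \<phi> (component R dg a p)" for a p
    by (auto simp: component_def \<phi>_def)
  let ?N = "lspan B.S (carrier R') (\<phi> ` I)" and ?N' = "lspan B.S (carrier R') (\<phi> ` (I \<inter> A.Xc D))"
  have c: "\<phi> ` I \<subseteq> carrier B.S" using \<phi>c IS by blast
  have c': "\<phi> ` (I \<inter> A.Xc D) \<subseteq> B.Xc D" using \<phi>X by blast
  have c'S: "\<phi> ` (I \<inter> A.Xc D) \<subseteq> carrier B.S" using c by blast
  have N: "submodule ?N R' B.S" and N': "submodule ?N' R' B.S"
    using B.M.span_submodule[OF c] B.M.span_submodule[OF c'S] .
  have "ideal ?N B.S"
  proof (rule B.shift_closed_ideal[OF N])
    fix t p assume t: "t \<in> expo n" and p: "p \<in> ?N"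
    have "B.shift t ` \<phi> ` I \<subseteq> \<phi> ` I" using \<phi>sh A.ideal_shift[OF I t] by auto
    then show "B.shift t p \<in> ?N" using B.lspan_shift[OF subset_refl p, of t] lspan_mono[OF subset_refl] by blast
  qed
  then have "Idl\<^bsub>B.S\<^esub> (\<phi> ` I) \<subseteq> ?N" using BS.genideal_minimal B.M.lspan_base1[OF c] by blast
  moreover have "?N \<subseteq> Idl\<^bsub>B.S\<^esub> (\<phi> ` I)"
    using B.M.span_subset[OF B.ideal_submodule[OF BS.genideal_ideal[OF c]] BS.genideal_self[OF c]] .
  ultimately have 1: "hilb_map R' n \<psi> I = ?N" unfolding hilb_map_def \<phi>_def by blast
  have 2: "hilb_deg_map R' n dg D \<psi> (restrict_degrees R n dg D I) = ?N'"
    unfolding hilb_deg_map_def A.restrict_eq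
    using BP.gen_submodule_eq_lspan[OF c'] by (simp add: B.lspan_P \<phi>_def)
  have comp: "component R' dg a x \<in> ?N'" if a: "a \<in> D" and x: "x \<in> ?N" for a x
    using x
  proof induction
    case lspan_zero
    then show ?case by (simp add: lspan.intros)
  next
    case (lspan_step r y x)
    then obtain p where p: "p \<in> I" "y = \<phi> p" by blast
    have "component R dg a p \<in> A.Xc {a}" using A.component_closed p(1) IS by blast
    then have "component R dg a p \<in> I \<inter> A.Xc D"
      using p(1) hom a by (auto simp: homogeneous_def A.Xc_iff)
    then have "component R' dg a y \<in> \<phi> ` (I \<inter> A.Xc D)" using p(2) \<phi>co by blast
    then show ?case
      using lspan_step by (simp add: B.component_add B.component_smult lspan.intros)
  qed
  have "?N \<inter> B.Xc D = ?N'"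
  proof (intro equalityI subsetI)
    fix x assume x: "x \<in> ?N \<inter> B.Xc D"
    have "component R' dg a x \<in> ?N'" for a
    proof (cases "a \<in> D")
      case True
      then show ?thesis using comp x by blast
    next
      case False
      then have "component R' dg a x = \<zero>\<^bsub>B.S\<^esub>"
        using x by (intro ext) (auto simp: B.Xc_iff component_def B.S_ops)
      then show ?thesis using B.M.submodule_zero[OF N'] by simp
    qed
    then show "x \<in> ?N'" using B.sum_components[OF N'] x B.Xc_sub by blast
  next
    fix x assume x: "x \<in> ?N'"
    have "?N' \<subseteq> ?N" by (rule lspan_mono) auto
    then show "x \<in> ?N \<inter> B.Xc D" using B.M.span_subset[OF B.submodule_Xc c'] x by blast
  qed
  then show ?thesis unfolding 1 2 B.restrict_eq .
qed

theorem theorem3p6: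
  fixes k :: "('k, 'x) ring_scheme"
    and n :: nat
    and dg :: "nat multiset \<Rightarrow> 'a::ab_group_add"
    and h :: "'a \<Rightarrow> nat"
    and D :: "'a set"
  assumes "cring k"
    and "grading n dg"
    and "\<And>a. h a \<noteq> 0 \<Longrightarrow> a \<in> dg ` expo n"
    and "very_supportive k n dg h D"
  shows "(\<forall>R :: ('k, 'r) module. algebra k R \<longrightarrow>
            bij_betw (restrict_degrees R n dg D) (hilb R n dg h) (hilb_deg R n dg h D))
       \<and> (\<forall>(R :: ('k, 'r) module) (R' :: ('k, 's) module) \<psi>.
            algebra k R \<longrightarrow> algebra k R' \<longrightarrow> \<psi> \<in> alg_hom k R R' \<longrightarrow>
            (\<forall>I \<in> hilb R n dg h.
               restrict_degrees R' n dg D (hilb_map R' n \<psi> I)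
             = hilb_deg_map R' n dg D \<psi> (restrict_degrees R n dg D I)))"
proof (intro conjI allI impI ballI)
  have gp: "graded_poly R n dg" if "cring R" for R :: "('c, 'd) ring_scheme"
  proof -
    interpret cring R by (rule that)
    show ?thesis by unfold_locales (use assms(2) in \<open>auto simp: grading_def\<close>)
  qed
  {
    fix R :: "('k, 'r) module" assume R: "algebra k R"
    interpret graded_poly R n dg by (rule gp[OF algebra.M_cring[OF R]])
    interpret k: module k R by (rule algebra.module[OF R])
    interpret K: poly k n by unfold_locales
    show "bij_betw (restrict_degrees R n dg D) (hilb R n dg h) (hilb_deg R n dg h D)"
    proof (rule bij_betw_hilb)
      fix L assume L: "L \<in> hilb_deg R n dg h D"
      have finD: "finite D" using assms(4) by (simp add: very_supportive_def)
      interpret hilb_data R n dg D L using hilb_degD(1)[OF finD L] .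
      show "hilb_point R n dg D L h"
      proof
        show "locally_free R (quot_module (P {b}) (Lc b)) (h b)" if "b \<in> D" for b
          using hilb_degD(2)[OF finD L that] by (simp add: Lc_def)
        \<comment> \<open>The sets of exponents involved do not depend on the ring, so the
          statements obtained over k are literally those required over R; a nonzero R forces k to be
          nonzero.\<close>
        fix U a assume ne: "\<one>\<^bsub>R\<^esub> \<noteq> \<zero>\<^bsub>R\<^esub>" and U: "U \<subseteq> {u \<in> expo n. dg u \<in> D}"
          and hD: "\<And>b. b \<in> D \<Longrightarrow> finite (std_mons n dg U b) \<and> card (std_mons n dg U b) = h b"
        have "\<one>\<^bsub>k\<^esub> \<noteq> \<zero>\<^bsub>k\<^esub>"
          using ne k.smult_one[OF one_closed] k.smult_l_null[OF one_closed] by metis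
        then show "finite (std_mons n dg U a) \<and> card (std_mons n dg U a) = h a \<and>
          (\<forall>w. \<forall>g\<in>min_mons n U. \<forall>g'\<in>min_mons n U. g \<subseteq># w \<longrightarrow> g' \<subseteq># w \<longrightarrow>
            (g, g') \<in> (lcm_edges n dg D U w)\<^sup>*)"
          using K.very_supportive_hilb_fun(2)[OF _ assms(4) U hD]
            K.very_supportive_connected[OF _ assms(4) U hD] by blast
      qed
    qed
  next
    fix R :: "('k, 'r) module" and R' :: "('k, 's) module" and \<psi> I
    assume R: "algebra k R" "algebra k R'" and \<psi>: "\<psi> \<in> alg_hom k R R'" and I: "I \<in> hilb R n dg h"
    show "restrict_degrees R' n dg D (hilb_map R' n \<psi> I)
        = hilb_deg_map R' n dg D \<psi> (restrict_degrees R n dg D I)"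
      by (rule restrict_hilb_map[OF gp[OF algebra.M_cring[OF R(1)]] gp[OF algebra.M_cring[OF R(2)]]])
        (use \<psi> I in \<open>auto simp: alg_hom_def hilb_def\<close>)
  }
qed

end
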